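(* Let $L$ and $\tilde L$ be matrix quadratic pencils satisfying all the assumptions listed in the context. Then for all $x\in[0,\pi]$ and all $\rho,\theta\in\mathbb C$ the following relations hold: $$\Omega(x)\tilde\varphi(x,\rho)=\varphi(x,\rho)+\sum_{n\in w}\sum_{q=1}^m\Bigl\{\varphi(x,\rho_{nq})m_{nq}^{-1}\alpha_{nq}\tilde D(x,\rho,\rho_{nq})-\varphi(x,\tilde\rho_{nq})\tilde m_{nq}^{-1}\tilde\alpha_{nq}\tilde D(x,\rho,\tilde\rho_{nq})\Bigr\},$$ $$D(x,\rho,\theta)-\tilde D(x,\rho,\theta)-\varphi^*(x,\theta)\Lambda(x)\tilde\varphi(x,\rho)+\sum_{n\in w}\sum_{q=1}^m\Bigl\{D(x,\rho_{nq},\theta)m_{nq}^{-1}\alpha_{nq}\tilde D(x,\rho,\rho_{nq})-D(x,\tilde\rho_{nq},\theta)\tilde m_{nq}^{-1}\tilde\alpha_{nq}\tilde D(x,\rho,\tilde\rho_{nq})\Bigr\}=0.$$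
   Context: **The pencils.** $m\ge1$; $I$ is the $m\times m$ identity; $\dagger$ is conjugate transpose; $\rho\in\mathbb C$. $L$ is the boundary value problem $$Y''+(\rho^2 I+2i\rho Q_1(x)+Q_0(x))Y=0,\ x\in(0,\pi),\qquad U(Y)=V(Y)=0,$$ $$U(Y):=Y'(0)+(i\rho h_1+h_0)Y(0),\qquad V(Y):=Y'(\pi)+(i\rho H_1+H_0)Y(\pi),$$ with $Q_1,Q_0$ being $m\times m$ matrix functions with entries in $W_1^1[0,\pi]$ and $L_1(0,\pi)$ respectively, $h_s,H_s\in\mathbb C^{m\times m}$, satisfying (I) $\det(I\pm h_1)\ne0$, $\det(I\pm H_1)\ne0$; (II) $Q_1^\dagger=-Q_1$, $Q_0^\dagger=Q_0$ a.e., $h_1^\dagger=-h_1$, $H_1^\dagger=-H_1$, $h_0^\dagger=h_0$, $H_0^\dagger=H_0$. $\tilde L$ is a pencil of the same form with coefficients $\tilde Q_s,\tilde h_s,\tilde H_s$ also satisfying (I), (II). Objects with a tilde are the analogous objects for $\tilde L$. **Spectral data.** $\varphi(x,\rho)$ is the matrix solution with $\varphi(0,\rho)=I$, $U(\varphi)=0$. The Weyl matrix is $M(\rho)=\Phi(0,\rho)$, where $\Phi$ is the matrix solution with $U(\Phi)=I$, $V(\Phi)=0$. The eigenvalues of $L$ are the zeros of $\det V(\varphi)$, numbered with multiplicities as $\{\rho_{nq}\}_{n\in w,\,1\le q\le m}$, $w=\{\pm0,\pm1,\pm2,\dots\}$ ($+0$ and $-0$ are distinct indices with value $0$), so that $\rho_{nq}=n+\omega_q+O(n^{-1})$,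 $|n|\to\infty$. $m_{nq}$ is the multiplicity of $\rho_{nq}$, and $\alpha_{nq}:=\operatorname{Res}_{\rho=\rho_{nq}}M(\rho)$. Let $P_\pm'=\pm Q_1P_\pm$, $P_\pm(0)=I$, and let $A=P_-^{-1}(\pi)(I+H_1)^{-1}(I-H_1)P_+(\pi)(I+h_1)(I-h_1)^{-1}$ (unitary), $A=W^\dagger\mathrm{diag}\{\mu_1,\dots,\mu_m\}W$ with $W$ unitary, $\mu_q=e^{2\pi i\omega_q}$, $\omega_q\in[0,1)$. Put $J_q=\{s:\omega_s=\omega_q\}$, and let $I_q$ be the diagonal matrix with $j$-th diagonal entry $1$ if $j\in J_q$ and $0$ otherwise. It is known that $\sum_{s\in J_q}m_{ns}^{-1}\alpha_{ns}=\frac1{\pi n}(I-h_1)^{-1}W^\dagger I_qW(I+h_1)^{-1}+O(n^{-2})$. **Standing assumptions.** (a) $\tilde L$ is a model pencil for $L$: $\tilde h_1=h_1$, and its spectral data have the asymptotics above with the same constants, i.e. $\tilde\omega_q=\omega_q$ and $\tilde W^\dagger I_q\tilde W=W^\dagger I_qW$ for all $q$. (b) For both $L$ and $\tilde L$, all eigenvalues are real, and all poles of the Weyl matrix are simple with residue of rank equal to the multiplicity of the eigenvalue. **Notation.** $\varphi^*(x,\theta):=\varphi^\dagger(x,\bar\theta)$, i.e. $(\varphi(x,\bar\theta))^\dagger$; $\langle Z,Y\rangle:=Z'Y-ZY'$ (derivatives in $x$); $$D(x,\rho,\theta)=\frac{\langle\varphi^*(x,\theta),\varphi(x,\rho)\rangle}{\rho-\theta},\qquad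 \tilde D(x,\rho,\theta)=\frac{\langle\tilde\varphi^*(x,\theta),\tilde\varphi(x,\rho)\rangle}{\rho-\theta},$$ extended by continuity to $\rho=\theta$ (the numerator vanishes there); $$\Omega(x)=\tfrac12\bigl(P_-(x)\tilde P_-^\dagger(x)+P_+(x)\tilde P_+^\dagger(x)\bigr),\qquad \Lambda(x)=\tfrac1{2i}\bigl(P_-(x)\tilde P_-^\dagger(x)-P_+(x)\tilde P_+^\dagger(x)\bigr).$$ Series over $n\in w$ of sums over $q$ are iterated sums: for each $n$ the finite sum over $q$ is taken first. *)

theory Defs
  imports "HOL-Complex_Analysis.Complex_Analysis" "HOL-Library.Landau_Symbols"
begin

definition cscale :: "complex \<Rightarrow> complex^'n^'m \<Rightarrow> complex^'n^'m" (infixr \<open>*\<^sub>M\<close> 75)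
  where "c *\<^sub>M A = (\<chi> i j. c * A $ i $ j)"

definition dagger :: "complex^'n^'m \<Rightarrow> complex^'m^'n"
  where "dagger A = (\<chi> i j. cnj (A $ j $ i))"

definition diag :: "('m \<Rightarrow> complex) \<Rightarrow> complex^'m^'m"
  where "diag d = (\<chi> i j. if i = j then d i else 0)"

definition unitary :: "complex^'m^'m \<Rightarrow> bool"
  where "unitary A \<longleftrightarrow> dagger A ** A = mat 1 \<and> A ** dagger A = mat 1"

text \<open>\<open>has_W11_derivative f g\<close>: \<open>f\<close> is (the continuous representative of) an element of
  \<open>W\<^sub>1\<^sup>1[0,\<pi>]\<close>, i.e. absolutely continuous, and \<open>g \<in> L\<^sub>1(0,\<pi>)\<close> is its derivative.\<close>

definition has_W11_derivative ::
    "(real \<Rightarrow> 'a::euclidean_space) \<Rightarrow> (real \<Rightarrow> 'a) \<Rightarrow> bool"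
  where "has_W11_derivative f g \<longleftrightarrow>
    g absolutely_integrable_on {0..pi} \<and>
    (\<forall>x\<in>{0..pi}. f x = f 0 + integral {0..x} g)"

definition W11 :: "(real \<Rightarrow> 'a::euclidean_space) \<Rightarrow> bool"
  where "W11 f \<longleftrightarrow> (\<exists>g. has_W11_derivative f g)"

text \<open>Derivative on \<open>[0,\<pi>]\<close>, one-sided at the endpoints.\<close>

definition dx :: "(real \<Rightarrow> 'a::real_normed_vector) \<Rightarrow> real \<Rightarrow> 'a"
  where "dx Y x = vector_derivative Y (at x within {0..pi})"

record 'm pencil =
  Q1 :: "real \<Rightarrow> complex^'m^'m"
  Q0 :: "real \<Rightarrow> complex^'m^'m"
  h1 :: "complex^'m^'m"
  h0 :: "complex^'m^'m"
  H1 :: "complex^'m^'m"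
  H0 :: "complex^'m^'m"

definition pencil_coeffs :: "'m::finite pencil \<Rightarrow> bool"
  where "pencil_coeffs L \<longleftrightarrow>
    (\<forall>i j. W11 (\<lambda>x. Q1 L x $ i $ j)) \<and>
    (\<forall>i j. (\<lambda>x. Q0 L x $ i $ j) absolutely_integrable_on {0..pi})"

definition condition_I :: "'m::finite pencil \<Rightarrow> bool"
  where "condition_I L \<longleftrightarrow>
    det (mat 1 + h1 L) \<noteq> 0 \<and> det (mat 1 - h1 L) \<noteq> 0 \<and>
    det (mat 1 + H1 L) \<noteq> 0 \<and> det (mat 1 - H1 L) \<noteq> 0"

definition condition_II :: "'m::finite pencil \<Rightarrow> bool"
  where "condition_II L \<longleftrightarrow>
    (\<forall>x\<in>{0..pi}. dagger (Q1 L x) = - Q1 L x) \<and>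
    (AE x in lebesgue_on {0..pi}. dagger (Q0 L x) = Q0 L x) \<and>
    dagger (h1 L) = - h1 L \<and> dagger (H1 L) = - H1 L \<and>
    dagger (h0 L) = h0 L \<and> dagger (H0 L) = H0 L"

text \<open>Since the coefficients are merely integrable, a solution is a \<open>C\<^sup>1\<close> function on
  \<open>[0,\<pi>]\<close> with absolutely continuous derivative which satisfies the equation almost
  everywhere.\<close>

definition solves :: "'m::finite pencil \<Rightarrow> complex \<Rightarrow> (real \<Rightarrow> complex^'m^'m) \<Rightarrow> bool"
  where "solves L \<rho> Y \<longleftrightarrow>
    (\<exists>Y' Y''.
      (\<forall>x\<in>{0..pi}. (Y has_vector_derivative Y' x) (at x within {0..pi})) \<and>
      has_W11_derivative Y' Y'' \<and>
      (AE x in lebesgue_on {0..pi}.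
        Y'' x + (\<rho>\<^sup>2 *\<^sub>M mat 1 + (2 * \<i> * \<rho>) *\<^sub>M Q1 L x + Q0 L x) ** Y x = 0))"

definition U_form :: "'m::finite pencil \<Rightarrow> complex \<Rightarrow> (real \<Rightarrow> complex^'m^'m) \<Rightarrow> complex^'m^'m"
  where "U_form L \<rho> Y = dx Y 0 + ((\<i> * \<rho>) *\<^sub>M h1 L + h0 L) ** Y 0"

definition V_form :: "'m::finite pencil \<Rightarrow> complex \<Rightarrow> (real \<Rightarrow> complex^'m^'m) \<Rightarrow> complex^'m^'m"
  where "V_form L \<rho> Y = dx Y pi + ((\<i> * \<rho>) *\<^sub>M H1 L + H0 L) ** Y pi"

text \<open>Solutions are functions on the whole real line whose values outside \<open>[0,\<pi>]\<close> are
  irrelevant, so the choices below are unique only on \<open>[0,\<pi>]\<close>; everything that follows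
  depends only on these values.\<close>

definition phi :: "'m::finite pencil \<Rightarrow> complex \<Rightarrow> real \<Rightarrow> complex^'m^'m"
  where "phi L \<rho> = (SOME Y. solves L \<rho> Y \<and> Y 0 = mat 1 \<and> U_form L \<rho> Y = 0)"

text \<open>The Weyl solution exists exactly when \<open>\<rho>\<close> is not an eigenvalue; at eigenvalues the
  value is unspecified, which affects neither residues nor pole orders.\<close>

definition Phi :: "'m::finite pencil \<Rightarrow> complex \<Rightarrow> real \<Rightarrow> complex^'m^'m"
  where "Phi L \<rho> = (SOME Y. solves L \<rho> Y \<and> U_form L \<rho> Y = mat 1 \<and> V_form L \<rho> Y = 0)"

definition weyl :: "'m::finite pencil \<Rightarrow> complex \<Rightarrow> complex^'m^'m"
  where "weyl L \<rho> = Phi L \<rho> 0"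

definition char_fun :: "'m::finite pencil \<Rightarrow> complex \<Rightarrow> complex"
  where "char_fun L \<rho> = det (V_form L \<rho> (phi L \<rho>))"

definition eigenvalue :: "'m::finite pencil \<Rightarrow> complex \<Rightarrow> bool"
  where "eigenvalue L z \<longleftrightarrow> char_fun L z = 0"

definition mult :: "'m::finite pencil \<Rightarrow> complex \<Rightarrow> nat"
  where "mult L z = nat (zorder (char_fun L) z)"

definition weyl_residue :: "'m::finite pencil \<Rightarrow> complex \<Rightarrow> complex^'m^'m"
  where "weyl_residue L z = (\<chi> i j. residue (\<lambda>\<rho>. weyl L \<rho> $ i $ j) z)"

text \<open>The index set \<open>{\<plusminus>0, \<plusminus>1, \<plusminus>2, \<dots>}\<close>: \<open>Pos k\<close> is \<open>+k\<close> and \<open>Neg k\<close> is \<open>-k\<close>, so that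
  \<open>Pos 0\<close> and \<open>Neg 0\<close> are distinct.\<close>

datatype windex = Pos nat | Neg nat

primrec wval :: "windex \<Rightarrow> int"
  where
    "wval (Pos k) = int k"
  | "wval (Neg k) = - int k"

text \<open>The branch index \<open>q = 1, \<dots>, m\<close> ranges over the matrix index type. The numbering is not
  unique: it is any enumeration with multiplicities having the stated asymptotics.\<close>

definition eigenvalue_numbering ::
    "'m::finite pencil \<Rightarrow> ('m \<Rightarrow> real) \<Rightarrow> (windex \<Rightarrow> 'm \<Rightarrow> complex) \<Rightarrow> bool"
  where "eigenvalue_numbering L \<omega> ev \<longleftrightarrow>
    (\<forall>n q. eigenvalue L (ev n q)) \<and>
    (\<forall>z. eigenvalue L z \<longrightarrow>
      finite {(n, q). ev n q = z} \<and> card {(n, q). ev n q = z} = mult L z) \<and>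
    (\<forall>q. (\<lambda>n. ev n q - (of_int (wval n) + of_real (\<omega> q)))
          \<in> O[cofinite](\<lambda>n. 1 / of_int (wval n)))"

text \<open>A pole of the matrix function is a pole of at least one of its entries.\<close>

definition simple_real_spectrum :: "'m::finite pencil \<Rightarrow> bool"
  where "simple_real_spectrum L \<longleftrightarrow>
    (\<forall>z. eigenvalue L z \<longrightarrow> z \<in> \<real>) \<and>
    (\<forall>z i j. is_pole (\<lambda>\<rho>. weyl L \<rho> $ i $ j) z \<longrightarrow>
      zorder (\<lambda>\<rho>. weyl L \<rho> $ i $ j) z = - 1) \<and>
    (\<forall>z. eigenvalue L z \<longrightarrow> rank (weyl_residue L z) = mult L z)"

definition P_sol :: "complex \<Rightarrow> 'm::finite pencil \<Rightarrow> real \<Rightarrow> complex^'m^'m"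
  where "P_sol s L = (SOME P. P 0 = mat 1 \<and>
    (\<forall>x\<in>{0..pi}. (P has_vector_derivative (s *\<^sub>M Q1 L x) ** P x) (at x within {0..pi})))"

abbreviation P_plus :: "'m::finite pencil \<Rightarrow> real \<Rightarrow> complex^'m^'m"
  where "P_plus \<equiv> P_sol 1"

abbreviation P_minus :: "'m::finite pencil \<Rightarrow> real \<Rightarrow> complex^'m^'m"
  where "P_minus \<equiv> P_sol (- 1)"

definition A_mat :: "'m::finite pencil \<Rightarrow> complex^'m^'m"
  where "A_mat L =
    matrix_inv (P_minus L pi) ** matrix_inv (mat 1 + H1 L) ** (mat 1 - H1 L) **
    P_plus L pi ** (mat 1 + h1 L) ** matrix_inv (mat 1 - h1 L)"

definition diagonalization :: "'m::finite pencil \<Rightarrow> ('m \<Rightarrow> real) \<Rightarrow> complex^'m^'m \<Rightarrow> bool"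
  where "diagonalization L \<omega> W \<longleftrightarrow>
    unitary W \<and> (\<forall>q. 0 \<le> \<omega> q \<and> \<omega> q < 1) \<and>
    A_mat L = dagger W ** diag (\<lambda>q. exp (2 * of_real pi * \<i> * of_real (\<omega> q))) ** W"

definition I_proj :: "('m::finite \<Rightarrow> real) \<Rightarrow> 'm \<Rightarrow> complex^'m^'m"
  where "I_proj \<omega> q = diag (\<lambda>j. if \<omega> j = \<omega> q then 1 else 0)"

definition phi_star :: "'m::finite pencil \<Rightarrow> complex \<Rightarrow> real \<Rightarrow> complex^'m^'m"
  where "phi_star L \<theta> x = dagger (phi L (cnj \<theta>) x)"

definition bracket ::
    "(real \<Rightarrow> complex^'m^'m) \<Rightarrow> (real \<Rightarrow> complex^'m^'m) \<Rightarrow> real \<Rightarrow> complex^'m^'m"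
  where "bracket Z Y x = dx Z x ** Y x - Z x ** dx Y x"

definition D_quot :: "'m::finite pencil \<Rightarrow> real \<Rightarrow> complex \<Rightarrow> complex \<Rightarrow> complex^'m^'m"
  where "D_quot L x \<rho> \<theta> = (1 / (\<rho> - \<theta>)) *\<^sub>M bracket (phi_star L \<theta>) (phi L \<rho>) x"

text \<open>The kernel is extended to the diagonal by continuity.\<close>

definition D_ker :: "'m::finite pencil \<Rightarrow> real \<Rightarrow> complex \<Rightarrow> complex \<Rightarrow> complex^'m^'m"
  where "D_ker L x \<rho> \<theta> =
    (if \<rho> \<noteq> \<theta> then D_quot L x \<rho> \<theta> else Lim (at \<theta>) (\<lambda>\<rho>'. D_quot L x \<rho>' \<theta>))"

definition Omega :: "'m::finite pencil \<Rightarrow> 'm pencil \<Rightarrow> real \<Rightarrow> complex^'m^'m"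
  where "Omega L Lt x = (1 / 2) *\<^sub>M
    (P_minus L x ** dagger (P_minus Lt x) + P_plus L x ** dagger (P_plus Lt x))"

definition Lambda :: "'m::finite pencil \<Rightarrow> 'm pencil \<Rightarrow> real \<Rightarrow> complex^'m^'m"
  where "Lambda L Lt x = (1 / (2 * \<i>)) *\<^sub>M
    (P_minus L x ** dagger (P_minus Lt x) - P_plus L x ** dagger (P_plus Lt x))"

definition weight :: "'m::finite pencil \<Rightarrow> complex \<Rightarrow> complex^'m^'m"
  where "weight L z = (1 / of_nat (mult L z)) *\<^sub>M weyl_residue L z"

end

theory Submission
  imports Defs
begin

text \<open>
  The entries of the spectral mapping matrix of the two pencils, combinations such as
  \<open>\<phi> \<Phi>'\<^sup>* - \<Phi> \<phi>'\<^sup>*\<close> with the starred factors taken from the model pencil, contain the spectral data only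
  through the difference of the two Weyl matrices. Multiply this difference by \<open>\<phi>(x, \<xi>)\<close> or
  \<open>D(x, \<xi>, \<theta>)\<close> on the left and by the model kernel \<open>D(x, \<rho>, \<xi>)\<close> on the right and integrate over \<open>\<xi>\<close> along large
  contours: the eigenvalues contribute the series, the points \<open>\<rho>\<close> and \<open>\<theta>\<close> the terms outside the
  series, and the behaviour of the spectral mapping matrix at infinity the terms with \<open>\<Omega>\<close> and \<open>\<Lambda>\<close>.

  This behaviour is found for merely integrable \<open>Q\<^sub>0\<close> as follows. The combinations
  \<open>Y' \<plusminus> (i\<xi> - Q\<^sub>1) Y\<close> satisfy first-order equations, hence they are travelling waves
  with the factor \<open>exp (\<plusminus>i\<xi>x)\<close> and the unitary amplitude \<open>P\<^sub>-\<close>, respectively \<open>P\<^sub>+\<close>, up to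
  a relative error \<open>O(1/\<xi>)\<close>. The leading part of \<open>\<Phi>\<close> depends on the pencil only through the amplitudes, \<open>h\<^sub>1\<close>
  and a resolvent of \<open>A\<close>; the last two agree for a model pair, so that the leading parts combine exactly
  to \<open>\<Omega>\<close> and \<open>\<Lambda>\<close>, and the Weyl matrices differ by \<open>O(\<xi>\<^sup>-\<^sup>2)\<close> on the contours. The same bound on
  a rectangle around the \<open>n\<close>-th group of eigenvalues shows that the series converge absolutely.
\<close>

text \<open>The obstacle is that the integrand, the difference of the Weyl matrices between two
  factors of exponential type x, may grow like \<open>exp (2 * x * \<bar>Im \<xi>\<bar>)\<close> and
  cannot be estimated on high horizontal sides. Terms that are entire, or entire up to a simple pole
  at \<rho> or \<theta>, are therefore added: they complete the Weyl solutions, so that the growing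
  exponentials cancel against decaying ones. What remains is a multiple of 1/\<xi> up to
  O(1/\<xi>^2), and the added terms are integrated by Cauchy's formula. The single terms of the
  series come from rectangles of height one, where the exponentials are bounded and the direct
  estimate works. Condition (II) carries the algebra: brackets of solutions at
  \<open>cnj \<xi>\<close> and \<xi> are constant in x, which makes the Weyl matrix symmetric, and
  the amplitudes P are unitary. The Weyl solution is reached by propagation from \<pi> to 0; the
  growth of this propagation is compensated by the decay of \<open>exp (\<i> * \<xi> * pi)\<close>
  times the resolvent of A.\<close>

no_notation fps_nth (infixl \<open>$\<close> 75)

section \<open>Absolutely continuous functions\<close>

text \<open>This replaces almost everywhere differentiability: the defects of the product and chain rules
  over \<open>[x, y]\<close> are quadratic in the variation.\<close>

lemma constant_of_quadratic_bound:
  fixes h :: "real \<Rightarrow> 'a::real_normed_vector" and m :: "real \<Rightarrow> real"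
  assumes ab: "a \<le> b" and cont: "continuous_on {a..b} m"
    and mono: "\<And>x y. a \<le> x \<Longrightarrow> x \<le> y \<Longrightarrow> y \<le> b \<Longrightarrow> m x \<le> m y"
    and bound: "\<And>x y. a \<le> x \<Longrightarrow> x \<le> y \<Longrightarrow> y \<le> b \<Longrightarrow> norm (h y - h x) \<le> C * (m y - m x)\<^sup>2"
    and C: "C \<ge> 0"
  shows "h b = h a"
proof (cases "a = b")
  case False
  with ab have ab: "a < b" by simp
  have "norm (h b - h a) \<le> 0 + e" if e: "e > 0" for e
  proof -
    \<comment> \<open>The summand 1 keeps \<open>M\<close> positive when \<open>C\<close> or the
      variation vanishes; the final bound is
      \<open>C * (e / M) * (m b - m a) \<le> e\<close>.\<close>
    define M where "M = C * (m b - m a) + 1"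
    have "C * (m b - m a) \<ge> 0" using C mono[of a b] ab by simp
    then have M: "M > 0" unfolding M_def by linarith
    have "uniformly_continuous_on {a..b} m"
      using cont by (rule compact_uniformly_continuous) simp
    then obtain d where d: "d > 0" and
      dd: "\<And>x y. x \<in> {a..b} \<Longrightarrow> y \<in> {a..b} \<Longrightarrow> dist y x < d \<Longrightarrow> dist (m y) (m x) < e / M"
      using e M unfolding uniformly_continuous_on_def by (metis divide_pos_pos)
    obtain n where n: "(b - a) / d < real n" using reals_Archimedean2 by blast
    then have n0: "n > 0" using ab d
      by (metis divide_nonneg_pos gr0I less_eq_real_def linorder_not_less of_nat_0 diff_ge_0_iff_ge)
    define s where "s = (b - a) / n"
    have s: "s > 0" "s < d" using ab n0 n d by (auto simp: s_def field_simps)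
    define t where "t = (\<lambda>i::nat. a + i * s)"
    have t0: "t 0 = a" and tn: "t n = b" using n0 by (auto simp: t_def s_def)
    have tstep: "t (Suc i) - t i = s" for i by (simp add: t_def algebra_simps)
    have tr: "a \<le> t i" "t i \<le> t (Suc i)" for i using s by (auto simp: t_def algebra_simps)
    have tb: "t i \<le> b" if "i \<le> n" for i
    proof -
      have "real i * s \<le> real n * s" using that s by (intro mult_right_mono) auto
      then show ?thesis using tn by (simp add: t_def)
    qed
    have "h b - h a = (\<Sum>i<n. h (t (Suc i)) - h (t i))"
      using t0 tn sum_lessThan_telescope[of "\<lambda>i. h (t i)" n] by simp
    also have "norm \<dots> \<le> (\<Sum>i<n. norm (h (t (Suc i)) - h (t i)))"
      by (rule norm_sum)
    \<comment> \<open>One factor of each square is at most \<open>e / M\<close> by uniform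
      continuity; the remaining factors telescope.\<close>
    also have "\<dots> \<le> (\<Sum>i<n. C * (e / M) * (m (t (Suc i)) - m (t i)))"
    proof (rule sum_mono)
      fix i assume i: "i \<in> {..<n}"
      then have b: "t (Suc i) \<le> b" using tb[of "Suc i"] by simp
      let ?D = "m (t (Suc i)) - m (t i)"
      have D0: "?D \<ge> 0" using mono[of "t i" "t (Suc i)"] tr b by auto
      have "dist (t (Suc i)) (t i) < d"
        using tstep[of i] s by (simp add: dist_real_def)
      then have "dist (m (t (Suc i))) (m (t i)) < e / M"
        using tr[of i] tr[of "Suc i"] b by (intro dd) auto
      then have D1: "?D \<le> e / M" by (auto simp: dist_real_def)
      have "norm (h (t (Suc i)) - h (t i)) \<le> C * (?D * ?D)"
        using bound[of "t i" "t (Suc i)"] tr b by (simp add: power2_eq_square)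
      also have "\<dots> \<le> C * (e / M * ?D)"
        using C D0 D1 by (intro mult_left_mono mult_right_mono) auto
      finally show "norm (h (t (Suc i)) - h (t i)) \<le> C * (e / M) * ?D" by (simp add: mult.assoc)
    qed
    also have "\<dots> = C * (e / M) * (m b - m a)"
      using t0 tn sum_lessThan_telescope[of "\<lambda>i. m (t i)" n]
      by (simp only: sum_distrib_left[symmetric])
    also have "\<dots> \<le> e"
      using e M unfolding M_def by (simp add: field_simps)
    finally show ?thesis by simp
  qed
  then have "norm (h b - h a) \<le> 0" by (rule field_le_epsilon)
  then show ?thesis by simp
qed auto

lemma absolutely_integrable_subinterval:
  fixes u :: "real \<Rightarrow> 'a::euclidean_space"
  assumes "u absolutely_integrable_on {0..pi}" "0 \<le> x" "y \<le> pi"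
  shows "u absolutely_integrable_on {x..y}"
  using assms by (auto intro: absolutely_integrable_on_subinterval)

lemma absolutely_integrable_bilinear_continuous:
  fixes f :: "real \<Rightarrow> 'a::euclidean_space" and g :: "real \<Rightarrow> 'b::euclidean_space"
    and pr :: "'a \<Rightarrow> 'b \<Rightarrow> 'c::euclidean_space"
  assumes "bounded_bilinear pr" "continuous_on {a..b} f" "g absolutely_integrable_on {a..b}"
  shows "(\<lambda>t. pr (f t) (g t)) absolutely_integrable_on {a..b}"
proof (rule absolutely_integrable_bounded_measurable_product[of pr f _ g])
  show "bilinear pr" using assms(1) by (simp add: bilinear_conv_bounded_bilinear)
  show "f \<in> borel_measurable (lebesgue_on {a..b})"
    using assms(2) by (intro continuous_imp_measurable_on_sets_lebesgue) auto
  show "bounded (f ` {a..b})"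
    using assms(2) by (intro compact_imp_bounded compact_continuous_image) auto
qed (use assms in auto)

lemma absolutely_integrable_bilinear_continuous':
  fixes f :: "real \<Rightarrow> 'a::euclidean_space" and g :: "real \<Rightarrow> 'b::euclidean_space"
    and pr :: "'b \<Rightarrow> 'a \<Rightarrow> 'c::euclidean_space"
  assumes "bounded_bilinear pr" "continuous_on {a..b} f" "g absolutely_integrable_on {a..b}"
  shows "(\<lambda>t. pr (g t) (f t)) absolutely_integrable_on {a..b}"
  using absolutely_integrable_bilinear_continuous[OF bounded_bilinear.flip[OF assms(1)] assms(2,3)] .

lemma absolutely_integrable_imp_integrable:
  fixes u :: "real \<Rightarrow> 'a::euclidean_space"
  shows "u absolutely_integrable_on S \<Longrightarrow> u integrable_on S"
  by (rule set_lebesgue_integral_eq_integral(1))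

lemma W11_integrable: "has_W11_derivative f u \<Longrightarrow> u absolutely_integrable_on {0..pi}"
  unfolding has_W11_derivative_def by (rule conjunct1)

lemma W11_eq: "has_W11_derivative f u \<Longrightarrow> x \<in> {0..pi} \<Longrightarrow> f x = f 0 + integral {0..x} u"
  unfolding has_W11_derivative_def by blast

lemma W11_I:
  "u absolutely_integrable_on {0..pi} \<Longrightarrow> (\<And>x. x \<in> {0..pi} \<Longrightarrow> f x = f 0 + integral {0..x} u)
    \<Longrightarrow> has_W11_derivative f u"
  unfolding has_W11_derivative_def by blast

lemma W11_indefinite_integral:
  "u absolutely_integrable_on {0..pi} \<Longrightarrow> has_W11_derivative (\<lambda>x. integral {0..x} u) u"
  by (rule W11_I) auto

lemma W11_increment:
  assumes "has_W11_derivative f u" "0 \<le> x" "x \<le> y" "y \<le> pi"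
  shows "f y - f x = integral {x..y} u"
proof -
  have "u integrable_on {0..y}"
    using assms absolutely_integrable_subinterval[OF W11_integrable[OF assms(1)], of 0 y]
    by (simp add: absolutely_integrable_imp_integrable)
  then have "integral {0..x} u + integral {x..y} u = integral {0..y} u"
    using assms by (intro Henstock_Kurzweil_Integration.integral_combine) auto
  moreover have "f x = f 0 + integral {0..x} u" "f y = f 0 + integral {0..y} u"
    using assms by (auto intro: W11_eq)
  ultimately show ?thesis by (metis add_diff_cancel_left add_diff_cancel_left')
qed

lemma W11_norm_increment:
  assumes "has_W11_derivative f u" "0 \<le> x" "x \<le> y" "y \<le> pi"
  shows "norm (f y - f x) \<le> integral {x..y} (\<lambda>t. norm (u t))"
proof -
  have "u absolutely_integrable_on {x..y}"
    by (rule absolutely_integrable_subinterval[OF W11_integrable[OF assms(1)] assms(2,4)])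
  then have "norm (integral {x..y} u) \<le> integral {x..y} (\<lambda>t. norm (u t))"
    by (intro integral_norm_bound_integral) (auto simp: absolutely_integrable_on_def)
  then show ?thesis using W11_increment[OF assms] by simp
qed

lemma W11_continuous:
  assumes "has_W11_derivative f u"
  shows "continuous_on {0..pi} f"
proof -
  have "u integrable_on {0..pi}"
    by (rule absolutely_integrable_imp_integrable[OF W11_integrable[OF assms]])
  then have "continuous_on {0..pi} (\<lambda>x. f 0 + integral {0..x} u)"
    by (intro continuous_intros indefinite_integral_continuous_1)
  then show ?thesis
    by (rule continuous_on_eq) (simp add: W11_eq[OF assms, symmetric])
qed

text \<open>An integrable derivative enters only through its integrals, so it may be changed on a
  null set. This turns the almost everywhere form of the equation into an identity.\<close>

lemma W11_eq_AE:
  assumes "has_W11_derivative f u" and "AE x in lebesgue_on {0..pi}. u x = u' x"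
  shows "has_W11_derivative f u'"
proof -
  from assms(2) obtain N where "N \<in> null_sets (lebesgue_on {0..pi})"
    and "{x \<in> space (lebesgue_on {0..pi}). u x \<noteq> u' x} \<subseteq> N"
    by (auto simp: eventually_ae_filter)
  then have N: "negligible N" "\<And>x. x \<in> {0..pi} - N \<Longrightarrow> u x = u' x"
    by (auto simp: negligible_iff_null_sets null_sets_restrict_space)
  have "u' absolutely_integrable_on {0..pi}"
    using absolutely_integrable_spike[OF W11_integrable[OF assms(1)] N(1)] N(2) by metis
  moreover have "integral {0..x} u' = integral {0..x} u" if "x \<in> {0..pi}" for x
    by (rule integral_spike[OF N(1)]) (use N that in auto)
  ultimately show ?thesis
    by (intro W11_I) (simp, metis W11_eq[OF assms(1)])
qed

lemma W11_linear:
  fixes T :: "'a::euclidean_space \<Rightarrow> 'b::euclidean_space"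
  assumes T: "bounded_linear T" and f: "has_W11_derivative f u"
  shows "has_W11_derivative (\<lambda>x. T (f x)) (\<lambda>x. T (u x))"
proof (rule W11_I)
  fix x assume x: "x \<in> {0..pi}"
  have "u integrable_on {0..x}"
    using absolutely_integrable_subinterval[OF W11_integrable[OF f], of 0 x] x
    by (simp add: absolutely_integrable_imp_integrable)
  then have "integral {0..x} (T \<circ> u) = T (integral {0..x} u)"
    using T by (intro integral_linear)
  then show "T (f x) = T (f 0) + integral {0..x} (\<lambda>x. T (u x))"
    using linear_add[OF bounded_linear.linear[OF T]] W11_eq[OF f x] by (simp add: o_def)
next
  show "(\<lambda>x. T (u x)) absolutely_integrable_on {0..pi}"
    using absolutely_integrable_linear[OF W11_integrable[OF f] T] by (simp add: o_def)
qed

lemma W11_add: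
  assumes f: "has_W11_derivative f u" and g: "has_W11_derivative g v"
  shows "has_W11_derivative (\<lambda>x. f x + g x) (\<lambda>x. u x + v x)"
proof (rule W11_I)
  fix x assume x: "x \<in> {0..pi}"
  have "integral {0..x} (\<lambda>x. u x + v x) = integral {0..x} u + integral {0..x} v"
    using x absolutely_integrable_subinterval[OF W11_integrable[OF f], of 0 x]
      absolutely_integrable_subinterval[OF W11_integrable[OF g], of 0 x]
    by (intro integral_add) (simp_all add: absolutely_integrable_imp_integrable)
  then show "f x + g x = f 0 + g 0 + integral {0..x} (\<lambda>x. u x + v x)"
    by (subst W11_eq[OF f x], subst W11_eq[OF g x]) simp
qed (intro set_integral_add(1) W11_integrable[OF f] W11_integrable[OF g])

lemma W11_diff:
  assumes "has_W11_derivative f u" "has_W11_derivative g v"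
  shows "has_W11_derivative (\<lambda>x. f x - g x) (\<lambda>x. u x - v x)"
  using W11_add[OF assms(1) W11_linear[OF bounded_linear_minus[OF bounded_linear_ident] assms(2)]]
  by simp

lemma W11_of_vector_derivative:
  assumes "\<And>x. x \<in> {0..pi} \<Longrightarrow> (f has_vector_derivative u x) (at x within {0..pi})"
    and "continuous_on {0..pi} u"
  shows "has_W11_derivative f u"
proof (rule W11_I)
  fix x assume x: "x \<in> {0..pi}"
  have "(u has_integral (f x - f 0)) {0..x}"
    using x assms(1) by (intro fundamental_theorem_of_calculus)
      (auto intro!: has_vector_derivative_within_subset[OF assms(1)])
  then show "f x = f 0 + integral {0..x} u" by (simp add: integral_unique)
qed (rule absolutely_integrable_continuous_real[OF assms(2)])

lemma vector_derivative_of_W11: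
  assumes f: "has_W11_derivative f u" and u: "continuous_on {0..pi} u" and x: "x \<in> {0..pi}"
  shows "(f has_vector_derivative u x) (at x within {0..pi})"
proof -
  have "((\<lambda>y. integral {0..y} u) has_vector_derivative u x) (at x within {0..pi})"
    using u x by (rule integral_has_vector_derivative)
  then have "((\<lambda>y. f 0 + integral {0..y} u) has_vector_derivative 0 + u x) (at x within {0..pi})"
    by (intro has_vector_derivative_add has_vector_derivative_const)
  then show ?thesis
    by (intro has_vector_derivative_transform[OF x, of f "\<lambda>y. f 0 + integral {0..y} u"])
      (simp_all add: W11_eq[OF f, symmetric])
qed

text \<open>Over \<open>[a, b]\<close> the increment of the product differs from the integral of the
  expected derivative by integrals in which an increment of one factor meets the derivative of the
  other. This defect is quadratic in the joint variation, so it vanishes.\<close>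

lemma W11_bilinear:
  fixes f :: "real \<Rightarrow> 'a::euclidean_space" and g :: "real \<Rightarrow> 'b::euclidean_space"
    and pr :: "'a \<Rightarrow> 'b \<Rightarrow> 'c::euclidean_space"
  assumes pr: "bounded_bilinear pr"
    and f: "has_W11_derivative f u" and g: "has_W11_derivative g v"
  shows "has_W11_derivative (\<lambda>x. pr (f x) (g x)) (\<lambda>x. pr (u x) (g x) + pr (f x) (v x))"
    (is "has_W11_derivative ?F ?w")
proof -
  interpret bounded_bilinear pr by (rule pr)
  obtain K where K0: "0 \<le> K" and K: "\<And>a b. norm (pr a b) \<le> norm a * norm b * K"
    using nonneg_bounded by blast
  have cf: "continuous_on {0..pi} f" and cg: "continuous_on {0..pi} g"
    using f g W11_continuous by auto
  have u: "u absolutely_integrable_on {0..pi}" and v: "v absolutely_integrable_on {0..pi}"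
    using f g by (auto intro: W11_integrable)
  have w: "?w absolutely_integrable_on {0..pi}"
    using absolutely_integrable_bilinear_continuous[OF pr cf v]
      absolutely_integrable_bilinear_continuous'[OF pr cg u] by (intro set_integral_add(1))
  \<comment> \<open>The joint variation of both factors: its increments dominate those of
    \<open>f\<close> and of \<open>g\<close>.\<close>
  define m where "m = (\<lambda>x. integral {0..x} (\<lambda>t. norm (u t) + norm (v t)))"
  have nuv: "(\<lambda>t. norm (u t) + norm (v t)) absolutely_integrable_on {0..pi}"
    using u v by (intro set_integral_add(1) absolutely_integrable_norm[unfolded o_def])
  have W: "has_W11_derivative m (\<lambda>t. norm (u t) + norm (v t))"
    unfolding m_def by (rule W11_indefinite_integral[OF nuv])
  have minc: "m y - m x = integral {x..y} (\<lambda>t. norm (u t)) + integral {x..y} (\<lambda>t. norm (v t))"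
    and minc0: "integral {x..y} (\<lambda>t. norm (u t)) \<ge> 0" "integral {x..y} (\<lambda>t. norm (v t)) \<ge> 0"
    if "0 \<le> x" "x \<le> y" "y \<le> pi" for x y
  proof -
    have "u absolutely_integrable_on {x..y}" "v absolutely_integrable_on {x..y}"
      using that u v by (auto intro: absolutely_integrable_subinterval)
    then have i: "(\<lambda>t. norm (u t)) integrable_on {x..y}" "(\<lambda>t. norm (v t)) integrable_on {x..y}"
      by (auto simp: absolutely_integrable_on_def)
    then show "m y - m x = integral {x..y} (\<lambda>t. norm (u t)) + integral {x..y} (\<lambda>t. norm (v t))"
      using W11_increment[OF W that] by (simp add: integral_add)
    show "integral {x..y} (\<lambda>t. norm (u t)) \<ge> 0" "integral {x..y} (\<lambda>t. norm (v t)) \<ge> 0"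
      using i by (auto intro: Henstock_Kurzweil_Integration.integral_nonneg)
  qed
  have "?F x = ?F 0 + integral {0..x} ?w" if x: "x \<in> {0..pi}" for x
  proof -
    let ?h = "\<lambda>x. ?F x - integral {0..x} ?w"
    have "?h x = ?h 0"
    proof (rule constant_of_quadratic_bound[of 0 x m ?h K])
      show "continuous_on {0..x} m"
        using W11_continuous[OF W] x by (auto elim: continuous_on_subset)
      show "m a \<le> m b" if "0 \<le> a" "a \<le> b" "b \<le> x" for a b
        using minc[of a b] minc0[of a b] that x by auto
      fix a b :: real assume ab: "0 \<le> a" "a \<le> b" "b \<le> x"
      with x have ab': "0 \<le> a" "a \<le> b" "b \<le> pi" by auto
      have ua: "u absolutely_integrable_on {a..b}" and va: "v absolutely_integrable_on {a..b}"
        and wa: "?w absolutely_integrable_on {a..b}"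
        using ab' u v w absolutely_integrable_subinterval by blast+
      have i: "u integrable_on {a..b}" "v integrable_on {a..b}" "?w integrable_on {a..b}"
        using ua va wa by (auto intro: absolutely_integrable_imp_integrable)
      have Wint: "has_W11_derivative (\<lambda>x. integral {0..x} ?w) ?w"
        by (rule W11_indefinite_integral[OF w])
      have l1: "((\<lambda>t. pr (u t) (g b)) has_integral pr (f b - f a) (g b)) {a..b}"
        using has_integral_linear[OF integrable_integral[OF i(1)] bounded_linear_left[of "g b"]]
          W11_increment[OF f ab'] by (simp add: o_def)
      have l2: "((\<lambda>t. pr (f a) (v t)) has_integral pr (f a) (g b - g a)) {a..b}"
        using has_integral_linear[OF integrable_integral[OF i(2)] bounded_linear_right[of "f a"]]
          W11_increment[OF g ab'] by (simp add: o_def)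
      have "((\<lambda>t. pr (u t) (g b) + pr (f a) (v t) - ?w t) has_integral
          (pr (f b - f a) (g b) + pr (f a) (g b - g a) - integral {a..b} ?w)) {a..b}"
        using l1 l2 i(3) by (intro has_integral_diff has_integral_add integrable_integral)
      moreover have "pr (f b - f a) (g b) + pr (f a) (g b - g a) = ?F b - ?F a"
        by (simp add: diff_left diff_right)
      moreover have "integral {a..b} ?w = integral {0..b} ?w - integral {0..a} ?w"
        using W11_increment[OF Wint ab'] by simp
      moreover have "(\<lambda>t. pr (u t) (g b) + pr (f a) (v t) - ?w t)
          = (\<lambda>t. pr (u t) (g b - g t) + pr (f a - f t) (v t))"
        by (auto simp: diff_left diff_right)
      moreover have "p = A - B \<Longrightarrow> q = C - D \<Longrightarrow> p - q = (A - C) - (B - D)" for p q A B C D :: 'c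
        by simp
      ultimately have hi: "((\<lambda>t. pr (u t) (g b - g t) + pr (f a - f t) (v t)) has_integral (?h b - ?h a)) {a..b}"
        by metis
      have "norm (?h b - ?h a) \<le> integral {a..b} (\<lambda>t. K * (m b - m a) * (norm (u t) + norm (v t)))"
      proof (rule order_trans[OF eq_refl integral_norm_bound_integral])
        show "norm (?h b - ?h a) = norm (integral {a..b} (\<lambda>t. pr (u t) (g b - g t) + pr (f a - f t) (v t)))"
          using integral_unique[OF hi] by simp
        show "(\<lambda>t. pr (u t) (g b - g t) + pr (f a - f t) (v t)) integrable_on {a..b}"
          using hi by blast
        show "(\<lambda>t. K * (m b - m a) * (norm (u t) + norm (v t))) integrable_on {a..b}"
          using ua va by (intro integrable_on_mult_right integrable_add) (auto simp: absolutely_integrable_on_def)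
        fix t assume t: "t \<in> {a..b}"
        with ab' have t1: "0 \<le> a" "a \<le> t" "t \<le> pi" and t2: "0 \<le> t" "t \<le> b" "b \<le> pi" by auto
        have *: "m t - m a \<ge> 0" "m b - m t \<ge> 0"
          using minc[OF t1] minc[OF t2] minc0[OF t1] minc0[OF t2] by auto
        have "norm (f a - f t) \<le> m b - m a"
          using W11_norm_increment[OF f t1] minc[OF t1] minc0[OF t1] * by (simp add: norm_minus_commute)
        moreover have "norm (g b - g t) \<le> m b - m a"
          using W11_norm_increment[OF g t2] minc[OF t2] minc0[OF t2] * by simp
        ultimately have "norm (u t) * norm (g b - g t) * K \<le> norm (u t) * (m b - m a) * K"
          "norm (f a - f t) * norm (v t) * K \<le> (m b - m a) * norm (v t) * K"
          using K0 by (intro mult_right_mono mult_left_mono; simp)+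
        then have "norm (pr (u t) (g b - g t)) + norm (pr (f a - f t) (v t)) \<le> K * (m b - m a) * (norm (u t) + norm (v t))"
          using K[of "u t" "g b - g t"] K[of "f a - f t" "v t"] by (simp add: algebra_simps)
        then show "norm (pr (u t) (g b - g t) + pr (f a - f t) (v t)) \<le> K * (m b - m a) * (norm (u t) + norm (v t))"
          using norm_triangle_ineq order_trans by blast
      qed
      also have "\<dots> = K * (m b - m a) * (m b - m a)"
        using W11_increment[OF W ab'] by simp
      finally show "norm (?h b - ?h a) \<le> K * (m b - m a)\<^sup>2" by (simp add: power2_eq_square mult.assoc)
    qed (use x K0 in auto)
    then show ?thesis by (simp add: algebra_simps)
  qed
  with w show ?thesis by (rule W11_I)
qed

text \<open>The integrand is the derivative of \<open>exp (2 * K) / 2\<close>. In a sup norm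
  weighted by \<open>exp (2 * K)\<close> a Volterra operator with kernel bound \<open>k\<close> is
  thus a contraction with constant 1/2, which serves both uniqueness and the Picard series.\<close>

lemma integral_exp_weight_le:
  fixes k :: "real \<Rightarrow> real"
  assumes k: "k absolutely_integrable_on {0..pi}" and k0: "\<And>t. k t \<ge> 0" and x: "x \<in> {0..pi}"
  defines "K \<equiv> \<lambda>x. integral {0..x} k"
  shows "(\<lambda>t. k t * exp (2 * K t)) absolutely_integrable_on {0..pi}"
    and "integral {0..x} (\<lambda>t. k t * exp (2 * K t)) \<le> exp (2 * K x) / 2"
proof -
  have W: "has_W11_derivative K k" unfolding K_def by (rule W11_indefinite_integral[OF k])
  have cK: "continuous_on {0..pi} K" by (rule W11_continuous[OF W])
  show w: "(\<lambda>t. k t * exp (2 * K t)) absolutely_integrable_on {0..pi}" (is "?w absolutely_integrable_on _")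
    by (rule absolutely_integrable_bilinear_continuous'[OF bounded_bilinear_mult])
       (use k cK in \<open>auto intro!: continuous_intros\<close>)
  have Wint: "has_W11_derivative (\<lambda>x. integral {0..x} ?w) ?w"
    by (rule W11_indefinite_integral[OF w])
  let ?h = "\<lambda>x. exp (2 * K x) / 2 - integral {0..x} ?w"
  have mono: "K a \<le> K b" if "0 \<le> a" "a \<le> b" "b \<le> pi" for a b
  proof -
    have "k integrable_on {a..b}"
      using absolutely_integrable_subinterval[OF k that(1,3)] by (auto intro: absolutely_integrable_imp_integrable)
    then show ?thesis
      using W11_increment[OF W that] Henstock_Kurzweil_Integration.integral_nonneg[of k "{a..b}"] k0 by simp
  qed
  have "?h x = ?h 0"
  proof (rule constant_of_quadratic_bound[of 0 x K ?h "2 * exp (2 * K pi)"])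
    show "continuous_on {0..x} K"
      using cK x by (auto elim: continuous_on_subset)
    fix a b :: real assume ab: "0 \<le> a" "a \<le> b" "b \<le> x"
    with x have ab': "0 \<le> a" "a \<le> b" "b \<le> pi" by auto
    then show "K a \<le> K b" by (rule mono)
    let ?J = "K b - K a"
    have J: "?J \<ge> 0" using mono[OF ab'] by simp
    \<comment> \<open>Convexity: the increment of \<open>exp\<close> lies between the tangent
      increments at the two ends.\<close>
    have exp_le: "exp s - exp r \<le> (s - r) * exp s" "exp s - exp r \<ge> (s - r) * exp r" for r s :: real
    proof -
      have "(1 + (r - s)) * exp s \<le> exp (r - s) * exp s" by (intro mult_right_mono exp_ge_add_one_self) auto
      then show "exp s - exp r \<le> (s - r) * exp s" by (simp add: algebra_simps flip: exp_add)
      have "(1 + (s - r)) * exp r \<le> exp (s - r) * exp r" by (intro mult_right_mono exp_ge_add_one_self) auto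
      then show "exp s - exp r \<ge> (s - r) * exp r" by (simp add: algebra_simps flip: exp_add)
    qed
    have kab: "k absolutely_integrable_on {a..b}" and wab: "?w absolutely_integrable_on {a..b}"
      using k w ab' absolutely_integrable_subinterval by blast+
    then have ki: "k integrable_on {a..b}" and wi: "?w integrable_on {a..b}"
      by (auto intro: absolutely_integrable_imp_integrable)
    have bd: "exp (2 * K a) \<le> exp (2 * K t)" "exp (2 * K t) \<le> exp (2 * K b)" if "t \<in> {a..b}" for t
      using mono[of a t] mono[of t b] that ab' by auto
    have "integral {a..b} (\<lambda>t. k t * exp (2 * K a)) \<le> integral {a..b} ?w"
      "integral {a..b} ?w \<le> integral {a..b} (\<lambda>t. k t * exp (2 * K b))"
      using ki wi bd k0 by (intro integral_le integrable_on_mult_left mult_left_mono; simp)+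
    then have I: "?J * exp (2 * K a) \<le> integral {a..b} ?w" "integral {a..b} ?w \<le> ?J * exp (2 * K b)"
      using W11_increment[OF W ab'] by simp_all
    have E: "?J * exp (2 * K a) \<le> exp (2 * K b) / 2 - exp (2 * K a) / 2"
      "exp (2 * K b) / 2 - exp (2 * K a) / 2 \<le> ?J * exp (2 * K b)"
      using exp_le[of "2 * K b" "2 * K a"] by (auto simp: algebra_simps)
    \<comment> \<open>The integral and the increment of \<open>exp (2 * K) / 2\<close> lie in the
      same interval, of length \<open>?J * (exp (2 * K b) - exp (2 * K a))\<close>, which is
      quadratic in \<open>?J\<close>.\<close>
    have "norm (?h b - ?h a) \<le> ?J * (exp (2 * K b) - exp (2 * K a))"
      using I E W11_increment[OF Wint ab'] by (simp add: abs_le_iff algebra_simps)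
    also have "\<dots> \<le> ?J * (2 * ?J * exp (2 * K b))"
      using exp_le(1)[of "2 * K b" "2 * K a"] J by (intro mult_left_mono) (auto simp: algebra_simps)
    also have "\<dots> \<le> ?J * (2 * ?J * exp (2 * K pi))"
      using J mono[of b pi] ab' by (intro mult_left_mono) auto
    also have "\<dots> = 2 * exp (2 * K pi) * ?J\<^sup>2" by (simp add: power2_eq_square)
    finally show "norm (?h b - ?h a) \<le> 2 * exp (2 * K pi) * ?J\<^sup>2" .
  qed (use x in auto)
  then show "integral {0..x} ?w \<le> exp (2 * K x) / 2"
    by (simp add: K_def)
qed

section \<open>Complex matrices\<close>

lemma cscale_nth [simp]: "(c *\<^sub>M A) $ i $ j = c * A $ i $ j"
  by (simp add: cscale_def)

lemma dagger_nth [simp]: "dagger A $ i $ j = cnj (A $ j $ i)"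
  by (simp add: dagger_def)

lemma diag_nth [simp]: "diag d $ i $ j = (if i = j then d i else 0)"
  by (simp add: diag_def)

lemma matrix_mult_nth: "(A ** B) $ i $ j = (\<Sum>k\<in>UNIV. A $ i $ k * B $ k $ j)"
  by (simp add: matrix_matrix_mult_def)

lemma cscale_mult_left: "(c *\<^sub>M A) ** B = c *\<^sub>M (A ** B)"
  by (simp add: vec_eq_iff matrix_mult_nth sum_distrib_left mult.assoc)

lemma cscale_mult_right: "A ** (c *\<^sub>M B) = c *\<^sub>M (A ** B)"
  for A :: "complex^'n^'m" and B :: "complex^'p^'n"
  by (simp add: vec_eq_iff matrix_mult_nth sum_distrib_left mult.left_commute)

lemma cscale_cscale [simp]: "c *\<^sub>M d *\<^sub>M A = (c * d) *\<^sub>M A"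
  by (simp add: vec_eq_iff mult.assoc)

lemma cscale_add: "c *\<^sub>M (A + B) = c *\<^sub>M A + c *\<^sub>M B"
  by (simp add: vec_eq_iff algebra_simps)

lemma cscale_diff: "c *\<^sub>M (A - B) = c *\<^sub>M A - c *\<^sub>M B"
  by (simp add: vec_eq_iff algebra_simps)

lemma cscale_minus [simp]: "c *\<^sub>M (- A) = - (c *\<^sub>M A)"
  by (simp add: vec_eq_iff)

lemma cscale_add_left: "(c + d) *\<^sub>M A = c *\<^sub>M A + d *\<^sub>M A"
  by (simp add: vec_eq_iff algebra_simps)

lemma cscale_diff_left: "(c - d) *\<^sub>M A = c *\<^sub>M A - d *\<^sub>M A"
  by (simp add: vec_eq_iff algebra_simps)

lemma cscale_uminus_left [simp]: "(- c) *\<^sub>M A = - (c *\<^sub>M A)"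
  by (simp add: vec_eq_iff)

lemma cscale_one [simp]: "1 *\<^sub>M A = A"
  by (simp add: vec_eq_iff)

lemma cscale_zero [simp]: "0 *\<^sub>M A = 0" "c *\<^sub>M 0 = 0"
  by (simp_all add: vec_eq_iff)

lemma matrix_mult_minus_left [simp]: "(- A) ** B = - (A ** B)" for A :: "complex^'n^'m"
  by (simp add: vec_eq_iff matrix_mult_nth sum_negf)

lemma matrix_mult_minus_right [simp]: "A ** (- B) = - (A ** B)" for A :: "complex^'n^'m"
  by (simp add: vec_eq_iff matrix_mult_nth sum_negf)

lemma matrix_add_rdistrib: "(A + B) ** C = A ** C + B ** C" for A :: "complex^'n^'m"
  by (simp add: vec_eq_iff matrix_mult_nth sum.distrib algebra_simps)

lemma matrix_diff_ldistrib: "A ** (B - C) = A ** B - A ** C" for A :: "complex^'n^'m"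
  by (simp add: vec_eq_iff matrix_mult_nth sum_subtractf algebra_simps)

lemma matrix_diff_rdistrib: "(A - B) ** C = A ** C - B ** C" for A :: "complex^'n^'m"
  by (simp add: vec_eq_iff matrix_mult_nth sum_subtractf algebra_simps)

lemma matrix_mult_sum_left: "(\<Sum>i\<in>S. f i) ** B = (\<Sum>i\<in>S. f i ** B)"
  for f :: "'i \<Rightarrow> complex^'n^'m" and B :: "complex^'p^'n"
  by (induction S rule: infinite_finite_induct) (simp_all add: matrix_add_rdistrib)

lemma matrix_mult_sum_right: "A ** (\<Sum>i\<in>S. f i) = (\<Sum>i\<in>S. A ** f i)"
  for f :: "'i \<Rightarrow> complex^'p^'n" and A :: "complex^'n^'m"
  by (induction S rule: infinite_finite_induct) (simp_all add: matrix_add_ldistrib)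

lemmas matrix_distribs =
  matrix_add_ldistrib matrix_add_rdistrib matrix_diff_ldistrib matrix_diff_rdistrib
  cscale_mult_left cscale_mult_right cscale_add cscale_diff

lemma dagger_mult: "dagger (A ** B) = dagger B ** dagger A"
  by (simp add: vec_eq_iff matrix_mult_nth mult.commute)

lemma dagger_add: "dagger (A + B) = dagger A + dagger B"
  by (simp add: vec_eq_iff)

lemma dagger_diff: "dagger (A - B) = dagger A - dagger B"
  by (simp add: vec_eq_iff)

lemma dagger_minus [simp]: "dagger (- A) = - dagger A"
  by (simp add: vec_eq_iff)

lemma dagger_cscale: "dagger (c *\<^sub>M A) = cnj c *\<^sub>M dagger A"
  by (simp add: vec_eq_iff)

lemma dagger_dagger [simp]: "dagger (dagger A) = A"
  by (simp add: vec_eq_iff)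

lemma dagger_mat [simp]: "dagger (mat 1) = mat 1"
  by (simp add: vec_eq_iff mat_def)

lemma dagger_zero [simp]: "dagger 0 = 0"
  by (simp add: vec_eq_iff)

lemmas dagger_simps = dagger_mult dagger_add dagger_diff dagger_cscale

lemma norm_cscale: "norm (c *\<^sub>M A) = norm c * norm A"
proof -
  have "norm ((c *\<^sub>M A) $ i) = norm c * norm (A $ i)" for i
    by (simp add: norm_vec_def norm_mult L2_set_right_distrib)
  then show ?thesis by (simp add: norm_vec_def[of A] norm_vec_def[of "c *\<^sub>M A"] L2_set_right_distrib)
qed

text \<open>The norm of the type is the Frobenius norm. Each row of the product is a combination of
  the rows of \<open>B\<close>, so Cauchy-Schwarz gives the constant 1.\<close>

lemma norm_matrix_mult_le: "norm (A ** B) \<le> norm A * norm B"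
  for A :: "complex^'n^'m" and B :: "complex^'p^'n"
proof -
  have "norm ((A ** B) $ i) \<le> norm (A $ i) * norm B" for i
  proof -
    have "(A ** B) $ i = (\<Sum>k\<in>UNIV. A $ i $ k *s B $ k)"
      by (simp add: vec_eq_iff matrix_mult_nth)
    also have "norm \<dots> \<le> (\<Sum>k\<in>UNIV. norm (A $ i $ k) * norm (B $ k))"
    proof (rule order_trans[OF norm_sum sum_mono])
      show "norm (A $ i $ k *s B $ k) \<le> norm (A $ i $ k) * norm (B $ k)" for k
        by (simp add: norm_vec_def norm_mult L2_set_right_distrib)
    qed
    also have "\<dots> \<le> norm (A $ i) * norm B"
      using L2_set_mult_ineq[of "\<lambda>k. norm (A $ i $ k)" "\<lambda>k. norm (B $ k)" UNIV]
      by (simp add: norm_vec_def)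
    finally show ?thesis .
  qed
  then have "L2_set (\<lambda>i. norm ((A ** B) $ i)) UNIV \<le> L2_set (\<lambda>i. norm (A $ i) * norm B) UNIV"
    by (intro L2_set_mono) auto
  then show ?thesis by (simp add: norm_vec_def[of "A ** B"] norm_vec_def[of A] L2_set_left_distrib)
qed

lemma bounded_bilinear_matrix_mult:
  "bounded_bilinear ((**) :: complex^'n^'m \<Rightarrow> complex^'p^'n \<Rightarrow> complex^'p^'m)"
proof
  show "\<exists>K. \<forall>(A :: complex^'n^'m) (B :: complex^'p^'n). norm (A ** B) \<le> norm A * norm B * K"
    using norm_matrix_mult_le by (intro exI[of _ 1]) auto
qed (simp_all add: matrix_add_ldistrib matrix_add_rdistrib vec_eq_iff matrix_mult_nth
    scaleR_sum_right algebra_simps)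

lemmas bounded_linear_matrix_mult_left = bounded_bilinear.bounded_linear_left[OF bounded_bilinear_matrix_mult]
lemmas bounded_linear_matrix_mult_right = bounded_bilinear.bounded_linear_right[OF bounded_bilinear_matrix_mult]
lemmas continuous_on_matrix_mult [continuous_intros] =
  bounded_bilinear.continuous_on[OF bounded_bilinear_matrix_mult]

lemma bounded_linear_cscale: "bounded_linear (\<lambda>A :: complex^'n^'m. c *\<^sub>M A)"
  by (rule bounded_linear_intro[where K = "norm c"])
    (simp_all add: norm_cscale cscale_add vec_eq_iff)

lemma bounded_bilinear_cscale: "bounded_bilinear (\<lambda>c (A :: complex^'n^'m). c *\<^sub>M A)"
proof
  show "\<exists>K. \<forall>c (A :: complex^'n^'m). norm (c *\<^sub>M A) \<le> norm c * norm A * K"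
    by (intro exI[of _ 1]) (simp add: norm_cscale)
qed (simp_all add: cscale_add cscale_add_left vec_eq_iff)

lemmas continuous_on_cscale [continuous_intros] =
  bounded_bilinear.continuous_on[OF bounded_bilinear_cscale]

lemma norm_dagger: "norm (dagger A) = norm A"
proof -
  have *: "(norm B)\<^sup>2 = (\<Sum>i\<in>UNIV. \<Sum>j\<in>UNIV. (norm (B $ i $ j))\<^sup>2)" for B :: "complex^'x^'y"
    by (simp add: norm_vec_def L2_set_def sum_nonneg)
  have "(norm (dagger A))\<^sup>2 = (norm A)\<^sup>2"
    unfolding * by (subst sum.swap) simp
  then show ?thesis by (simp add: power2_eq_iff_nonneg)
qed

lemma bounded_linear_dagger: "bounded_linear (dagger :: complex^'n^'m \<Rightarrow> complex^'m^'n)"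
  by (rule bounded_linear_intro[where K = 1]) (simp_all add: norm_dagger dagger_add vec_eq_iff)

lemma bounded_linear_entry: "bounded_linear (\<lambda>A :: complex^'n^'m. A $ i $ j)"
  using bounded_linear_compose[OF bounded_linear_vec_nth bounded_linear_vec_nth] .

lemma norm_entry_le: "norm (A $ i $ j) \<le> norm (A :: complex^'n^'m)"
  by (metis Finite_Cartesian_Product.norm_nth_le order_trans)

text \<open>A matrix is the finite sum of its \<open>unit_entry\<close> parts, so integrability and
  growth bounds pass from the entries to the matrix by linearity.\<close>

definition unit_entry :: "'m \<Rightarrow> 'n \<Rightarrow> complex \<Rightarrow> complex^'n^'m"
  where "unit_entry i j c = (\<chi> k l. if k = i \<and> l = j then c else 0)"

lemma unit_entry_nth [simp]: "unit_entry i j c $ k $ l = (if k = i \<and> l = j then c else 0)"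
  by (simp add: unit_entry_def)

lemma matrix_eq_sum_entries:
  "A = (\<Sum>i\<in>UNIV. \<Sum>j\<in>UNIV. unit_entry i j (A $ i $ j))" for A :: "complex^'n^'m"
proof -
  have "(\<Sum>i\<in>UNIV. \<Sum>j\<in>UNIV. if k = i \<and> l = j then A $ i $ j else 0) = A $ k $ l" for k l
  proof -
    have "(\<Sum>i\<in>UNIV. \<Sum>j\<in>UNIV. if k = i \<and> l = j then A $ i $ j else 0)
        = (\<Sum>i\<in>UNIV. if k = i then \<Sum>j\<in>UNIV. if l = j then A $ i $ j else 0 else 0)"
      by (intro sum.cong) auto
    then show ?thesis by simp
  qed
  then show ?thesis by (simp add: vec_eq_iff)
qed

lemma bounded_linear_unit_entry: "bounded_linear (unit_entry i j :: complex \<Rightarrow> complex^'n^'m)"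
proof (rule bounded_linear_intro[where K = 1])
  show "norm (unit_entry i j c :: complex^'n^'m) \<le> norm c * 1" for c
  proof -
    have r: "norm ((unit_entry i j c :: complex^'n^'m) $ k) = (if k = i then norm c else 0)" for k
      by (simp add: norm_vec_def L2_set_def if_distrib[of "\<lambda>x. x\<^sup>2"] if_distrib[of norm] cong: if_cong)
    then show ?thesis
      by (simp add: norm_vec_def[of "unit_entry i j c"] L2_set_def if_distrib[of "\<lambda>x. x\<^sup>2"] cong: if_cong)
  qed
qed (simp_all add: vec_eq_iff)

lemma absolutely_integrable_matrix:
  fixes A :: "real \<Rightarrow> complex^'n^'m"
  assumes "\<And>i j. (\<lambda>x. A x $ i $ j) absolutely_integrable_on S"
  shows "A absolutely_integrable_on S"
proof -
  have "(\<lambda>x. \<Sum>i\<in>UNIV. \<Sum>j\<in>UNIV. unit_entry i j (A x $ i $ j)) absolutely_integrable_on S"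
    using absolutely_integrable_linear[OF assms bounded_linear_unit_entry]
    by (intro absolutely_integrable_sum) (auto simp: o_def)
  then show ?thesis by (simp flip: matrix_eq_sum_entries)
qed

lemma W11_matrix:
  fixes A A' :: "real \<Rightarrow> complex^'n^'m"
  assumes "\<And>i j. has_W11_derivative (\<lambda>x. A x $ i $ j) (\<lambda>x. A' x $ i $ j)"
  shows "has_W11_derivative A A'"
proof (rule W11_I)
  show i: "A' absolutely_integrable_on {0..pi}"
    by (rule absolutely_integrable_matrix[OF W11_integrable[OF assms]])
  fix x assume x: "x \<in> {0..pi}"
  have "A' integrable_on {0..x}"
    using absolutely_integrable_subinterval[OF i, of 0 x] x absolutely_integrable_imp_integrable by auto
  then have "integral {0..x} A' $ i $ j = integral {0..x} (\<lambda>x. A' x $ i $ j)" for i j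
    using integral_linear[OF _ bounded_linear_entry, of A' "{0..x}" i j] by (simp add: o_def)
  then show "A x = A 0 + integral {0..x} A'"
    using W11_eq[OF assms x] by (simp add: vec_eq_iff)
qed

section \<open>Linear Volterra equations\<close>

text \<open>At a maximum of \<open>norm (z t)\<close> divided by the exponential weight, the
  integral equation bounds the quotient by half of itself, so the maximum is zero.\<close>

lemma W11_linear_ode_unique:
  fixes z :: "real \<Rightarrow> complex^'p^'n" and K :: "real \<Rightarrow> complex^'n^'n"
  assumes z: "has_W11_derivative z (\<lambda>t. K t ** z t)" and K: "K absolutely_integrable_on {0..pi}"
    and z0: "z 0 = 0" and x: "x \<in> {0..pi}"
  shows "z x = 0"
proof -
  define k where "k = (\<lambda>t. norm (K t))"
  define e where "e = (\<lambda>x. exp (2 * integral {0..x} k))"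
  have k: "k absolutely_integrable_on {0..pi}"
    unfolding k_def using absolutely_integrable_norm[OF K] by (simp add: o_def)
  have ce: "continuous_on {0..pi} e"
    unfolding e_def using W11_continuous[OF W11_indefinite_integral[OF k]] by (intro continuous_intros)
  have cz: "continuous_on {0..pi} z" by (rule W11_continuous[OF z])
  have e0: "e t > 0" for t by (simp add: e_def)
  have "continuous_on {0..pi} (\<lambda>t. norm (z t) / e t)"
    using cz ce e0 by (intro continuous_intros) (auto simp: less_imp_neq[symmetric])
  then obtain s where s: "s \<in> {0..pi}" and smax: "\<And>t. t \<in> {0..pi} \<Longrightarrow> norm (z t) / e t \<le> norm (z s) / e s"
    using continuous_attains_sup[of "{0..pi}" "\<lambda>t. norm (z t) / e t"] by auto
  define m where "m = norm (z s) / e s"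
  have m0: "m \<ge> 0" using e0[of s] by (simp add: m_def)
  have "norm (z s) = norm (integral {0..s} (\<lambda>t. K t ** z t))"
    using W11_eq[OF z s] z0 by simp
  also have "\<dots> \<le> integral {0..s} (\<lambda>t. m * (k t * e t))"
  proof (rule integral_norm_bound_integral)
    show "(\<lambda>t. K t ** z t) integrable_on {0..s}"
      using absolutely_integrable_subinterval[OF W11_integrable[OF z], of 0 s] s
      by (simp add: absolutely_integrable_imp_integrable)
    show "(\<lambda>t. m * (k t * e t)) integrable_on {0..s}"
      using absolutely_integrable_subinterval[OF integral_exp_weight_le(1)[OF k _ s], of 0 s] s
      unfolding e_def k_def by (intro integrable_on_mult_right) (simp add: absolutely_integrable_imp_integrable)
    fix t assume t: "t \<in> {0..s}"
    then have "norm (z t) \<le> m * e t"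
      using smax[of t] e0[of t] s by (simp add: m_def field_simps)
    then have "norm (K t) * norm (z t) \<le> norm (K t) * (m * e t)" by (rule mult_left_mono) simp
    then show "norm (K t ** z t) \<le> m * (k t * e t)"
      using norm_matrix_mult_le[of "K t" "z t"] by (simp add: k_def algebra_simps)
  qed
  also have "\<dots> = m * integral {0..s} (\<lambda>t. k t * e t)" by simp
  also have "\<dots> \<le> m * (e s / 2)"
    using integral_exp_weight_le(2)[OF k _ s] m0 unfolding e_def k_def by (intro mult_left_mono) simp_all
  finally have "norm (z s) \<le> norm (z s) / 2"
    using e0[of s] by (simp add: m_def)
  then have "norm (z s) = 0" by (smt (verit) norm_ge_zero field_sum_of_halves)
  then have "norm (z x) / e x \<le> 0" using smax[OF x] by simp
  then show ?thesis using e0[of x] by (simp add: divide_le_0_iff)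
qed

text \<open>The generated families are the polynomials in \<xi> with continuous matrix coefficients
  on \<open>{0..pi}\<close>. Induction shows that Volterra integration preserves the class, so
  Picard iterates are entire in \<xi> without differentiation under the integral sign;
  \<open>cong\<close> forgets the values outside the interval.\<close>

inductive entire_family :: "(complex \<Rightarrow> real \<Rightarrow> complex^'n^'n) \<Rightarrow> bool"
  where
    const: "continuous_on {0..pi} c \<Longrightarrow> entire_family (\<lambda>\<xi>. c)"
  | add: "entire_family f \<Longrightarrow> entire_family g \<Longrightarrow> entire_family (\<lambda>\<xi> x. f \<xi> x + g \<xi> x)"
  | scale: "entire_family f \<Longrightarrow> entire_family (\<lambda>\<xi> x. \<xi> *\<^sub>M f \<xi> x)"
  | cong: "entire_family f \<Longrightarrow> (\<And>\<xi> x. x \<in> {0..pi} \<Longrightarrow> f \<xi> x = g \<xi> x) \<Longrightarrow> entire_family g"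

lemma entire_family_continuous: "entire_family f \<Longrightarrow> continuous_on {0..pi} (f \<xi>)"
proof (induction rule: entire_family.induct)
  case (cong f g)
  then show ?case using continuous_on_eq by blast
qed (auto intro!: continuous_intros)

lemma entire_family_holomorphic:
  "entire_family f \<Longrightarrow> x \<in> {0..pi} \<Longrightarrow> (\<lambda>\<xi>. f \<xi> x $ i $ j) holomorphic_on UNIV"
proof (induction rule: entire_family.induct)
  case (cong f g)
  then show ?case by (metis (no_types, lifting) holomorphic_transform)
qed (auto intro!: holomorphic_intros)

text \<open>A kernel quadratic in the parameter covers the first-order system of the pencil; with
  \<open>K1\<close> and \<open>K2\<close> zero it also yields the amplitudes
  \<open>P_sol\<close>.\<close>

locale volterra =
  fixes K0 K1 K2 :: "real \<Rightarrow> complex^'n^'n"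
  assumes K0: "K0 absolutely_integrable_on {0..pi}" and K1: "K1 absolutely_integrable_on {0..pi}"
    and K2: "K2 absolutely_integrable_on {0..pi}"
begin

definition ker :: "complex \<Rightarrow> real \<Rightarrow> complex^'n^'n"
  where "ker \<xi> t = K0 t + \<xi> *\<^sub>M K1 t + \<xi>\<^sup>2 *\<^sub>M K2 t"

lemma ker_integrable: "ker \<xi> absolutely_integrable_on {0..pi}"
  unfolding ker_def
  using absolutely_integrable_linear[OF K1 bounded_linear_cscale] absolutely_integrable_linear[OF K2 bounded_linear_cscale]
  by (intro set_integral_add(1) K0) (simp_all add: o_def)

primrec picard :: "nat \<Rightarrow> complex \<Rightarrow> real \<Rightarrow> complex^'n^'n"
  where
    "picard 0 \<xi> x = mat 1"
  | "picard (Suc k) \<xi> x = integral {0..x} (\<lambda>t. ker \<xi> t ** picard k \<xi> t)"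

lemma mult_continuous_integrable:
  fixes c A :: "real \<Rightarrow> complex^'n^'n"
  assumes "A absolutely_integrable_on {0..pi}" "continuous_on {0..pi} c"
  shows "(\<lambda>t. A t ** c t) absolutely_integrable_on {0..pi}"
  by (rule absolutely_integrable_bilinear_continuous'[OF bounded_bilinear_matrix_mult assms(2,1)])

lemma mult_continuous_integrable':
  fixes c A :: "real \<Rightarrow> complex^'n^'n"
  assumes "A absolutely_integrable_on {0..pi}" "continuous_on {0..pi} c" "x \<in> {0..pi}"
  shows "(\<lambda>t. A t ** c t) integrable_on {0..x}"
  using absolutely_integrable_subinterval[OF mult_continuous_integrable[OF assms(1,2)], of 0 x] assms(3)
  by (auto intro: absolutely_integrable_imp_integrable)

lemma entire_family_integral:
  "entire_family f \<Longrightarrow> entire_family (\<lambda>\<xi> x. integral {0..x} (\<lambda>t. ker \<xi> t ** f \<xi> t))"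
proof (induction rule: entire_family.induct)
  case (const c)
  let ?I = "\<lambda>A x. integral {0..x} (\<lambda>t. A t ** c t)"
  have cont: "continuous_on {0..pi} (?I A)" if "A absolutely_integrable_on {0..pi}" for A :: "real \<Rightarrow> complex^'n^'n"
    by (rule W11_continuous[OF W11_indefinite_integral[OF mult_continuous_integrable[OF that const]]])
  have "entire_family (\<lambda>\<xi> x. ?I K0 x + \<xi> *\<^sub>M ?I K1 x + \<xi> *\<^sub>M \<xi> *\<^sub>M ?I K2 x)"
    by (intro entire_family.add entire_family.scale entire_family.const cont K0 K1 K2)
  then show ?case
  proof (rule entire_family.cong)
    fix \<xi> x assume x: "x \<in> {0..pi}"
    have s: "((\<lambda>t. c' *\<^sub>M (A t ** c t)) has_integral c' *\<^sub>M ?I A x) {0..x}"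
      if "A absolutely_integrable_on {0..pi}" for A :: "real \<Rightarrow> complex^'n^'n" and c'
      using has_integral_linear[OF integrable_integral[OF mult_continuous_integrable'[OF that const x]]
          bounded_linear_cscale[of c']] by (simp add: o_def)
    have "((\<lambda>t. K0 t ** c t + \<xi> *\<^sub>M (K1 t ** c t) + \<xi>\<^sup>2 *\<^sub>M (K2 t ** c t)) has_integral
        (?I K0 x + \<xi> *\<^sub>M ?I K1 x + \<xi>\<^sup>2 *\<^sub>M ?I K2 x)) {0..x}"
      by (intro has_integral_add s K1 K2 integrable_integral mult_continuous_integrable' K0 const x)
    moreover have "(\<lambda>t. K0 t ** c t + \<xi> *\<^sub>M (K1 t ** c t) + \<xi>\<^sup>2 *\<^sub>M (K2 t ** c t)) = (\<lambda>t. ker \<xi> t ** c t)"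
      by (simp add: ker_def matrix_distribs)
    ultimately show "?I K0 x + \<xi> *\<^sub>M ?I K1 x + \<xi> *\<^sub>M \<xi> *\<^sub>M ?I K2 x = integral {0..x} (\<lambda>t. ker \<xi> t ** c t)"
      by (simp add: integral_unique power2_eq_square)
  qed
next
  case (add f g)
  from entire_family.add[OF add.IH] show ?case
  proof (rule entire_family.cong)
    fix \<xi> x assume "x \<in> {0..pi}"
    then show "integral {0..x} (\<lambda>t. ker \<xi> t ** f \<xi> t) + integral {0..x} (\<lambda>t. ker \<xi> t ** g \<xi> t)
        = integral {0..x} (\<lambda>t. ker \<xi> t ** (f \<xi> t + g \<xi> t))"
      unfolding matrix_add_ldistrib
      by (intro integral_add[symmetric] mult_continuous_integrable' ker_integrable entire_family_continuous add.hyps)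
  qed
next
  case (scale f)
  from entire_family.scale[OF scale.IH] show ?case
  proof (rule entire_family.cong)
    fix \<xi> x assume "x \<in> {0..pi}"
    then show "\<xi> *\<^sub>M integral {0..x} (\<lambda>t. ker \<xi> t ** f \<xi> t) = integral {0..x} (\<lambda>t. ker \<xi> t ** (\<xi> *\<^sub>M f \<xi> t))"
      using integral_linear[OF mult_continuous_integrable'[OF ker_integrable entire_family_continuous[OF scale.hyps]]
          bounded_linear_cscale, of x \<xi> \<xi> \<xi>]
      by (simp add: o_def cscale_mult_right)
  qed
next
  case (cong f g)
  show ?case
  proof (rule entire_family.cong[OF cong.IH])
    fix \<xi> x assume "x \<in> {0..pi}"
    then show "integral {0..x} (\<lambda>t. ker \<xi> t ** f \<xi> t) = integral {0..x} (\<lambda>t. ker \<xi> t ** g \<xi> t)"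
      using cong.hyps by (intro integral_cong) auto
  qed
qed

lemma entire_family_picard: "entire_family (picard k)"
proof (induction k)
  case 0
  have "picard 0 = (\<lambda>\<xi> x. mat 1)" by (simp add: fun_eq_iff)
  then show ?case using entire_family.const[of "\<lambda>x. mat 1"] by simp
next
  case (Suc k)
  have "picard (Suc k) = (\<lambda>\<xi> x. integral {0..x} (\<lambda>t. ker \<xi> t ** picard k \<xi> t))" by (simp add: fun_eq_iff)
  then show ?case using entire_family_integral[OF Suc] by simp
qed

text \<open>Bounds the kernel for all \<xi> in the disc of radius \<open>R\<close>, so that the
  Picard series converges uniformly there.\<close>

definition kappa :: "real \<Rightarrow> real \<Rightarrow> real"
  where "kappa R t = norm (K0 t) + R * norm (K1 t) + R\<^sup>2 * norm (K2 t)"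

lemma kappa_integrable: "kappa R absolutely_integrable_on {0..pi}"
  unfolding kappa_def
  using absolutely_integrable_norm[OF K0] absolutely_integrable_norm[OF K1] absolutely_integrable_norm[OF K2]
  by (intro set_integral_add(1) set_integrable_mult_right) (simp_all add: o_def)

lemma norm_ker_le: "norm \<xi> \<le> R \<Longrightarrow> norm (ker \<xi> t) \<le> kappa R t"
  unfolding ker_def kappa_def
  by (intro order_trans[OF norm_triangle_ineq] add_mono; simp add: norm_cscale norm_power mult_right_mono power_mono)

lemma kappa_nonneg: "R \<ge> 0 \<Longrightarrow> kappa R t \<ge> 0"
  by (simp add: kappa_def)

text \<open>The induction carries the weight \<open>exp (2 * integral {0..x} (kappa R))\<close>; one
  Volterra step reproduces it with a factor 1/2, which makes the series geometric.\<close>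

lemma norm_picard_le:
  assumes "norm \<xi> \<le> R" "x \<in> {0..pi}"
  shows "norm (picard k \<xi> x) \<le> norm (mat 1 :: complex^'n^'n) * (1/2)^k * exp (2 * integral {0..x} (kappa R))"
  using assms(2)
proof (induction k arbitrary: x)
  case 0
  have R: "R \<ge> 0" using assms(1) norm_ge_zero order_trans by blast
  have "integral {0..x} (kappa R) \<ge> 0"
    using absolutely_integrable_subinterval[OF kappa_integrable, of 0 x R] 0 kappa_nonneg[OF R]
    by (intro Henstock_Kurzweil_Integration.integral_nonneg absolutely_integrable_imp_integrable) auto
  then have "norm (mat 1 :: complex^'n^'n) * 1 \<le> norm (mat 1 :: complex^'n^'n) * exp (2 * integral {0..x} (kappa R))"
    by (intro mult_left_mono) auto
  then show ?case by simp
next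
  case (Suc k)
  have R: "R \<ge> 0" using assms(1) norm_ge_zero order_trans by blast
  let ?e = "\<lambda>x. exp (2 * integral {0..x} (kappa R))"
  let ?c = "norm (mat 1 :: complex^'n^'n) * (1/2)^k"
  have "norm (picard (Suc k) \<xi> x) \<le> integral {0..x} (\<lambda>t. ?c * (kappa R t * ?e t))"
    unfolding picard.simps
  proof (rule integral_norm_bound_integral)
    show "(\<lambda>t. ker \<xi> t ** picard k \<xi> t) integrable_on {0..x}"
      by (rule mult_continuous_integrable'[OF ker_integrable entire_family_continuous[OF entire_family_picard] Suc.prems])
    show "(\<lambda>t. ?c * (kappa R t * ?e t)) integrable_on {0..x}"
      using absolutely_integrable_subinterval[OF integral_exp_weight_le(1)[OF kappa_integrable kappa_nonneg[OF R] Suc.prems], of 0 x] Suc.prems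
      by (intro integrable_on_mult_right absolutely_integrable_imp_integrable) simp
    fix t assume t: "t \<in> {0..x}"
    have "norm (ker \<xi> t ** picard k \<xi> t) \<le> norm (ker \<xi> t) * norm (picard k \<xi> t)"
      by (rule norm_matrix_mult_le)
    also have "\<dots> \<le> kappa R t * (?c * ?e t)"
      using t Suc.prems kappa_nonneg[OF R]
      by (intro mult_mono norm_ker_le assms Suc.IH) auto
    finally show "norm (ker \<xi> t ** picard k \<xi> t) \<le> ?c * (kappa R t * ?e t)" by (simp add: algebra_simps)
  qed
  also have "\<dots> = ?c * integral {0..x} (\<lambda>t. kappa R t * ?e t)" by simp
  also have "\<dots> \<le> ?c * (?e x / 2)"
    by (intro mult_left_mono integral_exp_weight_le(2)[OF kappa_integrable kappa_nonneg[OF R] Suc.prems]) auto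
  finally show ?case by simp
qed

definition fund :: "complex \<Rightarrow> real \<Rightarrow> complex^'n^'n"
  where "fund \<xi> x = (\<Sum>k. picard k \<xi> x)"

lemma norm_picard_le':
  assumes "norm \<xi> \<le> R" "x \<in> {0..pi}"
  shows "norm (picard k \<xi> x) \<le> norm (mat 1 :: complex^'n^'n) * exp (2 * integral {0..pi} (kappa R)) * (1/2)^k"
proof -
  have R: "R \<ge> 0" using assms(1) norm_ge_zero order_trans by blast
  have "integral {0..x} (kappa R) \<le> integral {0..pi} (kappa R)"
    using absolutely_integrable_subinterval[OF kappa_integrable, of 0 x R] assms kappa_nonneg[OF R] kappa_integrable
    by (intro integral_subset_le absolutely_integrable_imp_integrable) auto
  then have "norm (mat 1 :: complex^'n^'n) * (1/2)^k * exp (2 * integral {0..x} (kappa R))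
      \<le> norm (mat 1 :: complex^'n^'n) * (1/2)^k * exp (2 * integral {0..pi} (kappa R))"
    by (intro mult_left_mono) auto
  then show ?thesis using norm_picard_le[OF assms, of k] by (simp add: mult_ac)
qed

lemma summable_picard_bound: "summable (\<lambda>k. c * (1/2)^k :: real)"
  by (intro summable_mult summable_geometric) simp

lemma uniform_limit_picard:
  "uniform_limit ({0..pi} \<times> cball 0 R) (\<lambda>n (x, \<xi>). \<Sum>k<n. picard k \<xi> x) (\<lambda>(x, \<xi>). fund \<xi> x) sequentially"
  unfolding fund_def case_prod_unfold
  by (rule Weierstrass_m_test[OF _ summable_picard_bound[of "norm (mat 1 :: complex^'n^'n) * exp (2 * integral {0..pi} (kappa R))"]])
     (auto intro!: norm_picard_le')

lemma picard_sums:
  assumes "x \<in> {0..pi}" shows "(\<lambda>k. picard k \<xi> x) sums fund \<xi> x"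
  unfolding fund_def
  by (rule summable_sums[OF summable_comparison_test'[OF summable_picard_bound norm_picard_le'[OF order_refl assms]]])

lemma fund_continuous: "continuous_on {0..pi} (fund \<xi>)"
proof (rule uniform_limit_theorem)
  show "uniform_limit {0..pi} (\<lambda>n x. \<Sum>k<n. picard k \<xi> x) (fund \<xi>) sequentially"
    using uniform_limit_compose'[OF uniform_limit_picard[of "norm \<xi>"], of "\<lambda>x. (x, \<xi>)" "{0..pi}"] by simp
  show "\<forall>\<^sub>F n in sequentially. continuous_on {0..pi} (\<lambda>x. \<Sum>k<n. picard k \<xi> x)"
    by (intro always_eventually allI continuous_on_sum entire_family_continuous entire_family_picard)
qed simp

lemma fund_holomorphic:
  assumes x: "x \<in> {0..pi}"
  shows "(\<lambda>\<xi>. fund \<xi> x $ i $ j) holomorphic_on UNIV"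
proof (rule holomorphic_uniform_sequence[where f = "\<lambda>n \<xi>. (\<Sum>k<n. picard k \<xi> x) $ i $ j"])
  show "(\<lambda>\<xi>. (\<Sum>k<n. picard k \<xi> x) $ i $ j) holomorphic_on UNIV" for n
    using entire_family_holomorphic[OF entire_family_picard x] by (auto intro!: holomorphic_intros)
  fix z :: complex
  have "uniform_limit (cball 0 (norm z + 1)) (\<lambda>n \<xi>. \<Sum>k<n. picard k \<xi> x) (\<lambda>\<xi>. fund \<xi> x) sequentially"
    using uniform_limit_compose'[OF uniform_limit_picard[of "norm z + 1"], of "\<lambda>\<xi>. (x, \<xi>)" "cball 0 (norm z + 1)"] x
    by (auto simp: Pi_def)
  then have "uniform_limit (cball z 1) (\<lambda>n \<xi>. \<Sum>k<n. picard k \<xi> x) (\<lambda>\<xi>. fund \<xi> x) sequentially"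
    by (rule uniform_limit_on_subset) (auto simp: cball_subset_cball_iff dist_norm)
  then have "uniform_limit (cball z 1) (\<lambda>n \<xi>. (\<Sum>k<n. picard k \<xi> x) $ i $ j) (\<lambda>\<xi>. fund \<xi> x $ i $ j) sequentially"
    by (rule bounded_linear.uniform_limit[OF bounded_linear_entry])
  then show "\<exists>d>0. cball z d \<subseteq> UNIV \<and>
      uniform_limit (cball z d) (\<lambda>n \<xi>. (\<Sum>k<n. picard k \<xi> x) $ i $ j) (\<lambda>\<xi>. fund \<xi> x $ i $ j) sequentially"
    by (intro exI[of _ 1]) auto
qed simp

lemma fund_0: "fund \<xi> 0 = mat 1"
proof -
  have "picard k \<xi> 0 = (if k = 0 then mat 1 else 0)" for k
    by (cases k) auto
  then have "(\<lambda>k. picard k \<xi> 0) sums mat 1"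
    using sums_single[of 0 "\<lambda>_. mat 1 :: complex^'n^'n"] by simp
  then show ?thesis using picard_sums[of 0 \<xi>] sums_unique2 by fastforce
qed

lemma fund_W11: "has_W11_derivative (fund \<xi>) (\<lambda>t. ker \<xi> t ** fund \<xi> t)"
proof (rule W11_I)
  show "(\<lambda>t. ker \<xi> t ** fund \<xi> t) absolutely_integrable_on {0..pi}"
    by (rule mult_continuous_integrable[OF ker_integrable fund_continuous])
  fix x assume x: "x \<in> {0..pi}"
  let ?S = "\<lambda>n t. \<Sum>k<n. picard k \<xi> t"
  define C where "C = (\<Sum>k. norm (mat 1 :: complex^'n^'n) * exp (2 * integral {0..pi} (kappa (norm \<xi>))) * (1/2)^k)"
  have rec: "?S (Suc n) t = mat 1 + integral {0..t} (\<lambda>s. ker \<xi> s ** ?S n s)" if t: "t \<in> {0..pi}" for n t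
  proof -
    have "integral {0..t} (\<lambda>s. ker \<xi> s ** ?S n s) = (\<Sum>k<n. integral {0..t} (\<lambda>s. ker \<xi> s ** picard k \<xi> s))"
      unfolding matrix_mult_sum_right
      by (intro integral_sum mult_continuous_integrable' ker_integrable entire_family_continuous entire_family_picard t) simp
    then show ?thesis by (simp only: sum.lessThan_Suc_shift picard.simps)
  qed
  \<comment> \<open>The limit passes under the integral by dominated convergence: all partial sums
    are bounded by the sum \<open>C\<close> of the geometric majorant.\<close>
  have "(\<lambda>n. integral {0..x} (\<lambda>t. ker \<xi> t ** ?S n t)) \<longlonglongrightarrow> integral {0..x} (\<lambda>t. ker \<xi> t ** fund \<xi> t)"
  proof (rule dominated_convergence(2))
    show "(\<lambda>t. ker \<xi> t ** ?S n t) integrable_on {0..x}" for n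
      by (intro mult_continuous_integrable' ker_integrable continuous_on_sum entire_family_continuous entire_family_picard x)
    show "(\<lambda>t. kappa (norm \<xi>) t * C) integrable_on {0..x}"
      using absolutely_integrable_subinterval[OF kappa_integrable, of 0 x] x
      by (intro integrable_on_mult_left absolutely_integrable_imp_integrable) auto
    fix t assume t: "t \<in> {0..x}"
    then have t': "t \<in> {0..pi}" using x by auto
    show "(\<lambda>n. ker \<xi> t ** ?S n t) \<longlonglongrightarrow> ker \<xi> t ** fund \<xi> t"
      using bounded_linear.tendsto[OF bounded_linear_matrix_mult_right picard_sums[OF t', unfolded sums_def]] .
    fix n
    have "norm (?S n t) \<le> (\<Sum>k<n. norm (mat 1 :: complex^'n^'n) * exp (2 * integral {0..pi} (kappa (norm \<xi>))) * (1/2)^k)"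
      by (rule order_trans[OF norm_sum sum_mono]) (rule norm_picard_le'[OF order_refl t'])
    also have "\<dots> \<le> C" unfolding C_def by (intro sum_le_suminf summable_picard_bound) auto
    finally show "norm (ker \<xi> t ** ?S n t) \<le> kappa (norm \<xi>) t * C"
      by (intro order_trans[OF norm_matrix_mult_le] mult_mono norm_ker_le) (auto simp: kappa_nonneg)
  qed
  then have "(\<lambda>n. ?S (Suc n) x) \<longlonglongrightarrow> mat 1 + integral {0..x} (\<lambda>t. ker \<xi> t ** fund \<xi> t)"
    unfolding rec[OF x] by (intro tendsto_intros)
  moreover have "(\<lambda>n. ?S (Suc n) x) \<longlonglongrightarrow> fund \<xi> x"
    by (rule LIMSEQ_Suc[OF picard_sums[OF x, unfolded sums_def]])
  ultimately show "fund \<xi> x = fund \<xi> 0 + integral {0..x} (\<lambda>t. ker \<xi> t ** fund \<xi> t)"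
    unfolding fund_0 by (rule LIMSEQ_unique[rotated])
qed

end

section \<open>Solutions of the pencil equation\<close>

lemma sum_UNIV_Plus: "(\<Sum>k\<in>UNIV. f k) = (\<Sum>i\<in>UNIV. f (Inl i)) + (\<Sum>i\<in>UNIV. f (Inr i))"
  for f :: "'a::finite + 'b::finite \<Rightarrow> 'c::comm_monoid_add"
proof -
  have "sum f (UNIV <+> UNIV) = (\<Sum>i\<in>UNIV. f (Inl i)) + (\<Sum>i\<in>UNIV. f (Inr i))"
    by (subst sum.Plus) auto
  then show ?thesis by simp
qed

text \<open>Blocks over the sum type turn the second-order equation into a first-order system for
  \<open>Y\<close> stacked on its derivative.\<close>

definition block :: "complex^'m^'m \<Rightarrow> complex^'m^'m \<Rightarrow> complex^'m^'m \<Rightarrow> complex^'m^'m \<Rightarrow> complex^('m+'m)^('m+'m)"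
  where "block A B C D = (\<chi> r s. case r of
      Inl i \<Rightarrow> (case s of Inl j \<Rightarrow> A $ i $ j | Inr j \<Rightarrow> B $ i $ j)
    | Inr i \<Rightarrow> (case s of Inl j \<Rightarrow> C $ i $ j | Inr j \<Rightarrow> D $ i $ j))"

definition upper :: "complex^'p^('m+'m) \<Rightarrow> complex^'p^'m" where "upper Z = (\<chi> i. Z $ Inl i)"
definition lower :: "complex^'p^('m+'m) \<Rightarrow> complex^'p^'m" where "lower Z = (\<chi> i. Z $ Inr i)"
definition stack :: "complex^'p^'m \<Rightarrow> complex^'p^'m \<Rightarrow> complex^'p^('m+'m)"
  where "stack A B = (\<chi> r. case r of Inl i \<Rightarrow> A $ i | Inr i \<Rightarrow> B $ i)"

lemma upper_lower_stack [simp]: "upper (stack A B) = A" "lower (stack A B) = B"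
  by (simp_all add: upper_def lower_def stack_def vec_eq_iff)

lemma upper_block_mult: "upper (block A B C D ** Z) = A ** upper Z + B ** lower Z"
  for A :: "complex^'m::finite^'m"
  by (simp add: vec_eq_iff upper_def lower_def block_def matrix_mult_nth sum_UNIV_Plus)

lemma lower_block_mult: "lower (block A B C D ** Z) = C ** upper Z + D ** lower Z"
  for A :: "complex^'m::finite^'m"
  by (simp add: vec_eq_iff upper_def lower_def block_def matrix_mult_nth sum_UNIV_Plus)

lemma upper_lower_eqI: "upper Z = upper Z' \<Longrightarrow> lower Z = lower Z' \<Longrightarrow> Z = Z'"
proof -
  assume a: "upper Z = upper Z'" "lower Z = lower Z'"
  have "Z $ r = Z' $ r" for r
    using a by (cases r) (simp_all add: upper_def lower_def vec_eq_iff)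
  then show ?thesis by (simp add: vec_eq_iff)
qed

lemma bounded_linear_upper: "bounded_linear (upper :: complex^'p^('m::finite+'m) \<Rightarrow> complex^'p^'m)"
  by (simp add: linear_conv_bounded_linear[symmetric] linear_iff upper_def vec_eq_iff)

lemma bounded_linear_lower: "bounded_linear (lower :: complex^'p^('m::finite+'m) \<Rightarrow> complex^'p^'m)"
  by (simp add: linear_conv_bounded_linear[symmetric] linear_iff lower_def vec_eq_iff)

lemma block_absolutely_integrable:
  fixes A B C D :: "real \<Rightarrow> complex^'m::finite^'m"
  assumes "A absolutely_integrable_on S" "B absolutely_integrable_on S"
    "C absolutely_integrable_on S" "D absolutely_integrable_on S"
  shows "(\<lambda>x. block (A x) (B x) (C x) (D x)) absolutely_integrable_on S"
proof (rule absolutely_integrable_matrix)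
  fix r s :: "'m + 'm"
  show "(\<lambda>x. block (A x) (B x) (C x) (D x) $ r $ s) absolutely_integrable_on S"
    using absolutely_integrable_linear[OF assms(1) bounded_linear_entry] absolutely_integrable_linear[OF assms(2) bounded_linear_entry]
      absolutely_integrable_linear[OF assms(3) bounded_linear_entry] absolutely_integrable_linear[OF assms(4) bounded_linear_entry]
    by (cases r; cases s) (simp_all add: block_def o_def)
qed

lemma W11_cong:
  assumes "has_W11_derivative f u" "\<And>x. x \<in> {0..pi} \<Longrightarrow> f x = f' x" "\<And>x. x \<in> {0..pi} \<Longrightarrow> u x = u' x"
  shows "has_W11_derivative f' u'"
proof (rule W11_I)
  show "u' absolutely_integrable_on {0..pi}"
    using absolutely_integrable_spike[OF W11_integrable[OF assms(1)], of "{}" u'] assms(3) by auto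
  fix x assume x: "x \<in> {0..pi}"
  have "integral {0..x} u = integral {0..x} u'"
    using x assms(3) by (intro integral_cong) auto
  moreover have "0 \<in> {0..pi}" by simp
  ultimately show "f' x = f' 0 + integral {0..x} u'"
    using W11_eq[OF assms(1) x] assms(2)[OF x] assms(2)[of 0] by metis
qed

lemma W11_constant:
  assumes "has_W11_derivative f u" "AE x in lebesgue_on {0..pi}. u x = 0" "x \<in> {0..pi}"
  shows "f x = f 0"
  using W11_eq[OF W11_eq_AE[OF assms(1), of "\<lambda>_. 0"] assms(3)] assms(2) by simp

section \<open>Fundamental solutions of the pencil and the Weyl solution\<close>

definition coef :: "'m::finite pencil \<Rightarrow> complex \<Rightarrow> real \<Rightarrow> complex^'m^'m"
  where "coef L \<xi> x = \<xi>\<^sup>2 *\<^sub>M mat 1 + (2 * \<i> * \<xi>) *\<^sub>M Q1 L x + Q0 L x"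

text \<open>The derivative is carried as a second function, and the equation can be written as an
  identity because the weak derivative of \<open>Y1\<close> matters only up to null sets. Up to the
  choice of \<open>Y1\<close> this is \<open>solves\<close>.\<close>

definition sol :: "'m::finite pencil \<Rightarrow> complex \<Rightarrow> (real \<Rightarrow> complex^'m^'m) \<Rightarrow> (real \<Rightarrow> complex^'m^'m) \<Rightarrow> bool"
  where "sol L \<xi> Y Y1 \<longleftrightarrow> has_W11_derivative Y Y1 \<and> has_W11_derivative Y1 (\<lambda>x. - (coef L \<xi> x ** Y x))"

lemma sol_dx:
  assumes "sol L \<xi> Y Y1" "x \<in> {0..pi}"
  shows "(Y has_vector_derivative Y1 x) (at x within {0..pi})" "dx Y x = Y1 x"
proof -
  show *: "(Y has_vector_derivative Y1 x) (at x within {0..pi})"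
    using assms unfolding sol_def by (blast intro: vector_derivative_of_W11 W11_continuous)
  show "dx Y x = Y1 x"
    unfolding dx_def using assms(2)
    by (intro vector_derivative_within_cbox[of 0 pi, unfolded box_real, OF _ _ *]) auto
qed

lemma solves_of_sol: "sol L \<xi> Y Y1 \<Longrightarrow> solves L \<xi> Y"
  unfolding solves_def coef_def[symmetric]
  by (intro exI[of _ Y1] exI[of _ "\<lambda>x. - (coef L \<xi> x ** Y x)"])
     (use sol_dx(1)[of L \<xi> Y Y1] in \<open>auto simp: sol_def\<close>)

lemma sol_of_solves:
  assumes "solves L \<xi> Y"
  obtains Y1 where "sol L \<xi> Y Y1"
proof -
  obtain Y1 Y2 where Y1: "\<And>x. x \<in> {0..pi} \<Longrightarrow> (Y has_vector_derivative Y1 x) (at x within {0..pi})"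
    and Y2: "has_W11_derivative Y1 Y2" and ae: "AE x in lebesgue_on {0..pi}. Y2 x + coef L \<xi> x ** Y x = 0"
    using assms unfolding solves_def coef_def by blast
  have "has_W11_derivative Y Y1"
    by (rule W11_of_vector_derivative[OF Y1 W11_continuous[OF Y2]])
  moreover have "has_W11_derivative Y1 (\<lambda>x. - (coef L \<xi> x ** Y x))"
    by (rule W11_eq_AE[OF Y2]) (use ae in \<open>auto simp: add_eq_0_iff elim!: eventually_mono\<close>)
  ultimately show ?thesis using that by (auto simp: sol_def)
qed

lemma sol_mult_right:
  assumes "sol L \<xi> Y Y1" shows "sol L \<xi> (\<lambda>x. Y x ** A) (\<lambda>x. Y1 x ** A)"
  using assms W11_linear[OF bounded_linear_matrix_mult_left[of A], of Y Y1]
    W11_linear[OF bounded_linear_matrix_mult_left[of A], of Y1 "\<lambda>x. - (coef L \<xi> x ** Y x)"]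
  by (simp add: sol_def matrix_mul_assoc)

lemma sol_add:
  assumes "sol L \<xi> Y Y1" "sol L \<xi> Z Z1" shows "sol L \<xi> (\<lambda>x. Y x + Z x) (\<lambda>x. Y1 x + Z1 x)"
  using assms W11_add[of Y Y1 Z Z1] W11_add[of Y1 "\<lambda>x. - (coef L \<xi> x ** Y x)" Z1 "\<lambda>x. - (coef L \<xi> x ** Z x)"]
  by (simp add: sol_def matrix_add_ldistrib add.commute)

lemma sol_cong:
  assumes "sol L \<xi> Y Y1" "\<And>x. x \<in> {0..pi} \<Longrightarrow> Y x = Z x" "\<And>x. x \<in> {0..pi} \<Longrightarrow> Y1 x = Z1 x"
  shows "sol L \<xi> Z Z1"
proof -
  have "has_W11_derivative Z Z1"
    using assms(1) unfolding sol_def by (intro W11_cong[of Y Y1 Z Z1] assms) auto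
  moreover have "has_W11_derivative Z1 (\<lambda>x. - (coef L \<xi> x ** Z x))"
    using assms(1) unfolding sol_def
    by (intro W11_cong[of Y1 "\<lambda>x. - (coef L \<xi> x ** Y x)" Z1] assms) (auto simp: assms(2))
  ultimately show ?thesis by (simp add: sol_def)
qed

lemma continuous_bounded:
  fixes f :: "real \<Rightarrow> 'a::real_normed_vector"
  assumes "continuous_on {0..pi} f"
  obtains C where "C \<ge> 0" "\<And>x. x \<in> {0..pi} \<Longrightarrow> norm (f x) \<le> C"
proof -
  have "bounded (f ` {0..pi})"
    using assms by (intro compact_imp_bounded compact_continuous_image) auto
  then obtain C where "\<forall>y\<in>f ` {0..pi}. norm y \<le> C" by (auto simp: bounded_iff)
  then show ?thesis using that[of "max C 0"] by (auto simp: le_max_iff_disj)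
qed

definition pK0 :: "'m::finite pencil \<Rightarrow> real \<Rightarrow> complex^('m+'m)^('m+'m)"
  where "pK0 L x = block 0 (mat 1) (- Q0 L x) 0"
definition pK1 :: "'m::finite pencil \<Rightarrow> real \<Rightarrow> complex^('m+'m)^('m+'m)"
  where "pK1 L x = block 0 0 (- ((2 * \<i>) *\<^sub>M Q1 L x)) 0"
definition pK2 :: "'m::finite pencil \<Rightarrow> real \<Rightarrow> complex^('m+'m)^('m+'m)"
  where "pK2 L x = block 0 0 (- mat 1) 0"

definition fundp :: "'m::finite pencil \<Rightarrow> complex \<Rightarrow> real \<Rightarrow> complex^('m+'m)^('m+'m)"
  where "fundp L = volterra.fund (pK0 L) (pK1 L) (pK2 L)"

text \<open>The solutions with initial data (I, 0) and (0, I), read off from the columns of the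
  fundamental matrix; the suffix 1 marks their derivatives.\<close>

definition cosol :: "'m::finite pencil \<Rightarrow> complex \<Rightarrow> real \<Rightarrow> complex^'m^'m"
  where "cosol L \<xi> x = upper (fundp L \<xi> x ** stack (mat 1) 0)"
definition cosol1 :: "'m::finite pencil \<Rightarrow> complex \<Rightarrow> real \<Rightarrow> complex^'m^'m"
  where "cosol1 L \<xi> x = lower (fundp L \<xi> x ** stack (mat 1) 0)"
definition sisol :: "'m::finite pencil \<Rightarrow> complex \<Rightarrow> real \<Rightarrow> complex^'m^'m"
  where "sisol L \<xi> x = upper (fundp L \<xi> x ** stack 0 (mat 1))"
definition sisol1 :: "'m::finite pencil \<Rightarrow> complex \<Rightarrow> real \<Rightarrow> complex^'m^'m"
  where "sisol1 L \<xi> x = lower (fundp L \<xi> x ** stack 0 (mat 1))"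

text \<open>The derivative of the chosen solution \<open>phi\<close>, given by a formula that is
  visibly entire in \<xi>.\<close>

definition phi1 :: "'m::finite pencil \<Rightarrow> complex \<Rightarrow> real \<Rightarrow> complex^'m^'m"
  where "phi1 L \<xi> x = cosol1 L \<xi> x - sisol1 L \<xi> x ** ((\<i> * \<xi>) *\<^sub>M h1 L + h0 L)"

text \<open>The values of the boundary form V at \<open>phi\<close> and at
  \<open>sisol\<close>.\<close>

definition Vmat :: "'m::finite pencil \<Rightarrow> complex \<Rightarrow> complex^'m^'m"
  where "Vmat L \<xi> = phi1 L \<xi> pi + ((\<i> * \<xi>) *\<^sub>M H1 L + H0 L) ** phi L \<xi> pi"
definition VSmat :: "'m::finite pencil \<Rightarrow> complex \<Rightarrow> complex^'m^'m"
  where "VSmat L \<xi> = sisol1 L \<xi> pi + ((\<i> * \<xi>) *\<^sub>M H1 L + H0 L) ** sisol L \<xi> pi"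

text \<open>Away from the eigenvalues this is the derivative of the Weyl solution, which splits as
  \<open>sisol\<close> plus \<open>phi\<close> times the Weyl matrix.\<close>

definition Phi1 :: "'m::finite pencil \<Rightarrow> complex \<Rightarrow> real \<Rightarrow> complex^'m^'m"
  where "Phi1 L \<xi> x = sisol1 L \<xi> x + phi1 L \<xi> x ** weyl L \<xi>"

definition entire_mat :: "(complex \<Rightarrow> complex^'n^'m) \<Rightarrow> bool"
  where "entire_mat F \<longleftrightarrow> (\<forall>i j. (\<lambda>\<xi>. F \<xi> $ i $ j) holomorphic_on UNIV)"

lemma entire_mat_const: "entire_mat (\<lambda>\<xi>. A)"
  by (simp add: entire_mat_def)

lemma entire_mat_add: "entire_mat F \<Longrightarrow> entire_mat G \<Longrightarrow> entire_mat (\<lambda>\<xi>. F \<xi> + G \<xi>)"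
  by (auto simp: entire_mat_def intro!: holomorphic_intros)

lemma entire_mat_diff: "entire_mat F \<Longrightarrow> entire_mat G \<Longrightarrow> entire_mat (\<lambda>\<xi>. F \<xi> - G \<xi>)"
  by (auto simp: entire_mat_def intro!: holomorphic_intros)

lemma entire_mat_mult: "entire_mat F \<Longrightarrow> entire_mat G \<Longrightarrow> entire_mat (\<lambda>\<xi>. F \<xi> ** G \<xi>)"
  by (auto simp: entire_mat_def matrix_mult_nth intro!: holomorphic_intros)

lemma entire_mat_cscale: "f holomorphic_on UNIV \<Longrightarrow> entire_mat F \<Longrightarrow> entire_mat (\<lambda>\<xi>. f \<xi> *\<^sub>M F \<xi>)"
  by (auto simp: entire_mat_def intro!: holomorphic_intros)

text \<open>Conjugating both argument and value preserves holomorphy; this is why starred solutions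
  take the parameter \<open>cnj \<xi>\<close>.\<close>

lemma entire_mat_dagger:
  assumes "entire_mat F" shows "entire_mat (\<lambda>\<xi>. dagger (F (cnj \<xi>)))"
proof -
  have "(\<lambda>\<xi>. cnj (F (cnj \<xi>) $ j $ i)) holomorphic_on UNIV" for i j
  proof -
    have "(\<lambda>\<xi>. F \<xi> $ j $ i) holomorphic_on cnj ` UNIV"
      using assms unfolding entire_mat_def by (blast intro: holomorphic_on_subset)
    from holomorphic_on_compose_cnj_cnj[OF this open_UNIV] show ?thesis by (simp add: o_def)
  qed
  then show ?thesis by (simp add: entire_mat_def)
qed

lemmas entire_mat_intros = entire_mat_const entire_mat_add entire_mat_diff entire_mat_mult
  entire_mat_cscale entire_mat_dagger

locale regular_pencil =
  fixes L :: "'m::finite pencil"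
  assumes coeffs: "pencil_coeffs L"
begin

lemma Q0_integrable: "Q0 L absolutely_integrable_on {0..pi}"
  using coeffs by (intro absolutely_integrable_matrix) (simp add: pencil_coeffs_def)

definition dQ1 :: "real \<Rightarrow> complex^'m^'m"
  where "dQ1 = (\<lambda>x. \<chi> i j. (SOME g. has_W11_derivative (\<lambda>x. Q1 L x $ i $ j) g) x)"

lemma Q1_W11: "has_W11_derivative (Q1 L) dQ1"
proof (rule W11_matrix)
  fix i j
  have "\<exists>g. has_W11_derivative (\<lambda>x. Q1 L x $ i $ j) g"
    using coeffs by (simp add: pencil_coeffs_def W11_def)
  then have "has_W11_derivative (\<lambda>x. Q1 L x $ i $ j) (SOME g. has_W11_derivative (\<lambda>x. Q1 L x $ i $ j) g)"
    by (rule someI_ex)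
  then show "has_W11_derivative (\<lambda>x. Q1 L x $ i $ j) (\<lambda>x. dQ1 x $ i $ j)" by (simp add: dQ1_def)
qed

lemma Q1_continuous: "continuous_on {0..pi} (Q1 L)"
  by (rule W11_continuous[OF Q1_W11])

lemma Q1_integrable: "Q1 L absolutely_integrable_on {0..pi}"
  by (rule absolutely_integrable_continuous_real[OF Q1_continuous])

sublocale volterra "pK0 L" "pK1 L" "pK2 L"
proof
  have z: "(\<lambda>x. 0 :: complex^'m^'m) absolutely_integrable_on {0..pi}" by simp
  have o: "(\<lambda>x. mat 1 :: complex^'m^'m) absolutely_integrable_on {0..pi}"
    by (rule absolutely_integrable_continuous_real) simp
  show "pK0 L absolutely_integrable_on {0..pi}"
    using block_absolutely_integrable[OF z o absolutely_integrable_linear[OF Q0_integrable bounded_linear_minus[OF bounded_linear_ident]] z]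
    by (simp add: pK0_def[abs_def] o_def)
  show "pK1 L absolutely_integrable_on {0..pi}"
    using block_absolutely_integrable[OF z z absolutely_integrable_linear[OF Q1_integrable bounded_linear_minus[OF bounded_linear_cscale]] z]
    by (simp add: pK1_def[abs_def] o_def)
  show "pK2 L absolutely_integrable_on {0..pi}"
    using block_absolutely_integrable[OF z z absolutely_integrable_linear[OF o bounded_linear_minus[OF bounded_linear_ident]] z]
    by (simp add: pK2_def[abs_def] o_def)
qed

lemma ker_eq: "ker \<xi> x = block 0 (mat 1) (- coef L \<xi> x) 0"
proof -
  have "ker \<xi> x $ r $ s = block 0 (mat 1) (- coef L \<xi> x) 0 $ r $ s" for r s
    by (cases r; cases s) (simp_all add: ker_def pK0_def pK1_def pK2_def coef_def block_def algebra_simps)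
  then show ?thesis by (simp add: vec_eq_iff)
qed

lemma sol_fundp:
  "sol L \<xi> (\<lambda>x. upper (fundp L \<xi> x ** B)) (\<lambda>x. lower (fundp L \<xi> x ** B))"
proof -
  have "has_W11_derivative (\<lambda>x. fundp L \<xi> x ** B) (\<lambda>x. (ker \<xi> x ** fundp L \<xi> x) ** B)"
    unfolding fundp_def by (rule W11_linear[OF bounded_linear_matrix_mult_left fund_W11])
  then have *: "has_W11_derivative (\<lambda>x. fundp L \<xi> x ** B) (\<lambda>x. ker \<xi> x ** (fundp L \<xi> x ** B))"
    by (simp add: matrix_mul_assoc)
  show ?thesis
    using W11_linear[OF bounded_linear_upper *] W11_linear[OF bounded_linear_lower *]
    by (simp add: sol_def ker_eq upper_block_mult lower_block_mult)
qed

lemma sol_cosol: "sol L \<xi> (cosol L \<xi>) (cosol1 L \<xi>)"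
  using sol_fundp[of \<xi> "stack (mat 1) 0"] by (simp add: cosol_def[abs_def] cosol1_def[abs_def])

lemma sol_sisol: "sol L \<xi> (sisol L \<xi>) (sisol1 L \<xi>)"
  using sol_fundp[of \<xi> "stack 0 (mat 1)"] by (simp add: sisol_def[abs_def] sisol1_def[abs_def])

lemma sol_init [simp]:
  "cosol L \<xi> 0 = mat 1" "cosol1 L \<xi> 0 = 0" "sisol L \<xi> 0 = 0" "sisol1 L \<xi> 0 = mat 1"
  by (simp_all add: cosol_def cosol1_def sisol_def sisol1_def fundp_def fund_0)

lemma entire_cosol:
  assumes "x \<in> {0..pi}"
  shows "entire_mat (\<lambda>\<xi>. cosol L \<xi> x)" "entire_mat (\<lambda>\<xi>. cosol1 L \<xi> x)"
    "entire_mat (\<lambda>\<xi>. sisol L \<xi> x)" "entire_mat (\<lambda>\<xi>. sisol1 L \<xi> x)"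
  using fund_holomorphic[OF assms]
  by (auto simp: entire_mat_def cosol_def cosol1_def sisol_def sisol1_def upper_def lower_def
      matrix_mult_nth fundp_def intro!: holomorphic_intros)

lemma sol_zero:
  assumes Y: "sol L \<xi> Y Y1" and "Y 0 = 0" "Y1 0 = 0" and x: "x \<in> {0..pi}"
  shows "Y x = 0" "Y1 x = 0"
proof -
  let ?z = "\<lambda>x. stack (Y x) (Y1 x)"
  have "has_W11_derivative ?z (\<lambda>x. ker \<xi> x ** ?z x)"
  proof (rule W11_matrix)
    fix r :: "'m + 'm" and j
    have W: "has_W11_derivative (\<lambda>x. Y x $ i $ j) (\<lambda>x. Y1 x $ i $ j)"
      "has_W11_derivative (\<lambda>x. Y1 x $ i $ j) (\<lambda>x. (- (coef L \<xi> x ** Y x)) $ i $ j)" for i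
      using Y W11_linear[OF bounded_linear_entry, of Y Y1 i j]
        W11_linear[OF bounded_linear_entry, of Y1 "\<lambda>x. - (coef L \<xi> x ** Y x)" i j]
      unfolding sol_def by blast+
    have "(ker \<xi> x ** ?z x) $ Inl i $ j = Y1 x $ i $ j" for x i
      using upper_block_mult[of 0 "mat 1" "- coef L \<xi> x" 0 "?z x"]
      by (simp add: ker_eq upper_def vec_eq_iff)
    moreover have "(ker \<xi> x ** ?z x) $ Inr i $ j = (- (coef L \<xi> x ** Y x)) $ i $ j" for x i
      using lower_block_mult[of 0 "mat 1" "- coef L \<xi> x" 0 "?z x"]
      by (simp add: ker_eq lower_def vec_eq_iff)
    ultimately show "has_W11_derivative (\<lambda>x. ?z x $ r $ j) (\<lambda>x. (ker \<xi> x ** ?z x) $ r $ j)"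
      using W by (cases r) (simp_all add: stack_def)
  qed
  moreover have "?z 0 = 0" using assms(2,3) 
    by (intro upper_lower_eqI) (simp_all add: upper_def[of 0] lower_def[of 0] vec_eq_iff)
  ultimately have z: "?z x = 0" by (rule W11_linear_ode_unique[OF _ ker_integrable _ x])
  show "Y x = 0" "Y1 x = 0"
    using arg_cong[OF z, of upper] arg_cong[OF z, of lower]
    by (simp_all add: upper_def[of 0] lower_def[of 0] vec_eq_iff)
qed

lemma sol_rep:
  assumes Y: "sol L \<xi> Y Y1" and x: "x \<in> {0..pi}"
  shows "Y x = cosol L \<xi> x ** Y 0 + sisol L \<xi> x ** Y1 0"
    "Y1 x = cosol1 L \<xi> x ** Y 0 + sisol1 L \<xi> x ** Y1 0"
proof -
  let ?Z = "\<lambda>x. Y x + (cosol L \<xi> x ** (- Y 0) + sisol L \<xi> x ** (- Y1 0))"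
  let ?Z1 = "\<lambda>x. Y1 x + (cosol1 L \<xi> x ** (- Y 0) + sisol1 L \<xi> x ** (- Y1 0))"
  have "sol L \<xi> ?Z ?Z1"
    by (intro sol_add sol_mult_right Y sol_cosol sol_sisol)
  from sol_zero[OF this _ _ x] have "?Z x = 0" "?Z1 x = 0" by simp_all
  then show "Y x = cosol L \<xi> x ** Y 0 + sisol L \<xi> x ** Y1 0"
    "Y1 x = cosol1 L \<xi> x ** Y 0 + sisol1 L \<xi> x ** Y1 0" by (simp_all add: algebra_simps)
qed

lemma U_form_sol: "sol L \<xi> Y Y1 \<Longrightarrow> U_form L \<xi> Y = Y1 0 + ((\<i> * \<xi>) *\<^sub>M h1 L + h0 L) ** Y 0"
  by (simp add: U_form_def sol_dx)

lemma V_form_sol: "sol L \<xi> Y Y1 \<Longrightarrow> V_form L \<xi> Y = Y1 pi + ((\<i> * \<xi>) *\<^sub>M H1 L + H0 L) ** Y pi"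
  by (simp add: V_form_def sol_dx)

text \<open>Existence makes the choice in \<open>phi\<close> satisfy its specification; the
  condition U then fixes its derivative at 0, and uniqueness identifies it on the interval.\<close>

lemma phi_eq:
  assumes x: "x \<in> {0..pi}"
  shows "phi L \<xi> x = cosol L \<xi> x - sisol L \<xi> x ** ((\<i> * \<xi>) *\<^sub>M h1 L + h0 L)"
proof -
  let ?h = "(\<i> * \<xi>) *\<^sub>M h1 L + h0 L"
  let ?Y = "\<lambda>x. cosol L \<xi> x + sisol L \<xi> x ** (- ?h)"
  let ?Y1 = "\<lambda>x. cosol1 L \<xi> x + sisol1 L \<xi> x ** (- ?h)"
  have s: "sol L \<xi> ?Y ?Y1" by (intro sol_add sol_mult_right sol_cosol sol_sisol)
  have "solves L \<xi> ?Y \<and> ?Y 0 = mat 1 \<and> U_form L \<xi> ?Y = 0"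
    using solves_of_sol[OF s] U_form_sol[OF s] by simp
  then have "solves L \<xi> (phi L \<xi>) \<and> phi L \<xi> 0 = mat 1 \<and> U_form L \<xi> (phi L \<xi>) = 0"
    unfolding phi_def by (rule someI[where P = "\<lambda>Y. solves L \<xi> Y \<and> Y 0 = mat 1 \<and> U_form L \<xi> Y = 0"])
  moreover from this obtain Y1 where Y1: "sol L \<xi> (phi L \<xi>) Y1"
    using sol_of_solves by blast
  ultimately have "Y1 0 = - ?h" "phi L \<xi> 0 = mat 1"
    using U_form_sol[OF Y1] by (simp_all add: add_eq_0_iff2)
  then show ?thesis using sol_rep(1)[OF Y1 x] by (simp add: matrix_distribs)
qed

lemma sol_phi: "sol L \<xi> (phi L \<xi>) (phi1 L \<xi>)"
proof (rule sol_cong)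
  let ?h = "(\<i> * \<xi>) *\<^sub>M h1 L + h0 L"
  show "sol L \<xi> (\<lambda>x. cosol L \<xi> x + sisol L \<xi> x ** (- ?h)) (\<lambda>x. cosol1 L \<xi> x + sisol1 L \<xi> x ** (- ?h))"
    by (intro sol_add sol_mult_right sol_cosol sol_sisol)
qed (simp_all add: phi_eq phi1_def matrix_distribs)

lemma phi_init [simp]: "phi L \<xi> 0 = mat 1" "phi1 L \<xi> 0 = - ((\<i> * \<xi>) *\<^sub>M h1 L + h0 L)"
  by (simp_all add: phi_eq phi1_def)

lemma entire_phi:
  assumes "x \<in> {0..pi}"
  shows "entire_mat (\<lambda>\<xi>. phi L \<xi> x)" "entire_mat (\<lambda>\<xi>. phi1 L \<xi> x)"
  using assms unfolding phi_eq[OF assms] phi1_def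
  by (intro entire_mat_intros entire_cosol holomorphic_intros; simp)+

lemma V_form_phi: "V_form L \<xi> (phi L \<xi>) = Vmat L \<xi>"
  by (simp add: V_form_sol[OF sol_phi] Vmat_def)

lemma char_fun_eq: "char_fun L \<xi> = det (Vmat L \<xi>)"
  by (simp add: char_fun_def V_form_phi)

lemma entire_Vmat: "entire_mat (Vmat L)" "entire_mat (VSmat L)"
  unfolding Vmat_def[abs_def] VSmat_def[abs_def]
  by (intro entire_mat_intros entire_cosol entire_phi holomorphic_intros; simp)+

lemma holomorphic_char_fun: "char_fun L holomorphic_on UNIV"
proof -
  have "(\<lambda>\<xi>. det (Vmat L \<xi>)) holomorphic_on UNIV"
    using entire_Vmat(1) unfolding det_def entire_mat_def by (intro holomorphic_intros) auto
  then show ?thesis by (simp add: char_fun_eq[abs_def])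
qed

text \<open>Where V(phi) is invertible, \<open>sisol\<close> plus \<open>phi\<close> times
  \<open>M0\<close>, the matrix -V(phi)^(-1) V(sisol), meets both boundary conditions, so the choice
  in \<open>Phi\<close> satisfies them. The initial data of the chosen function, rewritten through
  U, force the same splitting with the Weyl matrix itself.\<close>

lemma Phi_spec:
  assumes "char_fun L \<xi> \<noteq> 0"
  shows "sol L \<xi> (Phi L \<xi>) (Phi1 L \<xi>)"
    and "\<And>x. x \<in> {0..pi} \<Longrightarrow> Phi L \<xi> x = sisol L \<xi> x + phi L \<xi> x ** weyl L \<xi>"
    and "Vmat L \<xi> ** weyl L \<xi> = - VSmat L \<xi>"
    and "Phi L \<xi> 0 = weyl L \<xi>"
    and "Phi1 L \<xi> 0 = mat 1 - ((\<i> * \<xi>) *\<^sub>M h1 L + h0 L) ** weyl L \<xi>"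
    and "Phi1 L \<xi> pi = - (((\<i> * \<xi>) *\<^sub>M H1 L + H0 L) ** Phi L \<xi> pi)"
proof -
  let ?h = "(\<i> * \<xi>) *\<^sub>M h1 L + h0 L"
  let ?H = "(\<i> * \<xi>) *\<^sub>M H1 L + H0 L"
  have "invertible (Vmat L \<xi>)" using assms by (simp add: char_fun_eq invertible_det_nz)
  then obtain Vi where Vi: "Vmat L \<xi> ** Vi = mat 1" by (auto simp: invertible_def)
  define M0 where "M0 = - (Vi ** VSmat L \<xi>)"
  have VM0: "Vmat L \<xi> ** M0 = - VSmat L \<xi>"
    by (simp add: M0_def matrix_mul_assoc Vi)
  let ?Y = "\<lambda>x. sisol L \<xi> x + phi L \<xi> x ** M0"
  let ?Y1 = "\<lambda>x. sisol1 L \<xi> x + phi1 L \<xi> x ** M0"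
  have s: "sol L \<xi> ?Y ?Y1" by (intro sol_add sol_mult_right sol_phi sol_sisol)
  have "U_form L \<xi> ?Y = mat 1" by (simp add: U_form_sol[OF s] matrix_distribs)
  moreover have "V_form L \<xi> ?Y = VSmat L \<xi> + Vmat L \<xi> ** M0"
    unfolding V_form_sol[OF s] VSmat_def Vmat_def by (simp add: matrix_distribs matrix_mul_assoc)
  ultimately have "solves L \<xi> ?Y \<and> U_form L \<xi> ?Y = mat 1 \<and> V_form L \<xi> ?Y = 0"
    using solves_of_sol[OF s] VM0 by simp
  then have "solves L \<xi> (Phi L \<xi>) \<and> U_form L \<xi> (Phi L \<xi>) = mat 1 \<and> V_form L \<xi> (Phi L \<xi>) = 0"
    unfolding Phi_def by (rule someI[where P = "\<lambda>Y. solves L \<xi> Y \<and> U_form L \<xi> Y = mat 1 \<and> V_form L \<xi> Y = 0"])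
  moreover from this obtain Y1 where Y1: "sol L \<xi> (Phi L \<xi>) Y1"
    using sol_of_solves by blast
  ultimately have U: "Y1 0 + ?h ** weyl L \<xi> = mat 1" and V: "Y1 pi + ?H ** Phi L \<xi> pi = 0"
    using U_form_sol[OF Y1] V_form_sol[OF Y1] by (simp_all add: weyl_def)
  from U have Y10: "Y1 0 = mat 1 - ?h ** weyl L \<xi>" by (simp add: algebra_simps)
  have rep: "Phi L \<xi> x = sisol L \<xi> x + phi L \<xi> x ** weyl L \<xi>" "Y1 x = Phi1 L \<xi> x"
    if "x \<in> {0..pi}" for x
    using sol_rep[OF Y1 that] that
    by (simp_all add: Y10 weyl_def[symmetric] phi_eq phi1_def Phi1_def matrix_distribs matrix_mul_assoc)
  show "sol L \<xi> (Phi L \<xi>) (Phi1 L \<xi>)"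
    using sol_cong[OF Y1] rep(2) by blast
  show "Phi L \<xi> x = sisol L \<xi> x + phi L \<xi> x ** weyl L \<xi>" if "x \<in> {0..pi}" for x
    using rep(1)[OF that] .
  have "VSmat L \<xi> + Vmat L \<xi> ** weyl L \<xi> = Y1 pi + ?H ** Phi L \<xi> pi"
    unfolding VSmat_def Vmat_def using rep[of pi] by (simp add: Phi1_def matrix_distribs matrix_mul_assoc)
  then show "Vmat L \<xi> ** weyl L \<xi> = - VSmat L \<xi>" using V by (simp add: eq_neg_iff_add_eq_0 add.commute)
  show "Phi L \<xi> 0 = weyl L \<xi>" by (simp add: weyl_def)
  show "Phi1 L \<xi> 0 = mat 1 - ?h ** weyl L \<xi>" using Y10 rep(2)[of 0] by simp
  show "Phi1 L \<xi> pi = - (?H ** Phi L \<xi> pi)" using V rep(2)[of pi] by (simp add: eq_neg_iff_add_eq_0)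
qed

lemma P_sol_spec:
  "P_sol s L 0 = mat 1"
  "has_W11_derivative (P_sol s L) (\<lambda>x. (s *\<^sub>M Q1 L x) ** P_sol s L x)"
proof -
  let ?K = "\<lambda>x. s *\<^sub>M Q1 L x"
  \<comment> \<open>The kernel does not depend on the parameter, so the solution is taken at
    parameter 0.\<close>
  interpret P: volterra ?K "\<lambda>x. 0" "\<lambda>x. 0"
    by unfold_locales (use absolutely_integrable_linear[OF Q1_integrable bounded_linear_cscale] in \<open>simp_all add: o_def\<close>)
  have ker: "P.ker 0 = ?K" by (simp add: P.ker_def fun_eq_iff)
  have W: "has_W11_derivative (P.fund 0) (\<lambda>x. ?K x ** P.fund 0 x)"
    using P.fund_W11[of 0] by (simp add: ker)
  have "continuous_on {0..pi} (\<lambda>x. ?K x ** P.fund 0 x)"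
    by (intro continuous_intros Q1_continuous P.fund_continuous)
  then have "P.fund 0 0 = mat 1 \<and>
    (\<forall>x\<in>{0..pi}. (P.fund 0 has_vector_derivative ?K x ** P.fund 0 x) (at x within {0..pi}))"
    using vector_derivative_of_W11[OF W] P.fund_0 by blast
  then have *: "P_sol s L 0 = mat 1 \<and>
    (\<forall>x\<in>{0..pi}. (P_sol s L has_vector_derivative ?K x ** P_sol s L x) (at x within {0..pi}))"
    unfolding P_sol_def
    by (rule someI[where P = "\<lambda>P. P 0 = mat 1 \<and>
      (\<forall>x\<in>{0..pi}. (P has_vector_derivative ?K x ** P x) (at x within {0..pi}))"])
  then show "P_sol s L 0 = mat 1" by blast
  have "continuous_on {0..pi} (P_sol s L)"
    using * by (intro continuous_on_vector_derivative) blast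
  then have "continuous_on {0..pi} (\<lambda>x. ?K x ** P_sol s L x)"
    by (intro continuous_intros Q1_continuous)
  then show "has_W11_derivative (P_sol s L) (\<lambda>x. ?K x ** P_sol s L x)"
    using * by (intro W11_of_vector_derivative) auto
qed

end

section \<open>Consequences of the symmetry condition (II)\<close>

locale hermitian_pencil = regular_pencil L for L :: "'m::finite pencil" +
  assumes condition_II: "condition_II L"
begin

lemma Q1_skew: "x \<in> {0..pi} \<Longrightarrow> dagger (Q1 L x) = - Q1 L x"
  using condition_II by (simp add: condition_II_def)

lemma Q0_herm: "AE x in lebesgue_on {0..pi}. dagger (Q0 L x) = Q0 L x"
  using condition_II by (simp add: condition_II_def)

lemma dagger_boundary [simp]:
  "dagger (h1 L) = - h1 L" "dagger (H1 L) = - H1 L" "dagger (h0 L) = h0 L" "dagger (H0 L) = H0 L"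
  using condition_II by (simp_all add: condition_II_def)

text \<open>For real \<open>s\<close> the coefficient of the equation is skew-Hermitian, so the
  product of the adjoint of P with P has derivative zero.\<close>

lemma P_unitary:
  assumes x: "x \<in> {0..pi}" and s: "cnj s = s"
  shows "dagger (P_sol s L x) ** P_sol s L x = mat 1" "P_sol s L x ** dagger (P_sol s L x) = mat 1"
proof -
  let ?P = "P_sol s L"
  have W: "has_W11_derivative (\<lambda>x. dagger (?P x) ** ?P x)
      (\<lambda>x. dagger ((s *\<^sub>M Q1 L x) ** ?P x) ** ?P x + dagger (?P x) ** ((s *\<^sub>M Q1 L x) ** ?P x))"
    by (intro W11_bilinear[OF bounded_bilinear_matrix_mult] W11_linear[OF bounded_linear_dagger] P_sol_spec)
  have "dagger ((s *\<^sub>M Q1 L x) ** ?P x) ** ?P x + dagger (?P x) ** ((s *\<^sub>M Q1 L x) ** ?P x) = 0"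
    if "x \<in> {0..pi}" for x
    using Q1_skew[OF that] s by (simp add: dagger_simps matrix_mul_assoc matrix_distribs)
  then have "AE x in lebesgue_on {0..pi}. dagger ((s *\<^sub>M Q1 L x) ** ?P x) ** ?P x + dagger (?P x) ** ((s *\<^sub>M Q1 L x) ** ?P x) = 0"
    by (intro AE_I2) auto
  from W11_constant[OF W this x] show "dagger (?P x) ** ?P x = mat 1"
    by (simp add: P_sol_spec)
  then show "?P x ** dagger (?P x) = mat 1" by (simp add: matrix_left_right_inverse)
qed

text \<open>Lagrange's identity: by (II) the coefficient at \<open>cnj \<xi>\<close> is almost
  everywhere the adjoint of that at \<xi>, so the derivative of the bracket vanishes.\<close>

lemma bracket_constant:
  assumes Y: "sol L \<xi> Y Y1" and Z: "sol L (cnj \<xi>) Z Z1" and x: "x \<in> {0..pi}"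
  shows "dagger (Z1 x) ** Y x - dagger (Z x) ** Y1 x = dagger (Z1 0) ** Y 0 - dagger (Z 0) ** Y1 0"
proof -
  note prod = W11_bilinear[OF bounded_bilinear_matrix_mult W11_linear[OF bounded_linear_dagger]]
  have W: "has_W11_derivative (\<lambda>x. dagger (Z1 x) ** Y x - dagger (Z x) ** Y1 x)
     (\<lambda>x. (dagger (- (coef L (cnj \<xi>) x ** Z x)) ** Y x + dagger (Z1 x) ** Y1 x)
        - (dagger (Z1 x) ** Y1 x + dagger (Z x) ** (- (coef L \<xi> x ** Y x))))"
    using Y Z unfolding sol_def by (intro W11_diff prod) auto
  have "AE x in lebesgue_on {0..pi}. x \<in> {0..pi} \<and> dagger (Q0 L x) = Q0 L x"
    using Q0_herm by (auto intro: AE_I2)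
  then have "AE x in lebesgue_on {0..pi}. (dagger (- (coef L (cnj \<xi>) x ** Z x)) ** Y x + dagger (Z1 x) ** Y1 x)
        - (dagger (Z1 x) ** Y1 x + dagger (Z x) ** (- (coef L \<xi> x ** Y x))) = 0"
  proof (rule eventually_mono)
    fix x assume "x \<in> {0..pi} \<and> dagger (Q0 L x) = Q0 L x"
    then have "dagger (coef L (cnj \<xi>) x) = coef L \<xi> x"
      using Q1_skew[of x] by (simp add: coef_def dagger_simps)
    then show "(dagger (- (coef L (cnj \<xi>) x ** Z x)) ** Y x + dagger (Z1 x) ** Y1 x)
        - (dagger (Z1 x) ** Y1 x + dagger (Z x) ** (- (coef L \<xi> x ** Y x))) = 0"
      by (simp add: dagger_mult matrix_mul_assoc)
  qed
  from W11_constant[OF W this x] show ?thesis .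
qed

text \<open>The bracket of the Weyl solutions at \<open>cnj \<xi>\<close> and \<xi> vanishes at
  \<pi> by the condition V, while at 0 the condition U turns it into the difference of the two
  sides.\<close>

lemma weyl_dagger:
  assumes "char_fun L \<xi> \<noteq> 0" "char_fun L (cnj \<xi>) \<noteq> 0"
  shows "dagger (weyl L (cnj \<xi>)) = weyl L \<xi>"
proof -
  let ?M = "weyl L \<xi>" and ?N = "dagger (weyl L (cnj \<xi>))"
  let ?h = "(\<i> * \<xi>) *\<^sub>M h1 L + h0 L" and ?H = "(\<i> * \<xi>) *\<^sub>M H1 L + H0 L"
  note P = Phi_spec[OF assms(1)] and Q = Phi_spec[OF assms(2)]
  have "dagger (Phi1 L (cnj \<xi>) 0) = mat 1 - ?N ** ?h"
    by (simp add: Q dagger_simps matrix_distribs)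
  moreover have "dagger (Phi1 L (cnj \<xi>) pi) = - (dagger (Phi L (cnj \<xi>) pi) ** ?H)"
    by (simp add: Q dagger_simps matrix_distribs)
  moreover have "dagger (Phi1 L (cnj \<xi>) pi) ** Phi L \<xi> pi - dagger (Phi L (cnj \<xi>) pi) ** Phi1 L \<xi> pi
      = dagger (Phi1 L (cnj \<xi>) 0) ** Phi L \<xi> 0 - dagger (Phi L (cnj \<xi>) 0) ** Phi1 L \<xi> 0"
    by (rule bracket_constant[OF P(1) Q(1)]) simp
  ultimately have "0 = (mat 1 - ?N ** ?h) ** ?M - ?N ** (mat 1 - ?h ** ?M)"
    by (simp add: P Q matrix_mul_assoc)
  also have "\<dots> = ?M - ?N" by (simp add: matrix_distribs matrix_mul_assoc)
  finally show ?thesis by simp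
qed

end

section \<open>Travelling waves\<close>

lemma W11_exp:
  "has_W11_derivative (\<lambda>x. exp (c * of_real x)) (\<lambda>x. c * exp (c * of_real x))" for c :: complex
proof (rule W11_of_vector_derivative)
  fix x
  have "((\<lambda>z. exp (c * z)) has_field_derivative c * exp (c * of_real x)) (at (of_real x))"
    by (auto intro!: derivative_eq_intros)
  then show "((\<lambda>x. exp (c * of_real x)) has_vector_derivative c * exp (c * of_real x)) (at x within {0..pi})"
    by (rule has_vector_derivative_real_field)
qed (auto intro!: continuous_intros)

lemma norm_exp_wave_le: "norm (exp (\<sigma> * \<i> * \<xi> * of_real y)) \<le> exp (\<bar>Im \<xi>\<bar> * \<bar>y\<bar>)"
  if "\<sigma> \<in> {1, -1}" for \<sigma> \<xi> :: complex and y :: real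
proof -
  have "Re (\<sigma> * \<i> * \<xi> * of_real y) \<le> \<bar>Im \<xi> * y\<bar>" using that by auto
  then show ?thesis by (simp add: norm_exp_eq_Re abs_mult)
qed

text \<open>For \<open>\<sigma> = 1\<close> this travels with \<open>exp (\<i> * \<xi> * x)\<close>,
  for \<open>\<sigma> = - 1\<close> with the inverse factor. The sum of the two waves is twice
  \<open>Y1\<close>, and their difference is \<open>2 * \<i> * \<xi>\<close> times \<open>Y\<close>
  up to a term with \<open>Q1\<close>, so \<open>Y\<close> is one order smaller in \<xi>.\<close>

definition wave :: "'m::finite pencil \<Rightarrow> complex \<Rightarrow> complex \<Rightarrow> (real \<Rightarrow> complex^'m^'m) \<Rightarrow> (real \<Rightarrow> complex^'m^'m) \<Rightarrow> real \<Rightarrow> complex^'m^'m"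
  where "wave L \<sigma> \<xi> Y Y1 x = Y1 x + \<sigma> *\<^sub>M ((\<i> * \<xi>) *\<^sub>M Y x - Q1 L x ** Y x)"

context regular_pencil
begin

text \<open>What is left of the equation once all terms with \<xi> are absorbed into the waves; the
  weak derivative of \<open>Q1\<close> enters here.\<close>

definition pot :: "complex \<Rightarrow> real \<Rightarrow> complex^'m^'m"
  where "pot \<sigma> x = Q0 L x + \<sigma> *\<^sub>M dQ1 x + Q1 L x ** Q1 L x"

text \<open>With this choice of wave the terms with \<xi>^2 and with \<open>2 * \<i> * \<xi>\<close>
  times \<open>Q1\<close> factor completely, so the inhomogeneity has no factor \<xi>.\<close>

lemma W11_wave:
  assumes Y: "sol L \<xi> Y Y1" and s: "\<sigma> * \<sigma> = 1"
  shows "has_W11_derivative (wave L \<sigma> \<xi> Y Y1)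
    (\<lambda>x. (\<sigma> * \<i> * \<xi>) *\<^sub>M wave L \<sigma> \<xi> Y Y1 x - (\<sigma> *\<^sub>M Q1 L x) ** wave L \<sigma> \<xi> Y Y1 x - pot \<sigma> x ** Y x)"
proof -
  have W: "has_W11_derivative (wave L \<sigma> \<xi> Y Y1)
    (\<lambda>x. - (coef L \<xi> x ** Y x) + \<sigma> *\<^sub>M ((\<i> * \<xi>) *\<^sub>M Y1 x - (dQ1 x ** Y x + Q1 L x ** Y1 x)))"
    using Y unfolding wave_def[abs_def] sol_def
    by (intro W11_add W11_diff W11_linear[OF bounded_linear_cscale] W11_bilinear[OF bounded_bilinear_matrix_mult] Q1_W11) auto
  have "\<sigma> * (\<sigma> * c) = c" for c using s by (simp flip: mult.assoc)
  then have "- (coef L \<xi> x ** Y x) + \<sigma> *\<^sub>M ((\<i> * \<xi>) *\<^sub>M Y1 x - (dQ1 x ** Y x + Q1 L x ** Y1 x))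
    = (\<sigma> * \<i> * \<xi>) *\<^sub>M wave L \<sigma> \<xi> Y Y1 x - (\<sigma> *\<^sub>M Q1 L x) ** wave L \<sigma> \<xi> Y Y1 x - pot \<sigma> x ** Y x" for x
    by (simp add: wave_def coef_def pot_def matrix_distribs s matrix_mul_assoc mult_ac power2_eq_square)
      (simp add: vec_eq_iff algebra_simps \<open>\<And>c. \<sigma> * (\<sigma> * c) = c\<close>)
  then show ?thesis using W by simp
qed

end

context hermitian_pencil
begin

text \<open>Variation of constants: the exponential and the unitary amplitude solve the homogeneous
  wave equation, and removing them leaves only the term with \<open>pot\<close>.\<close>

lemma W11_profile:
  assumes Y: "sol L \<xi> Y Y1" and s: "\<sigma> \<in> {1, -1}"
  shows "has_W11_derivative (\<lambda>x. exp (- (\<sigma> * \<i> * \<xi>) * of_real x) *\<^sub>M (dagger (P_sol (- \<sigma>) L x) ** wave L \<sigma> \<xi> Y Y1 x))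
    (\<lambda>x. - (exp (- (\<sigma> * \<i> * \<xi>) * of_real x) *\<^sub>M (dagger (P_sol (- \<sigma>) L x) ** (pot \<sigma> x ** Y x))))"
proof -
  have s1: "\<sigma> * \<sigma> = 1" and s2: "cnj \<sigma> = \<sigma>" using s by auto
  let ?P = "P_sol (- \<sigma>) L" and ?r = "wave L \<sigma> \<xi> Y Y1" and ?c = "- (\<sigma> * \<i> * \<xi>)"
  let ?e = "\<lambda>x. exp (?c * of_real x)"
  have W: "has_W11_derivative (\<lambda>x. ?e x *\<^sub>M (dagger (?P x) ** ?r x))
    (\<lambda>x. (?c * ?e x) *\<^sub>M (dagger (?P x) ** ?r x) + ?e x *\<^sub>M (dagger ((- \<sigma> *\<^sub>M Q1 L x) ** ?P x) ** ?r x
        + dagger (?P x) ** ((\<sigma> * \<i> * \<xi>) *\<^sub>M ?r x - (\<sigma> *\<^sub>M Q1 L x) ** ?r x - pot \<sigma> x ** Y x)))"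
    by (intro W11_bilinear[OF bounded_bilinear_cscale] W11_exp W11_bilinear[OF bounded_bilinear_matrix_mult]
        W11_linear[OF bounded_linear_dagger] P_sol_spec W11_wave Y s1)
  show ?thesis
  proof (rule W11_cong[OF W refl])
    fix x assume x: "x \<in> {0..pi}"
    have "dagger ((- \<sigma> *\<^sub>M Q1 L x) ** ?P x) = \<sigma> *\<^sub>M (dagger (?P x) ** Q1 L x)"
      using Q1_skew[OF x] s2 by (simp add: dagger_simps matrix_distribs)
    then show "(?c * ?e x) *\<^sub>M (dagger (?P x) ** ?r x) + ?e x *\<^sub>M (dagger ((- \<sigma> *\<^sub>M Q1 L x) ** ?P x) ** ?r x
        + dagger (?P x) ** ((\<sigma> * \<i> * \<xi>) *\<^sub>M ?r x - (\<sigma> *\<^sub>M Q1 L x) ** ?r x - pot \<sigma> x ** Y x))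
      = - (?e x *\<^sub>M (dagger (?P x) ** (pot \<sigma> x ** Y x)))"
      by (simp add: matrix_distribs matrix_mul_assoc) (simp add: vec_eq_iff algebra_simps)
  qed
qed

text \<open>The error integrates \<open>pot\<close> times \<open>Y\<close>, and \<open>Y\<close> is
  O(1/\<xi>) times the waves. For large \<xi> the weighted maximum of the waves is therefore
  controlled by their values at \<open>s\<close>, which makes the error O(1/\<xi>) in turn. The base
  point is arbitrary because \<open>phi\<close> is propagated from 0 and the Weyl solution from
  \<pi>.\<close>

lemma wave_estimate:
  obtains C R where "C \<ge> 0" "R > 0"
    "\<And>\<xi> Y Y1 s \<sigma> x. R \<le> norm \<xi> \<Longrightarrow> sol L \<xi> Y Y1 \<Longrightarrow> s \<in> {0..pi} \<Longrightarrow> x \<in> {0..pi} \<Longrightarrow> \<sigma> \<in> {1, -1} \<Longrightarrow>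
      norm (wave L \<sigma> \<xi> Y Y1 x - exp (\<sigma> * \<i> * \<xi> * of_real (x - s)) *\<^sub>M
          (P_sol (- \<sigma>) L x ** dagger (P_sol (- \<sigma>) L s) ** wave L \<sigma> \<xi> Y Y1 s))
        \<le> C / norm \<xi> * exp (\<bar>Im \<xi>\<bar> * \<bar>x - s\<bar>) * (norm (wave L 1 \<xi> Y Y1 s) + norm (wave L (-1) \<xi> Y Y1 s))"
    "\<And>\<xi> Y Y1 s x. R \<le> norm \<xi> \<Longrightarrow> sol L \<xi> Y Y1 \<Longrightarrow> s \<in> {0..pi} \<Longrightarrow> x \<in> {0..pi} \<Longrightarrow>
      norm (Y x) \<le> C / norm \<xi> * exp (\<bar>Im \<xi>\<bar> * \<bar>x - s\<bar>) * (norm (wave L 1 \<xi> Y Y1 s) + norm (wave L (-1) \<xi> Y Y1 s))"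
proof -
  obtain CQ where CQ: "CQ \<ge> 0" "\<And>x. x \<in> {0..pi} \<Longrightarrow> norm (Q1 L x) \<le> CQ"
    using continuous_bounded[OF Q1_continuous] by metis
  obtain Cp where Cp: "Cp \<ge> 0" "\<And>x. x \<in> {0..pi} \<Longrightarrow> norm (P_sol 1 L x) \<le> Cp"
    using continuous_bounded[OF W11_continuous[OF P_sol_spec(2)]] by metis
  obtain Cm where Cm: "Cm \<ge> 0" "\<And>x. x \<in> {0..pi} \<Longrightarrow> norm (P_sol (-1) L x) \<le> Cm"
    using continuous_bounded[OF W11_continuous[OF P_sol_spec(2)]] by metis
  define C0 where "C0 = Cp + Cm"
  have C0: "C0 \<ge> 0" "\<And>x \<sigma>. x \<in> {0..pi} \<Longrightarrow> \<sigma> \<in> {1, -1} \<Longrightarrow> norm (P_sol (- \<sigma>) L x) \<le> C0"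
    using Cp Cm by (auto simp: C0_def intro: add_increasing add_increasing2)
  define n where "n = (\<lambda>x. norm (Q0 L x) + norm (dQ1 x) + norm (Q1 L x) * norm (Q1 L x))"
  have n_int: "n absolutely_integrable_on {0..pi}"
    unfolding n_def
    by (intro set_integral_add(1) absolutely_integrable_norm[OF Q0_integrable, unfolded o_def]
        absolutely_integrable_norm[OF W11_integrable[OF Q1_W11], unfolded o_def]
        absolutely_integrable_continuous_real[of 0 pi "\<lambda>x. norm (Q1 L x) * norm (Q1 L x)"]
        continuous_intros Q1_continuous)
  have n0: "n x \<ge> 0" for x by (simp add: n_def)
  have pot_le: "norm (pot \<sigma> x) \<le> n x" if "\<sigma> \<in> {1, -1}" for \<sigma> x
    unfolding pot_def n_def using that
    by (intro order_trans[OF norm_triangle_ineq] add_mono norm_matrix_mult_le) (auto simp: norm_cscale)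
  define C1 where "C1 = C0 * C0 * integral {0..pi} n"
  have C1: "C1 \<ge> 0" unfolding C1_def
    using n0 n_int C0 by (intro mult_nonneg_nonneg Henstock_Kurzweil_Integration.integral_nonneg)
      (auto intro: absolutely_integrable_imp_integrable)
  \<comment> \<open>\<open>2 * CQ\<close> absorbs the term with \<open>Q1\<close> when
    \<open>Y\<close> is recovered from the waves; \<open>4 * C1\<close> makes the feedback of the
    waves on themselves at most one half.\<close>
  define R where "R = 2 * CQ + 4 * C1 + 1"
  define C where "C = (C1 + 1) * (2 * (C0 * C0) + 1)"
  have main: "norm (Y x) \<le> 2 * (C0 * C0) / norm \<xi> * exp (\<bar>Im \<xi>\<bar> * \<bar>x - s\<bar>) * (norm (wave L 1 \<xi> Y Y1 s) + norm (wave L (-1) \<xi> Y Y1 s)) \<and>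
     (\<forall>\<sigma>\<in>{1,-1}. norm (wave L \<sigma> \<xi> Y Y1 x - exp (\<sigma> * \<i> * \<xi> * of_real (x - s)) *\<^sub>M
          (P_sol (- \<sigma>) L x ** dagger (P_sol (- \<sigma>) L s) ** wave L \<sigma> \<xi> Y Y1 s))
        \<le> C1 * (2 * (C0 * C0)) / norm \<xi> * exp (\<bar>Im \<xi>\<bar> * \<bar>x - s\<bar>) * (norm (wave L 1 \<xi> Y Y1 s) + norm (wave L (-1) \<xi> Y Y1 s)))"
    if xi: "R \<le> norm \<xi>" and Y: "sol L \<xi> Y Y1" and s: "s \<in> {0..pi}" and x: "x \<in> {0..pi}" for \<xi> Y Y1 s x
  proof -
    define r where "r = (\<lambda>\<sigma>. wave L \<sigma> \<xi> Y Y1)"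
    have xi0: "norm \<xi> > 0" "norm \<xi> \<ge> 2 * CQ" "norm \<xi> \<ge> 4 * C1" using xi CQ C1 by (auto simp: R_def)
    have cr: "continuous_on {0..pi} (r \<sigma>)" if "\<sigma> \<in> {1,-1}" for \<sigma>
      unfolding r_def using that by (intro W11_continuous[OF W11_wave[OF Y]]) auto
    \<comment> \<open>The weight removes the largest possible growth away from \<open>s\<close>, so
      the maximum of \<open>g\<close> measures the waves uniformly.\<close>
    define g where "g = (\<lambda>t. exp (- \<bar>Im \<xi>\<bar> * \<bar>t - s\<bar>) * (norm (r 1 t) + norm (r (-1) t)))"
    have "continuous_on {0..pi} g"
      unfolding g_def by (intro continuous_intros cr) auto
    then obtain t0 where t0: "t0 \<in> {0..pi}" and gmax: "\<And>t. t \<in> {0..pi} \<Longrightarrow> g t \<le> g t0"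
      using continuous_attains_sup[of "{0..pi}" g] by auto
    define G where "G = g t0"
    have G0: "G \<ge> 0" by (simp add: G_def g_def)
    have rG: "norm (r 1 t) + norm (r (-1) t) \<le> exp (\<bar>Im \<xi>\<bar> * \<bar>t - s\<bar>) * G" if "t \<in> {0..pi}" for t
    proof -
      have "exp (\<bar>Im \<xi>\<bar> * \<bar>t - s\<bar>) * g t \<le> exp (\<bar>Im \<xi>\<bar> * \<bar>t - s\<bar>) * G"
        using gmax[OF that] by (intro mult_left_mono) (auto simp: G_def)
      moreover have "exp (\<bar>Im \<xi>\<bar> * \<bar>t - s\<bar>) * g t = norm (r 1 t) + norm (r (-1) t)"
        by (simp add: g_def mult.assoc[symmetric] flip: exp_add)
      ultimately show ?thesis by simp
    qed
    have YG: "norm (Y t) \<le> exp (\<bar>Im \<xi>\<bar> * \<bar>t - s\<bar>) * G / norm \<xi>" if t: "t \<in> {0..pi}" for t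
    proof -
      have "r 1 t - r (-1) t = 2 *\<^sub>M ((\<i> * \<xi>) *\<^sub>M Y t - Q1 L t ** Y t)"
        by (simp add: r_def wave_def vec_eq_iff)
      then have "2 *\<^sub>M (\<i> * \<xi>) *\<^sub>M Y t = (r 1 t - r (-1) t) + 2 *\<^sub>M (Q1 L t ** Y t)"
        by (simp add: cscale_diff)
      then have "norm (2 *\<^sub>M (\<i> * \<xi>) *\<^sub>M Y t) = norm ((r 1 t - r (-1) t) + 2 *\<^sub>M (Q1 L t ** Y t))"
        by (rule arg_cong)
      also have "\<dots> \<le> (norm (r 1 t) + norm (r (-1) t)) + 2 * (CQ * norm (Y t))"
        using norm_triangle_ineq[of "r 1 t - r (-1) t" "2 *\<^sub>M (Q1 L t ** Y t)"]
          norm_triangle_ineq4[of "r 1 t" "r (-1) t"] norm_matrix_mult_le[of "Q1 L t" "Y t"]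
          mult_right_mono[OF CQ(2)[OF t], of "norm (Y t)"]
        by (simp add: norm_cscale)
      also have "2 * (CQ * norm (Y t)) \<le> norm \<xi> * norm (Y t)"
        using mult_right_mono[OF xi0(2), of "norm (Y t)"] by simp
      finally have "norm \<xi> * norm (Y t) \<le> norm (r 1 t) + norm (r (-1) t)"
        by (simp add: norm_cscale norm_mult)
      then show ?thesis using rG[OF t] xi0(1) by (simp add: field_simps)
    qed
    have err: "norm (r \<sigma> x - exp (\<sigma> * \<i> * \<xi> * of_real (x - s)) *\<^sub>M (P_sol (- \<sigma>) L x ** dagger (P_sol (- \<sigma>) L s) ** r \<sigma> s))
        \<le> exp (\<bar>Im \<xi>\<bar> * \<bar>x - s\<bar>) * (C1 * (G / norm \<xi>))" if sg: "\<sigma> \<in> {1,-1}" and x: "x \<in> {0..pi}" for \<sigma> x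
    proof -
      let ?P = "P_sol (- \<sigma>) L"
      have sg': "cnj (- \<sigma>) = - \<sigma>" using sg by auto
      define a where "a = (\<lambda>x. exp (- (\<sigma> * \<i> * \<xi>) * of_real x) *\<^sub>M (dagger (?P x) ** r \<sigma> x))"
      define a' where "a' = (\<lambda>x. - (exp (- (\<sigma> * \<i> * \<xi>) * of_real x) *\<^sub>M (dagger (?P x) ** (pot \<sigma> x ** Y x))))"
      have Wa: "has_W11_derivative a a'"
        unfolding a_def a'_def r_def by (rule W11_profile[OF Y sg])
      have ra: "r \<sigma> x = exp (\<sigma> * \<i> * \<xi> * of_real x) *\<^sub>M (?P x ** a x)"
      proof -
        have "exp (\<sigma> * \<i> * \<xi> * of_real x) *\<^sub>M (?P x ** a x) = (?P x ** dagger (?P x)) ** r \<sigma> x"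
          by (simp add: a_def matrix_distribs matrix_mul_assoc flip: exp_add)
        then show ?thesis using P_unitary(2)[OF x sg'] by simp
      qed
      have as: "exp (\<sigma> * \<i> * \<xi> * of_real (x - s)) *\<^sub>M (?P x ** dagger (?P s) ** r \<sigma> s)
          = exp (\<sigma> * \<i> * \<xi> * of_real x) *\<^sub>M (?P x ** a s)"
        by (simp add: a_def matrix_distribs matrix_mul_assoc right_diff_distrib flip: exp_add)
      \<comment> \<open>Ordering the end points treats propagation to the right and to the left
        together.\<close>
      define l u where "l = min s x" and "u = max s x"
      have lu: "0 \<le> l" "l \<le> u" "u \<le> pi" using s x by (auto simp: l_def u_def)
      have "norm (a x - a s) = norm (a u - a l)"
        by (auto simp: l_def u_def min_def max_def norm_minus_commute)
      also have "\<dots> = norm (integral {l..u} a')" using W11_increment[OF Wa lu] by simp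
      finally have aint: "norm (a x - a s) = norm (integral {l..u} a')" .
      let ?E = "norm (exp (\<sigma> * \<i> * \<xi> * of_real x))"
      have nlu: "n integrable_on {l..u}"
        using absolutely_integrable_subinterval[OF n_int lu(1,3)] by (rule absolutely_integrable_imp_integrable)
      let ?D = "exp (\<bar>Im \<xi>\<bar> * \<bar>x - s\<bar>) * (C0 * (G / norm \<xi>))"
      have "?E * norm (a x - a s) = norm (integral {l..u} (\<lambda>t. exp (\<sigma> * \<i> * \<xi> * of_real x) *\<^sub>M a' t))"
      proof -
        have "a' integrable_on {l..u}"
          using absolutely_integrable_subinterval[OF W11_integrable[OF Wa] lu(1,3)] by (rule absolutely_integrable_imp_integrable)
        from integral_linear[OF this bounded_linear_cscale, of "exp (\<sigma> * \<i> * \<xi> * of_real x)"]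
        show ?thesis by (simp add: o_def aint norm_cscale)
      qed
      also have "\<dots> \<le> integral {l..u} (\<lambda>t. ?D * n t)"
      proof (rule integral_norm_bound_integral)
        show "(\<lambda>t. exp (\<sigma> * \<i> * \<xi> * of_real x) *\<^sub>M a' t) integrable_on {l..u}"
          by (rule absolutely_integrable_imp_integrable[OF absolutely_integrable_subinterval[OF
              absolutely_integrable_linear[OF W11_integrable[OF Wa] bounded_linear_cscale, unfolded o_def] lu(1,3)]])
        show "(\<lambda>t. ?D * n t) integrable_on {l..u}" using nlu by (rule integrable_on_mult_right)
        fix t assume t: "t \<in> {l..u}"
        then have tp: "t \<in> {0..pi}" using lu by auto
        \<comment> \<open>Since \<open>t\<close> lies between \<open>s\<close> and \<open>x\<close>,
          the growth factors from \<open>s\<close> to \<open>t\<close> and from \<open>t\<close> to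
          \<open>x\<close> multiply to that from \<open>s\<close> to \<open>x\<close>.\<close>
        have "\<bar>x - t\<bar> + \<bar>t - s\<bar> = \<bar>x - s\<bar>" using t by (auto simp: l_def u_def)
        then have ee: "exp (\<bar>Im \<xi>\<bar> * \<bar>x - t\<bar>) * exp (\<bar>Im \<xi>\<bar> * \<bar>t - s\<bar>) = exp (\<bar>Im \<xi>\<bar> * \<bar>x - s\<bar>)"
          by (simp add: distrib_left[symmetric] flip: exp_add)
        have "exp (\<sigma> * \<i> * \<xi> * of_real x) * exp (- (\<sigma> * \<i> * \<xi>) * of_real t) = exp (\<sigma> * \<i> * \<xi> * of_real (x - t))"
          by (simp add: right_diff_distrib flip: exp_add)
        then have "exp (\<sigma> * \<i> * \<xi> * of_real x) *\<^sub>M a' t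
            = - (exp (\<sigma> * \<i> * \<xi> * of_real (x - t)) *\<^sub>M (dagger (?P t) ** (pot \<sigma> t ** Y t)))"
          by (simp add: a'_def)
        then have "norm (exp (\<sigma> * \<i> * \<xi> * of_real x) *\<^sub>M a' t)
            \<le> norm (exp (\<sigma> * \<i> * \<xi> * of_real (x - t))) * (norm (dagger (?P t)) * (norm (pot \<sigma> t) * norm (Y t)))"
          by (simp only: norm_minus_cancel norm_cscale)
             (intro mult_left_mono order_trans[OF norm_matrix_mult_le] mult_left_mono[OF norm_matrix_mult_le] norm_ge_zero)
        also have "\<dots> \<le> exp (\<bar>Im \<xi>\<bar> * \<bar>x - t\<bar>) * (C0 * (n t * (exp (\<bar>Im \<xi>\<bar> * \<bar>t - s\<bar>) * G / norm \<xi>)))"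
          using C0 sg tp norm_exp_wave_le[OF sg] n0
          by (intro mult_mono pot_le YG) (auto simp: norm_dagger)
        also have "\<dots> = exp (\<bar>Im \<xi>\<bar> * \<bar>x - t\<bar>) * exp (\<bar>Im \<xi>\<bar> * \<bar>t - s\<bar>) * (C0 * (G / norm \<xi>)) * n t" by simp
        finally show "norm (exp (\<sigma> * \<i> * \<xi> * of_real x) *\<^sub>M a' t) \<le> ?D * n t" unfolding ee .
      qed
      also have "\<dots> = ?D * integral {l..u} n" by simp
      also have "\<dots> \<le> ?D * integral {0..pi} n"
        using n0 nlu n_int G0 C0 lu by (intro mult_left_mono integral_subset_le)
          (auto intro: absolutely_integrable_imp_integrable)
      finally have E: "?E * norm (a x - a s) \<le> ?D * integral {0..pi} n" .
      have "r \<sigma> x - exp (\<sigma> * \<i> * \<xi> * of_real (x - s)) *\<^sub>M (?P x ** dagger (?P s) ** r \<sigma> s)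
          = exp (\<sigma> * \<i> * \<xi> * of_real x) *\<^sub>M (?P x ** (a x - a s))"
        unfolding as by (subst ra) (simp add: matrix_distribs)
      also have "norm \<dots> \<le> ?E * (C0 * norm (a x - a s))"
        using C0(2)[OF x sg] mult_right_mono[OF C0(2)[OF x sg], of "norm (a x - a s)"] norm_matrix_mult_le[of "?P x" "a x - a s"]
        by (auto simp: norm_cscale intro!: mult_left_mono)
      also have "\<dots> = C0 * (?E * norm (a x - a s))" by simp
      also have "\<dots> \<le> C0 * (?D * integral {0..pi} n)" using E C0(1) by (intro mult_left_mono)
      also have "\<dots> = exp (\<bar>Im \<xi>\<bar> * \<bar>x - s\<bar>) * (C1 * (G / norm \<xi>))" by (simp add: C1_def)
      finally show ?thesis .
    qed
    have rs: "norm (r \<sigma> t0) \<le> exp (\<bar>Im \<xi>\<bar> * \<bar>t0 - s\<bar>) * (C0 * C0 * norm (r \<sigma> s) + C1 * (G / norm \<xi>))" if sg: "\<sigma> \<in> {1,-1}" for \<sigma>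
    proof -
      let ?w = "exp (\<sigma> * \<i> * \<xi> * of_real (t0 - s)) *\<^sub>M (P_sol (- \<sigma>) L t0 ** dagger (P_sol (- \<sigma>) L s) ** r \<sigma> s)"
      have "norm ?w \<le> norm (exp (\<sigma> * \<i> * \<xi> * of_real (t0 - s))) * (norm (P_sol (- \<sigma>) L t0) * norm (dagger (P_sol (- \<sigma>) L s)) * norm (r \<sigma> s))"
        unfolding norm_cscale
        by (intro mult_left_mono order_trans[OF norm_matrix_mult_le] mult_right_mono norm_matrix_mult_le) auto
      also have "\<dots> \<le> exp (\<bar>Im \<xi>\<bar> * \<bar>t0 - s\<bar>) * (C0 * C0 * norm (r \<sigma> s))"
        using C0 sg t0 s norm_exp_wave_le[OF sg]
        by (intro mult_mono) (auto simp: norm_dagger)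
      finally show ?thesis
        using err[OF sg t0] norm_triangle_ineq[of "r \<sigma> t0 - ?w" ?w] by (simp add: algebra_simps)
    qed
    have gs: "g s = norm (r 1 s) + norm (r (-1) s)" by (simp add: g_def)
    \<comment> \<open>At the maximum point the weight cancels the growth; the feedback term is then
      absorbed into the left side.\<close>
    have "G \<le> C0 * C0 * g s + 2 * (C1 * (G / norm \<xi>))"
    proof -
      have "G = exp (- \<bar>Im \<xi>\<bar> * \<bar>t0 - s\<bar>) * (norm (r 1 t0) + norm (r (-1) t0))" by (simp add: G_def g_def)
      also have "norm (r 1 t0) + norm (r (-1) t0)
          \<le> exp (\<bar>Im \<xi>\<bar> * \<bar>t0 - s\<bar>) * (C0 * C0 * norm (r 1 s) + C1 * (G / norm \<xi>))
            + exp (\<bar>Im \<xi>\<bar> * \<bar>t0 - s\<bar>) * (C0 * C0 * norm (r (-1) s) + C1 * (G / norm \<xi>))"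
        by (intro add_mono rs) auto
      also have "\<dots> = exp (\<bar>Im \<xi>\<bar> * \<bar>t0 - s\<bar>) * (C0 * C0 * g s + 2 * (C1 * (G / norm \<xi>)))"
        unfolding gs by (simp only: distrib_left mult_2 add_ac)
      finally have "G \<le> exp (- \<bar>Im \<xi>\<bar> * \<bar>t0 - s\<bar>) * (exp (\<bar>Im \<xi>\<bar> * \<bar>t0 - s\<bar>) * (C0 * C0 * g s + 2 * (C1 * (G / norm \<xi>))))"
        by (simp add: mult_left_mono)
      also have "\<dots> = C0 * C0 * g s + 2 * (C1 * (G / norm \<xi>))" by (simp add: mult.assoc[symmetric] flip: exp_add)
      finally show ?thesis .
    qed
    moreover have "2 * (C1 * (G / norm \<xi>)) \<le> G / 2"
      using mult_right_mono[OF xi0(3) G0] xi0(1) by (simp add: field_simps)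
    ultimately have GG: "G \<le> 2 * (C0 * C0) * g s" by simp
    let ?e = "exp (\<bar>Im \<xi>\<bar> * \<bar>x - s\<bar>)"
    have "norm (Y x) \<le> ?e * G / norm \<xi>" by (rule YG[OF x])
    also have "\<dots> \<le> ?e * (2 * (C0 * C0) * g s) / norm \<xi>"
      using GG xi0 by (intro divide_right_mono mult_left_mono) auto
    finally have 1: "norm (Y x) \<le> 2 * (C0 * C0) / norm \<xi> * ?e * g s" by (simp add: mult_ac)
    have "?e * (C1 * (G / norm \<xi>)) \<le> ?e * (C1 * (2 * (C0 * C0) * g s / norm \<xi>))"
      using GG xi0 C1 by (intro divide_right_mono mult_left_mono) auto
    also have "\<dots> = C1 * (2 * (C0 * C0)) / norm \<xi> * ?e * g s" by simp
    finally have 2: "?e * (C1 * (G / norm \<xi>)) \<le> C1 * (2 * (C0 * C0)) / norm \<xi> * ?e * g s" .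
    show ?thesis
      using 1 order_trans[OF err[OF _ x] 2] unfolding gs r_def by blast
  qed
  have le: "A / norm \<xi> * e * g \<le> C / norm \<xi> * e * g" if "A \<le> C" "e \<ge> 0" "g \<ge> 0" for A e g and \<xi> :: complex
    using that by (intro mult_right_mono divide_right_mono) auto
  show ?thesis
  proof (rule that[of C R])
    show "C \<ge> 0" using C1 C0 by (simp add: C_def)
    show "R > 0" using CQ C1 by (simp add: R_def)
    have "0 \<le> C1 * (C0 * C0)" using C1 C0 by simp
    then have "2 * (C0 * C0) \<le> C" "C1 * (2 * (C0 * C0)) \<le> C"
      using C1 C0 by (simp_all add: C_def algebra_simps)
    note le1 = le[OF this(1)] and le2 = le[OF this(2)]
    show "norm (wave L \<sigma> \<xi> Y Y1 x - exp (\<sigma> * \<i> * \<xi> * of_real (x - s)) *\<^sub>M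
          (P_sol (- \<sigma>) L x ** dagger (P_sol (- \<sigma>) L s) ** wave L \<sigma> \<xi> Y Y1 s))
        \<le> C / norm \<xi> * exp (\<bar>Im \<xi>\<bar> * \<bar>x - s\<bar>) * (norm (wave L 1 \<xi> Y Y1 s) + norm (wave L (-1) \<xi> Y Y1 s))"
      if "R \<le> norm \<xi>" "sol L \<xi> Y Y1" "s \<in> {0..pi}" "x \<in> {0..pi}" "\<sigma> \<in> {1, -1}" for \<xi> Y Y1 s \<sigma> x
      using main[OF that(1-4)] that(5) by (blast intro: order_trans[OF _ le2] exp_ge_zero add_nonneg_nonneg norm_ge_zero)
    show "norm (Y x) \<le> C / norm \<xi> * exp (\<bar>Im \<xi>\<bar> * \<bar>x - s\<bar>) * (norm (wave L 1 \<xi> Y Y1 s) + norm (wave L (-1) \<xi> Y Y1 s))"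
      if "R \<le> norm \<xi>" "sol L \<xi> Y Y1" "s \<in> {0..pi}" "x \<in> {0..pi}" for \<xi> Y Y1 s x
      using main[OF that(1-4)] by (blast intro: order_trans[OF _ le1] exp_ge_zero add_nonneg_nonneg norm_ge_zero)
  qed
qed

end

section \<open>Asymptotics\<close>

text \<open>An O-bound along the filter \<open>F\<close> that records the exponential type
  \<open>y\<close> and the power \<open>k\<close> separately. Both may be negative: the Weyl
  solution has type \<open>- x\<close> and power -1.\<close>

definition growth :: "complex filter \<Rightarrow> (complex \<Rightarrow> 'a::real_normed_vector) \<Rightarrow> real \<Rightarrow> int \<Rightarrow> bool"
  where "growth F f y k \<longleftrightarrow>
    (\<exists>C. \<forall>\<^sub>F \<xi> in F. norm (f \<xi>) \<le> C * (exp (\<bar>Im \<xi>\<bar> * y) * norm \<xi> powi k))"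

lemma growthI: "\<forall>\<^sub>F \<xi> in F. norm (f \<xi>) \<le> C * (exp (\<bar>Im \<xi>\<bar> * y) * norm \<xi> powi k) \<Longrightarrow> growth F f y k"
  by (auto simp: growth_def)

lemma growthI_always: "(\<And>\<xi>. norm (f \<xi>) \<le> C * (exp (\<bar>Im \<xi>\<bar> * y) * norm \<xi> powi k)) \<Longrightarrow> growth F f y k"
  by (rule growthI) (rule always_eventually, blast)

lemma growthE:
  assumes "growth F f y k"
  obtains C where "C \<ge> 0" "\<forall>\<^sub>F \<xi> in F. norm (f \<xi>) \<le> C * (exp (\<bar>Im \<xi>\<bar> * y) * norm \<xi> powi k)"
proof -
  obtain C where C: "\<forall>\<^sub>F \<xi> in F. norm (f \<xi>) \<le> C * (exp (\<bar>Im \<xi>\<bar> * y) * norm \<xi> powi k)"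
    using assms by (auto simp: growth_def)
  have "\<forall>\<^sub>F \<xi> in F. norm (f \<xi>) \<le> \<bar>C\<bar> * (exp (\<bar>Im \<xi>\<bar> * y) * norm \<xi> powi k)"
    using C by (rule eventually_mono) (meson abs_ge_self mult_nonneg_nonneg mult_right_mono exp_ge_zero order_trans zero_le_power_int norm_ge_zero)
  then show ?thesis using that[of "\<bar>C\<bar>"] by simp
qed

lemma growth_cong:
  assumes "growth F f y k" "\<forall>\<^sub>F \<xi> in F. f \<xi> = g \<xi>"
  shows "growth F g y k"
proof -
  obtain C where "\<forall>\<^sub>F \<xi> in F. norm (f \<xi>) \<le> C * (exp (\<bar>Im \<xi>\<bar> * y) * norm \<xi> powi k)"
    using assms(1) by (auto simp: growth_def)
  with assms(2) have "\<forall>\<^sub>F \<xi> in F. norm (g \<xi>) \<le> C * (exp (\<bar>Im \<xi>\<bar> * y) * norm \<xi> powi k)"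
    by eventually_elim simp
  then show ?thesis by (rule growthI)
qed

lemma growth_add:
  assumes "growth F f y k" "growth F g y k"
  shows "growth F (\<lambda>\<xi>. f \<xi> + g \<xi>) y k"
proof -
  obtain C where C: "\<forall>\<^sub>F \<xi> in F. norm (f \<xi>) \<le> C * (exp (\<bar>Im \<xi>\<bar> * y) * norm \<xi> powi k)"
    using assms(1) by (auto simp: growth_def)
  obtain D where D: "\<forall>\<^sub>F \<xi> in F. norm (g \<xi>) \<le> D * (exp (\<bar>Im \<xi>\<bar> * y) * norm \<xi> powi k)"
    using assms(2) by (auto simp: growth_def)
  from C D have "\<forall>\<^sub>F \<xi> in F. norm (f \<xi> + g \<xi>) \<le> (C + D) * (exp (\<bar>Im \<xi>\<bar> * y) * norm \<xi> powi k)"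
  proof eventually_elim
    case (elim \<xi>)
    then show ?case using norm_triangle_ineq[of "f \<xi>" "g \<xi>"] by (simp only: distrib_right)
  qed
  then show ?thesis by (rule growthI)
qed

lemma growth_norm_le:
  assumes "growth F f y k" "\<And>\<xi>. norm (g \<xi>) \<le> norm (f \<xi>)"
  shows "growth F g y k"
proof -
  obtain C where "\<forall>\<^sub>F \<xi> in F. norm (f \<xi>) \<le> C * (exp (\<bar>Im \<xi>\<bar> * y) * norm \<xi> powi k)"
    using assms(1) by (auto simp: growth_def)
  then have "\<forall>\<^sub>F \<xi> in F. norm (g \<xi>) \<le> C * (exp (\<bar>Im \<xi>\<bar> * y) * norm \<xi> powi k)"
    by (rule eventually_mono) (rule order_trans[OF assms(2)])
  then show ?thesis by (rule growthI)
qed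

lemma growth_minus: "growth F f y k \<Longrightarrow> growth F (\<lambda>\<xi>. - f \<xi>) y k"
  by (rule growth_norm_le) auto

lemma growth_diff: "growth F f y k \<Longrightarrow> growth F g y k \<Longrightarrow> growth F (\<lambda>\<xi>. f \<xi> - g \<xi>) y k"
  using growth_add[of F f y k "\<lambda>\<xi>. - g \<xi>"] growth_minus by auto

lemma growth_zero: "growth F (\<lambda>\<xi>. 0) y k"
  by (rule growthI_always[of _ 0]) simp

lemma growth_sum: "(\<And>i. i \<in> S \<Longrightarrow> growth F (f i) y k) \<Longrightarrow> growth F (\<lambda>\<xi>. \<Sum>i\<in>S. f i \<xi>) y k"
  by (induction S rule: infinite_finite_induct) (auto simp: growth_zero intro!: growth_add)

lemma norm_unit_entry: "norm (unit_entry i j c :: complex^'n^'m) = norm c"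
proof -
  have r: "norm ((unit_entry i j c :: complex^'n^'m) $ k) = (if k = i then norm c else 0)" for k
    by (simp add: norm_vec_def L2_set_def if_distrib[of "\<lambda>x. x\<^sup>2"] if_distrib[of norm] cong: if_cong)
  then show ?thesis
    by (simp add: norm_vec_def[of "unit_entry i j c"] L2_set_def if_distrib[of "\<lambda>x. x\<^sup>2"] cong: if_cong)
qed

lemma growth_matrix:
  fixes f :: "complex \<Rightarrow> complex^'n^'m"
  assumes "\<And>i j. growth F (\<lambda>\<xi>. f \<xi> $ i $ j) y k"
  shows "growth F f y k"
proof -
  have "growth F (\<lambda>\<xi>. unit_entry i j (f \<xi> $ i $ j) :: complex^'n^'m) y k" for i j
    by (rule growth_norm_le[OF assms[of i j]]) (simp add: norm_unit_entry)
  then have "growth F (\<lambda>\<xi>. \<Sum>i\<in>UNIV. \<Sum>j\<in>UNIV. unit_entry i j (f \<xi> $ i $ j) :: complex^'n^'m) y k"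
    by (intro growth_sum)
  then show ?thesis by (simp flip: matrix_eq_sum_entries)
qed

lemma growth_const0: "growth F (\<lambda>\<xi>. A) 0 0"
  by (rule growthI_always[of _ "norm A"]) simp

section \<open>Calculus of growth bounds at infinity\<close>

locale large_filter =
  fixes F :: "complex filter"
  assumes large: "F \<le> at_infinity"
begin

lemma eventually_large: "\<forall>\<^sub>F \<xi> in F. norm \<xi> \<ge> r"
  using large by (rule filter_leD) (auto simp: eventually_at_infinity)

lemma growth_mono:
  assumes "growth F f y k" "y \<le> z" "k \<le> l"
  shows "growth F f z l"
proof -
  obtain C where "C \<ge> 0" and C: "\<forall>\<^sub>F \<xi> in F. norm (f \<xi>) \<le> C * (exp (\<bar>Im \<xi>\<bar> * y) * norm \<xi> powi k)"
    using growthE[OF assms(1)] .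
  from C eventually_large[of 1] have "\<forall>\<^sub>F \<xi> in F. norm (f \<xi>) \<le> C * (exp (\<bar>Im \<xi>\<bar> * z) * norm \<xi> powi l)"
  proof eventually_elim
    case (elim \<xi>)
    have "C * (exp (\<bar>Im \<xi>\<bar> * y) * norm \<xi> powi k) \<le> C * (exp (\<bar>Im \<xi>\<bar> * z) * norm \<xi> powi l)"
      using \<open>C \<ge> 0\<close> assms(2,3) elim by (intro mult_left_mono mult_mono power_int_increasing) (auto intro: mult_left_mono)
    then show ?case using elim by linarith
  qed
  then show ?thesis by (rule growthI)
qed

lemma growth_prod:
  assumes "growth F f y k" "growth F g z l" and "\<And>a b. norm (pr a b) \<le> norm a * norm b"
  shows "growth F (\<lambda>\<xi>. pr (f \<xi>) (g \<xi>)) (y + z) (k + l)"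
proof -
  obtain C where "C \<ge> 0" and C: "\<forall>\<^sub>F \<xi> in F. norm (f \<xi>) \<le> C * (exp (\<bar>Im \<xi>\<bar> * y) * norm \<xi> powi k)"
    using growthE[OF assms(1)] .
  obtain D where "D \<ge> 0" and D: "\<forall>\<^sub>F \<xi> in F. norm (g \<xi>) \<le> D * (exp (\<bar>Im \<xi>\<bar> * z) * norm \<xi> powi l)"
    using growthE[OF assms(2)] .
  from C D eventually_large[of 1]
  have "\<forall>\<^sub>F \<xi> in F. norm (pr (f \<xi>) (g \<xi>)) \<le> (C * D) * (exp (\<bar>Im \<xi>\<bar> * (y + z)) * norm \<xi> powi (k + l))"
  proof eventually_elim
    case (elim \<xi>)
    have "norm (pr (f \<xi>) (g \<xi>)) \<le> norm (f \<xi>) * norm (g \<xi>)" by (rule assms(3))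
    also have "\<dots> \<le> (C * (exp (\<bar>Im \<xi>\<bar> * y) * norm \<xi> powi k)) * (D * (exp (\<bar>Im \<xi>\<bar> * z) * norm \<xi> powi l))"
      using elim by (intro mult_mono) (auto intro: order_trans[OF norm_ge_zero])
    also have "\<dots> = (C * D) * (exp (\<bar>Im \<xi>\<bar> * (y + z)) * norm \<xi> powi (k + l))"
    proof -
      have "norm \<xi> \<noteq> 0" using elim(3) by linarith
      then have "norm \<xi> powi (k + l) = norm \<xi> powi k * norm \<xi> powi l" by (intro power_int_add) auto
      then show ?thesis by (simp add: distrib_left exp_add)
    qed
    finally show ?case .
  qed
  then show ?thesis by (rule growthI)
qed

lemma growth_mult:
  fixes f :: "complex \<Rightarrow> complex^'n^'m" and g :: "complex \<Rightarrow> complex^'p^'n"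
  shows "growth F f y k \<Longrightarrow> growth F g z l \<Longrightarrow> growth F (\<lambda>\<xi>. f \<xi> ** g \<xi>) (y + z) (k + l)"
  by (rule growth_prod[OF _ _ norm_matrix_mult_le])

lemma growth_cscale:
  fixes c :: "complex \<Rightarrow> complex" and g :: "complex \<Rightarrow> complex^'p^'n"
  shows "growth F c y k \<Longrightarrow> growth F g z l \<Longrightarrow> growth F (\<lambda>\<xi>. c \<xi> *\<^sub>M g \<xi>) (y + z) (k + l)"
  by (rule growth_prod) (simp_all add: norm_cscale)

lemma growth_times:
  fixes f g :: "complex \<Rightarrow> complex"
  shows "growth F f y k \<Longrightarrow> growth F g z l \<Longrightarrow> growth F (\<lambda>\<xi>. f \<xi> * g \<xi>) (y + z) (k + l)"
  by (rule growth_prod) (simp_all add: norm_mult)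

lemma growth_const_mult:
  fixes g :: "complex \<Rightarrow> complex^'p^'n"
  shows "growth F g y k \<Longrightarrow> growth F (\<lambda>\<xi>. A ** g \<xi>) y k"
  using growth_mult[OF growth_const0, of g y k A] by simp

lemma growth_mult_const:
  fixes g :: "complex \<Rightarrow> complex^'p^'n"
  shows "growth F g y k \<Longrightarrow> growth F (\<lambda>\<xi>. g \<xi> ** A) y k"
  using growth_mult[OF _ growth_const0, of g y k A] by simp

lemma growth_const_cscale:
  fixes g :: "complex \<Rightarrow> complex^'p^'n"
  shows "growth F g y k \<Longrightarrow> growth F (\<lambda>\<xi>. c *\<^sub>M g \<xi>) y k"
  using growth_cscale[OF growth_const0, of g y k c] by simp

lemma growth_ident: "growth F (\<lambda>\<xi>. \<xi>) 0 1"
  by (rule growthI_always[of _ 1]) simp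

lemma growth_inverse: "growth F (\<lambda>\<xi>. 1 / \<xi>) 0 (-1)"
  by (rule growthI_always[of _ 1]) (simp add: norm_divide field_simps power_int_minus)

lemma growth_inverse_shift: "growth F (\<lambda>\<xi>. 1 / (\<xi> - a)) 0 (-1)"
proof -
  have "\<forall>\<^sub>F \<xi> in F. norm (1 / (\<xi> - a)) \<le> 2 * (exp (\<bar>Im \<xi>\<bar> * 0) * norm \<xi> powi (-1))"
    using eventually_large[of "2 * norm a + 1"]
  proof eventually_elim
    case (elim \<xi>)
    have "norm \<xi> \<le> 2 * norm (\<xi> - a)" using norm_triangle_ineq2[of \<xi> a] elim by simp
    moreover have "norm \<xi> > 0" using elim norm_ge_zero[of a] by linarith
    moreover from calculation have "norm (\<xi> - a) > 0" by linarith
    ultimately show ?case by (simp add: norm_divide power_int_minus divide_simps)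
  qed
  then show ?thesis by (rule growthI)
qed

lemma growth_exp: "\<sigma> \<in> {1, -1} \<Longrightarrow> growth F (\<lambda>\<xi>. exp (\<sigma> * \<i> * \<xi> * of_real x)) \<bar>x\<bar> 0"
  by (rule growthI_always[of _ 1]) (use norm_exp_wave_le in auto)

text \<open>The difference of the products expands into three products, each with an error factor,
  which gains one power. The types add up, so opposite types cancel.\<close>

lemma growth_product_diff:
  fixes f f0 :: "complex \<Rightarrow> complex^'n^'m" and g g0 :: "complex \<Rightarrow> complex^'p^'n"
  assumes f: "growth F (\<lambda>\<xi>. f \<xi> - f0 \<xi>) y (k - 1)" and f0: "growth F f0 y k"
    and g: "growth F (\<lambda>\<xi>. g \<xi> - g0 \<xi>) z (l - 1)" and g0: "growth F g0 z l"
  shows "growth F (\<lambda>\<xi>. f \<xi> ** g \<xi> - f0 \<xi> ** g0 \<xi>) (y + z) (k + l - 1)"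
proof -
  have "growth F (\<lambda>\<xi>. (f \<xi> - f0 \<xi>) ** (g \<xi> - g0 \<xi>) + (f \<xi> - f0 \<xi>) ** g0 \<xi> + f0 \<xi> ** (g \<xi> - g0 \<xi>)) (y + z) (k + l - 1)"
    by (intro growth_add growth_mono[OF growth_mult[OF f g]] growth_mono[OF growth_mult[OF f g0]]
        growth_mono[OF growth_mult[OF f0 g]]) auto
  then show ?thesis by (simp add: matrix_distribs algebra_simps)
qed

lemma growth_of_diff:
  assumes "growth F (\<lambda>\<xi>. f \<xi> - f0 \<xi>) y (k - 1)" "growth F f0 y k"
  shows "growth F f y k"
  using growth_add[OF growth_mono[OF assms(1), of y k] assms(2)] by simp

end

lemma matrix_inv_mult:
  fixes A :: "complex^'n^'n"
  assumes "det A \<noteq> 0"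
  shows "matrix_inv A ** A = mat 1" "A ** matrix_inv A = mat 1"
proof -
  have "\<exists>B. A ** B = mat 1 \<and> B ** A = mat 1"
    using assms by (auto simp: invertible_det_nz[symmetric] invertible_def)
  then have "A ** matrix_inv A = mat 1 \<and> matrix_inv A ** A = mat 1"
    unfolding matrix_inv_def by (rule someI_ex)
  then show "matrix_inv A ** A = mat 1" "A ** matrix_inv A = mat 1" by auto
qed

lemma diag_mult: "diag d ** diag e = diag (\<lambda>q. d q * e q)"
proof -
  have "(\<Sum>k\<in>UNIV. (if i = k then d i else 0) * (if k = j then e k else 0))
      = (\<Sum>k\<in>UNIV. if k = i then d i * (if i = j then e i else 0) else 0)" for i j
    by (rule sum.cong) auto
  then show ?thesis by (simp add: vec_eq_iff matrix_mult_nth)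
qed

lemma det_zero_kernel:
  fixes A :: "complex^'n^'n"
  assumes "det A = 0"
  obtains C :: "complex^'n^'n" where "C \<noteq> 0" "A ** C = 0"
proof -
  have "\<not> (\<exists>B. B ** A = mat 1)"
    using assms by (metis invertible_det_nz invertible_left_inverse)
  then obtain v where v: "A *v v = 0" "v \<noteq> 0"
    using matrix_left_invertible_ker by blast
  show ?thesis
  proof (rule that[of "\<chi> i j. v $ i"])
    show "(\<chi> i j. v $ i) \<noteq> 0" using v(2) by (auto simp: vec_eq_iff)
    show "A ** (\<chi> i j. v $ i) = 0"
      using v(1) by (simp add: vec_eq_iff matrix_mult_nth matrix_vector_mult_def)
  qed
qed

text \<open>Factoring out half of the exponential leaves a sine; lower bounds for the sine thus
  control the denominators of the resolvent.\<close>

lemma norm_one_minus_exp: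
  "norm (1 - exp (2 * of_real pi * \<i> * z)) = exp (- pi * Im z) * (2 * norm (sin (of_real pi * z)))"
proof -
  have "1 - exp (2 * of_real pi * \<i> * z) = - (2 * \<i>) * exp (\<i> * (of_real pi * z)) * sin (of_real pi * z)"
    by (simp add: sin_exp_eq field_simps flip: exp_add)
  then show ?thesis by (simp add: norm_mult norm_exp_eq_Re)
qed

text \<open>For the pencil at hand this is the inverse of \<open>mat 1 - exp (2 * of_real pi * \<i>
  * \<xi>) *\<^sub>M dagger (A_mat L)\<close>, diagonalized by \<open>W\<close>. It arises when the
  boundary conditions at both ends couple the two waves.\<close>

definition resolv :: "('m \<Rightarrow> real) \<Rightarrow> complex^'m^'m \<Rightarrow> complex \<Rightarrow> complex^'m^'m"
  where "resolv \<omega> W \<xi> = dagger W ** diag (\<lambda>q. 1 / (1 - exp (2 * of_real pi * \<i> * (\<xi> - of_real (\<omega> q))))) ** W"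

text \<open>The filter restricts the spectral parameter to large values on which the exponential
  functions \<open>exp (2\<pi>i(\<xi> - \<omega>\<^sub>q))\<close> stay away from \<open>1\<close>.\<close>

locale contour_filter = large_filter F for F :: "complex filter" +
  fixes \<omega> :: "'m::finite \<Rightarrow> real" and \<delta> :: real
  assumes cnj_invariant: "\<And>P. eventually P F \<Longrightarrow> eventually (\<lambda>\<xi>. P (cnj \<xi>)) F"
    and delta: "\<delta> > 0"
    and separated: "\<forall>\<^sub>F \<xi> in F. \<forall>q. \<delta> * exp (pi * \<bar>Im \<xi>\<bar>) \<le> norm (sin (of_real pi * (\<xi> - of_real (\<omega> q))))"
begin

lemma growth_dagger:
  assumes "growth F f y k" shows "growth F (\<lambda>\<xi>. dagger (f (cnj \<xi>))) y k"
proof -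
  obtain C where "\<forall>\<^sub>F \<xi> in F. norm (f \<xi>) \<le> C * (exp (\<bar>Im \<xi>\<bar> * y) * norm \<xi> powi k)"
    using assms by (auto simp: growth_def)
  from cnj_invariant[OF this] show ?thesis by (intro growthI[of _ C]) (simp add: norm_dagger)
qed

text \<open>The denominator is at least \<open>2 * \<delta> * exp (pi * \<bar>Im \<xi>\<bar> - pi *
  Im \<xi>)\<close>, which is of order 1 in the upper half-plane and exponentially large in the
  lower one. In both half-planes either numerator, compared with it, leaves the factor
  \<open>exp (\<bar>Im \<xi>\<bar> * (- x))\<close>.\<close>

lemma norm_exp_quotient:
  assumes "\<delta> * exp (pi * \<bar>Im \<xi>\<bar>) \<le> norm (sin (of_real pi * (\<xi> - of_real r)))" and x: "x \<in> {0..pi}"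
  shows "norm (exp (1 * \<i> * \<xi> * of_real x) * (1 / (1 - exp (2 * of_real pi * \<i> * (\<xi> - of_real r))))) \<le> 1 / (2 * \<delta>) * exp (\<bar>Im \<xi>\<bar> * (- x))"
    and "norm (exp (- 1 * \<i> * \<xi> * of_real x) * (1 / (1 - exp (2 * of_real pi * \<i> * (\<xi> - of_real r))) - 1)) \<le> 1 / (2 * \<delta>) * exp (\<bar>Im \<xi>\<bar> * (- x))"
    and "1 - exp (2 * of_real pi * \<i> * (\<xi> - of_real r)) \<noteq> 0"
proof -
  let ?s = "norm (sin (of_real pi * (\<xi> - of_real r)))"
  let ?t = "Im \<xi>"
  let ?w = "exp (2 * of_real pi * \<i> * (\<xi> - of_real r))"
  have s0: "?s > 0" using assms(1) delta by (smt (verit) exp_gt_zero mult_pos_pos)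
  have D: "norm (1 - ?w) = exp (- pi * ?t) * (2 * ?s)"
    using norm_one_minus_exp[of "\<xi> - of_real r"] by simp
  have "norm (1 - ?w) > 0" unfolding D using s0 by simp
  then show nz: "1 - ?w \<noteq> 0" by simp
  have D2: "norm (1 - ?w) \<ge> 2 * \<delta> * exp (pi * \<bar>?t\<bar> - pi * ?t)"
  proof -
    have "exp (- pi * ?t) * (2 * (\<delta> * exp (pi * \<bar>?t\<bar>))) \<le> exp (- pi * ?t) * (2 * ?s)"
      using assms(1) by (intro mult_left_mono) auto
    also have "exp (- pi * ?t) * (2 * (\<delta> * exp (pi * \<bar>?t\<bar>))) = 2 * \<delta> * exp (pi * \<bar>?t\<bar> - pi * ?t)"
      by (simp add: exp_diff exp_minus divide_inverse)
    finally show ?thesis unfolding D .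
  qed
  have key: "norm N / norm (1 - ?w) \<le> 1 / (2 * \<delta>) * exp (\<bar>?t\<bar> * (- x))"
    if "norm N \<le> exp b" "b - (pi * \<bar>?t\<bar> - pi * ?t) \<le> \<bar>?t\<bar> * (- x)" for N :: complex and b
  proof -
    have "norm N / norm (1 - ?w) \<le> exp b / (2 * \<delta> * exp (pi * \<bar>?t\<bar> - pi * ?t))"
      using that(1) D2 delta by (intro frac_le) auto
    also have "\<dots> = 1 / (2 * \<delta>) * exp (b - (pi * \<bar>?t\<bar> - pi * ?t))" by (simp add: exp_diff)
    also have "\<dots> \<le> 1 / (2 * \<delta>) * exp (\<bar>?t\<bar> * (- x))"
      using that(2) delta by (intro mult_left_mono) auto
    finally show ?thesis .
  qed
  have tx: "\<bar>?t\<bar> * x \<le> \<bar>?t\<bar> * pi" using x by (intro mult_left_mono) auto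
  have "norm (exp (1 * \<i> * \<xi> * of_real x)) / norm (1 - ?w) \<le> 1 / (2 * \<delta>) * exp (\<bar>?t\<bar> * (- x))"
  proof (rule key)
    show "norm (exp (1 * \<i> * \<xi> * of_real x)) \<le> exp (- ?t * x)" by (simp add: norm_exp_eq_Re)
    show "- ?t * x - (pi * \<bar>?t\<bar> - pi * ?t) \<le> \<bar>?t\<bar> * (- x)"
      using tx by (cases "?t \<ge> 0") (auto simp: algebra_simps abs_if)
  qed
  then show "norm (exp (1 * \<i> * \<xi> * of_real x) * (1 / (1 - ?w))) \<le> 1 / (2 * \<delta>) * exp (\<bar>?t\<bar> * (- x))"
    by (simp only: norm_mult norm_divide norm_one mult_1_right times_divide_eq_right)
  have "norm (exp (- 1 * \<i> * \<xi> * of_real x) * ?w) / norm (1 - ?w) \<le> 1 / (2 * \<delta>) * exp (\<bar>?t\<bar> * (- x))"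
  proof (rule key)
    show "norm (exp (- 1 * \<i> * \<xi> * of_real x) * ?w) \<le> exp (?t * x - 2 * pi * ?t)"
      by (simp add: norm_mult norm_exp_eq_Re flip: exp_add)
    show "?t * x - 2 * pi * ?t - (pi * \<bar>?t\<bar> - pi * ?t) \<le> \<bar>?t\<bar> * (- x)"
      using tx by (cases "?t \<ge> 0") (auto simp: algebra_simps abs_if)
  qed
  moreover have "exp (- 1 * \<i> * \<xi> * of_real x) * (1 / (1 - ?w) - 1) = (exp (- 1 * \<i> * \<xi> * of_real x) * ?w) / (1 - ?w)"
    using nz by (simp add: field_simps)
  ultimately show "norm (exp (- 1 * \<i> * \<xi> * of_real x) * (1 / (1 - ?w) - 1)) \<le> 1 / (2 * \<delta>) * exp (\<bar>?t\<bar> * (- x))"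
    by (simp only: norm_divide)
qed

text \<open>The resolvent is close to the identity far up in the upper half-plane and close to 0 far
  down in the lower one; each exponential is paired with the combination that is small where the
  exponential is large.\<close>

lemma growth_resolv:
  assumes x: "x \<in> {0..pi}" and W: "dagger W ** W = mat 1"
  shows "growth F (\<lambda>\<xi>. exp (1 * \<i> * \<xi> * of_real x) *\<^sub>M resolv \<omega> W \<xi>) (- x) 0"
    and "growth F (\<lambda>\<xi>. exp (- 1 * \<i> * \<xi> * of_real x) *\<^sub>M (resolv \<omega> W \<xi> - mat 1)) (- x) 0"
proof -
  let ?d = "\<lambda>\<xi> q. 1 / (1 - exp (2 * of_real pi * \<i> * (\<xi> - of_real (\<omega> q))))"
  have "growth F (\<lambda>\<xi>. diag (\<lambda>q. exp (1 * \<i> * \<xi> * of_real x) * ?d \<xi> q)) (- x) 0"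
  proof (rule growth_matrix)
    fix i j
    have "\<forall>\<^sub>F \<xi> in F. norm (exp (1 * \<i> * \<xi> * of_real x) * ?d \<xi> i) \<le> 1 / (2 * \<delta>) * (exp (\<bar>Im \<xi>\<bar> * (- x)) * norm \<xi> powi 0)"
      using separated by eventually_elim (use norm_exp_quotient(1)[OF _ x] in force)
    from growthI[OF this] show "growth F (\<lambda>\<xi>. diag (\<lambda>q. exp (1 * \<i> * \<xi> * of_real x) * ?d \<xi> q) $ i $ j) (- x) 0"
      by (cases "i = j") (auto simp: growth_zero)
  qed
  from growth_mult_const[OF growth_const_mult[OF this, of "dagger W"], of W]
  show "growth F (\<lambda>\<xi>. exp (1 * \<i> * \<xi> * of_real x) *\<^sub>M resolv \<omega> W \<xi>) (- x) 0"
  proof (rule growth_cong)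
    have "diag (\<lambda>q. c * d q) = c *\<^sub>M diag d" for c and d :: "'m \<Rightarrow> complex" by (simp add: vec_eq_iff)
    then show "\<forall>\<^sub>F \<xi> in F. dagger W ** diag (\<lambda>q. exp (1 * \<i> * \<xi> * of_real x) * ?d \<xi> q) ** W
        = exp (1 * \<i> * \<xi> * of_real x) *\<^sub>M resolv \<omega> W \<xi>"
      by (intro always_eventually allI) (simp only: resolv_def cscale_mult_left cscale_mult_right)
  qed
  have "growth F (\<lambda>\<xi>. diag (\<lambda>q. exp (- 1 * \<i> * \<xi> * of_real x) * (?d \<xi> q - 1))) (- x) 0"
  proof (rule growth_matrix)
    fix i j
    have "\<forall>\<^sub>F \<xi> in F. norm (exp (- 1 * \<i> * \<xi> * of_real x) * (?d \<xi> i - 1)) \<le> 1 / (2 * \<delta>) * (exp (\<bar>Im \<xi>\<bar> * (- x)) * norm \<xi> powi 0)"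
      using separated by eventually_elim (use norm_exp_quotient(2)[OF _ x] in force)
    from growthI[OF this] show "growth F (\<lambda>\<xi>. diag (\<lambda>q. exp (- 1 * \<i> * \<xi> * of_real x) * (?d \<xi> q - 1)) $ i $ j) (- x) 0"
      by (cases "i = j") (auto simp: growth_zero)
  qed
  from growth_mult_const[OF growth_const_mult[OF this, of "dagger W"], of W]
  show "growth F (\<lambda>\<xi>. exp (- 1 * \<i> * \<xi> * of_real x) *\<^sub>M (resolv \<omega> W \<xi> - mat 1)) (- x) 0"
  proof (rule growth_cong)
    have *: "diag (\<lambda>q. c * (d q - 1)) = c *\<^sub>M (diag d - mat 1)" for c and d :: "'m \<Rightarrow> complex"
      by (simp add: vec_eq_iff mat_def)
    have "resolv \<omega> W \<xi> - mat 1 = dagger W ** (diag (?d \<xi>) - mat 1) ** W" for \<xi>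
      by (simp add: resolv_def matrix_distribs W)
    then show "\<forall>\<^sub>F \<xi> in F. dagger W ** diag (\<lambda>q. exp (- 1 * \<i> * \<xi> * of_real x) * (?d \<xi> q - 1)) ** W
        = exp (- 1 * \<i> * \<xi> * of_real x) *\<^sub>M (resolv \<omega> W \<xi> - mat 1)"
      unfolding * by (intro always_eventually allI) (simp only: cscale_mult_left cscale_mult_right)
  qed
qed

end

section \<open>Asymptotics of phi and of the Weyl solution\<close>

locale asymptotic_pencil = hermitian_pencil L + contour_filter F \<omega> \<delta>
  for L :: "'m::finite pencil" and F :: "complex filter" and \<omega> :: "'m \<Rightarrow> real" and \<delta> :: real +
  fixes W :: "complex^'m^'m"
  assumes condition_I: "condition_I L" and diagonalization: "diagonalization L \<omega> W"
begin

abbreviation "hp \<equiv> matrix_inv (mat 1 + h1 L)"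
abbreviation "hm \<equiv> matrix_inv (mat 1 - h1 L)"
abbreviation "Hm \<equiv> matrix_inv (mat 1 - H1 L)"
abbreviation "Rs \<equiv> resolv \<omega> W"

lemma h_inverses:
  "hp ** (mat 1 + h1 L) = mat 1" "(mat 1 + h1 L) ** hp = mat 1"
  "hm ** (mat 1 - h1 L) = mat 1" "(mat 1 - h1 L) ** hm = mat 1"
  "Hm ** (mat 1 - H1 L) = mat 1" "(mat 1 - H1 L) ** Hm = mat 1"
  "matrix_inv (mat 1 + H1 L) ** (mat 1 + H1 L) = mat 1" "(mat 1 + H1 L) ** matrix_inv (mat 1 + H1 L) = mat 1"
  using condition_I matrix_inv_mult by (auto simp: condition_I_def)

lemma W_unitary: "dagger W ** W = mat 1" "W ** dagger W = mat 1"
  using diagonalization by (auto simp: diagonalization_def unitary_def)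

lemma P_pi_unitary:
  "x \<in> {0..pi} \<Longrightarrow> dagger (P_plus L x) ** P_plus L x = mat 1"
  "x \<in> {0..pi} \<Longrightarrow> P_plus L x ** dagger (P_plus L x) = mat 1"
  "x \<in> {0..pi} \<Longrightarrow> dagger (P_minus L x) ** P_minus L x = mat 1"
  "x \<in> {0..pi} \<Longrightarrow> P_minus L x ** dagger (P_minus L x) = mat 1"
  using P_unitary by auto

lemma P_minus_inv: "P_minus L pi ** matrix_inv (P_minus L pi) = mat 1"
proof -
  have "invertible (P_minus L pi)"
    using P_pi_unitary[of pi] by (auto simp: invertible_def)
  then show ?thesis by (simp add: invertible_det_nz matrix_inv_mult)
qed

text \<open>The definition of A cleared of its inverses, with adjoints taken by (II). In this form A
  translates the coefficient of one wave at \<pi> into that of the other.\<close>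

lemma A_relation:
  "(mat 1 - h1 L) ** dagger (P_plus L pi) ** (mat 1 + H1 L)
    = (mat 1 + h1 L) ** dagger (A_mat L) ** dagger (P_minus L pi) ** (mat 1 - H1 L)"
proof -
  have "(mat 1 + H1 L) ** P_minus L pi ** A_mat L ** (mat 1 - h1 L)
    = ((mat 1 + H1 L) ** (P_minus L pi ** matrix_inv (P_minus L pi)) ** matrix_inv (mat 1 + H1 L)) ** (mat 1 - H1 L)
      ** P_plus L pi ** (mat 1 + h1 L) ** (hm ** (mat 1 - h1 L))"
    unfolding A_mat_def by (simp only: matrix_mul_assoc)
  also have "\<dots> = (mat 1 - H1 L) ** P_plus L pi ** (mat 1 + h1 L)"
    by (simp add: h_inverses P_minus_inv)
  finally have "dagger ((mat 1 + H1 L) ** P_minus L pi ** A_mat L ** (mat 1 - h1 L))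
      = dagger ((mat 1 - H1 L) ** P_plus L pi ** (mat 1 + h1 L))" by (rule arg_cong)
  then show ?thesis by (simp add: dagger_mult dagger_add dagger_diff matrix_mul_assoc)
qed

lemma A_dagger: "dagger (A_mat L) = dagger W ** diag (\<lambda>q. exp (- (2 * of_real pi * \<i> * of_real (\<omega> q)))) ** W"
proof -
  have "dagger (diag d) = diag (\<lambda>q. cnj (d q))" for d :: "'m \<Rightarrow> complex"
    by (auto simp: vec_eq_iff)
  then have "dagger (A_mat L) = dagger W ** diag (\<lambda>q. cnj (exp (2 * of_real pi * \<i> * of_real (\<omega> q)))) ** W"
    using diagonalization by (simp add: diagonalization_def dagger_mult matrix_mul_assoc)
  then show ?thesis by (simp add: exp_cnj)
qed

lemma resolv_identity:
  assumes "\<And>q. 1 - exp (2 * of_real pi * \<i> * (\<xi> - of_real (\<omega> q))) \<noteq> 0"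
  shows "Rs \<xi> ** (mat 1 - exp (2 * of_real pi * \<i> * \<xi>) *\<^sub>M dagger (A_mat L)) = mat 1"
    and "exp (2 * of_real pi * \<i> * \<xi>) *\<^sub>M (dagger (A_mat L) ** Rs \<xi>) = Rs \<xi> - mat 1"
proof -
  let ?w = "\<lambda>q. exp (2 * of_real pi * \<i> * (\<xi> - of_real (\<omega> q)))"
  have A: "exp (2 * of_real pi * \<i> * \<xi>) *\<^sub>M dagger (A_mat L) = dagger W ** diag ?w ** W"
  proof -
    have "exp (2 * of_real pi * \<i> * \<xi>) *\<^sub>M diag (\<lambda>q. exp (- (2 * of_real pi * \<i> * of_real (\<omega> q)))) = diag ?w"
      by (simp add: vec_eq_iff right_diff_distrib exp_diff exp_minus divide_inverse)
    moreover have "c *\<^sub>M (dagger W ** D ** W) = dagger W ** (c *\<^sub>M D) ** W" for c D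
      by (simp only: cscale_mult_left cscale_mult_right)
    ultimately show ?thesis unfolding A_dagger by simp
  qed
  have one: "mat 1 = dagger W ** diag (\<lambda>q. 1) ** W" (is "mat 1 = ?one")
  proof -
    have "diag (\<lambda>q. 1) = (mat 1 :: complex^'m^'m)" by (simp add: vec_eq_iff mat_def)
    then show ?thesis by (simp add: W_unitary)
  qed
  have mul: "(dagger W ** diag d ** W) ** (dagger W ** diag e ** W) = dagger W ** diag (\<lambda>q. d q * e q) ** W" for d e
  proof -
    have "(dagger W ** diag d ** W) ** (dagger W ** diag e ** W) = dagger W ** diag d ** (W ** dagger W) ** diag e ** W"
      by (simp only: matrix_mul_assoc)
    then show ?thesis by (simp add: W_unitary diag_mult flip: matrix_mul_assoc)
  qed
  have sub: "dagger W ** diag d ** W - dagger W ** diag e ** W = dagger W ** diag (\<lambda>q. d q - e q) ** W" for d e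
  proof -
    have "diag (\<lambda>q. d q - e q) = diag d - diag e" by (simp add: vec_eq_iff)
    then show ?thesis by (simp add: matrix_distribs)
  qed
  have inv: "1 / (1 - ?w q) * (1 - ?w q) = 1" for q
    using assms[of q] by simp
  show "Rs \<xi> ** (mat 1 - exp (2 * of_real pi * \<i> * \<xi>) *\<^sub>M dagger (A_mat L)) = mat 1"
    unfolding A resolv_def by (subst one) (simp only: sub mul inv, rule one[symmetric])
  have "?w q * (1 / (1 - ?w q)) = 1 / (1 - ?w q) - 1" for q
    using assms[of q] by (simp add: field_simps)
  then show "exp (2 * of_real pi * \<i> * \<xi>) *\<^sub>M (dagger (A_mat L) ** Rs \<xi>) = Rs \<xi> - mat 1"
    unfolding cscale_mult_left[symmetric] A resolv_def by (subst one) (simp only: sub mul)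
qed

lemma eventually_separated:
  "\<forall>\<^sub>F \<xi> in F. \<forall>q. 1 - exp (2 * of_real pi * \<i> * (\<xi> - of_real (\<omega> q))) \<noteq> 0"
  using separated by eventually_elim (use norm_exp_quotient(3)[of _ _ 0] in force)

lemma P_init [simp]: "P_sol s L 0 = mat 1"
  by (rule P_sol_spec)

text \<open>Concerns solutions subject only to the condition at \<pi>. They are normalized by
  \<open>X\<close>, the leading amplitude of the wave with \<open>\<sigma> = 1\<close>, referred
  back through \<open>P_minus\<close>. The other amplitude is then expressed through A, so both
  waves are known up to a relative error O(1/\<xi>).\<close>

definition back_bound :: "real \<Rightarrow> real \<Rightarrow> bool"
  where "back_bound C R \<longleftrightarrow> (\<forall>\<xi> Y Y1 x X. R \<le> norm \<xi> \<longrightarrow> sol L \<xi> Y Y1 \<longrightarrow>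
    Y1 pi = - (((\<i> * \<xi>) *\<^sub>M H1 L + H0 L) ** Y pi) \<longrightarrow>
    X = (\<i> * \<xi>) *\<^sub>M (dagger (P_minus L pi) ** (mat 1 - H1 L) ** Y pi) \<longrightarrow> x \<in> {0..pi} \<longrightarrow>
      norm (wave L 1 \<xi> Y Y1 x - exp (1 * \<i> * \<xi> * of_real (x - pi)) *\<^sub>M (P_minus L x ** X))
        \<le> C / norm \<xi> * exp (\<bar>Im \<xi>\<bar> * (pi - x)) * norm X \<and>
      norm (wave L (-1) \<xi> Y Y1 x + exp (- 1 * \<i> * \<xi> * of_real (x - pi)) *\<^sub>M
          (P_plus L x ** (hm ** (mat 1 + h1 L) ** dagger (A_mat L) ** X)))
        \<le> C / norm \<xi> * exp (\<bar>Im \<xi>\<bar> * (pi - x)) * norm X \<and>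
      norm (Y x) \<le> C / norm \<xi> * exp (\<bar>Im \<xi>\<bar> * (pi - x)) * norm X)"

lemma back_boundD:
  assumes "back_bound C R" "R \<le> norm \<xi>" "sol L \<xi> Y Y1"
    "Y1 pi = - (((\<i> * \<xi>) *\<^sub>M H1 L + H0 L) ** Y pi)"
    "X = (\<i> * \<xi>) *\<^sub>M (dagger (P_minus L pi) ** (mat 1 - H1 L) ** Y pi)" "x \<in> {0..pi}"
  shows "norm (wave L 1 \<xi> Y Y1 x - exp (1 * \<i> * \<xi> * of_real (x - pi)) *\<^sub>M (P_minus L x ** X))
        \<le> C / norm \<xi> * exp (\<bar>Im \<xi>\<bar> * (pi - x)) * norm X"
    and "norm (wave L (-1) \<xi> Y Y1 x + exp (- 1 * \<i> * \<xi> * of_real (x - pi)) *\<^sub>M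
          (P_plus L x ** (hm ** (mat 1 + h1 L) ** dagger (A_mat L) ** X)))
        \<le> C / norm \<xi> * exp (\<bar>Im \<xi>\<bar> * (pi - x)) * norm X"
    and "norm (Y x) \<le> C / norm \<xi> * exp (\<bar>Im \<xi>\<bar> * (pi - x)) * norm X"
  using assms unfolding back_bound_def by blast+

lemma back_estimate: obtains C R where "C \<ge> 0" "R \<ge> 1" "back_bound C R"
proof -
  obtain C0 R0 where C0: "C0 \<ge> 0" "R0 > 0"
    and we: "\<And>\<xi> Y Y1 s \<sigma> x. R0 \<le> norm \<xi> \<Longrightarrow> sol L \<xi> Y Y1 \<Longrightarrow> s \<in> {0..pi} \<Longrightarrow> x \<in> {0..pi} \<Longrightarrow> \<sigma> \<in> {1, -1} \<Longrightarrow>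
      norm (wave L \<sigma> \<xi> Y Y1 x - exp (\<sigma> * \<i> * \<xi> * of_real (x - s)) *\<^sub>M
          (P_sol (- \<sigma>) L x ** dagger (P_sol (- \<sigma>) L s) ** wave L \<sigma> \<xi> Y Y1 s))
        \<le> C0 / norm \<xi> * exp (\<bar>Im \<xi>\<bar> * \<bar>x - s\<bar>) * (norm (wave L 1 \<xi> Y Y1 s) + norm (wave L (-1) \<xi> Y Y1 s))"
    and ye: "\<And>\<xi> Y Y1 s x. R0 \<le> norm \<xi> \<Longrightarrow> sol L \<xi> Y Y1 \<Longrightarrow> s \<in> {0..pi} \<Longrightarrow> x \<in> {0..pi} \<Longrightarrow>
      norm (Y x) \<le> C0 / norm \<xi> * exp (\<bar>Im \<xi>\<bar> * \<bar>x - s\<bar>) * (norm (wave L 1 \<xi> Y Y1 s) + norm (wave L (-1) \<xi> Y Y1 s))"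
    using wave_estimate by metis
  obtain Cp where Cp: "Cp \<ge> 0" "\<And>x. x \<in> {0..pi} \<Longrightarrow> norm (P_sol 1 L x) \<le> Cp"
    using continuous_bounded[OF W11_continuous[OF P_sol_spec(2)]] by metis
  obtain Cm where Cm: "Cm \<ge> 0" "\<And>x. x \<in> {0..pi} \<Longrightarrow> norm (P_sol (-1) L x) \<le> Cm"
    using continuous_bounded[OF W11_continuous[OF P_sol_spec(2)]] by metis
  define P where "P = Cp + Cm"
  have P: "P \<ge> 0" "\<And>x. x \<in> {0..pi} \<Longrightarrow> norm (P_sol 1 L x) \<le> P" "\<And>x. x \<in> {0..pi} \<Longrightarrow> norm (P_sol (-1) L x) \<le> P"
    using Cp Cm by (auto simp: P_def intro: add_increasing add_increasing2)
  define c where "c = norm (mat 1 - H1 L) + norm (mat 1 + H1 L) + norm (H0 L + Q1 L pi) + norm (H0 L - Q1 L pi)"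
  define b where "b = norm Hm * P"
  have cb: "c \<ge> 0" "b \<ge> 0" using P(1) by (auto simp: c_def b_def)
  \<comment> \<open>The first summand bounds the propagation error from \<pi>, the second the terms
    with \<open>H0\<close> and \<open>Q1\<close> at \<pi>, which carry no factor \<xi>.\<close>
  define C where "C = C0 * (2 * c * b) + P * P * c * b"
  define R where "R = R0 + 1"
  have main: "norm (wave L 1 \<xi> Y Y1 x - exp (1 * \<i> * \<xi> * of_real (x - pi)) *\<^sub>M (P_minus L x ** X))
        \<le> C / norm \<xi> * exp (\<bar>Im \<xi>\<bar> * (pi - x)) * norm X \<and>
      norm (wave L (-1) \<xi> Y Y1 x + exp (- 1 * \<i> * \<xi> * of_real (x - pi)) *\<^sub>M
          (P_plus L x ** (hm ** (mat 1 + h1 L) ** dagger (A_mat L) ** X)))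
        \<le> C / norm \<xi> * exp (\<bar>Im \<xi>\<bar> * (pi - x)) * norm X \<and>
      norm (Y x) \<le> C / norm \<xi> * exp (\<bar>Im \<xi>\<bar> * (pi - x)) * norm X"
    if xi: "R \<le> norm \<xi>" and Y: "sol L \<xi> Y Y1" and V: "Y1 pi = - (((\<i> * \<xi>) *\<^sub>M H1 L + H0 L) ** Y pi)"
      and X: "X = (\<i> * \<xi>) *\<^sub>M (dagger (P_minus L pi) ** (mat 1 - H1 L) ** Y pi)" and x: "x \<in> {0..pi}" for \<xi> Y Y1 x X
  proof -
    define B where "B = Y pi"
    have xi1: "norm \<xi> \<ge> 1" "norm \<xi> \<ge> R0" using xi C0 by (auto simp: R_def)
    then have nz: "\<xi> \<noteq> 0" by auto
    let ?e = "exp (\<bar>Im \<xi>\<bar> * (pi - x))"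
    have ee: "\<bar>Im \<xi>\<bar> * \<bar>x - pi\<bar> = \<bar>Im \<xi>\<bar> * (pi - x)" using x by simp
    have "P_minus L pi ** X = (\<i> * \<xi>) *\<^sub>M ((P_minus L pi ** dagger (P_minus L pi)) ** (mat 1 - H1 L) ** B)"
      unfolding X B_def by (simp only: cscale_mult_right matrix_mul_assoc)
    also have "\<dots> = (\<i> * \<xi>) *\<^sub>M ((mat 1 - H1 L) ** B)" by (simp add: P_pi_unitary)
    finally have PX: "P_minus L pi ** X = (\<i> * \<xi>) *\<^sub>M ((mat 1 - H1 L) ** B)" .
    \<comment> \<open>Invertibility of \<open>mat 1 - H1 L\<close> recovers the value at \<pi> from
      \<open>X\<close>; that value is smaller than \<open>X\<close> by one power of \<xi>.\<close>
    have "Hm ** (P_minus L pi ** X) = (\<i> * \<xi>) *\<^sub>M ((Hm ** (mat 1 - H1 L)) ** B)"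
      unfolding PX by (simp only: cscale_mult_right matrix_mul_assoc)
    then have "(\<i> * \<xi>) *\<^sub>M B = Hm ** (P_minus L pi ** X)" by (simp add: h_inverses)
    then have "norm \<xi> * norm B = norm (Hm ** (P_minus L pi ** X))"
      by (metis norm_cscale norm_mult norm_ii mult_1)
    also have "\<dots> \<le> norm Hm * (P * norm X)"
      using P(3)[of pi] by (intro order_trans[OF norm_matrix_mult_le] mult_left_mono order_trans[OF norm_matrix_mult_le] mult_right_mono) auto
    finally have B: "norm B \<le> b * norm X / norm \<xi>"
      using nz by (simp add: b_def field_simps)
    have w1: "wave L 1 \<xi> Y Y1 pi = P_minus L pi ** X - (H0 L + Q1 L pi) ** B"
      unfolding PX by (simp add: wave_def V B_def matrix_distribs algebra_simps)
    have w2: "wave L (-1) \<xi> Y Y1 pi = - ((\<i> * \<xi>) *\<^sub>M ((mat 1 + H1 L) ** B)) - (H0 L - Q1 L pi) ** B"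
      by (simp add: wave_def V B_def matrix_distribs algebra_simps)
    have c': "norm (mat 1 - H1 L) + norm (H0 L + Q1 L pi) \<le> c" "norm (mat 1 + H1 L) + norm (H0 L - Q1 L pi) \<le> c"
      "norm (H0 L + Q1 L pi) \<le> c" "norm (H0 L - Q1 L pi) \<le> c"
      by (auto simp: c_def intro: add_increasing)
    have est: "norm (\<xi>' *\<^sub>M (Z ** B) - Z' ** B) \<le> c * norm \<xi> * norm B"
      if "norm Z + norm Z' \<le> c" "norm \<xi>' = norm \<xi>" for Z Z' :: "complex^'m^'m" and \<xi>'
    proof -
      have "norm (\<xi>' *\<^sub>M (Z ** B) - Z' ** B) \<le> norm \<xi> * norm (Z ** B) + norm (Z' ** B)"
        using norm_triangle_ineq4[of "\<xi>' *\<^sub>M (Z ** B)" "Z' ** B"] that(2) by (simp add: norm_cscale)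
      also have "\<dots> \<le> norm \<xi> * (norm Z * norm B) + norm \<xi> * (norm Z' * norm B)"
      proof (intro add_mono mult_left_mono norm_matrix_mult_le)
        have "1 * (norm Z' * norm B) \<le> norm \<xi> * (norm Z' * norm B)" using xi1 by (intro mult_right_mono) auto
        then show "norm (Z' ** B) \<le> norm \<xi> * (norm Z' * norm B)"
          using norm_matrix_mult_le[of Z' B] by linarith
      qed auto
      also have "\<dots> = (norm Z + norm Z') * (norm \<xi> * norm B)" by (simp add: algebra_simps)
      also have "\<dots> \<le> c * (norm \<xi> * norm B)" using that(1) by (intro mult_right_mono) auto
      finally show ?thesis by (simp add: mult.assoc)
    qed
    have "norm (wave L 1 \<xi> Y Y1 pi) \<le> c * norm \<xi> * norm B"
      unfolding w1 PX by (rule est) (use c' in \<open>auto simp: norm_mult\<close>)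
    moreover have "norm (wave L (-1) \<xi> Y Y1 pi) \<le> c * norm \<xi> * norm B"
      using est[of "mat 1 + H1 L" "H0 L - Q1 L pi" "- (\<i> * \<xi>)"] c' unfolding w2 by (simp add: norm_mult)
    moreover have "c * norm \<xi> * norm B \<le> c * norm \<xi> * (b * norm X / norm \<xi>)"
      using B cb by (intro mult_left_mono) auto
    ultimately have Wsum: "norm (wave L 1 \<xi> Y Y1 pi) + norm (wave L (-1) \<xi> Y Y1 pi) \<le> 2 * c * b * norm X"
      using nz by simp
    have main_le: "C0 / norm \<xi> * ?e * (norm (wave L 1 \<xi> Y Y1 pi) + norm (wave L (-1) \<xi> Y Y1 pi))
        \<le> C0 * (2 * c * b) / norm \<xi> * ?e * norm X"
      using mult_left_mono[OF Wsum, of "C0 / norm \<xi> * ?e"] C0 by (simp add: mult_ac)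
    have rest_le: "norm (exp (\<sigma> * \<i> * \<xi> * of_real (x - pi)) *\<^sub>M (S ** dagger S' ** (Z ** B))) \<le> P * P * c * b / norm \<xi> * ?e * norm X"
      if "norm S \<le> P" "norm S' \<le> P" "norm Z \<le> c" "\<sigma> \<in> {1,-1}" for \<sigma> and S S' Z :: "complex^'m^'m"
    proof -
      have "norm (exp (\<sigma> * \<i> * \<xi> * of_real (x - pi)) *\<^sub>M (S ** dagger S' ** (Z ** B)))
          \<le> ?e * (P * P * (c * (b * norm X / norm \<xi>)))"
        unfolding norm_cscale
      proof (rule mult_mono)
        show "norm (exp (\<sigma> * \<i> * \<xi> * of_real (x - pi))) \<le> ?e"
          using norm_exp_wave_le[OF that(4), of \<xi> "x - pi"] ee by simp
        have "norm (S ** dagger S' ** (Z ** B)) \<le> (norm S * norm S') * (norm Z * norm B)"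
          by (intro order_trans[OF norm_matrix_mult_le] mult_mono order_trans[OF norm_matrix_mult_le])
             (auto simp: norm_dagger)
        also have "\<dots> \<le> (P * P) * (c * (b * norm X / norm \<xi>))"
          using that B P(1) cb by (intro mult_mono) auto
        finally show "norm (S ** dagger S' ** (Z ** B)) \<le> P * P * (c * (b * norm X / norm \<xi>))" .
      qed auto
      then show ?thesis by (simp add: mult_ac)
    qed
    have C_split: "C / norm \<xi> * ?e * norm X = C0 * (2 * c * b) / norm \<xi> * ?e * norm X + P * P * c * b / norm \<xi> * ?e * norm X"
      by (simp add: C_def add_divide_distrib distrib_right)
    have pospart: "P * P * c * b / norm \<xi> * ?e * norm X \<ge> 0" using P cb by simp
    have we1: "norm (wave L 1 \<xi> Y Y1 x - exp (1 * \<i> * \<xi> * of_real (x - pi)) *\<^sub>M (P_minus L x ** dagger (P_minus L pi) ** wave L 1 \<xi> Y Y1 pi))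
        \<le> C0 / norm \<xi> * ?e * (norm (wave L 1 \<xi> Y Y1 pi) + norm (wave L (-1) \<xi> Y Y1 pi))"
      using we[OF xi1(2) Y _ x, of pi 1] by (simp only: ee insert_iff simp_thms atLeastAtMost_iff pi_ge_zero order_refl)
    have we2: "norm (wave L (-1) \<xi> Y Y1 x - exp (- 1 * \<i> * \<xi> * of_real (x - pi)) *\<^sub>M (P_plus L x ** dagger (P_plus L pi) ** wave L (-1) \<xi> Y Y1 pi))
        \<le> C0 / norm \<xi> * ?e * (norm (wave L 1 \<xi> Y Y1 pi) + norm (wave L (-1) \<xi> Y Y1 pi))"
      using we[OF xi1(2) Y _ x, of pi "-1"]
      by (simp only: ee insert_iff simp_thms atLeastAtMost_iff pi_ge_zero order_refl minus_minus)
    have 1: "norm (wave L 1 \<xi> Y Y1 x - exp (1 * \<i> * \<xi> * of_real (x - pi)) *\<^sub>M (P_minus L x ** X)) \<le> C / norm \<xi> * ?e * norm X"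
    proof -
      let ?E = "exp (1 * \<i> * \<xi> * of_real (x - pi))"
      have "P_minus L x ** dagger (P_minus L pi) ** wave L 1 \<xi> Y Y1 pi
          = P_minus L x ** (dagger (P_minus L pi) ** P_minus L pi) ** X - P_minus L x ** dagger (P_minus L pi) ** ((H0 L + Q1 L pi) ** B)"
        unfolding w1 by (simp only: matrix_diff_ldistrib matrix_mul_assoc)
      also have "\<dots> = P_minus L x ** X - P_minus L x ** dagger (P_minus L pi) ** ((H0 L + Q1 L pi) ** B)"
        by (simp add: P_pi_unitary)
      finally have "wave L 1 \<xi> Y Y1 x - ?E *\<^sub>M (P_minus L x ** X)
        = (wave L 1 \<xi> Y Y1 x - ?E *\<^sub>M (P_minus L x ** dagger (P_minus L pi) ** wave L 1 \<xi> Y Y1 pi))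
          - ?E *\<^sub>M (P_minus L x ** dagger (P_minus L pi) ** ((H0 L + Q1 L pi) ** B))"
        by (simp only: cscale_diff) simp
      also have "norm \<dots> \<le> C0 / norm \<xi> * ?e * (norm (wave L 1 \<xi> Y Y1 pi) + norm (wave L (-1) \<xi> Y Y1 pi)) + P * P * c * b / norm \<xi> * ?e * norm X"
        by (rule order_trans[OF norm_triangle_ineq4 add_mono[OF we1 rest_le]]) (use P x c' in auto)
      finally show ?thesis using main_le C_split by linarith
    qed
    have 2: "norm (wave L (-1) \<xi> Y Y1 x + exp (- 1 * \<i> * \<xi> * of_real (x - pi)) *\<^sub>M
          (P_plus L x ** (hm ** (mat 1 + h1 L) ** dagger (A_mat L) ** X))) \<le> C / norm \<xi> * ?e * norm X"
    proof -
      let ?E = "exp (- 1 * \<i> * \<xi> * of_real (x - pi))"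
      \<comment> \<open>\<open>A_relation\<close> rewrites the amplitude of the second wave as the
        leading part of its value at \<pi>.\<close>
      have "hm ** (mat 1 + h1 L) ** dagger (A_mat L) ** X
          = (\<i> * \<xi>) *\<^sub>M (hm ** ((mat 1 + h1 L) ** dagger (A_mat L) ** dagger (P_minus L pi) ** (mat 1 - H1 L)) ** B)"
        unfolding X B_def by (simp only: cscale_mult_right matrix_mul_assoc)
      also have "\<dots> = (\<i> * \<xi>) *\<^sub>M ((hm ** (mat 1 - h1 L)) ** dagger (P_plus L pi) ** (mat 1 + H1 L) ** B)"
        unfolding A_relation[symmetric] by (simp only: matrix_mul_assoc)
      finally have k: "hm ** (mat 1 + h1 L) ** dagger (A_mat L) ** X = dagger (P_plus L pi) ** ((\<i> * \<xi>) *\<^sub>M ((mat 1 + H1 L) ** B))"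
        by (simp add: h_inverses cscale_mult_right matrix_mul_assoc)
      have "P_plus L x ** dagger (P_plus L pi) ** wave L (-1) \<xi> Y Y1 pi
          = - (P_plus L x ** (hm ** (mat 1 + h1 L) ** dagger (A_mat L) ** X)) - P_plus L x ** dagger (P_plus L pi) ** ((H0 L - Q1 L pi) ** B)"
        unfolding w2 k by (simp only: matrix_diff_ldistrib matrix_mul_assoc matrix_mult_minus_right)
      then have "wave L (-1) \<xi> Y Y1 x + ?E *\<^sub>M (P_plus L x ** (hm ** (mat 1 + h1 L) ** dagger (A_mat L) ** X))
        = (wave L (-1) \<xi> Y Y1 x - ?E *\<^sub>M (P_plus L x ** dagger (P_plus L pi) ** wave L (-1) \<xi> Y Y1 pi))
          - ?E *\<^sub>M (P_plus L x ** dagger (P_plus L pi) ** ((H0 L - Q1 L pi) ** B))"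
        by (simp only: cscale_diff cscale_minus) simp
      also have "norm \<dots> \<le> C0 / norm \<xi> * ?e * (norm (wave L 1 \<xi> Y Y1 pi) + norm (wave L (-1) \<xi> Y Y1 pi)) + P * P * c * b / norm \<xi> * ?e * norm X"
        by (rule order_trans[OF norm_triangle_ineq4 add_mono[OF we2 rest_le]]) (use P x c' in auto)
      finally show ?thesis using main_le C_split by linarith
    qed
    have 3: "norm (Y x) \<le> C / norm \<xi> * ?e * norm X"
    proof -
      have "norm (Y x) \<le> C0 / norm \<xi> * ?e * (norm (wave L 1 \<xi> Y Y1 pi) + norm (wave L (-1) \<xi> Y Y1 pi))"
        using ye[OF xi1(2) Y _ x, of pi] ee by simp
      then show ?thesis using main_le C_split pospart by linarith
    qed
    show ?thesis using 1 2 3 by blast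
  qed
  show ?thesis
  proof (rule that[of C R])
    show "C \<ge> 0" using C0 P cb by (simp add: C_def)
    show "R \<ge> 1" using C0 by (simp add: R_def)
    show "back_bound C R" unfolding back_bound_def using main by blast
  qed
qed

end

context large_filter
begin

lemma growth_le:
  assumes "growth F f y k" "\<forall>\<^sub>F \<xi> in F. norm (g \<xi>) \<le> K * norm (f \<xi>)"
  shows "growth F g y k"
proof -
  obtain C where "C \<ge> 0" and C: "\<forall>\<^sub>F \<xi> in F. norm (f \<xi>) \<le> C * (exp (\<bar>Im \<xi>\<bar> * y) * norm \<xi> powi k)"
    using growthE[OF assms(1)] .
  from C assms(2) have "\<forall>\<^sub>F \<xi> in F. norm (g \<xi>) \<le> \<bar>K\<bar> * C * (exp (\<bar>Im \<xi>\<bar> * y) * norm \<xi> powi k)"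
  proof eventually_elim
    case (elim \<xi>)
    have "norm (g \<xi>) \<le> \<bar>K\<bar> * norm (f \<xi>)"
      using elim(2) mult_right_mono[OF abs_ge_self[of K], of "norm (f \<xi>)"] by simp
    also have "\<dots> \<le> \<bar>K\<bar> * (C * (exp (\<bar>Im \<xi>\<bar> * y) * norm \<xi> powi k))"
      using elim(1) by (intro mult_left_mono) auto
    finally show ?case by (simp add: mult.assoc)
  qed
  then show ?thesis by (rule growthI)
qed

lemma growth_le_exp:
  assumes "growth F X z 0" "\<forall>\<^sub>F \<xi> in F. norm (g \<xi>) \<le> C / norm \<xi> * exp (\<bar>Im \<xi>\<bar> * y) * norm (X \<xi>)" "C \<ge> 0"
  shows "growth F g (y + z) (-1)"
proof -
  obtain D where "D \<ge> 0" and D: "\<forall>\<^sub>F \<xi> in F. norm (X \<xi>) \<le> D * (exp (\<bar>Im \<xi>\<bar> * z) * norm \<xi> powi 0)"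
    using growthE[OF assms(1)] .
  from D assms(2) have "\<forall>\<^sub>F \<xi> in F. norm (g \<xi>) \<le> C * D * (exp (\<bar>Im \<xi>\<bar> * (y + z)) * norm \<xi> powi (-1))"
  proof eventually_elim
    case (elim \<xi>)
    have "norm (g \<xi>) \<le> C / norm \<xi> * exp (\<bar>Im \<xi>\<bar> * y) * norm (X \<xi>)" by (rule elim(2))
    also have "\<dots> \<le> C / norm \<xi> * exp (\<bar>Im \<xi>\<bar> * y) * (D * exp (\<bar>Im \<xi>\<bar> * z))"
      using elim(1) assms(3) by (intro mult_left_mono) auto
    also have "\<dots> = C * D * (exp (\<bar>Im \<xi>\<bar> * (y + z)) * norm \<xi> powi (-1))"
      by (simp add: distrib_left exp_add power_int_minus field_simps)
    finally show ?case .
  qed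
  then show ?thesis by (rule growthI)
qed

text \<open>The sum of the waves gives the derivative; their difference, divided by
  \<open>2 * \<i> * \<xi>\<close>, gives the solution, and the correction with \<open>Q1\<close> is
  of the order of the error. The amplitude \<open>v\<close> of the second wave is entered with a
  minus sign.\<close>

lemma growth_from_waves:
  fixes L :: "'m::finite pencil"
  assumes "growth F (\<lambda>\<xi>. wave L 1 \<xi> (Y \<xi>) (Y1 \<xi>) x - u \<xi>) y k"
    and "growth F (\<lambda>\<xi>. wave L (-1) \<xi> (Y \<xi>) (Y1 \<xi>) x + v \<xi>) y k"
    and "growth F (\<lambda>\<xi>. Y \<xi> x) y k"
  shows "growth F (\<lambda>\<xi>. Y1 \<xi> x - (1/2) *\<^sub>M (u \<xi> - v \<xi>)) y k"
    and "growth F (\<lambda>\<xi>. Y \<xi> x - (1 / (2 * \<i> * \<xi>)) *\<^sub>M (u \<xi> + v \<xi>)) y (k - 1)"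
proof -
  let ?w = "\<lambda>\<sigma> \<xi>. wave L \<sigma> \<xi> (Y \<xi>) (Y1 \<xi>) x"
  have "growth F (\<lambda>\<xi>. (1/2) *\<^sub>M ((?w 1 \<xi> - u \<xi>) + (?w (-1) \<xi> + v \<xi>))) y k"
    by (intro growth_const_cscale growth_add assms)
  moreover have "(1/2) *\<^sub>M ((?w 1 \<xi> - u \<xi>) + (?w (-1) \<xi> + v \<xi>)) = Y1 \<xi> x - (1/2) *\<^sub>M (u \<xi> - v \<xi>)" for \<xi>
    by (simp add: wave_def vec_eq_iff field_simps)
  ultimately show "growth F (\<lambda>\<xi>. Y1 \<xi> x - (1/2) *\<^sub>M (u \<xi> - v \<xi>)) y k" by simp
  have "growth F (\<lambda>\<xi>. (1 / \<xi>) *\<^sub>M ((1 / (2 * \<i>)) *\<^sub>M (((?w 1 \<xi> - u \<xi>) - (?w (-1) \<xi> + v \<xi>)) + 2 *\<^sub>M (Q1 L x ** Y \<xi> x)))) (0 + y) (-1 + k)"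
    by (intro growth_cscale growth_inverse growth_const_cscale growth_add growth_diff assms growth_const_mult)
  then have *: "growth F (\<lambda>\<xi>. (1 / \<xi>) *\<^sub>M ((1 / (2 * \<i>)) *\<^sub>M (((?w 1 \<xi> - u \<xi>) - (?w (-1) \<xi> + v \<xi>)) + 2 *\<^sub>M (Q1 L x ** Y \<xi> x)))) y (k - 1)"
    by simp
  show "growth F (\<lambda>\<xi>. Y \<xi> x - (1 / (2 * \<i> * \<xi>)) *\<^sub>M (u \<xi> + v \<xi>)) y (k - 1)"
  proof (rule growth_cong[OF *])
    show "\<forall>\<^sub>F \<xi> in F. (1 / \<xi>) *\<^sub>M ((1 / (2 * \<i>)) *\<^sub>M (((?w 1 \<xi> - u \<xi>) - (?w (-1) \<xi> + v \<xi>)) + 2 *\<^sub>M (Q1 L x ** Y \<xi> x)))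
        = Y \<xi> x - (1 / (2 * \<i> * \<xi>)) *\<^sub>M (u \<xi> + v \<xi>)"
      using eventually_large[of 1]
    proof eventually_elim
      case (elim \<xi>)
      then have "\<xi> \<noteq> 0" by auto
      then show ?case by (simp add: wave_def vec_eq_iff field_simps)
    qed
  qed
qed

end

context asymptotic_pencil
begin

text \<open>\<open>a0\<close> and \<open>b0\<close> are the amplitudes of the two waves in the
  leading part of the Weyl solution. The factor \<open>Rs \<xi> - mat 1\<close> in \<open>b0\<close>
  is the resolvent multiplied by \<open>exp (2 * of_real pi * \<i> * \<xi>) *\<^sub>M dagger (A_mat
  L)\<close>.\<close>

definition a0 :: "complex \<Rightarrow> complex^'m^'m"
  where "a0 \<xi> = 2 *\<^sub>M (Rs \<xi> ** hp)"

definition b0 :: "complex \<Rightarrow> complex^'m^'m"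
  where "b0 \<xi> = 2 *\<^sub>M (hm ** (mat 1 + h1 L) ** (Rs \<xi> - mat 1) ** hp)"

definition EP :: "real \<Rightarrow> complex \<Rightarrow> complex^'m^'m"
  where "EP x \<xi> = exp (1 * \<i> * \<xi> * of_real x) *\<^sub>M P_minus L x"

definition EM :: "real \<Rightarrow> complex \<Rightarrow> complex^'m^'m"
  where "EM x \<xi> = exp (- 1 * \<i> * \<xi> * of_real x) *\<^sub>M P_plus L x"

definition phi_0 :: "real \<Rightarrow> complex \<Rightarrow> complex^'m^'m"
  where "phi_0 x \<xi> = (1/2) *\<^sub>M (EP x \<xi> ** (mat 1 - h1 L) + EM x \<xi> ** (mat 1 + h1 L))"

definition phi1_0 :: "real \<Rightarrow> complex \<Rightarrow> complex^'m^'m"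
  where "phi1_0 x \<xi> = (\<i> * \<xi> / 2) *\<^sub>M (EP x \<xi> ** (mat 1 - h1 L) - EM x \<xi> ** (mat 1 + h1 L))"

definition Phi_0 :: "real \<Rightarrow> complex \<Rightarrow> complex^'m^'m"
  where "Phi_0 x \<xi> = (1 / (2 * \<i> * \<xi>)) *\<^sub>M (EP x \<xi> ** a0 \<xi> + EM x \<xi> ** b0 \<xi>)"

definition Phi1_0 :: "real \<Rightarrow> complex \<Rightarrow> complex^'m^'m"
  where "Phi1_0 x \<xi> = (1/2) *\<^sub>M (EP x \<xi> ** a0 \<xi> - EM x \<xi> ** b0 \<xi>)"

lemma growth_EP: "x \<in> {0..pi} \<Longrightarrow> growth F (EP x) x 0" "x \<in> {0..pi} \<Longrightarrow> growth F (EM x) x 0"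
  unfolding EP_def[abs_def] EM_def[abs_def]
  using growth_cscale[OF growth_exp[of 1 x] growth_const0] growth_cscale[OF growth_exp[of "-1" x] growth_const0] by auto

lemma growth_EPa:
  assumes "x \<in> {0..pi}"
  shows "growth F (\<lambda>\<xi>. EP x \<xi> ** a0 \<xi>) (- x) 0" "growth F (\<lambda>\<xi>. EM x \<xi> ** b0 \<xi>) (- x) 0"
proof -
  have "growth F (\<lambda>\<xi>. 2 *\<^sub>M (P_minus L x ** (exp (1 * \<i> * \<xi> * of_real x) *\<^sub>M Rs \<xi>) ** hp)) (- x) 0"
    by (intro growth_const_cscale growth_mult_const growth_const_mult growth_resolv assms W_unitary)
  moreover have "2 *\<^sub>M (P_minus L x ** (exp (1 * \<i> * \<xi> * of_real x) *\<^sub>M Rs \<xi>) ** hp) = EP x \<xi> ** a0 \<xi>" for \<xi>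
    by (simp add: EP_def a0_def cscale_mult_left cscale_mult_right matrix_mul_assoc)
  ultimately show "growth F (\<lambda>\<xi>. EP x \<xi> ** a0 \<xi>) (- x) 0" by simp
  have "growth F (\<lambda>\<xi>. 2 *\<^sub>M (P_plus L x ** hm ** (mat 1 + h1 L) ** (exp (- 1 * \<i> * \<xi> * of_real x) *\<^sub>M (Rs \<xi> - mat 1)) ** hp)) (- x) 0"
    by (intro growth_const_cscale growth_mult_const growth_const_mult growth_resolv assms W_unitary)
  moreover have "2 *\<^sub>M (P_plus L x ** hm ** (mat 1 + h1 L) ** (exp (- 1 * \<i> * \<xi> * of_real x) *\<^sub>M (Rs \<xi> - mat 1)) ** hp) = EM x \<xi> ** b0 \<xi>" for \<xi>
    unfolding EM_def b0_def by (simp only: cscale_mult_left cscale_mult_right matrix_mul_assoc cscale_cscale mult.commute)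
  ultimately show "growth F (\<lambda>\<xi>. EM x \<xi> ** b0 \<xi>) (- x) 0" by simp
qed

lemma growth_leading:
  assumes x: "x \<in> {0..pi}"
  shows "growth F (phi_0 x) x 0" "growth F (phi1_0 x) x 1" "growth F (Phi_0 x) (- x) (-1)" "growth F (Phi1_0 x) (- x) 0"
proof -
  show "growth F (phi_0 x) x 0" unfolding phi_0_def[abs_def]
    by (intro growth_const_cscale growth_add growth_mult_const growth_EP x)
  have "growth F (\<lambda>\<xi>. \<xi> *\<^sub>M ((\<i> / 2) *\<^sub>M (EP x \<xi> ** (mat 1 - h1 L) - EM x \<xi> ** (mat 1 + h1 L)))) (0 + x) (1 + 0)"
    by (intro growth_cscale growth_ident growth_const_cscale growth_diff growth_mult_const growth_EP x)
  then show "growth F (phi1_0 x) x 1" unfolding phi1_0_def[abs_def] by (simp add: mult_ac)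
  have "growth F (\<lambda>\<xi>. (1 / \<xi>) *\<^sub>M ((1 / (2 * \<i>)) *\<^sub>M (EP x \<xi> ** a0 \<xi> + EM x \<xi> ** b0 \<xi>))) (0 + (- x)) (-1 + 0)"
    by (intro growth_cscale growth_inverse growth_const_cscale growth_add growth_EPa x)
  then show "growth F (Phi_0 x) (- x) (-1)" unfolding Phi_0_def[abs_def] by (simp add: mult_ac)
  show "growth F (Phi1_0 x) (- x) 0" unfolding Phi1_0_def[abs_def]
    by (intro growth_const_cscale growth_diff growth_EPa x)
qed

text \<open>Propagation from 0, where the waves are \<open>\<i> * \<xi>\<close> times
  \<open>mat 1 - h1 L\<close> and \<open>- (mat 1 + h1 L)\<close>, up to constants.\<close>

lemma phi_asymptotics:
  assumes x: "x \<in> {0..pi}"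
  shows "growth F (\<lambda>\<xi>. phi L \<xi> x - phi_0 x \<xi>) x (-1)" "growth F (\<lambda>\<xi>. phi1 L \<xi> x - phi1_0 x \<xi>) x 0"
proof -
  obtain C0 R0 where C0: "C0 \<ge> 0" "R0 > 0"
    and we: "\<And>\<xi> Y Y1 s \<sigma> x. R0 \<le> norm \<xi> \<Longrightarrow> sol L \<xi> Y Y1 \<Longrightarrow> s \<in> {0..pi} \<Longrightarrow> x \<in> {0..pi} \<Longrightarrow> \<sigma> \<in> {1, -1} \<Longrightarrow>
      norm (wave L \<sigma> \<xi> Y Y1 x - exp (\<sigma> * \<i> * \<xi> * of_real (x - s)) *\<^sub>M
          (P_sol (- \<sigma>) L x ** dagger (P_sol (- \<sigma>) L s) ** wave L \<sigma> \<xi> Y Y1 s))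
        \<le> C0 / norm \<xi> * exp (\<bar>Im \<xi>\<bar> * \<bar>x - s\<bar>) * (norm (wave L 1 \<xi> Y Y1 s) + norm (wave L (-1) \<xi> Y Y1 s))"
    and ye: "\<And>\<xi> Y Y1 s x. R0 \<le> norm \<xi> \<Longrightarrow> sol L \<xi> Y Y1 \<Longrightarrow> s \<in> {0..pi} \<Longrightarrow> x \<in> {0..pi} \<Longrightarrow>
      norm (Y x) \<le> C0 / norm \<xi> * exp (\<bar>Im \<xi>\<bar> * \<bar>x - s\<bar>) * (norm (wave L 1 \<xi> Y Y1 s) + norm (wave L (-1) \<xi> Y Y1 s))"
    using wave_estimate by metis
  let ?w = "\<lambda>\<sigma> \<xi>. wave L \<sigma> \<xi> (phi L \<xi>) (phi1 L \<xi>)"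
  have w0: "?w 1 \<xi> 0 = \<xi> *\<^sub>M (\<i> *\<^sub>M (mat 1 - h1 L)) - (h0 L + Q1 L 0)"
    "?w (-1) \<xi> 0 = - (\<xi> *\<^sub>M (\<i> *\<^sub>M (mat 1 + h1 L))) - (h0 L - Q1 L 0)" for \<xi>
    by (simp_all add: wave_def vec_eq_iff algebra_simps)
  have xi_const: "growth F (\<lambda>\<xi>. \<xi> *\<^sub>M A) 0 1" for A :: "complex^'m^'m"
    using growth_cscale[OF growth_ident growth_const0, of A] by simp
  have const1: "growth F (\<lambda>\<xi>. A) 0 1" for A :: "complex^'m^'m"
    by (rule growth_mono[OF growth_const0]) auto
  have gw0: "growth F (\<lambda>\<xi>. ?w 1 \<xi> 0) 0 1" "growth F (\<lambda>\<xi>. ?w (-1) \<xi> 0) 0 1"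
    unfolding w0 by (intro growth_diff growth_minus xi_const const1)+
  define N where "N = (\<lambda>\<xi>. norm (?w 1 \<xi> 0) + norm (?w (-1) \<xi> 0))"
  have gN: "growth F (\<lambda>\<xi>. (1 / norm \<xi>) * N \<xi>) 0 0"
  proof -
    have "growth F (\<lambda>\<xi>. norm (?w 1 \<xi> 0)) 0 1" "growth F (\<lambda>\<xi>. norm (?w (-1) \<xi> 0)) 0 1"
      by (rule growth_norm_le[OF gw0(1)], simp, rule growth_norm_le[OF gw0(2)], simp)
    then have n: "growth F N 0 1" unfolding N_def by (rule growth_add)
    have i: "growth F (\<lambda>\<xi>. 1 / norm \<xi>) 0 (-1)"
      by (rule growth_norm_le[OF growth_inverse]) (simp add: norm_divide)
    have "growth F (\<lambda>\<xi>. (1 / norm \<xi>) * N \<xi>) (0 + 0) (-1 + 1)"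
      by (rule growth_prod[OF i n]) (simp add: abs_mult)
    then show ?thesis by simp
  qed
  have bound: "growth F g x 0"
    if "\<forall>\<^sub>F \<xi> in F. norm (g \<xi>) \<le> C0 / norm \<xi> * exp (\<bar>Im \<xi>\<bar> * \<bar>x - 0\<bar>) * N \<xi>" for g :: "complex \<Rightarrow> complex^'m^'m"
  proof -
    obtain D where "D \<ge> 0" and D: "\<forall>\<^sub>F \<xi> in F. norm ((1 / norm \<xi>) * N \<xi>) \<le> D * (exp (\<bar>Im \<xi>\<bar> * 0) * norm \<xi> powi 0)"
      using growthE[OF gN] .
    from D that have "\<forall>\<^sub>F \<xi> in F. norm (g \<xi>) \<le> C0 * D * (exp (\<bar>Im \<xi>\<bar> * x) * norm \<xi> powi 0)"
    proof eventually_elim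
      case (elim \<xi>)
      have "C0 / norm \<xi> * exp (\<bar>Im \<xi>\<bar> * \<bar>x - 0\<bar>) * N \<xi> = (C0 * exp (\<bar>Im \<xi>\<bar> * x)) * ((1 / norm \<xi>) * N \<xi>)"
        using x by simp
      also have "\<dots> \<le> (C0 * exp (\<bar>Im \<xi>\<bar> * x)) * D"
        using elim(1) C0 abs_ge_self[of "(1 / norm \<xi>) * N \<xi>"] by (intro mult_left_mono) auto
      finally show ?case using elim(2) by (simp add: mult_ac)
    qed
    then show ?thesis by (rule growthI)
  qed
  have gphi: "growth F (\<lambda>\<xi>. phi L \<xi> x) x 0"
    using eventually_large[of R0] ye[OF _ sol_phi _ x, of _ 0] unfolding N_def[symmetric]
    by (intro bound) (auto elim!: eventually_mono simp: N_def)
  have P0: "P_sol s L 0 = mat 1" for s by (rule P_sol_spec)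
  have small: "growth F (\<lambda>\<xi>. exp (\<sigma> * \<i> * \<xi> * of_real x) *\<^sub>M (P ** A)) x 0" if "\<sigma> \<in> {1,-1}" for \<sigma> and P A :: "complex^'m^'m"
    using growth_cscale[OF growth_exp[OF that, of x] growth_const0, of "P ** A"] x by simp
  have "growth F (\<lambda>\<xi>. ?w 1 \<xi> x - exp (1 * \<i> * \<xi> * of_real x) *\<^sub>M (P_minus L x ** ?w 1 \<xi> 0)) x 0"
  proof (rule bound)
    show "\<forall>\<^sub>F \<xi> in F. norm (?w 1 \<xi> x - exp (1 * \<i> * \<xi> * of_real x) *\<^sub>M (P_minus L x ** ?w 1 \<xi> 0))
        \<le> C0 / norm \<xi> * exp (\<bar>Im \<xi>\<bar> * \<bar>x - 0\<bar>) * N \<xi>"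
      using eventually_large[of R0]
    proof eventually_elim
      case (elim \<xi>)
      have "0 \<in> {0..pi}" "1 \<in> {1, -1 :: complex}" by auto
      from we[OF elim sol_phi this(1) x this(2)] show ?case
        by (simp only: P0 diff_zero dagger_mat matrix_mul_rid N_def)
    qed
  qed
  from growth_diff[OF this small[of 1 "P_minus L x" "h0 L + Q1 L 0"]]
  have g1: "growth F (\<lambda>\<xi>. ?w 1 \<xi> x - (\<i> * \<xi>) *\<^sub>M (EP x \<xi> ** (mat 1 - h1 L))) x 0"
    by (simp add: w0 EP_def matrix_distribs mult_ac algebra_simps)
  have "growth F (\<lambda>\<xi>. ?w (-1) \<xi> x - exp (- 1 * \<i> * \<xi> * of_real x) *\<^sub>M (P_plus L x ** ?w (-1) \<xi> 0)) x 0"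
  proof (rule bound)
    show "\<forall>\<^sub>F \<xi> in F. norm (?w (-1) \<xi> x - exp (- 1 * \<i> * \<xi> * of_real x) *\<^sub>M (P_plus L x ** ?w (-1) \<xi> 0))
        \<le> C0 / norm \<xi> * exp (\<bar>Im \<xi>\<bar> * \<bar>x - 0\<bar>) * N \<xi>"
      using eventually_large[of R0]
    proof eventually_elim
      case (elim \<xi>)
      have "0 \<in> {0..pi}" "-1 \<in> {1, -1 :: complex}" by auto
      from we[OF elim sol_phi this(1) x this(2)] show ?case
        by (simp only: P0 diff_zero dagger_mat matrix_mul_rid N_def minus_minus)
    qed
  qed
  from growth_diff[OF this small[of "-1" "P_plus L x" "h0 L - Q1 L 0"]]
  have g2: "growth F (\<lambda>\<xi>. ?w (-1) \<xi> x + (\<i> * \<xi>) *\<^sub>M (EM x \<xi> ** (mat 1 + h1 L))) x 0"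
    by (simp add: w0 EM_def matrix_distribs mult_ac algebra_simps)
  note r = growth_from_waves[OF g1 g2 gphi]
  show "growth F (\<lambda>\<xi>. phi1 L \<xi> x - phi1_0 x \<xi>) x 0"
    using r(1) by (simp add: phi1_0_def cscale_diff mult_ac)
  have "growth F (\<lambda>\<xi>. phi L \<xi> x - (1 / (2 * \<i> * \<xi>)) *\<^sub>M ((\<i> * \<xi>) *\<^sub>M (EP x \<xi> ** (mat 1 - h1 L)) + (\<i> * \<xi>) *\<^sub>M (EM x \<xi> ** (mat 1 + h1 L)))) x (-1)"
    using r(2) by simp
  then show "growth F (\<lambda>\<xi>. phi L \<xi> x - phi_0 x \<xi>) x (-1)"
  proof (rule growth_cong)
    show "\<forall>\<^sub>F \<xi> in F. phi L \<xi> x - (1 / (2 * \<i> * \<xi>)) *\<^sub>M ((\<i> * \<xi>) *\<^sub>M (EP x \<xi> ** (mat 1 - h1 L)) + (\<i> * \<xi>) *\<^sub>M (EM x \<xi> ** (mat 1 + h1 L)))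
        = phi L \<xi> x - phi_0 x \<xi>"
      using eventually_large[of 1]
    proof eventually_elim
      case (elim \<xi>)
      then have "\<xi> \<noteq> 0" by auto
      then show ?case by (simp add: phi_0_def cscale_add field_simps)
    qed
  qed
qed

text \<open>Propagated back to 0 and combined with the weights \<open>mat 1 + h1 L\<close> and
  \<open>mat 1 - h1 L\<close>, the two waves give twice U(Y) up to terms without \<xi>. Both depend
  on \<open>X\<close>, one of them through A, so this is a linear equation for \<open>X\<close> that
  the resolvent solves; the decay of \<open>exp (\<i> * \<xi> * pi)\<close> times the resolvent
  compensates the growth of the propagation. Leaving U(Y) free serves both eigenfunctions and the
  Weyl solution.\<close>

lemma X_estimate:
  obtains C where "C \<ge> 0"
    "\<forall>\<^sub>F \<xi> in F. \<forall>Y Y1 X. sol L \<xi> Y Y1 \<longrightarrow> Y1 pi = - (((\<i> * \<xi>) *\<^sub>M H1 L + H0 L) ** Y pi) \<longrightarrow>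
      X = (\<i> * \<xi>) *\<^sub>M (dagger (P_minus L pi) ** (mat 1 - H1 L) ** Y pi) \<longrightarrow>
      norm (X - 2 *\<^sub>M ((exp (1 * \<i> * \<xi> * of_real pi) *\<^sub>M Rs \<xi>) ** hp ** (Y1 0 + ((\<i> * \<xi>) *\<^sub>M h1 L + h0 L) ** Y 0)))
        \<le> C / norm \<xi> * norm X"
proof -
  obtain C R where C: "C \<ge> 0" "R \<ge> 1" and bb: "back_bound C R"
    using back_estimate .
  note b1 = back_boundD(1)[OF bb] and b2 = back_boundD(2)[OF bb] and b3 = back_boundD(3)[OF bb]
  obtain D where D: "D \<ge> 0" and Dev: "\<forall>\<^sub>F \<xi> in F. norm (exp (1 * \<i> * \<xi> * of_real pi) *\<^sub>M Rs \<xi>) \<le> D * (exp (\<bar>Im \<xi>\<bar> * (- pi)) * norm \<xi> powi 0)"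
    using growthE[OF growth_resolv(1)[OF _ W_unitary(1), of pi]] by auto
  define c where "c = 2 * norm (h0 L + h1 L ** Q1 L 0) + norm (mat 1 + h1 L) + norm (mat 1 - h1 L)"
  have c: "c \<ge> 0" by (simp add: c_def)
  show ?thesis
  proof (rule that[of "D * norm hp * c * C"])
    show "D * norm hp * c * C \<ge> 0" using D c C by simp
    show "\<forall>\<^sub>F \<xi> in F. \<forall>Y Y1 X. sol L \<xi> Y Y1 \<longrightarrow> Y1 pi = - (((\<i> * \<xi>) *\<^sub>M H1 L + H0 L) ** Y pi) \<longrightarrow>
      X = (\<i> * \<xi>) *\<^sub>M (dagger (P_minus L pi) ** (mat 1 - H1 L) ** Y pi) \<longrightarrow>
      norm (X - 2 *\<^sub>M ((exp (1 * \<i> * \<xi> * of_real pi) *\<^sub>M Rs \<xi>) ** hp ** (Y1 0 + ((\<i> * \<xi>) *\<^sub>M h1 L + h0 L) ** Y 0)))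
        \<le> D * norm hp * c * C / norm \<xi> * norm X"
      using Dev eventually_large[of R] eventually_separated
    proof eventually_elim
      case (elim \<xi>)
      show ?case
      proof (intro allI impI)
        fix Y Y1 X assume Y: "sol L \<xi> Y Y1" and V: "Y1 pi = - (((\<i> * \<xi>) *\<^sub>M H1 L + H0 L) ** Y pi)"
          and X: "X = (\<i> * \<xi>) *\<^sub>M (dagger (P_minus L pi) ** (mat 1 - H1 L) ** Y pi)"
        have z: "0 \<in> {0..pi}" by simp
        define k where "k = C / norm \<xi> * exp (\<bar>Im \<xi>\<bar> * pi) * norm X"
        define a b where "a = exp (- (\<i> * \<xi> * of_real pi))" and "b = exp (\<i> * \<xi> * of_real pi)"
        have ab: "b * a = 1" "b * b = exp (2 * of_real pi * \<i> * \<xi>)"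
          by (simp_all add: a_def b_def mult_ac flip: exp_add mult_2)
        define T where "T = hm ** (mat 1 + h1 L) ** dagger (A_mat L) ** X"
        define e1 where "e1 = wave L 1 \<xi> Y Y1 0 - a *\<^sub>M X"
        define e2 where "e2 = wave L (-1) \<xi> Y Y1 0 + b *\<^sub>M T"
        have e1: "norm e1 \<le> k"
          using b1[OF elim(2) Y V X z] by (simp add: e1_def a_def k_def)
        have e2: "norm e2 \<le> k"
          using b2[OF elim(2) Y V X z] by (simp add: e2_def b_def k_def T_def)
        have Y0: "norm (Y 0) \<le> k"
          using b3[OF elim(2) Y V X z] by (simp add: k_def)
        let ?U = "Y1 0 + ((\<i> * \<xi>) *\<^sub>M h1 L + h0 L) ** Y 0"
        let ?err = "2 *\<^sub>M ((h0 L + h1 L ** Q1 L 0) ** Y 0) + (mat 1 + h1 L) ** e1 + (mat 1 - h1 L) ** e2"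
        \<comment> \<open>Gives the second wave the left factor \<open>mat 1 + h1 L\<close> of the
          first, so that the identity and A can be combined.\<close>
        have T: "(mat 1 - h1 L) ** T = (mat 1 + h1 L) ** (dagger (A_mat L) ** X)"
        proof -
          have "(mat 1 - h1 L) ** T = ((mat 1 - h1 L) ** hm) ** (mat 1 + h1 L) ** dagger (A_mat L) ** X"
            unfolding T_def by (simp only: matrix_mul_assoc)
          then show ?thesis by (simp add: h_inverses matrix_mul_assoc)
        qed
        have lin: "m = u - (z + f + g)" if "p = u - z" "p = f + g + s" "s = m" for p u z f g s m :: "complex^'m^'m"
        proof -
          have "u - (z + f + g) = (u - z) - (f + g)" by simp
          also have "\<dots> = (f + g + s) - (f + g)" using that by simp
          finally show ?thesis using that(3) by simp
        qed
        have "(mat 1 + h1 L) ** wave L 1 \<xi> Y Y1 0 + (mat 1 - h1 L) ** wave L (-1) \<xi> Y Y1 0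
            = 2 *\<^sub>M ?U - 2 *\<^sub>M ((h0 L + h1 L ** Q1 L 0) ** Y 0)"
          by (simp add: wave_def matrix_distribs matrix_mul_assoc) (simp add: vec_eq_iff)
        moreover have "(mat 1 + h1 L) ** wave L 1 \<xi> Y Y1 0 + (mat 1 - h1 L) ** wave L (-1) \<xi> Y Y1 0
            = (mat 1 + h1 L) ** e1 + (mat 1 - h1 L) ** e2 + (a *\<^sub>M ((mat 1 + h1 L) ** X) - b *\<^sub>M ((mat 1 - h1 L) ** T))"
          unfolding e1_def e2_def by (simp only: matrix_add_ldistrib matrix_diff_ldistrib cscale_mult_right) simp
        moreover have "a *\<^sub>M ((mat 1 + h1 L) ** X) - b *\<^sub>M ((mat 1 - h1 L) ** T)
            = (mat 1 + h1 L) ** (a *\<^sub>M X - b *\<^sub>M (dagger (A_mat L) ** X))"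
          unfolding T by (simp only: matrix_diff_ldistrib cscale_mult_right)
        ultimately have main: "(mat 1 + h1 L) ** (a *\<^sub>M X - b *\<^sub>M (dagger (A_mat L) ** X)) = 2 *\<^sub>M ?U - ?err"
          by (rule lin)
        have "(b *\<^sub>M Rs \<xi>) ** hp ** ((mat 1 + h1 L) ** (a *\<^sub>M X - b *\<^sub>M (dagger (A_mat L) ** X)))
            = (b *\<^sub>M Rs \<xi>) ** (hp ** (mat 1 + h1 L)) ** (a *\<^sub>M X - b *\<^sub>M (dagger (A_mat L) ** X))"
          by (simp only: matrix_mul_assoc)
        also have "\<dots> = Rs \<xi> ** ((b * a) *\<^sub>M X - (b * b) *\<^sub>M (dagger (A_mat L) ** X))"
          unfolding h_inverses matrix_mul_rid
          by (simp only: cscale_mult_left cscale_mult_right matrix_diff_ldistrib cscale_diff cscale_cscale mult.commute)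
        also have "\<dots> = Rs \<xi> ** (mat 1 - exp (2 * of_real pi * \<i> * \<xi>) *\<^sub>M dagger (A_mat L)) ** X"
          unfolding ab by (simp add: matrix_distribs matrix_mul_assoc)
        also have "\<dots> = X" using resolv_identity(1)[OF elim(3)[rule_format]] by simp
        finally have "X = (b *\<^sub>M Rs \<xi>) ** hp ** (2 *\<^sub>M ?U - ?err)" by (simp add: main)
        then have "X - 2 *\<^sub>M ((b *\<^sub>M Rs \<xi>) ** hp ** ?U) = - ((b *\<^sub>M Rs \<xi>) ** hp ** ?err)"
          by (simp only: matrix_diff_ldistrib cscale_mult_right) simp
        then have "norm (X - 2 *\<^sub>M ((b *\<^sub>M Rs \<xi>) ** hp ** ?U)) = norm ((b *\<^sub>M Rs \<xi>) ** hp ** ?err)"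
          by simp
        also have "\<dots> \<le> (norm (b *\<^sub>M Rs \<xi>) * norm hp) * norm ?err"
          by (intro order_trans[OF norm_matrix_mult_le] mult_right_mono norm_matrix_mult_le) auto
        also have "\<dots> \<le> (D * exp (\<bar>Im \<xi>\<bar> * (- pi)) * norm hp) * (c * k)"
        proof (intro mult_mono)
          show "norm (b *\<^sub>M Rs \<xi>) \<le> D * exp (\<bar>Im \<xi>\<bar> * (- pi))"
            using elim(1) by (simp add: b_def)
          have "norm ?err \<le> 2 * (norm (h0 L + h1 L ** Q1 L 0) * k) + norm (mat 1 + h1 L) * k + norm (mat 1 - h1 L) * k"
            using Y0 e1 e2
            by (intro order_trans[OF norm_triangle_ineq] add_mono order_trans[OF norm_matrix_mult_le] mult_left_mono)
               (auto simp: norm_cscale intro!: order_trans[OF norm_matrix_mult_le] mult_left_mono)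
          then show "norm ?err \<le> c * k" by (simp add: c_def algebra_simps)
        qed (use D in auto)
        also have "\<dots> = D * norm hp * c * C / norm \<xi> * norm X * (exp (\<bar>Im \<xi>\<bar> * (- pi)) * exp (\<bar>Im \<xi>\<bar> * pi))"
          by (simp add: k_def mult_ac)
        also have "exp (\<bar>Im \<xi>\<bar> * (- pi)) * exp (\<bar>Im \<xi>\<bar> * pi) = 1" by (simp flip: exp_add)
        finally show "norm (X - 2 *\<^sub>M ((exp (1 * \<i> * \<xi> * of_real pi) *\<^sub>M Rs \<xi>) ** hp ** ?U)) \<le> D * norm hp * c * C / norm \<xi> * norm X"
          by (simp add: b_def)
      qed
    qed
  qed
qed

text \<open>A kernel matrix of V(phi) would give a solution with U = V = 0, whose amplitude
  satisfies \<open>norm X \<le> D / norm \<xi> * norm X\<close> and so vanishes for large \<xi>; the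
  estimate from \<pi> then makes its value at 0 vanish as well.\<close>

lemma eventually_char_fun_nonzero: "\<forall>\<^sub>F \<xi> in F. char_fun L \<xi> \<noteq> 0"
proof -
  obtain C R where C: "C \<ge> 0" "R \<ge> 1" and bb: "back_bound C R"
    using back_estimate .
  obtain D where D: "D \<ge> 0" and ev: "\<forall>\<^sub>F \<xi> in F. \<forall>Y Y1 X. sol L \<xi> Y Y1 \<longrightarrow> Y1 pi = - (((\<i> * \<xi>) *\<^sub>M H1 L + H0 L) ** Y pi) \<longrightarrow>
      X = (\<i> * \<xi>) *\<^sub>M (dagger (P_minus L pi) ** (mat 1 - H1 L) ** Y pi) \<longrightarrow>
      norm (X - 2 *\<^sub>M ((exp (1 * \<i> * \<xi> * of_real pi) *\<^sub>M Rs \<xi>) ** hp ** (Y1 0 + ((\<i> * \<xi>) *\<^sub>M h1 L + h0 L) ** Y 0)))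
        \<le> D / norm \<xi> * norm X"
    using X_estimate .
  show ?thesis using ev eventually_large[of R] eventually_large[of "D + 1"]
  proof eventually_elim
    case (elim \<xi>)
    show ?case
    proof
      assume "char_fun L \<xi> = 0"
      then have "det (Vmat L \<xi>) = 0" by (simp add: char_fun_eq)
      then obtain B :: "complex^'m^'m" where B: "B \<noteq> 0" "Vmat L \<xi> ** B = 0"
        by (rule det_zero_kernel)
      let ?Y = "\<lambda>x. phi L \<xi> x ** B" and ?Y1 = "\<lambda>x. phi1 L \<xi> x ** B"
      define X where "X = (\<i> * \<xi>) *\<^sub>M (dagger (P_minus L pi) ** (mat 1 - H1 L) ** ?Y pi)"
      have Y: "sol L \<xi> ?Y ?Y1" by (rule sol_mult_right[OF sol_phi])
      have "?Y1 pi + ((\<i> * \<xi>) *\<^sub>M H1 L + H0 L) ** ?Y pi = 0"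
        using B(2) by (simp add: Vmat_def matrix_add_rdistrib matrix_mul_assoc)
      then have V: "?Y1 pi = - (((\<i> * \<xi>) *\<^sub>M H1 L + H0 L) ** ?Y pi)" by (simp add: eq_neg_iff_add_eq_0)
      have "?Y1 0 + ((\<i> * \<xi>) *\<^sub>M h1 L + h0 L) ** ?Y 0 = 0"
        by (simp add: matrix_distribs)
      then have "norm X \<le> D / norm \<xi> * norm X"
        using elim(1)[rule_format, OF Y V X_def] by simp
      moreover have "norm \<xi> > 0" using elim(3) D by linarith
      ultimately have "norm X * (norm \<xi> - D) \<le> 0" by (simp add: field_simps)
      then have "norm X \<le> 0" using elim(3) by (simp add: mult_le_0_iff)
      then have "norm (?Y 0) \<le> 0"
        using back_boundD(3)[OF bb elim(2) Y V X_def, of 0] by simp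
      then show False using B(1) by simp
    qed
  qed
qed

text \<open>For the Weyl solution U is the identity, which fixes the amplitude \<open>X\<close> up
  to a relative error O(1/\<xi>); both waves then follow by propagation from \<pi>.\<close>

lemma Phi_asymptotics:
  assumes x: "x \<in> {0..pi}"
  shows "growth F (\<lambda>\<xi>. Phi L \<xi> x - Phi_0 x \<xi>) (- x) (-2)" "growth F (\<lambda>\<xi>. Phi1 L \<xi> x - Phi1_0 x \<xi>) (- x) (-1)"
proof -
  obtain C R where C: "C \<ge> 0" "R \<ge> 1" and bb: "back_bound C R"
    using back_estimate .
  obtain D where D: "D \<ge> 0" and ev: "\<forall>\<^sub>F \<xi> in F. \<forall>Y Y1 X. sol L \<xi> Y Y1 \<longrightarrow> Y1 pi = - (((\<i> * \<xi>) *\<^sub>M H1 L + H0 L) ** Y pi) \<longrightarrow>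
      X = (\<i> * \<xi>) *\<^sub>M (dagger (P_minus L pi) ** (mat 1 - H1 L) ** Y pi) \<longrightarrow>
      norm (X - 2 *\<^sub>M ((exp (1 * \<i> * \<xi> * of_real pi) *\<^sub>M Rs \<xi>) ** hp ** (Y1 0 + ((\<i> * \<xi>) *\<^sub>M h1 L + h0 L) ** Y 0)))
        \<le> D / norm \<xi> * norm X"
    using X_estimate .
  define X where "X = (\<lambda>\<xi>. (\<i> * \<xi>) *\<^sub>M (dagger (P_minus L pi) ** (mat 1 - H1 L) ** Phi L \<xi> pi))"
  define X0 where "X0 = (\<lambda>\<xi>. 2 *\<^sub>M ((exp (1 * \<i> * \<xi> * of_real pi) *\<^sub>M Rs \<xi>) ** hp))"
  let ?w = "\<lambda>\<sigma> \<xi>. wave L \<sigma> \<xi> (Phi L \<xi>) (Phi1 L \<xi>) x"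
  have U: "Phi1 L \<xi> 0 + ((\<i> * \<xi>) *\<^sub>M h1 L + h0 L) ** Phi L \<xi> 0 = mat 1" if "char_fun L \<xi> \<noteq> 0" for \<xi>
    by (simp add: Phi_spec[OF that])
  have dX: "\<forall>\<^sub>F \<xi> in F. norm (X \<xi> - X0 \<xi>) \<le> D / norm \<xi> * norm (X \<xi>)"
    using ev eventually_char_fun_nonzero
  proof eventually_elim
    case (elim \<xi>)
    note P = Phi_spec[OF elim(2)]
    show ?case
      using elim(1)[rule_format, OF P(1) P(6) refl] unfolding U[OF elim(2)] X_def X0_def by simp
  qed
  have gX0: "growth F X0 (- pi) 0"
    unfolding X0_def by (intro growth_const_cscale growth_mult_const growth_resolv W_unitary) auto
  \<comment> \<open>For large \<xi> the relative error is at most 1/2, so \<open>X\<close> inherits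
    the bound of \<open>X0\<close>.\<close>
  have gX: "growth F X (- pi) 0"
  proof (rule growth_le[OF gX0])
    show "\<forall>\<^sub>F \<xi> in F. norm (X \<xi>) \<le> 2 * norm (X0 \<xi>)"
      using dX eventually_large[of "2 * D + 1"]
    proof eventually_elim
      case (elim \<xi>)
      have "norm \<xi> > 0" using elim(2) D by linarith
      then have "D / norm \<xi> \<le> 1 / 2" using elim(2) D by (simp add: field_simps)
      then have "D / norm \<xi> * norm (X \<xi>) \<le> 1 / 2 * norm (X \<xi>)" by (rule mult_right_mono) simp
      then show ?case using elim(1) norm_triangle_ineq2[of "X \<xi>" "X0 \<xi>"] by linarith
    qed
  qed
  have gdX: "growth F (\<lambda>\<xi>. X \<xi> - X0 \<xi>) (- pi) (-1)"
    using growth_le_exp[OF gX, of "\<lambda>\<xi>. X \<xi> - X0 \<xi>" D 0] dX D by simp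
  have y: "pi - x + - pi = - x" by simp
  have ev3: "\<forall>\<^sub>F \<xi> in F. norm (?w 1 \<xi> - exp (1 * \<i> * \<xi> * of_real (x - pi)) *\<^sub>M (P_minus L x ** X \<xi>))
        \<le> C / norm \<xi> * exp (\<bar>Im \<xi>\<bar> * (pi - x)) * norm (X \<xi>)"
    "\<forall>\<^sub>F \<xi> in F. norm (?w (-1) \<xi> + exp (- 1 * \<i> * \<xi> * of_real (x - pi)) *\<^sub>M
          (P_plus L x ** (hm ** (mat 1 + h1 L) ** dagger (A_mat L) ** X \<xi>)))
        \<le> C / norm \<xi> * exp (\<bar>Im \<xi>\<bar> * (pi - x)) * norm (X \<xi>)"
    "\<forall>\<^sub>F \<xi> in F. norm (Phi L \<xi> x) \<le> C / norm \<xi> * exp (\<bar>Im \<xi>\<bar> * (pi - x)) * norm (X \<xi>)"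
  proof -
    have *: "\<forall>\<^sub>F \<xi> in F. R \<le> norm \<xi> \<and> char_fun L \<xi> \<noteq> 0"
      using eventually_large[of R] eventually_char_fun_nonzero by (rule eventually_conj)
    have "norm (?w 1 \<xi> - exp (1 * \<i> * \<xi> * of_real (x - pi)) *\<^sub>M (P_minus L x ** X \<xi>))
        \<le> C / norm \<xi> * exp (\<bar>Im \<xi>\<bar> * (pi - x)) * norm (X \<xi>)"
      if "R \<le> norm \<xi> \<and> char_fun L \<xi> \<noteq> 0" for \<xi>
      using back_boundD(1)[OF bb conjunct1[OF that] Phi_spec(1)[OF conjunct2[OF that]] Phi_spec(6)[OF conjunct2[OF that]] refl x]
      unfolding X_def .
    from eventually_mono[OF * this] show "\<forall>\<^sub>F \<xi> in F. norm (?w 1 \<xi> - exp (1 * \<i> * \<xi> * of_real (x - pi)) *\<^sub>M (P_minus L x ** X \<xi>))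
        \<le> C / norm \<xi> * exp (\<bar>Im \<xi>\<bar> * (pi - x)) * norm (X \<xi>)" .
    have "norm (?w (-1) \<xi> + exp (- 1 * \<i> * \<xi> * of_real (x - pi)) *\<^sub>M
          (P_plus L x ** (hm ** (mat 1 + h1 L) ** dagger (A_mat L) ** X \<xi>)))
        \<le> C / norm \<xi> * exp (\<bar>Im \<xi>\<bar> * (pi - x)) * norm (X \<xi>)"
      if "R \<le> norm \<xi> \<and> char_fun L \<xi> \<noteq> 0" for \<xi>
      using back_boundD(2)[OF bb conjunct1[OF that] Phi_spec(1)[OF conjunct2[OF that]] Phi_spec(6)[OF conjunct2[OF that]] refl x]
      unfolding X_def .
    from eventually_mono[OF * this] show "\<forall>\<^sub>F \<xi> in F. norm (?w (-1) \<xi> + exp (- 1 * \<i> * \<xi> * of_real (x - pi)) *\<^sub>M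
          (P_plus L x ** (hm ** (mat 1 + h1 L) ** dagger (A_mat L) ** X \<xi>)))
        \<le> C / norm \<xi> * exp (\<bar>Im \<xi>\<bar> * (pi - x)) * norm (X \<xi>)" .
    have "norm (Phi L \<xi> x) \<le> C / norm \<xi> * exp (\<bar>Im \<xi>\<bar> * (pi - x)) * norm (X \<xi>)"
      if "R \<le> norm \<xi> \<and> char_fun L \<xi> \<noteq> 0" for \<xi>
      using back_boundD(3)[OF bb conjunct1[OF that] Phi_spec(1)[OF conjunct2[OF that]] Phi_spec(6)[OF conjunct2[OF that]] refl x]
      unfolding X_def .
    from eventually_mono[OF * this] show "\<forall>\<^sub>F \<xi> in F. norm (Phi L \<xi> x) \<le> C / norm \<xi> * exp (\<bar>Im \<xi>\<bar> * (pi - x)) * norm (X \<xi>)" .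
  qed
  have gPhi: "growth F (\<lambda>\<xi>. Phi L \<xi> x) (- x) (-1)"
    using growth_le_exp[OF gX ev3(3) C(1)] unfolding y .
  have small: "growth F (\<lambda>\<xi>. exp (\<sigma> * \<i> * \<xi> * of_real (x - pi)) *\<^sub>M (Z ** (X \<xi> - X0 \<xi>))) (- x) (-1)"
    if "\<sigma> \<in> {1,-1}" for \<sigma> and Z :: "complex^'m^'m"
    using growth_cscale[OF growth_exp[OF that, of "x - pi"] growth_const_mult[OF gdX, of Z]] x by simp
  have g1: "growth F (\<lambda>\<xi>. ?w 1 \<xi> - EP x \<xi> ** a0 \<xi>) (- x) (-1)"
  proof -
    have "growth F (\<lambda>\<xi>. (?w 1 \<xi> - exp (1 * \<i> * \<xi> * of_real (x - pi)) *\<^sub>M (P_minus L x ** X \<xi>))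
        + exp (1 * \<i> * \<xi> * of_real (x - pi)) *\<^sub>M (P_minus L x ** (X \<xi> - X0 \<xi>))) (- x) (-1)"
      using growth_le_exp[OF gX ev3(1) C(1)] unfolding y by (intro growth_add small) auto
    moreover have "exp (1 * \<i> * \<xi> * of_real (x - pi)) *\<^sub>M (P_minus L x ** X0 \<xi>) = EP x \<xi> ** a0 \<xi>" for \<xi>
    proof -
      have "exp (1 * \<i> * \<xi> * of_real (x - pi)) * exp (1 * \<i> * \<xi> * of_real pi) = exp (1 * \<i> * \<xi> * of_real x)"
        by (simp add: right_diff_distrib flip: exp_add)
      then show ?thesis unfolding X0_def EP_def a0_def
        by (simp only: cscale_mult_left cscale_mult_right cscale_cscale mult.left_commute[of _ 2])
    qed
    ultimately show ?thesis by (simp add: matrix_diff_ldistrib cscale_diff)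
  qed
  have g2: "growth F (\<lambda>\<xi>. ?w (-1) \<xi> + EM x \<xi> ** b0 \<xi>) (- x) (-1)"
  proof -
    let ?K = "P_plus L x ** hm ** (mat 1 + h1 L) ** dagger (A_mat L)"
    have "growth F (\<lambda>\<xi>. (?w (-1) \<xi> + exp (- 1 * \<i> * \<xi> * of_real (x - pi)) *\<^sub>M (P_plus L x ** (hm ** (mat 1 + h1 L) ** dagger (A_mat L) ** X \<xi>)))
        - exp (- 1 * \<i> * \<xi> * of_real (x - pi)) *\<^sub>M (?K ** (X \<xi> - X0 \<xi>))) (- x) (-1)"
      using growth_le_exp[OF gX ev3(2) C(1)] unfolding y by (intro growth_diff small) auto
    then have "growth F (\<lambda>\<xi>. ?w (-1) \<xi> + exp (- 1 * \<i> * \<xi> * of_real (x - pi)) *\<^sub>M (?K ** X0 \<xi>)) (- x) (-1)"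
      by (simp add: matrix_diff_ldistrib cscale_diff matrix_mul_assoc)
    then show ?thesis
    proof (rule growth_cong)
      show "\<forall>\<^sub>F \<xi> in F. ?w (-1) \<xi> + exp (- 1 * \<i> * \<xi> * of_real (x - pi)) *\<^sub>M (?K ** X0 \<xi>) = ?w (-1) \<xi> + EM x \<xi> ** b0 \<xi>"
        using eventually_separated
      proof eventually_elim
        case (elim \<xi>)
        let ?c = "exp (- 1 * \<i> * \<xi> * of_real x)" and ?d = "exp (2 * of_real pi * \<i> * \<xi>)"
        \<comment> \<open>The exponentials combine to
          \<open>exp (2 * of_real pi * \<i> * \<xi>)\<close>, the factor that turns the adjoint of A
          times the resolvent into the resolvent minus the identity.\<close>
        have e: "exp (- 1 * \<i> * \<xi> * of_real (x - pi)) * exp (1 * \<i> * \<xi> * of_real pi) = ?c * ?d"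
          by (simp add: algebra_simps flip: exp_add)
        have "exp (- 1 * \<i> * \<xi> * of_real (x - pi)) *\<^sub>M (?K ** X0 \<xi>)
          = (2 * (exp (- 1 * \<i> * \<xi> * of_real (x - pi)) * exp (1 * \<i> * \<xi> * of_real pi))) *\<^sub>M (P_plus L x ** hm ** (mat 1 + h1 L) ** (dagger (A_mat L) ** Rs \<xi>) ** hp)"
          unfolding X0_def by (simp only: cscale_mult_left cscale_mult_right cscale_cscale matrix_mul_assoc mult_ac)
        also have "\<dots> = (2 * ?c) *\<^sub>M (P_plus L x ** hm ** (mat 1 + h1 L) ** (?d *\<^sub>M (dagger (A_mat L) ** Rs \<xi>)) ** hp)"
          unfolding e by (simp only: cscale_mult_left cscale_mult_right cscale_cscale mult_ac)
        also have "\<dots> = EM x \<xi> ** b0 \<xi>"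
          unfolding resolv_identity(2)[OF elim[rule_format]] EM_def b0_def
          by (simp only: cscale_mult_left cscale_mult_right cscale_cscale matrix_mul_assoc mult_ac)
        finally show ?case by simp
      qed
    qed
  qed
  note r = growth_from_waves[OF g1 g2 gPhi]
  show "growth F (\<lambda>\<xi>. Phi1 L \<xi> x - Phi1_0 x \<xi>) (- x) (-1)"
    using r(1) by (simp add: Phi1_0_def)
  show "growth F (\<lambda>\<xi>. Phi L \<xi> x - Phi_0 x \<xi>) (- x) (-2)"
    using r(2) by (simp add: Phi_0_def)
qed

end

text \<open>Of the four pairings of waves, the two that carry \<open>e * e\<close> and
  \<open>f * f\<close> are annihilated by the two hypotheses with value 0; the other two are
  constant. The sign \<open>s\<close> is 1 for solutions and -1 for derivatives, which produces the
  sum in \<open>Omega\<close> and the difference in \<open>Lambda\<close>.\<close>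

lemma leading_product:
  fixes p q p' q' u v a b a' b' :: "complex^'m::finite^'m" and e f s :: complex
  assumes "u ** a' + a ** v = 2 *\<^sub>M mat 1" "u ** b' + a ** u = 0"
    "v ** a' + b ** v = 0" "v ** b' + b ** u = - (2 *\<^sub>M mat 1)" and ef: "e * f = 1"
  shows "((e *\<^sub>M p) ** u + s *\<^sub>M ((f *\<^sub>M q) ** v)) ** (a' ** (f *\<^sub>M p') - b' ** (e *\<^sub>M q'))
      + ((e *\<^sub>M p) ** a + s *\<^sub>M ((f *\<^sub>M q) ** b)) ** (v ** (f *\<^sub>M p') - u ** (e *\<^sub>M q'))
    = 2 *\<^sub>M (p ** p') + (2 * s) *\<^sub>M (q ** q')"
proof -
  have fe: "f * e = 1" using ef by (simp add: mult.commute)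
  have "((e *\<^sub>M p) ** u + s *\<^sub>M ((f *\<^sub>M q) ** v)) ** (a' ** (f *\<^sub>M p') - b' ** (e *\<^sub>M q'))
      + ((e *\<^sub>M p) ** a + s *\<^sub>M ((f *\<^sub>M q) ** b)) ** (v ** (f *\<^sub>M p') - u ** (e *\<^sub>M q'))
    = (e * f) *\<^sub>M (p ** (u ** a' + a ** v) ** p') - (e * e) *\<^sub>M (p ** (u ** b' + a ** u) ** q')
      + (s * f * f) *\<^sub>M (q ** (v ** a' + b ** v) ** p') - (s * (f * e)) *\<^sub>M (q ** (v ** b' + b ** u) ** q')"
    by (simp add: matrix_distribs matrix_mul_assoc) (simp add: vec_eq_iff algebra_simps)
  also have "\<dots> = 2 *\<^sub>M (p ** p') + (2 * s) *\<^sub>M (q ** q')"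
    unfolding assms(1-4) ef fe by (simp add: matrix_distribs) (simp add: vec_eq_iff algebra_simps)
  finally show ?thesis .
qed

context asymptotic_pencil
begin

lemma dagger_hp: "dagger hp = hm"
proof -
  have "dagger ((mat 1 + h1 L) ** hp) = mat 1" by (simp add: h_inverses)
  then have "dagger hp ** (mat 1 - h1 L) = mat 1" by (simp add: dagger_simps)
  then have "dagger hp ** ((mat 1 - h1 L) ** hm) = hm" by (simp add: matrix_mul_assoc)
  then show ?thesis by (simp add: h_inverses)
qed

lemma dagger_hm: "dagger hm = hp"
  using dagger_hp by (metis dagger_dagger)

lemma h_commute:
  "hp ** (mat 1 - h1 L) = (mat 1 - h1 L) ** hp" "hm ** (mat 1 + h1 L) = (mat 1 + h1 L) ** hm"
proof -
  have c: "(mat 1 + h1 L) ** (mat 1 - h1 L) = (mat 1 - h1 L) ** (mat 1 + h1 L)"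
    by (simp add: matrix_distribs)
  have "hp ** (mat 1 - h1 L) = hp ** ((mat 1 - h1 L) ** (mat 1 + h1 L)) ** hp"
    using h_inverses(2) by (metis matrix_mul_assoc matrix_mul_rid)
  also have "\<dots> = (hp ** (mat 1 + h1 L)) ** (mat 1 - h1 L) ** hp"
    unfolding c[symmetric] by (simp only: matrix_mul_assoc)
  finally show "hp ** (mat 1 - h1 L) = (mat 1 - h1 L) ** hp" by (simp add: h_inverses)
  have "hm ** (mat 1 + h1 L) = hm ** ((mat 1 + h1 L) ** (mat 1 - h1 L)) ** hm"
    using h_inverses(4) by (metis matrix_mul_assoc matrix_mul_rid)
  also have "\<dots> = (hm ** (mat 1 - h1 L)) ** (mat 1 + h1 L) ** hm"
    unfolding c by (simp only: matrix_mul_assoc)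
  finally show "hm ** (mat 1 + h1 L) = (mat 1 + h1 L) ** hm" by (simp add: h_inverses)
qed

text \<open>Conjugation at \<open>cnj \<xi>\<close> replaces each exponential w by its reciprocal,
  and 1/(1 - 1/w) = 1 - 1/(1 - w).\<close>

lemma dagger_resolv:
  assumes "\<And>q. 1 - exp (2 * of_real pi * \<i> * (\<xi> - of_real (\<omega> q))) \<noteq> 0"
  shows "dagger (Rs (cnj \<xi>)) = mat 1 - Rs \<xi>"
proof -
  let ?w = "\<lambda>q. exp (2 * of_real pi * \<i> * (\<xi> - of_real (\<omega> q)))"
  have "cnj (1 / (1 - exp (2 * of_real pi * \<i> * (cnj \<xi> - of_real (\<omega> q))))) = 1 - 1 / (1 - ?w q)" for q
  proof -
    have "cnj (exp (2 * of_real pi * \<i> * (cnj \<xi> - of_real (\<omega> q)))) = exp (- (2 * of_real pi * \<i> * (\<xi> - of_real (\<omega> q))))"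
      by (simp add: exp_cnj)
    also have "\<dots> = 1 / ?w q" by (simp only: exp_minus inverse_eq_divide)
    finally have "cnj (1 / (1 - exp (2 * of_real pi * \<i> * (cnj \<xi> - of_real (\<omega> q))))) = 1 / (1 - 1 / ?w q)" by simp
    also have "\<dots> = 1 - 1 / (1 - ?w q)"
    proof -
      have w: "?w q \<noteq> 0" "1 - ?w q \<noteq> 0" "?w q - 1 \<noteq> 0" using assms[of q] by auto
      have "1 - 1 / ?w q = (?w q - 1) / ?w q" using w by (simp add: field_simps)
      then have "1 / (1 - 1 / ?w q) = ?w q / (?w q - 1)" by simp
      also have "\<dots> = 1 - 1 / (1 - ?w q)" using w by (simp add: divide_simps) (simp add: algebra_simps)
      finally show ?thesis .
    qed
    finally show ?thesis .
  qed
  then have "dagger (diag (\<lambda>q. 1 / (1 - exp (2 * of_real pi * \<i> * (cnj \<xi> - of_real (\<omega> q))))))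
      = mat 1 - diag (\<lambda>q. 1 / (1 - ?w q))"
    by (auto simp: vec_eq_iff mat_def simp del: complex_cnj_divide)
  then show ?thesis
    by (simp add: resolv_def dagger_mult matrix_mul_assoc[symmetric])
       (simp add: matrix_distribs matrix_mul_assoc W_unitary)
qed

text \<open>These supply the hypotheses of \<open>leading_product\<close>, with
  \<open>mat 1 - h1 L\<close>, \<open>mat 1 + h1 L\<close> as amplitudes of \<open>phi\<close> and
  \<open>a0\<close>, \<open>b0\<close> as those of the Weyl solution. They hold exactly because the
  resolvent and its adjoint at \<open>cnj \<xi>\<close> add up to the identity and the factors built
  from \<open>h1\<close> commute.\<close>

lemma leading_relations:
  assumes "\<And>q. 1 - exp (2 * of_real pi * \<i> * (\<xi> - of_real (\<omega> q))) \<noteq> 0"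
  shows "(mat 1 - h1 L) ** dagger (a0 (cnj \<xi>)) + a0 \<xi> ** (mat 1 + h1 L) = 2 *\<^sub>M mat 1"
    and "(mat 1 - h1 L) ** dagger (b0 (cnj \<xi>)) + a0 \<xi> ** (mat 1 - h1 L) = 0"
    and "(mat 1 + h1 L) ** dagger (a0 (cnj \<xi>)) + b0 \<xi> ** (mat 1 + h1 L) = 0"
    and "(mat 1 + h1 L) ** dagger (b0 (cnj \<xi>)) + b0 \<xi> ** (mat 1 - h1 L) = - (2 *\<^sub>M mat 1)"
proof -
  let ?u = "mat 1 - h1 L" and ?v = "mat 1 + h1 L" and ?R = "Rs \<xi>"
  have a': "dagger (a0 (cnj \<xi>)) = 2 *\<^sub>M (hm ** (mat 1 - ?R))"
    by (simp add: a0_def dagger_cscale dagger_mult dagger_hp dagger_resolv[OF assms])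
  have b': "dagger (b0 (cnj \<xi>)) = - (2 *\<^sub>M (hm ** ?R ** ?u ** hp))"
  proof -
    have "dagger (Rs (cnj \<xi>) - mat 1) = - ?R" by (simp add: dagger_diff dagger_resolv[OF assms])
    then show ?thesis
      by (simp add: b0_def dagger_cscale dagger_mult dagger_hp dagger_hm dagger_add matrix_mul_assoc)
  qed
  have "?u ** dagger (a0 (cnj \<xi>)) = 2 *\<^sub>M ((?u ** hm) ** (mat 1 - ?R))"
    unfolding a' by (simp only: cscale_mult_right matrix_mul_assoc)
  moreover have "a0 \<xi> ** ?v = 2 *\<^sub>M (?R ** (hp ** ?v))"
    unfolding a0_def by (simp only: cscale_mult_left matrix_mul_assoc)
  ultimately show "?u ** dagger (a0 (cnj \<xi>)) + a0 \<xi> ** ?v = 2 *\<^sub>M mat 1"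
    by (simp add: h_inverses flip: cscale_add)
  have "?u ** dagger (b0 (cnj \<xi>)) = - (2 *\<^sub>M ((?u ** hm) ** ?R ** (?u ** hp)))"
    unfolding b' by (simp only: matrix_mult_minus_right cscale_mult_right matrix_mul_assoc)
  moreover have "a0 \<xi> ** ?u = 2 *\<^sub>M (?R ** (hp ** ?u))"
    unfolding a0_def by (simp only: cscale_mult_left matrix_mul_assoc)
  ultimately show "?u ** dagger (b0 (cnj \<xi>)) + a0 \<xi> ** ?u = 0"
    by (simp only: h_inverses h_commute matrix_mul_lid) simp
  have "?v ** dagger (a0 (cnj \<xi>)) = 2 *\<^sub>M ((?v ** hm) ** (mat 1 - ?R))"
    unfolding a' by (simp only: cscale_mult_right matrix_mul_assoc)
  moreover have "b0 \<xi> ** ?v = 2 *\<^sub>M ((hm ** ?v) ** (?R - mat 1) ** (hp ** ?v))"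
    unfolding b0_def by (simp only: cscale_mult_left matrix_mul_assoc)
  ultimately show "?v ** dagger (a0 (cnj \<xi>)) + b0 \<xi> ** ?v = 0"
    by (simp only: h_inverses h_commute matrix_mul_rid flip: cscale_add)
       (simp add: matrix_diff_ldistrib)
  have "?v ** dagger (b0 (cnj \<xi>)) = - (2 *\<^sub>M ((?v ** hm) ** ?R ** (?u ** hp)))"
    unfolding b' by (simp only: matrix_mult_minus_right cscale_mult_right matrix_mul_assoc)
  moreover have "b0 \<xi> ** ?u = 2 *\<^sub>M ((hm ** ?v) ** (?R - mat 1) ** (hp ** ?u))"
    unfolding b0_def by (simp only: cscale_mult_left matrix_mul_assoc)
  ultimately have "?v ** dagger (b0 (cnj \<xi>)) + b0 \<xi> ** ?u = - (2 *\<^sub>M ((?v ** hm) ** (?u ** hp)))"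
    by (simp only: h_commute) (simp add: matrix_diff_ldistrib matrix_diff_rdistrib cscale_diff)
  also have "(?v ** hm) ** (?u ** hp) = ?v ** (hm ** ?u) ** hp" by (simp only: matrix_mul_assoc)
  also have "\<dots> = mat 1" by (simp add: h_inverses)
  finally show "?v ** dagger (b0 (cnj \<xi>)) + b0 \<xi> ** ?u = - (2 *\<^sub>M mat 1)" .
qed

lemma dagger_EP:
  "dagger (EP x (cnj \<xi>)) = exp (- 1 * \<i> * \<xi> * of_real x) *\<^sub>M dagger (P_minus L x)"
  "dagger (EM x (cnj \<xi>)) = exp (1 * \<i> * \<xi> * of_real x) *\<^sub>M dagger (P_plus L x)"
  by (simp_all add: EP_def EM_def dagger_cscale exp_cnj)

end

section \<open>The spectral mapping matrix of a model pair\<close>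

locale model_pair = A: asymptotic_pencil L F \<omega> \<delta> W + B: asymptotic_pencil Lt F \<omega> \<delta> Wt
  for L Lt :: "'m::finite pencil" and F \<omega> \<delta> W Wt +
  assumes h1_eq: "h1 Lt = h1 L" and resolv_eq: "resolv \<omega> Wt = resolv \<omega> W"
begin

lemma a0_eq: "B.a0 = A.a0" "B.b0 = A.b0"
  by (simp_all add: fun_eq_iff A.a0_def B.a0_def A.b0_def B.b0_def h1_eq resolv_eq)

text \<open>The model conditions make the wave amplitudes of both pencils equal, so products of
  leading parts from different pencils obey the relations of a single one. Only the factors P
  differ, and they survive in \<open>Omega\<close> and \<open>Lambda\<close>.\<close>

lemma leading_identities:
  assumes "\<And>q. 1 - exp (2 * of_real pi * \<i> * (\<xi> - of_real (\<omega> q))) \<noteq> 0" and xi: "\<xi> \<noteq> 0"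
  shows "A.phi_0 x \<xi> ** dagger (B.Phi1_0 x (cnj \<xi>)) - A.Phi_0 x \<xi> ** dagger (B.phi1_0 x (cnj \<xi>)) = Omega L Lt x"
    and "A.phi1_0 x \<xi> ** dagger (B.Phi1_0 x (cnj \<xi>)) - A.Phi1_0 x \<xi> ** dagger (B.phi1_0 x (cnj \<xi>)) = - (\<xi> *\<^sub>M Lambda L Lt x)"
proof -
  let ?u = "mat 1 - h1 L" and ?v = "mat 1 + h1 L"
  let ?e = "exp (1 * \<i> * \<xi> * of_real x)" and ?f = "exp (- 1 * \<i> * \<xi> * of_real x)"
  let ?p = "P_minus L x" and ?q = "P_plus L x"
  let ?p' = "dagger (P_minus Lt x)" and ?q' = "dagger (P_plus Lt x)"
  let ?a = "A.a0 \<xi>" and ?b = "A.b0 \<xi>" and ?a' = "dagger (A.a0 (cnj \<xi>))" and ?b' = "dagger (A.b0 (cnj \<xi>))"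
  have ef: "?e * ?f = 1" by (simp flip: exp_add)
  note lp = leading_product[OF A.leading_relations[OF assms(1)] ef]
  define X1 where "X1 = ?a' ** (?f *\<^sub>M ?p') - ?b' ** (?e *\<^sub>M ?q')"
  define X2 where "X2 = ?v ** (?f *\<^sub>M ?p') - ?u ** (?e *\<^sub>M ?q')"
  have s1: "dagger (B.Phi1_0 x (cnj \<xi>)) = (1/2) *\<^sub>M X1"
    by (simp add: B.Phi1_0_def X1_def dagger_cscale dagger_diff dagger_mult B.dagger_EP a0_eq)
  have s2: "dagger (B.phi1_0 x (cnj \<xi>)) = (- (\<i> * \<xi> / 2)) *\<^sub>M X2"
    by (simp add: B.phi1_0_def X2_def dagger_cscale dagger_diff dagger_add dagger_mult B.dagger_EP h1_eq A.dagger_boundary)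
  define Y1 where "Y1 = (\<lambda>s. (?e *\<^sub>M ?p) ** ?u + s *\<^sub>M ((?f *\<^sub>M ?q) ** ?v))"
  define Y2 where "Y2 = (\<lambda>s. (?e *\<^sub>M ?p) ** ?a + s *\<^sub>M ((?f *\<^sub>M ?q) ** ?b))"
  have lp': "Y1 s ** X1 + Y2 s ** X2 = 2 *\<^sub>M (?p ** ?p') + (2 * s) *\<^sub>M (?q ** ?q')" for s
    unfolding Y1_def Y2_def X1_def X2_def by (rule lp)
  have l: "A.phi_0 x \<xi> = (1/2) *\<^sub>M Y1 1" "A.phi1_0 x \<xi> = (\<i> * \<xi> / 2) *\<^sub>M Y1 (-1)"
    "A.Phi_0 x \<xi> = (1 / (2 * \<i> * \<xi>)) *\<^sub>M Y2 1" "A.Phi1_0 x \<xi> = (1/2) *\<^sub>M Y2 (-1)"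
    by (simp_all add: A.phi_0_def A.phi1_0_def A.Phi_0_def A.Phi1_0_def Y1_def Y2_def A.EP_def A.EM_def)
  have "A.phi_0 x \<xi> ** dagger (B.Phi1_0 x (cnj \<xi>)) - A.Phi_0 x \<xi> ** dagger (B.phi1_0 x (cnj \<xi>))
      = (1/4) *\<^sub>M (Y1 1 ** X1 + Y2 1 ** X2)"
    unfolding l s1 s2 using xi by (simp add: cscale_mult_left cscale_mult_right cscale_add)
  then show "A.phi_0 x \<xi> ** dagger (B.Phi1_0 x (cnj \<xi>)) - A.Phi_0 x \<xi> ** dagger (B.phi1_0 x (cnj \<xi>)) = Omega L Lt x"
    unfolding lp' by (simp add: Omega_def cscale_add)
  have "A.phi1_0 x \<xi> ** dagger (B.Phi1_0 x (cnj \<xi>)) - A.Phi1_0 x \<xi> ** dagger (B.phi1_0 x (cnj \<xi>))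
      = (\<i> * \<xi> / 4) *\<^sub>M (Y1 (-1) ** X1 + Y2 (-1) ** X2)"
    unfolding l s1 s2 by (simp add: cscale_mult_left cscale_mult_right cscale_add)
  then show "A.phi1_0 x \<xi> ** dagger (B.Phi1_0 x (cnj \<xi>)) - A.Phi1_0 x \<xi> ** dagger (B.phi1_0 x (cnj \<xi>)) = - (\<xi> *\<^sub>M Lambda L Lt x)"
  proof (simp only: lp')
    have "1 / (2 * \<i>) = - (\<i> / 2)" by (simp add: field_simps)
    then show "(\<i> * \<xi> / 4) *\<^sub>M (2 *\<^sub>M (?p ** ?p') + (2 * (-1)) *\<^sub>M (?q ** ?q')) = - (\<xi> *\<^sub>M Lambda L Lt x)"
      by (simp add: Lambda_def vec_eq_iff algebra_simps)
  qed
qed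

lemma growth_solutions:
  assumes x: "x \<in> {0..pi}"
  shows "growth F (\<lambda>\<xi>. phi L \<xi> x) x 0" "growth F (\<lambda>\<xi>. phi1 L \<xi> x) x 1"
    "growth F (\<lambda>\<xi>. Phi L \<xi> x) (- x) (-1)" "growth F (\<lambda>\<xi>. Phi1 L \<xi> x) (- x) 0"
    "growth F (\<lambda>\<xi>. dagger (phi Lt (cnj \<xi>) x)) x 0" "growth F (\<lambda>\<xi>. dagger (phi1 Lt (cnj \<xi>) x)) x 1"
    "growth F (\<lambda>\<xi>. dagger (Phi Lt (cnj \<xi>) x)) (- x) (-1)" "growth F (\<lambda>\<xi>. dagger (Phi1 Lt (cnj \<xi>) x)) (- x) 0"
proof -
  show "growth F (\<lambda>\<xi>. phi L \<xi> x) x 0" "growth F (\<lambda>\<xi>. phi1 L \<xi> x) x 1"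
    "growth F (\<lambda>\<xi>. Phi L \<xi> x) (- x) (-1)" "growth F (\<lambda>\<xi>. Phi1 L \<xi> x) (- x) 0"
    by (rule A.growth_of_diff[OF _ A.growth_leading(1)[OF x]], use A.phi_asymptotics[OF x] in simp)
       (rule A.growth_of_diff[OF _ A.growth_leading(2)[OF x]], use A.phi_asymptotics[OF x] in simp,
        rule A.growth_of_diff[OF _ A.growth_leading(3)[OF x]], use A.Phi_asymptotics[OF x] in simp,
        rule A.growth_of_diff[OF _ A.growth_leading(4)[OF x]], use A.Phi_asymptotics[OF x] in simp)
  show "growth F (\<lambda>\<xi>. dagger (phi Lt (cnj \<xi>) x)) x 0" "growth F (\<lambda>\<xi>. dagger (phi1 Lt (cnj \<xi>) x)) x 1"
    "growth F (\<lambda>\<xi>. dagger (Phi Lt (cnj \<xi>) x)) (- x) (-1)" "growth F (\<lambda>\<xi>. dagger (Phi1 Lt (cnj \<xi>) x)) (- x) 0"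
    by (rule A.growth_dagger, rule A.growth_of_diff[OF _ B.growth_leading(1)[OF x]], use B.phi_asymptotics[OF x] in simp)
       (rule A.growth_dagger, rule A.growth_of_diff[OF _ B.growth_leading(2)[OF x]], use B.phi_asymptotics[OF x] in simp,
        rule A.growth_dagger, rule A.growth_of_diff[OF _ B.growth_leading(3)[OF x]], use B.Phi_asymptotics[OF x] in simp,
        rule A.growth_dagger, rule A.growth_of_diff[OF _ B.growth_leading(4)[OF x]], use B.Phi_asymptotics[OF x] in simp)
qed

text \<open>Entries of the matrix that carries the pair (phi, Phi) of \<open>Lt\<close>, with
  derivatives, to that of \<open>L\<close>; up to sign the starred factors are the entries of the
  inverse solution matrix of \<open>Lt\<close>.\<close>

definition P11 :: "real \<Rightarrow> complex \<Rightarrow> complex^'m^'m"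
  where "P11 x \<xi> = phi L \<xi> x ** dagger (Phi1 Lt (cnj \<xi>) x) - Phi L \<xi> x ** dagger (phi1 Lt (cnj \<xi>) x)"
definition P12 :: "real \<Rightarrow> complex \<Rightarrow> complex^'m^'m"
  where "P12 x \<xi> = Phi L \<xi> x ** dagger (phi Lt (cnj \<xi>) x) - phi L \<xi> x ** dagger (Phi Lt (cnj \<xi>) x)"
definition P21 :: "real \<Rightarrow> complex \<Rightarrow> complex^'m^'m"
  where "P21 x \<xi> = phi1 L \<xi> x ** dagger (Phi1 Lt (cnj \<xi>) x) - Phi1 L \<xi> x ** dagger (phi1 Lt (cnj \<xi>) x)"
definition P22 :: "real \<Rightarrow> complex \<Rightarrow> complex^'m^'m"
  where "P22 x \<xi> = Phi1 L \<xi> x ** dagger (phi Lt (cnj \<xi>) x) - phi1 L \<xi> x ** dagger (Phi Lt (cnj \<xi>) x)"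

text \<open>In every product one factor has type \<open>x\<close> and the other \<open>- x\<close>,
  so the exponentials cancel. Replacing the factors by their leading parts costs one power of \<xi>,
  and in \<open>P11\<close> and \<open>P21\<close> the leading parts combine exactly.\<close>

lemma spectral_mapping_asymptotics:
  assumes x: "x \<in> {0..pi}"
  shows "growth F (\<lambda>\<xi>. P11 x \<xi> - Omega L Lt x) 0 (-1)" "growth F (P12 x) 0 (-1)"
    "growth F (\<lambda>\<xi>. P21 x \<xi> + \<xi> *\<^sub>M Lambda L Lt x) 0 0" "growth F (P22 x) 0 0"
proof -
  note g = growth_solutions[OF x]
  have dd: "growth F (\<lambda>\<xi>. dagger (f (cnj \<xi>)) - dagger (g (cnj \<xi>))) y k" if "growth F (\<lambda>\<xi>. f \<xi> - g \<xi>) y k"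
    for f g :: "complex \<Rightarrow> complex^'m^'m" and y k
    using A.growth_dagger[OF that] by (simp add: dagger_diff)
  show "growth F (P12 x) 0 (-1)"
    using growth_diff[OF A.growth_mult[OF g(3) g(5)], of "\<lambda>\<xi>. phi L \<xi> x ** dagger (Phi Lt (cnj \<xi>) x)"]
      A.growth_mult[OF g(1) g(7)] by (simp add: P12_def[abs_def])
  show "growth F (P22 x) 0 0"
    using growth_diff[OF A.growth_mult[OF g(4) g(5)], of "\<lambda>\<xi>. phi1 L \<xi> x ** dagger (Phi Lt (cnj \<xi>) x)"]
      A.growth_mult[OF g(2) g(7)] by (simp add: P22_def[abs_def])
  have ev: "\<forall>\<^sub>F \<xi> in F. (\<forall>q. 1 - exp (2 * of_real pi * \<i> * (\<xi> - of_real (\<omega> q))) \<noteq> 0) \<and> \<xi> \<noteq> 0"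
    using A.eventually_separated A.eventually_large[of 1] by eventually_elim auto
  have d: "growth F (\<lambda>\<xi>. phi L \<xi> x - A.phi_0 x \<xi>) x (0 - 1)" "growth F (\<lambda>\<xi>. phi1 L \<xi> x - A.phi1_0 x \<xi>) x (1 - 1)"
    "growth F (\<lambda>\<xi>. Phi L \<xi> x - A.Phi_0 x \<xi>) (- x) (-1 - 1)" "growth F (\<lambda>\<xi>. Phi1 L \<xi> x - A.Phi1_0 x \<xi>) (- x) (0 - 1)"
    "growth F (\<lambda>\<xi>. dagger (phi1 Lt (cnj \<xi>) x) - dagger (B.phi1_0 x (cnj \<xi>))) x (1 - 1)"
    "growth F (\<lambda>\<xi>. dagger (Phi1 Lt (cnj \<xi>) x) - dagger (B.Phi1_0 x (cnj \<xi>))) (- x) (0 - 1)"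
    using A.phi_asymptotics[OF x] A.Phi_asymptotics[OF x] dd[OF B.phi_asymptotics(2)[OF x]] dd[OF B.Phi_asymptotics(2)[OF x]]
    by simp_all
  note l = A.growth_leading[OF x] and lB = A.growth_dagger[OF B.growth_leading(2)[OF x]] A.growth_dagger[OF B.growth_leading(4)[OF x]]
  have "growth F (\<lambda>\<xi>. (phi L \<xi> x ** dagger (Phi1 Lt (cnj \<xi>) x) - A.phi_0 x \<xi> ** dagger (B.Phi1_0 x (cnj \<xi>)))
      - (Phi L \<xi> x ** dagger (phi1 Lt (cnj \<xi>) x) - A.Phi_0 x \<xi> ** dagger (B.phi1_0 x (cnj \<xi>)))) 0 (-1)"
    by (rule growth_diff; use A.growth_product_diff[OF d(1) l(1) d(6) lB(2)] A.growth_product_diff[OF d(3) l(3) d(5) lB(1)] in simp)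
  then show "growth F (\<lambda>\<xi>. P11 x \<xi> - Omega L Lt x) 0 (-1)"
  proof (rule growth_cong)
    show "\<forall>\<^sub>F \<xi> in F. (phi L \<xi> x ** dagger (Phi1 Lt (cnj \<xi>) x) - A.phi_0 x \<xi> ** dagger (B.Phi1_0 x (cnj \<xi>)))
      - (Phi L \<xi> x ** dagger (phi1 Lt (cnj \<xi>) x) - A.Phi_0 x \<xi> ** dagger (B.phi1_0 x (cnj \<xi>))) = P11 x \<xi> - Omega L Lt x"
      using ev
    proof eventually_elim
      case (elim \<xi>)
      then show ?case using leading_identities(1)[of \<xi> x] by (simp add: P11_def algebra_simps)
    qed
  qed
  have "growth F (\<lambda>\<xi>. (phi1 L \<xi> x ** dagger (Phi1 Lt (cnj \<xi>) x) - A.phi1_0 x \<xi> ** dagger (B.Phi1_0 x (cnj \<xi>)))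
      - (Phi1 L \<xi> x ** dagger (phi1 Lt (cnj \<xi>) x) - A.Phi1_0 x \<xi> ** dagger (B.phi1_0 x (cnj \<xi>)))) 0 0"
    by (rule growth_diff; use A.growth_product_diff[OF d(2) l(2) d(6) lB(2)] A.growth_product_diff[OF d(4) l(4) d(5) lB(1)] in simp)
  then show "growth F (\<lambda>\<xi>. P21 x \<xi> + \<xi> *\<^sub>M Lambda L Lt x) 0 0"
  proof (rule growth_cong)
    show "\<forall>\<^sub>F \<xi> in F. (phi1 L \<xi> x ** dagger (Phi1 Lt (cnj \<xi>) x) - A.phi1_0 x \<xi> ** dagger (B.Phi1_0 x (cnj \<xi>)))
      - (Phi1 L \<xi> x ** dagger (phi1 Lt (cnj \<xi>) x) - A.Phi1_0 x \<xi> ** dagger (B.phi1_0 x (cnj \<xi>))) = P21 x \<xi> + \<xi> *\<^sub>M Lambda L Lt x"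
      using ev
    proof eventually_elim
      case (elim \<xi>)
      then show ?case using leading_identities(2)[of \<xi> x] by (simp add: P21_def algebra_simps)
    qed
  qed
qed

text \<open>At x = 0 the amplitudes P are the identity, so the leading parts of the two Weyl
  solutions coincide and only the errors remain.\<close>

lemma growth_weyl_diff: "growth F (\<lambda>\<xi>. weyl L \<xi> - weyl Lt \<xi>) 0 (-2)"
proof -
  have z: "0 \<in> {0..pi}" by simp
  have "A.Phi_0 0 \<xi> = B.Phi_0 0 \<xi>" for \<xi>
    by (simp add: A.Phi_0_def B.Phi_0_def a0_eq A.EP_def A.EM_def B.EP_def B.EM_def)
  then have "(Phi L \<xi> 0 - A.Phi_0 0 \<xi>) - (Phi Lt \<xi> 0 - B.Phi_0 0 \<xi>) = weyl L \<xi> - weyl Lt \<xi>" for \<xi>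
    by (simp add: weyl_def)
  then show ?thesis
    using growth_diff[OF A.Phi_asymptotics(1)[OF z] B.Phi_asymptotics(1)[OF z]] by simp
qed

end

section \<open>Contour integrals\<close>

lemma entire_mat_det: "entire_mat A \<Longrightarrow> (\<lambda>\<xi>. det (A \<xi>)) holomorphic_on UNIV"
  unfolding det_def entire_mat_def by (intro holomorphic_intros) auto

lemma contour_integral_rectpath_bound:
  assumes f: "f contour_integrable_on (rectpath a b)" and ab: "Re a \<le> Re b" "Im a \<le> Im b"
    and B: "\<And>z. z \<in> path_image (rectpath a b) \<Longrightarrow> norm (f z) \<le> B" "B \<ge> 0"
  shows "norm (contour_integral (rectpath a b) f) \<le> B * (2 * (Re b - Re a) + 2 * (Im b - Im a))"
proof -
  define p q where "p = Complex (Re b) (Im a)" and "q = Complex (Re a) (Im b)"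
  have rp: "rectpath a b = linepath a p +++ linepath p b +++ linepath b q +++ linepath q a"
    by (simp add: rectpath_def Let_def p_def q_def)
  have i: "f contour_integrable_on linepath a p" "f contour_integrable_on linepath p b"
    "f contour_integrable_on linepath b q" "f contour_integrable_on linepath q a"
    using f unfolding rp by auto
  have sub: "closed_segment a p \<subseteq> path_image (rectpath a b)" "closed_segment p b \<subseteq> path_image (rectpath a b)"
    "closed_segment b q \<subseteq> path_image (rectpath a b)" "closed_segment q a \<subseteq> path_image (rectpath a b)"
    unfolding rp by (auto simp: path_image_join)
  have n: "norm (p - a) = Re b - Re a" "norm (b - p) = Im b - Im a" "norm (q - b) = Re b - Re a" "norm (a - q) = Im b - Im a"
    using ab by (simp_all add: p_def q_def cmod_def)
  have "norm (contour_integral (rectpath a b) f)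
      \<le> norm (contour_integral (linepath a p) f) + (norm (contour_integral (linepath p b) f)
        + (norm (contour_integral (linepath b q) f) + norm (contour_integral (linepath q a) f)))"
    unfolding rp using i by (simp, intro order_trans[OF norm_triangle_ineq] add_left_mono order_refl)
  also have "\<dots> \<le> B * norm (p - a) + (B * norm (b - p) + (B * norm (q - b) + B * norm (a - q)))"
    using sub B i by (intro add_mono contour_integral_bound_linepath) auto
  also have "\<dots> = B * (2 * (Re b - Re a) + 2 * (Im b - Im a))"
    unfolding n by (simp add: algebra_simps)
  finally show ?thesis .
qed

lemma Cauchy_rectpath:
  assumes "f holomorphic_on UNIV" "w \<in> box a b"
  shows "((\<lambda>z. f z / (z - w)) has_contour_integral (2 * of_real pi * \<i> * f w)) (rectpath a b)"
proof -
  have "path_image (rectpath a b) \<subseteq> UNIV - {w}"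
    using path_image_rectpath_inter_box[of a b] assms(2) by (auto simp: in_box_complex_iff)
  then show ?thesis
    using Cauchy_integral_formula_convex_simple[of UNIV f w "rectpath a b"] assms winding_number_rectpath[OF assms(2)]
    by simp
qed

context regular_pencil
begin

text \<open>The numerator in Cramer's rule for the equation V(phi) M = -V(sisol). It exhibits the
  Weyl matrix, whose values at the eigenvalues are unspecified, as a quotient of entire functions
  elsewhere.\<close>

definition weyl_num :: "'m \<Rightarrow> 'm \<Rightarrow> complex \<Rightarrow> complex"
  where "weyl_num i j \<xi> = det ((\<chi> k l. if l = i then (- VSmat L \<xi>) $ k $ j else Vmat L \<xi> $ k $ l) :: complex^'m^'m)"

lemma weyl_cramer:
  assumes "char_fun L \<xi> \<noteq> 0"
  shows "weyl L \<xi> $ i $ j = weyl_num i j \<xi> / char_fun L \<xi>"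
proof -
  have d: "det (Vmat L \<xi>) \<noteq> 0" using assms by (simp add: char_fun_eq)
  have "Vmat L \<xi> *v (\<chi> k. weyl L \<xi> $ k $ j) = (\<chi> k. (- VSmat L \<xi>) $ k $ j)"
    using Phi_spec(3)[OF assms] by (simp add: vec_eq_iff matrix_mult_nth matrix_vector_mult_def)
  then have "(\<chi> k. weyl L \<xi> $ k $ j) $ i = (\<chi> i. det (\<chi> k l. if l = i then (\<chi> k. (- VSmat L \<xi>) $ k $ j) $ k else Vmat L \<xi> $ k $ l) / det (Vmat L \<xi>)) $ i"
    by (simp only: cramer[OF d])
  then show ?thesis by (simp only: vec_lambda_beta weyl_num_def char_fun_eq)
qed

lemma holomorphic_weyl_num: "weyl_num i j holomorphic_on UNIV"
  unfolding weyl_num_def[abs_def]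
proof (rule entire_mat_det)
  show "entire_mat (\<lambda>\<xi>. (\<chi> k l. if l = i then (- VSmat L \<xi>) $ k $ j else Vmat L \<xi> $ k $ l) :: complex^'m^'m)"
    unfolding entire_mat_def
  proof (intro allI)
    fix k l
    show "(\<lambda>\<xi>. ((\<chi> k l. if l = i then (- VSmat L \<xi>) $ k $ j else Vmat L \<xi> $ k $ l) :: complex^'m^'m) $ k $ l) holomorphic_on UNIV"
      using entire_Vmat by (cases "l = i") (auto simp: entire_mat_def intro!: holomorphic_intros)
  qed
qed

lemma open_resolvent: "open {\<xi>. char_fun L \<xi> \<noteq> 0}"
  using open_Collect_neq[of "char_fun L" "\<lambda>_. 0"] holomorphic_on_imp_continuous_on[OF holomorphic_char_fun]
  by auto

lemma holomorphic_weyl: "(\<lambda>\<xi>. weyl L \<xi> $ i $ j) holomorphic_on {\<xi>. char_fun L \<xi> \<noteq> 0}"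
proof (rule holomorphic_transform)
  show "(\<lambda>\<xi>. weyl_num i j \<xi> / char_fun L \<xi>) holomorphic_on {\<xi>. char_fun L \<xi> \<noteq> 0}"
    by (intro holomorphic_intros holomorphic_on_subset[OF holomorphic_weyl_num] holomorphic_on_subset[OF holomorphic_char_fun]) auto
qed (simp add: weyl_cramer)

end

section \<open>Residues of the Weyl matrix and location of the eigenvalues\<close>

locale spectral_pencil = regular_pencil L for L :: "'m::finite pencil" +
  fixes \<omega> :: "'m \<Rightarrow> real" and ev :: "windex \<Rightarrow> 'm \<Rightarrow> complex"
  assumes char_fun_nonzero: "\<exists>\<beta>. char_fun L \<beta> \<noteq> 0"
    and simple: "simple_real_spectrum L" and numbering: "eigenvalue_numbering L \<omega> ev"
begin

lemma punctured_resolvent: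
  assumes "eigenvalue L z"
  obtains r where "r > 0" "\<And>\<xi>. \<xi> \<in> ball z r - {z} \<Longrightarrow> char_fun L \<xi> \<noteq> 0"
proof -
  obtain \<beta> where \<beta>: "char_fun L \<beta> \<noteq> 0" using char_fun_nonzero by blast
  show ?thesis
    by (rule isolated_zeros[OF holomorphic_char_fun open_UNIV connected_UNIV UNIV_I _ UNIV_I \<beta>, of z])
       (use assms that in \<open>auto simp: eigenvalue_def\<close>)
qed

text \<open>Each entry is near \<open>z\<close> a quotient of entire functions, hence has a pole or
  a limit there. A pole is simple by assumption, so in either case multiplication by
  \<open>\<xi> - z\<close> yields a limit, and that limit is the residue.\<close>

lemma weyl_residue_limit:
  assumes z: "eigenvalue L z"
  shows "((\<lambda>\<xi>. weyl L \<xi> $ i $ j * (\<xi> - z)) \<longlongrightarrow> weyl_residue L z $ i $ j) (at z)"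
proof -
  let ?f = "\<lambda>\<xi>. weyl L \<xi> $ i $ j"
  obtain r where r: "r > 0" and nz: "\<And>\<xi>. \<xi> \<in> ball z r - {z} \<Longrightarrow> char_fun L \<xi> \<noteq> 0"
    using punctured_resolvent[OF z] by blast
  have holo: "?f holomorphic_on ball z r - {z}"
    by (rule holomorphic_on_subset[OF holomorphic_weyl]) (use nz in auto)
  have an: "weyl_num i j analytic_on {z}" "char_fun L analytic_on {z}"
    using holomorphic_weyl_num holomorphic_char_fun by (auto simp: analytic_at intro: open_UNIV)
  have ness: "not_essential ?f z"
  proof (rule not_essential_transform)
    show "not_essential (\<lambda>\<xi>. weyl_num i j \<xi> / char_fun L \<xi>) z"
      by (intro not_essential_divide not_essential_analytic isolated_singularity_at_analytic an)
    have "\<forall>\<^sub>F \<xi> in at z. \<xi> \<in> ball z r - {z}"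
      using r eventually_at_in_open[of "ball z r" z] by simp
    then show "\<forall>\<^sub>F \<xi> in at z. weyl_num i j \<xi> / char_fun L \<xi> = ?f \<xi>"
      by (rule eventually_mono) (use nz weyl_cramer in auto)
  qed
  have "\<exists>c. ((\<lambda>\<xi>. ?f \<xi> * (\<xi> - z)) \<longlongrightarrow> c) (at z)"
  proof (cases "is_pole ?f z")
    case True
    then have zo: "zorder ?f z = - 1" using simple by (auto simp: simple_real_spectrum_def)
    from zorder_exist_pole[OF holo open_ball _ True] r zo obtain s where s: "s > 0"
      and g: "zor_poly ?f z holomorphic_on cball z s"
      and fg: "\<And>w. w \<in> cball z s - {z} \<Longrightarrow> ?f w = zor_poly ?f z w / (w - z) ^ 1" by auto
    have "isCont (zor_poly ?f z) z"
      using g s by (intro continuous_on_interior[OF holomorphic_on_imp_continuous_on]) auto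
    then have "(zor_poly ?f z \<longlongrightarrow> zor_poly ?f z z) (at z)" by (simp add: isCont_def)
    moreover have "\<forall>\<^sub>F \<xi> in at z. \<xi> \<in> ball z s - {z}"
      using s eventually_at_in_open[of "ball z s" z] by simp
    then have "\<forall>\<^sub>F \<xi> in at z. zor_poly ?f z \<xi> = ?f \<xi> * (\<xi> - z)"
      by (rule eventually_mono) (use fg in auto)
    ultimately have "((\<lambda>\<xi>. ?f \<xi> * (\<xi> - z)) \<longlongrightarrow> zor_poly ?f z z) (at z)"
      by (rule Lim_transform_eventually)
    then show ?thesis by blast
  next
    case False
    then obtain c where "(?f \<longlongrightarrow> c) (at z)" using ness by (auto simp: not_essential_def)
    then have "((\<lambda>\<xi>. ?f \<xi> * (\<xi> - z)) \<longlongrightarrow> c * (z - z)) (at z)" by (intro tendsto_intros)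
    then show ?thesis by blast
  qed
  then obtain c where c: "((\<lambda>\<xi>. ?f \<xi> * (\<xi> - z)) \<longlongrightarrow> c) (at z)" by blast
  have "residue ?f z = c"
    by (rule residue_simple'[OF open_ball _ holo c]) (use r in auto)
  then show ?thesis using c by (simp add: weyl_residue_def)
qed

lemma eigenvalue_ev: "eigenvalue L (ev n q)"
  using numbering by (simp add: eigenvalue_numbering_def)

lemma fiber: "eigenvalue L z \<Longrightarrow> finite {(n, q). ev n q = z}" "eigenvalue L z \<Longrightarrow> card {(n, q). ev n q = z} = mult L z"
  using numbering by (auto simp: eigenvalue_numbering_def)

lemma mult_pos:
  assumes "eigenvalue L z" shows "mult L z > 0"
proof -
  have "\<exists>w\<in>UNIV. char_fun L w \<noteq> 0" using char_fun_nonzero by simp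
  from zorder_exist_zero[OF holomorphic_char_fun open_UNIV connected_UNIV UNIV_I this, of z]
  show ?thesis using assms by (simp add: mult_def eigenvalue_def)
qed

lemma eigenvalue_numbered: "eigenvalue L z \<Longrightarrow> \<exists>n q. ev n q = z"
proof (rule ccontr)
  assume z: "eigenvalue L z" and "\<nexists>n q. ev n q = z"
  then have "{(n, q). ev n q = z} = {}" by auto
  then show False using fiber(2)[OF z] mult_pos[OF z] by simp
qed

lemma finite_wval_le: "finite {n. \<bar>wval n\<bar> \<le> k}"
proof (rule finite_subset)
  show "{n. \<bar>wval n\<bar> \<le> k} \<subseteq> Pos ` {..nat k} \<union> Neg ` {..nat k}"
  proof
    fix n assume "n \<in> {n. \<bar>wval n\<bar> \<le> k}"
    then show "n \<in> Pos ` {..nat k} \<union> Neg ` {..nat k}" by (cases n) auto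
  qed
qed auto

lemma ev_near:
  assumes e: "e > 0"
  obtains n0 where "n0 \<ge> 0" "\<And>n q. n0 \<le> \<bar>wval n\<bar> \<Longrightarrow> norm (ev n q - (of_int (wval n) + of_real (\<omega> q))) < e"
proof -
  have "\<exists>k\<ge>0. \<forall>n. k \<le> \<bar>wval n\<bar> \<longrightarrow> norm (ev n q - (of_int (wval n) + of_real (\<omega> q))) < e" for q
  proof -
    have "(\<lambda>n. ev n q - (of_int (wval n) + of_real (\<omega> q))) \<in> O[cofinite](\<lambda>n. 1 / of_int (wval n))"
      using numbering by (simp add: eigenvalue_numbering_def)
    then obtain C where C: "C > 0" and
      ev: "\<forall>\<^sub>F n in cofinite. norm (ev n q - (of_int (wval n) + of_real (\<omega> q))) \<le> C * norm (1 / of_int (wval n) :: complex)"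
      by (elim landau_o.bigE) 
    define X where "X = {n. \<not> norm (ev n q - (of_int (wval n) + of_real (\<omega> q))) \<le> C * norm (1 / of_int (wval n) :: complex)}"
    have X: "finite X" using ev by (simp add: X_def eventually_cofinite)
    \<comment> \<open>The first part makes the bound \<open>C\<close> over
      \<open>\<bar>wval n\<bar>\<close> smaller than \<open>e\<close>; the sum exceeds every index
      in the finite exceptional set \<open>X\<close>, which \<open>n\<close> therefore
      avoids.\<close>
    define k where "k = \<lceil>C / e\<rceil> + 1 + (\<Sum>n\<in>X. \<bar>wval n\<bar> + 1)"
    have s0: "(\<Sum>n\<in>X. \<bar>wval n\<bar> + 1) \<ge> 0" by (intro sum_nonneg) auto
    have Ce: "C / e > 0" using C e by simp
    then have c0: "\<lceil>C / e\<rceil> > 0" by simp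
    show ?thesis
    proof (intro exI[of _ k] conjI allI impI)
      show "k \<ge> 0" using s0 c0 by (simp add: k_def)
      fix n assume n: "k \<le> \<bar>wval n\<bar>"
      have "n \<notin> X"
      proof
        assume "n \<in> X"
        then have "\<bar>wval n\<bar> + 1 \<le> (\<Sum>n\<in>X. \<bar>wval n\<bar> + 1)" using X by (intro member_le_sum) auto
        then show False using n c0 by (simp add: k_def)
      qed
      then have b: "norm (ev n q - (of_int (wval n) + of_real (\<omega> q))) \<le> C * norm (1 / of_int (wval n) :: complex)"
        by (simp add: X_def)
      have "C / e < of_int \<bar>wval n\<bar>" using n s0 unfolding k_def by linarith
      then have "C < e * real_of_int \<bar>wval n\<bar>" using e by (simp add: field_simps)
      moreover have "real_of_int \<bar>wval n\<bar> > 0" using \<open>C / e < of_int \<bar>wval n\<bar>\<close> Ce by linarith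
      ultimately have "C * norm (1 / of_int (wval n) :: complex) < e"
        by (simp add: norm_divide field_simps)
      then show "norm (ev n q - (of_int (wval n) + of_real (\<omega> q))) < e" using b by linarith
    qed
  qed
  then obtain k where k: "\<And>q. k q \<ge> 0" "\<And>q n. k q \<le> \<bar>wval n\<bar> \<Longrightarrow> norm (ev n q - (of_int (wval n) + of_real (\<omega> q))) < e"
    by metis
  have le: "k q \<le> (\<Sum>q\<in>UNIV. k q)" for q using k(1) by (intro member_le_sum) auto
  show ?thesis
  proof (rule that[of "\<Sum>q\<in>UNIV. k q"])
    show "(\<Sum>q\<in>UNIV. k q) \<ge> 0" using k(1) by (simp add: sum_nonneg)
    show "norm (ev n q - (of_int (wval n) + of_real (\<omega> q))) < e" if "(\<Sum>q\<in>UNIV. k q) \<le> \<bar>wval n\<bar>" for n q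
      using k(2)[OF order_trans[OF le that]] .
  qed
qed

lemma finite_bounded_eigenvalues: "finite {(n, q). norm (ev n q) \<le> R}"
proof -
  obtain n0 where n0: "n0 \<ge> 0" "\<And>n q. n0 \<le> \<bar>wval n\<bar> \<Longrightarrow> norm (ev n q - (of_int (wval n) + of_real (\<omega> q))) < 1"
    using ev_near[of 1] by auto
  define K where "K = max n0 (\<lceil>R + 1 + (\<Sum>q\<in>UNIV. \<bar>\<omega> q\<bar>)\<rceil>)"
  have "{(n, q). norm (ev n q) \<le> R} \<subseteq> {n. \<bar>wval n\<bar> \<le> K} \<times> UNIV"
  proof clarsimp
    fix n q assume R: "norm (ev n q) \<le> R"
    show "\<bar>wval n\<bar> \<le> K"
    proof (rule ccontr)
      assume "\<not> \<bar>wval n\<bar> \<le> K"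
      then have n: "n0 \<le> \<bar>wval n\<bar>" "real_of_int \<bar>wval n\<bar> > R + 1 + (\<Sum>q\<in>UNIV. \<bar>\<omega> q\<bar>)"
        unfolding K_def by linarith+
      have "\<bar>\<omega> q\<bar> \<le> (\<Sum>q\<in>UNIV. \<bar>\<omega> q\<bar>)" by (intro member_le_sum) auto
      moreover have "norm (of_int (wval n) :: complex) \<le> norm (ev n q) + norm (ev n q - (of_int (wval n) + of_real (\<omega> q))) + norm (of_real (\<omega> q) :: complex)"
        by norm
      ultimately show False using n0(2)[OF n(1), of q] R n(2) by simp
    qed
  qed
  then show ?thesis by (rule finite_subset) (simp add: finite_wval_le)
qed

text \<open>The residue theorem. An eigenvalue \<open>z\<close> is listed \<open>mult L z\<close>
  times and its weight divides the residue by that number, so the sum over index pairs counts every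
  residue once.\<close>

lemma box_residues:
  assumes K: "entire_mat K" and J: "entire_mat J" and ab: "Re a \<le> Re b" "Im a \<le> Im b"
    and avoid: "\<And>z. z \<in> path_image (rectpath a b) \<Longrightarrow> char_fun L z \<noteq> 0"
  shows "((\<lambda>\<xi>. (K \<xi> ** weyl L \<xi> ** J \<xi>) $ i $ j) has_contour_integral
      (2 * of_real pi * \<i> * (\<Sum>(n, q) | ev n q \<in> box a b. K (ev n q) ** weight L (ev n q) ** J (ev n q)) $ i $ j)) (rectpath a b)"
proof -
  let ?f = "\<lambda>\<xi>. (K \<xi> ** weyl L \<xi> ** J \<xi>) $ i $ j"
  have fK: "(\<lambda>\<xi>. K \<xi> $ k $ l) holomorphic_on S" for k l S
    using K holomorphic_on_subset[of "\<lambda>\<xi>. K \<xi> $ k $ l" UNIV S] by (simp add: entire_mat_def)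
  have fJ: "(\<lambda>\<xi>. J \<xi> $ k $ l) holomorphic_on S" for k l S
    using J holomorphic_on_subset[of "\<lambda>\<xi>. J \<xi> $ k $ l" UNIV S] by (simp add: entire_mat_def)
  have holo: "?f holomorphic_on {\<xi>. char_fun L \<xi> \<noteq> 0}"
    by (auto simp: matrix_mult_nth intro!: holomorphic_intros fK fJ holomorphic_weyl)
  have int: "?f contour_integrable_on (rectpath a b)"
    by (rule contour_integrable_holomorphic_simple[OF holo open_resolvent]) (use avoid in auto)
  obtain R where R: "cbox a b \<subseteq> ball 0 R"
    using bounded_subset_ballD[OF bounded_cbox[of a b]] by blast
  \<comment> \<open>The residue theorem is applied in a larger ball; eigenvalues outside the box
    have winding number 0 and drop out afterwards.\<close>
  define pts where "pts = {z. eigenvalue L z \<and> z \<in> ball 0 R}"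
  have "pts \<subseteq> (\<lambda>(n, q). ev n q) ` {(n, q). norm (ev n q) \<le> R}"
  proof
    fix z assume "z \<in> pts"
    then have "eigenvalue L z" "norm z \<le> R" by (auto simp: pts_def)
    moreover from this(1) obtain n q where "ev n q = z" using eigenvalue_numbered by blast
    ultimately have "(n, q) \<in> {(n, q). norm (ev n q) \<le> R}" "(\<lambda>(n, q). ev n q) (n, q) = z" by auto
    then show "z \<in> (\<lambda>(n, q). ev n q) ` {(n, q). norm (ev n q) \<le> R}" by blast
  qed
  then have fin: "finite pts" using finite_bounded_eigenvalues finite_surj by blast
  have pim: "path_image (rectpath a b) \<subseteq> cbox a b"
    using path_image_rectpath_subset_cbox[OF ab] .
  have "contour_integral (rectpath a b) ?f = 2 * pi * \<i> * (\<Sum>p\<in>pts. winding_number (rectpath a b) p * residue ?f p)"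
  proof (rule Residue_theorem)
    show "?f holomorphic_on ball 0 R - pts"
      by (rule holomorphic_on_subset[OF holo]) (auto simp: pts_def eigenvalue_def)
    show "path_image (rectpath a b) \<subseteq> ball 0 R - pts"
      using pim R avoid by (auto simp: pts_def eigenvalue_def)
    show "\<forall>z. z \<notin> ball 0 R \<longrightarrow> winding_number (rectpath a b) z = 0"
      using R winding_number_rectpath_outside[OF ab] by blast
  qed (use fin in auto)
  also have "(\<Sum>p\<in>pts. winding_number (rectpath a b) p * residue ?f p)
      = (\<Sum>p\<in>pts \<inter> box a b. (K p ** weyl_residue L p ** J p) $ i $ j)"
  proof (rule sum.mono_neutral_cong_right)
    show "\<forall>p\<in>pts - pts \<inter> box a b. winding_number (rectpath a b) p * residue ?f p = 0"
    proof
      fix p assume p: "p \<in> pts - pts \<inter> box a b"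
      then have "p \<notin> path_image (rectpath a b)" using avoid by (auto simp: pts_def eigenvalue_def)
      then have "p \<notin> cbox a b" using p path_image_rectpath_cbox_minus_box[OF ab] by blast
      then show "winding_number (rectpath a b) p * residue ?f p = 0"
        using winding_number_rectpath_outside[OF ab] by simp
    qed
    fix p assume p: "p \<in> pts \<inter> box a b"
    then have ev: "eigenvalue L p" by (simp add: pts_def)
    obtain r where r: "r > 0" "\<And>\<xi>. \<xi> \<in> ball p r - {p} \<Longrightarrow> char_fun L \<xi> \<noteq> 0"
      using punctured_resolvent[OF ev] by blast
    have cont: "((\<lambda>\<xi>. K \<xi> $ k $ l) \<longlongrightarrow> K p $ k $ l) (at p)" for k l
      using holomorphic_on_imp_continuous_on[OF fK[of k l UNIV]] by (simp add: continuous_on_eq_continuous_at isCont_def)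
    have contJ: "((\<lambda>\<xi>. J \<xi> $ k $ l) \<longlongrightarrow> J p $ k $ l) (at p)" for k l
      using holomorphic_on_imp_continuous_on[OF fJ[of k l UNIV]] by (simp add: continuous_on_eq_continuous_at isCont_def)
    have "((\<lambda>\<xi>. \<Sum>l\<in>UNIV. (\<Sum>k\<in>UNIV. K \<xi> $ i $ k * (weyl L \<xi> $ k $ l * (\<xi> - p))) * J \<xi> $ l $ j)
        \<longlongrightarrow> (\<Sum>l\<in>UNIV. (\<Sum>k\<in>UNIV. K p $ i $ k * weyl_residue L p $ k $ l) * J p $ l $ j)) (at p)"
      by (intro tendsto_intros cont contJ weyl_residue_limit ev)
    moreover have "(\<Sum>l\<in>UNIV. (\<Sum>k\<in>UNIV. K \<xi> $ i $ k * (weyl L \<xi> $ k $ l * (\<xi> - p))) * J \<xi> $ l $ j) = ?f \<xi> * (\<xi> - p)" for \<xi>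
      by (simp add: matrix_mult_nth sum_distrib_right sum_distrib_left mult_ac)
    ultimately have "((\<lambda>\<xi>. ?f \<xi> * (\<xi> - p)) \<longlongrightarrow> (K p ** weyl_residue L p ** J p) $ i $ j) (at p)"
      by (simp add: matrix_mult_nth)
    then have "residue ?f p = (K p ** weyl_residue L p ** J p) $ i $ j"
      by (intro residue_simple'[of "ball p r"] holomorphic_on_subset[OF holo]) (use r in auto)
    then show "winding_number (rectpath a b) p * residue ?f p = (K p ** weyl_residue L p ** J p) $ i $ j"
      using winding_number_rectpath p by simp
  qed (use fin in auto)
  also have "(\<Sum>p\<in>pts \<inter> box a b. (K p ** weyl_residue L p ** J p) $ i $ j)
      = (\<Sum>p\<in>pts \<inter> box a b. \<Sum>x | x \<in> {(n, q). ev n q \<in> box a b} \<and> (case x of (n, q) \<Rightarrow> ev n q) = p.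
          case x of (n, q) \<Rightarrow> (K (ev n q) ** weight L (ev n q) ** J (ev n q)) $ i $ j)"
  proof (rule sum.cong[OF refl])
    fix p assume p: "p \<in> pts \<inter> box a b"
    then have evp: "eigenvalue L p" by (simp add: pts_def)
    have eq: "{x. x \<in> {(n, q). ev n q \<in> box a b} \<and> (case x of (n, q) \<Rightarrow> ev n q) = p} = {(n, q). ev n q = p}"
      using p by auto
    have "(\<Sum>x | x \<in> {(n, q). ev n q \<in> box a b} \<and> (case x of (n, q) \<Rightarrow> ev n q) = p.
          case x of (n, q) \<Rightarrow> (K (ev n q) ** weight L (ev n q) ** J (ev n q)) $ i $ j)
        = (\<Sum>x\<in>{(n, q). ev n q = p}. (K p ** weight L p ** J p) $ i $ j)"
      unfolding eq by (rule sum.cong) auto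
    also have "\<dots> = of_nat (mult L p) * (K p ** weight L p ** J p) $ i $ j"
      using fiber(2)[OF evp] by simp
    also have "(K p ** weight L p ** J p) = (1 / of_nat (mult L p)) *\<^sub>M (K p ** weyl_residue L p ** J p)"
      by (simp add: weight_def cscale_mult_left cscale_mult_right)
    finally show "(K p ** weyl_residue L p ** J p) $ i $ j = (\<Sum>x | x \<in> {(n, q). ev n q \<in> box a b} \<and> (case x of (n, q) \<Rightarrow> ev n q) = p.
          case x of (n, q) \<Rightarrow> (K (ev n q) ** weight L (ev n q) ** J (ev n q)) $ i $ j)"
      using mult_pos[OF evp] by simp
  qed
  also have "\<dots> = (\<Sum>x\<in>{(n, q). ev n q \<in> box a b}. case x of (n, q) \<Rightarrow> (K (ev n q) ** weight L (ev n q) ** J (ev n q)) $ i $ j)"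
  proof (rule sum.group)
    have sub: "box a b \<subseteq> ball 0 R" using R box_subset_cbox by blast
    show "finite {(n, q). ev n q \<in> box a b}"
      by (rule finite_subset[OF _ finite_bounded_eigenvalues[of R]]) (use sub in force)
    show "(\<lambda>x. case x of (n, q) \<Rightarrow> ev n q) ` {(n, q). ev n q \<in> box a b} \<subseteq> pts \<inter> box a b"
      using sub eigenvalue_ev by (auto simp: pts_def)
  qed (use fin in auto)
  also have "\<dots> = (\<Sum>(n, q) | ev n q \<in> box a b. K (ev n q) ** weight L (ev n q) ** J (ev n q)) $ i $ j"
    by (simp add: case_prod_unfold)
  finally show ?thesis using has_contour_integral_integral[OF int] by simp
qed

end

text \<open>All contours are rectangles whose vertical sides lie on the lines \<open>Re \<xi> \<in> c + \<int>\<close>,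
  where \<open>max\<^sub>q \<omega>\<^sub>q < c < 1\<close>, and whose horizontal sides satisfy \<open>\<bar>Im \<xi>\<bar> \<ge> 1/2\<close>.\<close>

definition grid :: "real \<Rightarrow> complex set"
  where "grid c = {\<xi>. 1/2 \<le> \<bar>Im \<xi>\<bar> \<or> (\<exists>k::int. Re \<xi> = c + of_int k)}"

definition gridF :: "real \<Rightarrow> complex filter"
  where "gridF c = inf at_infinity (principal (grid c))"

lemma eventually_gridF:
  "eventually P (gridF c) \<longleftrightarrow> (\<exists>r. \<forall>\<xi>\<in>grid c. r \<le> norm \<xi> \<longrightarrow> P \<xi>)"
  by (auto simp: gridF_def eventually_inf_principal eventually_at_infinity)

lemma gridF_le: "gridF c \<le> at_infinity"
  by (simp add: gridF_def)

text \<open>Points far up the imaginary axis belong to the grid, so the contour filter is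
  nontrivial. This turns eventual nonvanishing of \<open>char_fun\<close> into a point where it does
  not vanish.\<close>

lemma gridF_witness:
  assumes "eventually P (gridF c)" shows "\<exists>\<xi>. P \<xi>"
proof -
  obtain r where r: "\<And>\<xi>. \<xi> \<in> grid c \<Longrightarrow> r \<le> norm \<xi> \<Longrightarrow> P \<xi>"
    using assms by (auto simp: eventually_gridF)
  have "P (of_real (\<bar>r\<bar> + 1) * \<i>)"
    by (rule r) (auto simp: grid_def norm_mult)
  then show ?thesis by blast
qed

section \<open>Lower bounds for the sine on the contours\<close>

lemma norm_sin_ge_sinh: "norm (sin w) \<ge> (exp \<bar>Im w\<bar> - exp (- \<bar>Im w\<bar>)) / 2" for w :: complex
proof -
  have n: "norm (exp (\<i> * w)) = exp (- Im w)" "norm (exp (- (\<i> * w))) = exp (Im w)"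
    by (simp_all add: norm_exp_eq_Re)
  have "norm (exp (\<i> * w) - exp (- (\<i> * w))) \<ge> \<bar>exp (- Im w) - exp (Im w)\<bar>"
    using norm_triangle_ineq3[of "exp (\<i> * w)" "exp (- (\<i> * w))"] n by simp
  moreover have "norm (sin w) = norm (exp (\<i> * w) - exp (- (\<i> * w))) / 2"
    by (simp add: sin_exp_eq norm_divide norm_mult)
  moreover have "\<bar>exp (- Im w) - exp (Im w)\<bar> \<ge> exp \<bar>Im w\<bar> - exp (- \<bar>Im w\<bar>)"
    by (cases "Im w \<ge> 0") auto
  ultimately show ?thesis by simp
qed

lemma norm_sin_ge_sin_Re: "norm (sin w) \<ge> \<bar>sin (Re w)\<bar>" for w :: complex
proof -
  have "2 \<le> exp (Im w) + exp (- Im w)"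
    using exp_ge_add_one_self[of "Im w"] exp_ge_add_one_self[of "- Im w"] by linarith
  then have "\<bar>sin (Re w)\<bar> * 1 \<le> \<bar>sin (Re w)\<bar> * ((exp (Im w) + exp (- Im w)) / 2)"
    by (intro mult_left_mono) auto
  also have "\<dots> = \<bar>Re (sin w)\<bar>" by (simp add: Re_sin abs_mult)
  also have "\<dots> \<le> norm (sin w)" by (rule abs_Re_le_cmod)
  finally show ?thesis by simp
qed

text \<open>Where \<open>1/2 \<le> \<bar>Im \<xi>\<bar>\<close>, the hyperbolic growth of the sine
  gives the constant 1/4. On the vertical lines closer to the real axis the real part bounds the
  sine from below by \<open>sin (pi * (c - \<omega> q))\<close>, which is positive because
  \<open>c - \<omega> q\<close> lies strictly between 0 and 1.\<close>

lemma contour_filter_grid: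
  fixes \<omega> :: "'m::finite \<Rightarrow> real"
  assumes \<omega>: "\<And>q. 0 \<le> \<omega> q" "\<And>q. \<omega> q < c" and c: "c < 1"
  obtains \<delta> where "contour_filter (gridF c) \<omega> \<delta>"
proof -
  \<comment> \<open>The factor \<open>exp (- pi / 2)\<close> offsets the growth of
    \<open>exp (pi * \<bar>Im \<xi>\<bar>)\<close> for
    \<open>\<bar>Im \<xi>\<bar> < 1/2\<close>.\<close>
  define s where "s = (\<lambda>q. sin (pi * (c - \<omega> q)) * exp (- pi / 2))"
  define \<delta> where "\<delta> = Min (insert (1/4) (range s))"
  have s: "s q > 0" for q
  proof -
    have "0 < c - \<omega> q" "c - \<omega> q < 1" using \<omega>[of q] c by auto
    then have "0 < pi * (c - \<omega> q)" "pi * (c - \<omega> q) < pi" by simp_all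
    then show ?thesis by (simp add: s_def sin_gt_zero)
  qed
  have \<delta>: "\<delta> > 0" using s by (simp add: \<delta>_def)
  have \<delta>_le: "\<delta> \<le> 1/4" "\<delta> \<le> s q" for q
    unfolding \<delta>_def by (rule Min_le; simp)+
  have sep: "\<delta> * exp (pi * \<bar>Im \<xi>\<bar>) \<le> norm (sin (of_real pi * (\<xi> - of_real (\<omega> q))))" if "\<xi> \<in> grid c" for \<xi> q
  proof (cases "1/2 \<le> \<bar>Im \<xi>\<bar>")
    case True
    define t where "t = pi * \<bar>Im \<xi>\<bar>"
    have "t \<ge> 3/2" using True pi_gt3 mult_mono[of 3 pi "1/2" "\<bar>Im \<xi>\<bar>"] by (simp add: t_def)
    then have "2 \<le> exp t" using exp_ge_add_one_self[of t] by linarith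
    then have "1 / exp t \<le> 1 / 2" by (intro divide_left_mono) auto
    then have "exp (- t) \<le> 1 / 2" by (simp add: exp_minus inverse_eq_divide)
    with \<open>2 \<le> exp t\<close> have "exp (- t) \<le> exp t / 2" by linarith
    then have "exp t / 4 \<le> (exp t - exp (- t)) / 2" by simp
    moreover have "\<bar>Im (of_real pi * (\<xi> - of_real (\<omega> q)))\<bar> = t" by (simp add: t_def abs_mult)
    ultimately have "exp t / 4 \<le> norm (sin (of_real pi * (\<xi> - of_real (\<omega> q))))"
      using norm_sin_ge_sinh[of "of_real pi * (\<xi> - of_real (\<omega> q))"] by simp
    moreover have "\<delta> * exp t \<le> 1/4 * exp t" using \<delta>_le(1) by (intro mult_right_mono) auto
    ultimately have "\<delta> * exp t \<le> norm (sin (of_real pi * (\<xi> - of_real (\<omega> q))))" by linarith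
    then show ?thesis by (simp only: t_def)
  next
    case False
    with \<open>\<xi> \<in> grid c\<close> have "\<exists>k::int. Re \<xi> = c + of_int k" by (simp add: grid_def)
    then obtain k :: int where k: "Re \<xi> = c + of_int k" ..
    have "Re (of_real pi * (\<xi> - of_real (\<omega> q))) = pi * (c - \<omega> q) + of_int k * pi"
      by (simp add: k algebra_simps)
    moreover have s0: "sin (of_int k * pi) = 0" by (auto simp: sin_zero_iff_int2)
    moreover have "\<bar>cos (of_int k * pi)\<bar> = 1" by (rule sin_zero_abs_cos_one[OF s0])
    ultimately have "\<bar>sin (Re (of_real pi * (\<xi> - of_real (\<omega> q))))\<bar> = \<bar>sin (pi * (c - \<omega> q))\<bar>"
      by (simp only: sin_add abs_mult) (simp add: abs_mult)
    then have "sin (pi * (c - \<omega> q)) \<le> norm (sin (of_real pi * (\<xi> - of_real (\<omega> q))))"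
      using norm_sin_ge_sin_Re[of "of_real pi * (\<xi> - of_real (\<omega> q))"] by linarith
    moreover have "\<delta> * exp (pi * \<bar>Im \<xi>\<bar>) \<le> s q * exp (pi / 2)"
      using \<delta>_le(2)[of q] s[of q] False by (intro mult_mono) auto
    moreover have "s q * exp (pi / 2) = sin (pi * (c - \<omega> q))"
      by (simp add: s_def mult.assoc flip: exp_add)
    ultimately show ?thesis by simp
  qed
  have "contour_filter (gridF c) \<omega> \<delta>"
  proof
    show "gridF c \<le> at_infinity" by (rule gridF_le)
    show "\<delta> > 0" by (rule \<delta>)
    show "\<forall>\<^sub>F \<xi> in gridF c. \<forall>q. \<delta> * exp (pi * \<bar>Im \<xi>\<bar>) \<le> norm (sin (of_real pi * (\<xi> - of_real (\<omega> q))))"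
      using sep by (auto simp: eventually_gridF)
    fix P assume "eventually P (gridF c)"
    then obtain r where "\<And>\<xi>. \<xi> \<in> grid c \<Longrightarrow> r \<le> norm \<xi> \<Longrightarrow> P \<xi>" by (auto simp: eventually_gridF)
    then show "eventually (\<lambda>\<xi>. P (cnj \<xi>)) (gridF c)"
      unfolding eventually_gridF by (intro exI[of _ r]) (auto simp: grid_def)
  qed
  then show ?thesis by (rule that)
qed

text \<open>Slot \<open>n\<close> has width and height 1 and contains the points
  \<open>n + \<omega> q\<close>, since \<open>c - 1 < 0 \<le> \<omega> q < c\<close>. The big
  rectangle spans the slots from \<open>- N\<close> to \<open>N\<close>, and its height grows with
  its width.\<close>

definition slot_a :: "real \<Rightarrow> int \<Rightarrow> complex" where "slot_a c n = Complex (of_int n - 1 + c) (-1/2)"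
definition slot_b :: "real \<Rightarrow> int \<Rightarrow> complex" where "slot_b c n = Complex (of_int n + c) (1/2)"
definition big_a :: "real \<Rightarrow> nat \<Rightarrow> complex" where "big_a c N = Complex (- of_nat N - 1 + c) (- of_nat N - 1/2)"
definition big_b :: "real \<Rightarrow> nat \<Rightarrow> complex" where "big_b c N = Complex (of_nat N + c) (of_nat N + 1/2)"

lemma slot_path:
  assumes "0 < c" "c < 1" "z \<in> path_image (rectpath (slot_a c n) (slot_b c n))"
  shows "z \<in> grid c" "\<bar>Im z\<bar> \<le> 1/2" "norm z \<ge> of_int \<bar>n\<bar> - 1"
proof -
  have z: "(Re z = of_int n - 1 + c \<or> Re z = of_int n + c) \<and> - 1/2 \<le> Im z \<and> Im z \<le> 1/2 \<or>
      (Im z = - 1/2 \<or> Im z = 1/2) \<and> of_int n - 1 + c \<le> Re z \<and> Re z \<le> of_int n + c"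
    using assms(3) by (subst (asm) path_image_rectpath) (auto simp: slot_a_def slot_b_def)
  have "Re z = c + of_int (n - 1) \<or> Re z = c + of_int n \<or> 1/2 \<le> \<bar>Im z\<bar>" using z by auto
  then show "z \<in> grid c" unfolding grid_def by blast
  show "\<bar>Im z\<bar> \<le> 1/2" using z by (auto simp: abs_le_iff)
  have "\<bar>Re z\<bar> \<ge> of_int \<bar>n\<bar> - 1" using z assms(1,2) by (auto simp: abs_if)
  then show "norm z \<ge> of_int \<bar>n\<bar> - 1" using abs_Re_le_cmod[of z] by linarith
qed

lemma big_path:
  assumes "0 < c" "c < 1" "z \<in> path_image (rectpath (big_a c N) (big_b c N))"
  shows "z \<in> grid c" "norm z \<ge> of_nat N"
proof -
  have z: "(Re z = - of_nat N - 1 + c \<or> Re z = of_nat N + c) \<or> (Im z = - of_nat N - 1/2 \<or> Im z = of_nat N + 1/2)"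
    using assms(3) by (subst (asm) path_image_rectpath) (auto simp: big_a_def big_b_def)
  have "Re z = c + of_int (- int N - 1) \<or> Re z = c + of_int (int N) \<or> 1/2 \<le> \<bar>Im z\<bar>" using z by auto
  then show "z \<in> grid c" unfolding grid_def by blast
  have "\<bar>Re z\<bar> \<ge> of_nat N \<or> \<bar>Im z\<bar> \<ge> of_nat N" using z assms(1,2) by auto
  then show "norm z \<ge> of_nat N" using abs_Re_le_cmod[of z] abs_Im_le_cmod[of z] by linarith
qed

context spectral_pencil
begin

lemma ev_real: "Im (ev n q) = 0"
  using simple eigenvalue_ev[of n q] by (auto simp: simple_real_spectrum_def complex_is_Real_iff)

text \<open>Separates the indices for which the asymptotics already place the eigenvalue in its own
  slot from the finitely many others, which are merely bounded. This suffices to decide which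
  eigenvalues a rectangle contains.\<close>

lemma ev_located:
  assumes \<omega>: "\<And>q. 0 \<le> \<omega> q" "\<And>q. \<omega> q < c" and c: "c < 1"
  obtains n0 :: int and R :: real where "n0 \<ge> 0"
    "\<And>m q. n0 \<le> \<bar>wval m\<bar> \<Longrightarrow> of_int (wval m) - 1 + c < Re (ev m q) \<and> Re (ev m q) < of_int (wval m) + c"
    "\<And>m q. \<bar>wval m\<bar> < n0 \<Longrightarrow> \<bar>Re (ev m q)\<bar> \<le> R"
proof -
  \<comment> \<open>The distance from \<open>\<omega> q\<close> to the right edge of its slot is
    \<open>c - \<omega> q\<close>, and to the left edge it is at least \<open>1 - c\<close>.\<close>
  define e where "e = Min (insert (1 - c) (range (\<lambda>q. c - \<omega> q)))"
  have e: "e > 0" using \<omega> c by (auto simp: e_def)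
  have e_le: "e \<le> 1 - c" "e \<le> c - \<omega> q" for q
    unfolding e_def by (rule Min_le; simp)+
  obtain n0 where n0: "n0 \<ge> 0" "\<And>n q. n0 \<le> \<bar>wval n\<bar> \<Longrightarrow> norm (ev n q - (of_int (wval n) + of_real (\<omega> q))) < e"
    using ev_near[OF e] by metis
  have fin: "finite ({m. \<bar>wval m\<bar> \<le> n0} \<times> (UNIV :: 'm set))"
    using finite_wval_le by simp
  define R where "R = (\<Sum>(m, q)\<in>{m. \<bar>wval m\<bar> \<le> n0} \<times> UNIV. \<bar>Re (ev m q)\<bar>)"
  show ?thesis
  proof (rule that[of n0 R])
    fix m q assume "n0 \<le> \<bar>wval m\<bar>"
    from n0(2)[OF this, of q] have "\<bar>Re (ev m q) - (of_int (wval m) + \<omega> q)\<bar> < e"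
      using abs_Re_le_cmod[of "ev m q - (of_int (wval m) + of_real (\<omega> q))"] by simp
    then show "of_int (wval m) - 1 + c < Re (ev m q) \<and> Re (ev m q) < of_int (wval m) + c"
      using e_le(1) e_le(2)[of q] \<omega>(1)[of q] by linarith
  next
    fix m q assume m: "\<bar>wval m\<bar> < n0"
    have "(case (m, q) of (m, q) \<Rightarrow> \<bar>Re (ev m q)\<bar>) \<le> R"
      unfolding R_def by (rule member_le_sum) (use m fin in auto)
    then show "\<bar>Re (ev m q)\<bar> \<le> R" by simp
  qed (rule n0)
qed

lemma ev_in_slot:
  assumes \<omega>: "\<And>q. 0 \<le> \<omega> q" "\<And>q. \<omega> q < c" and c: "c < 1"
  obtains n1 :: int where "\<And>n m q. n1 \<le> \<bar>n\<bar> \<Longrightarrow> ev m q \<in> box (slot_a c n) (slot_b c n) \<longleftrightarrow> wval m = n"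
proof -
  have c0: "0 < c" using \<omega>[of undefined] by linarith
  obtain n0 R where n0: "n0 \<ge> 0"
    and l: "\<And>m q. n0 \<le> \<bar>wval m\<bar> \<Longrightarrow> of_int (wval m) - 1 + c < Re (ev m q) \<and> Re (ev m q) < of_int (wval m) + c"
    and s: "\<And>m q. \<bar>wval m\<bar> < n0 \<Longrightarrow> \<bar>Re (ev m q)\<bar> \<le> R"
    using ev_located[OF \<omega> c] by metis
  have eq: "ev m q \<in> box (slot_a c n) (slot_b c n) \<longleftrightarrow> of_int n - 1 + c < Re (ev m q) \<and> Re (ev m q) < of_int n + c" for m q n
    using ev_real by (auto simp: in_box_complex_iff slot_a_def slot_b_def)
  show ?thesis
  \<comment> \<open>The summand 2 puts the whole slot outside the strip of half-width
    \<open>R\<close> that holds the finitely many eigenvalues of small index.\<close>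
  proof (rule that[of "max n0 (\<lceil>\<bar>R\<bar>\<rceil> + 2)"])
    fix n m q assume n: "max n0 (\<lceil>\<bar>R\<bar>\<rceil> + 2) \<le> \<bar>n\<bar>"
    show "ev m q \<in> box (slot_a c n) (slot_b c n) \<longleftrightarrow> wval m = n"
    proof (cases "n0 \<le> \<bar>wval m\<bar>")
      case True
      note b = l[OF True, of q]
      show ?thesis
      proof
        assume "ev m q \<in> box (slot_a c n) (slot_b c n)"
        then have "of_int n - 1 + c < Re (ev m q)" "Re (ev m q) < of_int n + c" by (simp_all add: eq)
        with b have "real_of_int n - 1 < of_int (wval m)" "real_of_int (wval m) - 1 < of_int n" by linarith+
        then show "wval m = n" by linarith
      qed (use b in \<open>simp add: eq\<close>)
    next
      case False
      then have "\<bar>Re (ev m q)\<bar> \<le> R" using s by simp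
      moreover have "R + 2 \<le> of_int \<bar>n\<bar>" using n by linarith
      ultimately have "\<not> (of_int n - 1 + c < Re (ev m q) \<and> Re (ev m q) < of_int n + c)"
        using c c0 by (auto simp: abs_if split: if_splits)
      then show ?thesis using False n by (auto simp: eq)
    qed
  qed
qed

lemma ev_in_big:
  assumes \<omega>: "\<And>q. 0 \<le> \<omega> q" "\<And>q. \<omega> q < c" and c: "c < 1"
  obtains N1 :: nat where "\<And>N m q. N1 \<le> N \<Longrightarrow> ev m q \<in> box (big_a c N) (big_b c N) \<longleftrightarrow> \<bar>wval m\<bar> \<le> int N"
proof -
  have c0: "0 < c" using \<omega>[of undefined] by linarith
  obtain n0 R where n0: "n0 \<ge> 0"
    and l: "\<And>m q. n0 \<le> \<bar>wval m\<bar> \<Longrightarrow> of_int (wval m) - 1 + c < Re (ev m q) \<and> Re (ev m q) < of_int (wval m) + c"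
    and s: "\<And>m q. \<bar>wval m\<bar> < n0 \<Longrightarrow> \<bar>Re (ev m q)\<bar> \<le> R"
    using ev_located[OF \<omega> c] by metis
  have eq: "ev m q \<in> box (big_a c N) (big_b c N) \<longleftrightarrow> - of_nat N - 1 + c < Re (ev m q) \<and> Re (ev m q) < of_nat N + c" for m q N
    using ev_real by (auto simp: in_box_complex_iff big_a_def big_b_def)
  show ?thesis
  proof (rule that[of "nat (max n0 (\<lceil>\<bar>R\<bar>\<rceil> + 1))"])
    fix N :: nat and m q assume "nat (max n0 (\<lceil>\<bar>R\<bar>\<rceil> + 1)) \<le> N"
    then have N: "n0 \<le> int N" "\<lceil>\<bar>R\<bar>\<rceil> + 1 \<le> int N" by linarith+
    show "ev m q \<in> box (big_a c N) (big_b c N) \<longleftrightarrow> \<bar>wval m\<bar> \<le> int N"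
    proof (cases "n0 \<le> \<bar>wval m\<bar>")
      case True
      note b = l[OF True, of q]
      show ?thesis
      proof
        assume "ev m q \<in> box (big_a c N) (big_b c N)"
        then have "- of_nat N - 1 + c < Re (ev m q)" "Re (ev m q) < of_nat N + c" by (simp_all add: eq)
        with b have "- real N - 1 < of_int (wval m)" "real_of_int (wval m) < real N + 1" by linarith+
        then show "\<bar>wval m\<bar> \<le> int N" by linarith
      next
        assume "\<bar>wval m\<bar> \<le> int N"
        then have "- real N \<le> of_int (wval m)" "of_int (wval m) \<le> real N" by linarith+
        then show "ev m q \<in> box (big_a c N) (big_b c N)" using b by (simp add: eq)
      qed
    next
      case False
      then have "\<bar>Re (ev m q)\<bar> \<le> R" using s by simp
      moreover have "R + 1 \<le> of_nat N" using N(2) by linarith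
      ultimately have "- of_nat N - 1 + c < Re (ev m q) \<and> Re (ev m q) < of_nat N + c"
        using c c0 by (auto simp: abs_le_iff)
      then show ?thesis using False N by (auto simp: eq)
    qed
  qed
qed

end

lemma summable_on_windex:
  fixes f :: "windex \<Rightarrow> 'a::banach"
  assumes "\<And>n. n1 \<le> \<bar>wval n\<bar> \<Longrightarrow> norm (f n) \<le> C / (of_int (wval n))\<^sup>2"
  shows "f summable_on UNIV"
proof -
  have UN: "UNIV = range Pos \<union> range Neg" using windex.exhaust by blast
  have sq: "summable (\<lambda>n. C / (real n)\<^sup>2)"
    using summable_mult[OF inverse_power_summable[of 2], of C] by (simp add: divide_inverse)
  have "(\<lambda>n. f (Pos n)) summable_on UNIV"
  proof (rule norm_summable_imp_summable_on)
    show "summable (\<lambda>n. norm (f (Pos n)))"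
      by (rule summable_comparison_test'[OF sq, of "nat n1"]) (use assms[of "Pos _"] in auto)
  qed
  moreover have "(\<lambda>n. f (Neg n)) summable_on UNIV"
  proof (rule norm_summable_imp_summable_on)
    show "summable (\<lambda>n. norm (f (Neg n)))"
      by (rule summable_comparison_test'[OF sq, of "nat n1"]) (use assms[of "Neg _"] in auto)
  qed
  ultimately show ?thesis
    unfolding UN by (intro summable_on_Un_disjoint) (auto simp: summable_on_reindex o_def inj_def)
qed

section \<open>Series over the spectra as contour integrals\<close>

locale spectral_pair = A: spectral_pencil L \<omega> ev + B: spectral_pencil Lt \<omega> evt
  for L Lt :: "'m::finite pencil" and \<omega> ev evt +
  fixes c :: real
  assumes omega: "\<And>q. 0 \<le> \<omega> q" "\<And>q. \<omega> q < c" and c1: "c < 1"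
    and weyl_diff: "growth (gridF c) (\<lambda>\<xi>. weyl L \<xi> - weyl Lt \<xi>) 0 (-2)"
    and resolvents: "\<forall>\<^sub>F \<xi> in gridF c. char_fun L \<xi> \<noteq> 0" "\<forall>\<^sub>F \<xi> in gridF c. char_fun Lt \<xi> \<noteq> 0"
begin

sublocale large_filter "gridF c"
  by unfold_locales (rule gridF_le)

lemma c0: "0 < c"
  using omega[of undefined] by linarith

text \<open>The terms of the series are integrals over small rectangles around one group of
  eigenvalues, which bounds them by \<open>O(n\<^sup>-\<^sup>2)\<close>; the partial sums are integrals over large ones.\<close>

lemma residue_series:
  fixes K J E0 E1 E2 :: "complex \<Rightarrow> complex^'m^'m"
  assumes K: "entire_mat K" and J: "entire_mat J"
    and gK: "growth (gridF c) K y 0" and gJ: "growth (gridF c) J y 0" and y: "y \<ge> 0"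
    and E: "entire_mat E0" "entire_mat E1" "entire_mat E2"
    and lim: "growth (gridF c) (\<lambda>\<xi>. K \<xi> ** (weyl L \<xi> - weyl Lt \<xi>) ** J \<xi>
        + (E0 \<xi> + (1 / (\<xi> - \<rho>)) *\<^sub>M E1 \<xi> + (1 / (\<xi> - \<theta>)) *\<^sub>M E2 \<xi>) - (1 / \<xi>) *\<^sub>M C) 0 (-2)"
  defines "S \<equiv> \<lambda>n. \<Sum>q\<in>UNIV. K (ev n q) ** weight L (ev n q) ** J (ev n q) - K (evt n q) ** weight Lt (evt n q) ** J (evt n q)"
  shows "S summable_on UNIV" "(\<Sum>\<^sub>\<infinity>n. S n) = C - E1 \<rho> - E2 \<theta>"
proof -
  let ?T = "\<lambda>\<xi>. K \<xi> ** (weyl L \<xi> - weyl Lt \<xi>) ** J \<xi>"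
  obtain r where r: "\<And>\<xi>. \<xi> \<in> grid c \<Longrightarrow> r \<le> norm \<xi> \<Longrightarrow> char_fun L \<xi> \<noteq> 0 \<and> char_fun Lt \<xi> \<noteq> 0"
    using eventually_conj[OF resolvents] by (auto simp: eventually_gridF)
  have integral: "((\<lambda>\<xi>. ?T \<xi> $ i $ j) has_contour_integral (2 * of_real pi * \<i> *
        ((\<Sum>(n, q) | ev n q \<in> box a b. K (ev n q) ** weight L (ev n q) ** J (ev n q))
        - (\<Sum>(n, q) | evt n q \<in> box a b. K (evt n q) ** weight Lt (evt n q) ** J (evt n q))) $ i $ j)) (rectpath a b)"
    if "Re a \<le> Re b" "Im a \<le> Im b" "\<And>z. z \<in> path_image (rectpath a b) \<Longrightarrow> z \<in> grid c \<and> r \<le> norm z" for a b i j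
  proof -
    have n: "char_fun L z \<noteq> 0" "char_fun Lt z \<noteq> 0" if "z \<in> path_image (rectpath a b)" for z
      using r \<open>\<And>z. z \<in> path_image (rectpath a b) \<Longrightarrow> z \<in> grid c \<and> r \<le> norm z\<close>[OF that] by auto
    from has_contour_integral_diff[OF A.box_residues[OF K J that(1,2) n(1), of i j] B.box_residues[OF K J that(1,2) n(2), of i j]]
    show ?thesis by (simp add: matrix_distribs right_diff_distrib)
  qed
  have gT: "growth (gridF c) ?T (y + y) (-2)"
    using growth_mult[OF growth_mult[OF gK weyl_diff] gJ] by simp
  obtain D where D: "D \<ge> 0" and Dev: "\<forall>\<^sub>F \<xi> in gridF c. norm (?T \<xi>) \<le> D * (exp (\<bar>Im \<xi>\<bar> * (y + y)) * norm \<xi> powi (-2))"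
    using growthE[OF gT] .
  obtain r' where r': "\<And>\<xi>. \<xi> \<in> grid c \<Longrightarrow> r' \<le> norm \<xi> \<Longrightarrow> norm (?T \<xi>) \<le> D * (exp (\<bar>Im \<xi>\<bar> * (y + y)) * norm \<xi> powi (-2))"
    using Dev by (auto simp: eventually_gridF)
  obtain nA where nA: "\<And>n m q. nA \<le> \<bar>n\<bar> \<Longrightarrow> ev m q \<in> box (slot_a c n) (slot_b c n) \<longleftrightarrow> wval m = n"
    using A.ev_in_slot[OF omega c1] by metis
  obtain nB where nB: "\<And>n m q. nB \<le> \<bar>n\<bar> \<Longrightarrow> evt m q \<in> box (slot_a c n) (slot_b c n) \<longleftrightarrow> wval m = n"
    using B.ev_in_slot[OF omega c1] by metis
  \<comment> \<open>The bound 2 keeps away from the value 0 shared by \<open>Pos 0\<close> and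
    \<open>Neg 0\<close>, and it ensures \<open>norm z \<ge> \<bar>n\<bar> / 2\<close> on the
    contour; the shifts by 1 account for \<open>norm z \<ge> \<bar>n\<bar> - 1\<close>.\<close>
  define n1 where "n1 = max (max nA nB) (max 2 (max \<lceil>r + 1\<rceil> \<lceil>r' + 1\<rceil>))"
  have slot_bound: "norm (S m $ i $ j) \<le> 8 * D * exp y / (of_int (wval m))\<^sup>2" if m: "n1 \<le> \<bar>wval m\<bar>" for m i j
  proof -
    define n where "n = wval m"
    have n: "nA \<le> \<bar>n\<bar>" "nB \<le> \<bar>n\<bar>" "2 \<le> \<bar>n\<bar>" "r + 1 \<le> of_int \<bar>n\<bar>" "r' + 1 \<le> of_int \<bar>n\<bar>"
      using m unfolding n1_def n_def by linarith+
    have uniq: "wval m' = n \<longleftrightarrow> m' = m" for m'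
      using n(3) unfolding n_def by (cases m; cases m') auto
    have setA: "{(m', q). ev m' q \<in> box (slot_a c n) (slot_b c n)} = {m} \<times> UNIV"
      using nA[OF n(1)] uniq by auto
    have setB: "{(m', q). evt m' q \<in> box (slot_a c n) (slot_b c n)} = {m} \<times> UNIV"
      using nB[OF n(2)] uniq by auto
    have ab: "Re (slot_a c n) \<le> Re (slot_b c n)" "Im (slot_a c n) \<le> Im (slot_b c n)"
      by (simp_all add: slot_a_def slot_b_def)
    let ?g = "rectpath (slot_a c n) (slot_b c n)"
    have path: "z \<in> grid c \<and> r \<le> norm z" if "z \<in> path_image ?g" for z
      using slot_path[OF c0 c1 that] n(4) by auto
    have "(\<Sum>(m', q)\<in>{m} \<times> UNIV. X m' q) = (\<Sum>q\<in>UNIV. X m q)" for X :: "windex \<Rightarrow> 'm \<Rightarrow> complex^'m^'m"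
      by (simp add: sum.cartesian_product[symmetric])
    then have int: "((\<lambda>\<xi>. ?T \<xi> $ i $ j) has_contour_integral (2 * of_real pi * \<i> * S m $ i $ j)) ?g"
      using integral[OF ab path, of i j] unfolding setA setB S_def by (simp add: sum_subtractf)
    \<comment> \<open>On the contour \<open>\<bar>Im z\<bar> \<le> 1/2\<close> and
      \<open>norm z \<ge> \<bar>n\<bar> / 2\<close>, so the bound of type \<open>y + y\<close>
      becomes a constant over n^2; the perimeter is 4.\<close>
    let ?B = "D * (exp y * (4 / (of_int n)\<^sup>2))"
    have "norm (contour_integral ?g (\<lambda>\<xi>. ?T \<xi> $ i $ j)) \<le> ?B * (2 * (Re (slot_b c n) - Re (slot_a c n)) + 2 * (Im (slot_b c n) - Im (slot_a c n)))"
    proof (rule contour_integral_rectpath_bound[OF _ ab])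
      show "(\<lambda>\<xi>. ?T \<xi> $ i $ j) contour_integrable_on ?g" using int by (auto simp: contour_integrable_on_def)
      fix z assume z: "z \<in> path_image ?g"
      note p = slot_path[OF c0 c1 z]
      have zn: "norm z \<ge> of_int \<bar>n\<bar> / 2" using p(3) n(3) by linarith
      have nn: "real_of_int \<bar>n\<bar> > 0" using n(3) by linarith
      have "norm (?T z $ i $ j) \<le> norm (?T z)" by (rule norm_entry_le)
      also have "\<dots> \<le> D * (exp (\<bar>Im z\<bar> * (y + y)) * norm z powi (-2))"
        using p n(5) by (intro r') auto
      also have "\<dots> \<le> ?B"
      proof (intro mult_left_mono mult_mono)
        have "\<bar>Im z\<bar> * (y + y) \<le> 1/2 * (y + y)" using p(2) y by (intro mult_right_mono) auto
        then show "exp (\<bar>Im z\<bar> * (y + y)) \<le> exp y" by simp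
        have "(of_int \<bar>n\<bar> / 2)\<^sup>2 \<le> (norm z)\<^sup>2" using zn nn by (intro power_mono) auto
        moreover have "(norm z)\<^sup>2 > 0" using zn nn by (intro zero_less_power) linarith
        ultimately have "1 / (norm z)\<^sup>2 \<le> 1 / (of_int \<bar>n\<bar> / 2)\<^sup>2"
          using nn by (intro divide_left_mono) auto
        also have "1 / (real_of_int \<bar>n\<bar> / 2)\<^sup>2 = 4 / (of_int n)\<^sup>2" by (simp add: power_divide)
        finally show "norm z powi (-2) \<le> 4 / (of_int n)\<^sup>2"
          by (simp add: power_int_minus divide_inverse)
      qed (use D in auto)
      finally show "norm (?T z $ i $ j) \<le> ?B" .
    qed (use D in auto)
    then have "norm (2 * of_real pi * \<i> * S m $ i $ j) \<le> ?B * 4"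
      unfolding contour_integral_unique[OF int] by (simp add: slot_a_def slot_b_def)
    then have "2 * pi * norm (S m $ i $ j) \<le> 16 * D * exp y / (of_int n)\<^sup>2" by (simp add: norm_mult)
    moreover have "2 * norm (S m $ i $ j) \<le> 2 * pi * norm (S m $ i $ j)"
      using pi_gt3 mult_right_mono[of 2 "2 * pi" "norm (S m $ i $ j)"] by simp
    ultimately show ?thesis unfolding n_def by simp
  qed
  have norm_le: "norm A \<le> (\<Sum>i\<in>UNIV. \<Sum>j\<in>UNIV. norm (A $ i $ j))" for A :: "complex^'m^'m"
    by (subst matrix_eq_sum_entries) (intro order_trans[OF norm_sum] sum_mono, simp add: norm_unit_entry)
  define M where "M = real CARD('m) * real CARD('m) * (8 * D * exp y)"
  have "norm (S m) \<le> M / (of_int (wval m))\<^sup>2" if "n1 \<le> \<bar>wval m\<bar>" for m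
  proof -
    have "norm (S m) \<le> (\<Sum>i\<in>(UNIV::'m set). \<Sum>j\<in>(UNIV::'m set). 8 * D * exp y / (of_int (wval m))\<^sup>2)"
      by (intro order_trans[OF norm_le] sum_mono slot_bound that)
    then show ?thesis by (simp add: M_def)
  qed
  then show summ: "S summable_on UNIV" by (rule summable_on_windex)
  obtain NA where NA: "\<And>N m q. NA \<le> N \<Longrightarrow> ev m q \<in> box (big_a c N) (big_b c N) \<longleftrightarrow> \<bar>wval m\<bar> \<le> int N"
    using A.ev_in_big[OF omega c1] by metis
  obtain NB where NB: "\<And>N m q. NB \<le> N \<Longrightarrow> evt m q \<in> box (big_a c N) (big_b c N) \<longleftrightarrow> \<bar>wval m\<bar> \<le> int N"
    using B.ev_in_big[OF omega c1] by metis
  define V where "V = (\<lambda>N. {m. \<bar>wval m\<bar> \<le> int N})"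
  have finV: "finite (V N)" for N unfolding V_def by (rule A.finite_wval_le)
  let ?f2 = "\<lambda>\<xi>. E0 \<xi> + (1 / (\<xi> - \<rho>)) *\<^sub>M E1 \<xi> + (1 / (\<xi> - \<theta>)) *\<^sub>M E2 \<xi>"
  obtain G where G: "G \<ge> 0" and Gev: "\<forall>\<^sub>F \<xi> in gridF c. norm (?T \<xi> + ?f2 \<xi> - (1 / \<xi>) *\<^sub>M C) \<le> G * (exp (\<bar>Im \<xi>\<bar> * 0) * norm \<xi> powi (-2))"
    using growthE[OF lim] .
  obtain r'' where r'': "\<And>\<xi>. \<xi> \<in> grid c \<Longrightarrow> r'' \<le> norm \<xi> \<Longrightarrow> norm (?T \<xi> + ?f2 \<xi> - (1 / \<xi>) *\<^sub>M C) \<le> G * (exp (\<bar>Im \<xi>\<bar> * 0) * norm \<xi> powi (-2))"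
    using Gev by (auto simp: eventually_gridF)
  \<comment> \<open>The shifts by 2 place both poles inside the rectangle; the other summands
    validate the eigenvalue count and the bounds on its boundary and keep \<open>N\<close>
    positive.\<close>
  define N1 where "N1 = NA + NB + 1 + nat \<lceil>r\<rceil> + nat \<lceil>r''\<rceil> + (nat \<lceil>norm \<rho>\<rceil> + 2) + (nat \<lceil>norm \<theta>\<rceil> + 2)"
  have partial: "norm ((\<Sum>m\<in>V N. S m) $ i $ j - (C - E1 \<rho> - E2 \<theta>) $ i $ j) \<le> 12 * G / real N" if N: "N1 \<le> N" for N i j
  proof -
    have N': "NA \<le> N" "NB \<le> N" "1 \<le> N" "nat \<lceil>r\<rceil> \<le> N" "nat \<lceil>r''\<rceil> \<le> N" "nat \<lceil>norm \<rho>\<rceil> + 2 \<le> N" "nat \<lceil>norm \<theta>\<rceil> + 2 \<le> N"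
      using N unfolding N1_def by linarith+
    have Nr: "r \<le> real N" "r'' \<le> real N" "norm \<rho> + 2 \<le> real N" "norm \<theta> + 2 \<le> real N"
      using N' by linarith+
    let ?g = "rectpath (big_a c N) (big_b c N)"
    have ab: "Re (big_a c N) \<le> Re (big_b c N)" "Im (big_a c N) \<le> Im (big_b c N)"
      by (simp_all add: big_a_def big_b_def)
    have path: "z \<in> grid c \<and> r \<le> norm z" if "z \<in> path_image ?g" for z
      using big_path[OF c0 c1 that] Nr by auto
    have setA: "{(m', q). ev m' q \<in> box (big_a c N) (big_b c N)} = V N \<times> UNIV"
      using NA[OF N'(1)] by (auto simp: V_def)
    have setB: "{(m', q). evt m' q \<in> box (big_a c N) (big_b c N)} = V N \<times> UNIV"
      using NB[OF N'(2)] by (auto simp: V_def)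
    have int: "((\<lambda>\<xi>. ?T \<xi> $ i $ j) has_contour_integral (2 * of_real pi * \<i> * (\<Sum>m\<in>V N. S m) $ i $ j)) ?g"
      using integral[OF ab path, of i j] unfolding setA setB S_def
      by (simp add: sum.cartesian_product[symmetric] sum_subtractf)
    have inside: "w \<in> box (big_a c N) (big_b c N)" if "norm w + 2 \<le> real N" for w
      using that abs_Re_le_cmod[of w] abs_Im_le_cmod[of w] c0 c1
      by (auto simp: in_box_complex_iff big_a_def big_b_def abs_le_iff)
    \<comment> \<open>On this contour the available bound for the Weyl part alone grows
      exponentially. The entire term contributes 0 and the Cauchy terms contribute explicit values,
      while their sum with the Weyl part is \<open>C\<close> over \<xi> up to O(1/\<xi>^2).\<close>
    have i0: "((\<lambda>\<xi>. E0 \<xi> $ i $ j) has_contour_integral 0) ?g"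
      using E(1) by (intro Cauchy_theorem_convex_simple[of _ UNIV]) (auto simp: entire_mat_def)
    have i1: "((\<lambda>\<xi>. E1 \<xi> $ i $ j / (\<xi> - \<rho>)) has_contour_integral (2 * of_real pi * \<i> * E1 \<rho> $ i $ j)) ?g"
      using E(2) Nr by (intro Cauchy_rectpath inside) (auto simp: entire_mat_def)
    have i2: "((\<lambda>\<xi>. E2 \<xi> $ i $ j / (\<xi> - \<theta>)) has_contour_integral (2 * of_real pi * \<i> * E2 \<theta> $ i $ j)) ?g"
      using E(3) Nr by (intro Cauchy_rectpath inside) (auto simp: entire_mat_def)
    have i3: "((\<lambda>\<xi>. C $ i $ j / (\<xi> - 0)) has_contour_integral (2 * of_real pi * \<i> * C $ i $ j)) ?g"
      using Nr norm_ge_zero[of \<rho>] by (intro Cauchy_rectpath inside) (auto simp del: norm_ge_zero)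
    let ?h = "\<lambda>\<xi>. ?T \<xi> $ i $ j + (E0 \<xi> $ i $ j + E1 \<xi> $ i $ j / (\<xi> - \<rho>) + E2 \<xi> $ i $ j / (\<xi> - \<theta>)) - C $ i $ j / (\<xi> - 0)"
    have ih: "(?h has_contour_integral (2 * of_real pi * \<i> * (\<Sum>m\<in>V N. S m) $ i $ j
        + (0 + 2 * of_real pi * \<i> * E1 \<rho> $ i $ j + 2 * of_real pi * \<i> * E2 \<theta> $ i $ j) - 2 * of_real pi * \<i> * C $ i $ j)) ?g"
      by (intro has_contour_integral_add has_contour_integral_diff int i0 i1 i2 i3)
    \<comment> \<open>A perimeter of order N against a bound of order 1/N^2, so the remainder
      vanishes like 1/N.\<close>
    have "norm (contour_integral ?g ?h) \<le> G / (real N)\<^sup>2 * (2 * (Re (big_b c N) - Re (big_a c N)) + 2 * (Im (big_b c N) - Im (big_a c N)))"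
    proof (rule contour_integral_rectpath_bound[OF _ ab])
      show "?h contour_integrable_on ?g" using ih by (auto simp: contour_integrable_on_def)
      fix z assume z: "z \<in> path_image ?g"
      note p = big_path[OF c0 c1 z]
      have h: "?h z = (?T z + ?f2 z - (1 / z) *\<^sub>M C) $ i $ j" by simp
      have "norm (?h z) \<le> norm (?T z + ?f2 z - (1 / z) *\<^sub>M C)"
        unfolding h by (rule norm_entry_le)
      also have "\<dots> \<le> G * (exp (\<bar>Im z\<bar> * 0) * norm z powi (-2))"
        using p Nr by (intro r'') auto
      also have "\<dots> = G / (norm z)\<^sup>2" by (simp add: power_int_minus divide_inverse)
      also have "\<dots> \<le> G / (real N)\<^sup>2"
      proof (rule divide_left_mono)
        show "(real N)\<^sup>2 \<le> (norm z)\<^sup>2" using p by (intro power_mono) auto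
        show "0 < (norm z)\<^sup>2 * (real N)\<^sup>2" using p N'(3) by (intro mult_pos_pos zero_less_power) auto
      qed (rule G)
      finally show "norm (?h z) \<le> G / (real N)\<^sup>2" .
    qed (use G in auto)
    also have "2 * (Re (big_b c N) - Re (big_a c N)) + 2 * (Im (big_b c N) - Im (big_a c N)) = 8 * real N + 4"
      by (simp add: big_a_def big_b_def)
    also have "G / (real N)\<^sup>2 * (8 * real N + 4) \<le> G / (real N)\<^sup>2 * (12 * real N)"
      using G N'(3) by (intro mult_left_mono) auto
    also have "\<dots> = 12 * G / real N" using N'(3) by (simp add: power2_eq_square field_simps)
    finally have "norm (contour_integral ?g ?h) \<le> 12 * G / real N" .
    moreover have "contour_integral ?g ?h = 2 * of_real pi * \<i> * ((\<Sum>m\<in>V N. S m) $ i $ j - (C - E1 \<rho> - E2 \<theta>) $ i $ j)"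
      unfolding contour_integral_unique[OF ih] by (simp add: algebra_simps)
    ultimately have "2 * pi * norm ((\<Sum>m\<in>V N. S m) $ i $ j - (C - E1 \<rho> - E2 \<theta>) $ i $ j) \<le> 12 * G / real N"
      by (simp add: norm_mult)
    moreover have "1 * norm ((\<Sum>m\<in>V N. S m) $ i $ j - (C - E1 \<rho> - E2 \<theta>) $ i $ j)
        \<le> 2 * pi * norm ((\<Sum>m\<in>V N. S m) $ i $ j - (C - E1 \<rho> - E2 \<theta>) $ i $ j)"
      using pi_gt3 by (intro mult_right_mono) auto
    ultimately show ?thesis by simp
  qed
  have lim_entry: "(\<lambda>N. (\<Sum>m\<in>V N. S m) $ i $ j) \<longlonglongrightarrow> (C - E1 \<rho> - E2 \<theta>) $ i $ j" for i j
  proof (rule LIM_zero_cancel, rule Lim_null_comparison)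
    show "\<forall>\<^sub>F N in sequentially. norm ((\<Sum>m\<in>V N. S m) $ i $ j - (C - E1 \<rho> - E2 \<theta>) $ i $ j) \<le> 12 * G / real N"
      using eventually_ge_at_top[of N1] by (rule eventually_mono) (rule partial)
    show "(\<lambda>N. 12 * G / real N) \<longlonglongrightarrow> 0"
      by (intro tendsto_divide_0[OF tendsto_const] filterlim_at_top_imp_at_infinity filterlim_real_sequentially)
  qed
  then have "(\<lambda>N. \<Sum>m\<in>V N. S m) \<longlonglongrightarrow> C - E1 \<rho> - E2 \<theta>"
    by (intro vec_tendstoI) auto
  \<comment> \<open>The symmetric index ranges eventually contain every finite index set, so these
    partial sums converge to the unordered sum.\<close>
  moreover have "(\<lambda>N. \<Sum>m\<in>V N. S m) \<longlonglongrightarrow> (\<Sum>\<^sub>\<infinity>n. S n)"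
  proof -
    have "(sum S \<longlongrightarrow> (\<Sum>\<^sub>\<infinity>n. S n)) (finite_subsets_at_top UNIV)"
      using has_sum_infsum[OF summ] by (simp add: has_sum_def)
    moreover have "filterlim V (finite_subsets_at_top UNIV) sequentially"
      unfolding filterlim_finite_subsets_at_top
    proof (intro allI impI)
      fix X :: "windex set" assume X: "finite X \<and> X \<subseteq> UNIV"
      have "X \<subseteq> V N" if "nat (\<Sum>m\<in>X. \<bar>wval m\<bar>) \<le> N" for N
      proof
        fix m assume "m \<in> X"
        then have "\<bar>wval m\<bar> \<le> (\<Sum>m\<in>X. \<bar>wval m\<bar>)" using X by (intro member_le_sum) auto
        then show "m \<in> V N" using that by (simp add: V_def)
      qed
      then have "\<forall>\<^sub>F N in sequentially. X \<subseteq> V N"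
        by (rule eventually_mono[OF eventually_ge_at_top[of "nat (\<Sum>m\<in>X. \<bar>wval m\<bar>)"]])
      then show "\<forall>\<^sub>F N in sequentially. finite (V N) \<and> X \<subseteq> V N \<and> V N \<subseteq> UNIV"
        by (rule eventually_mono) (use finV in auto)
    qed
    ultimately show ?thesis by (rule filterlim_compose)
  qed
  ultimately show "(\<Sum>\<^sub>\<infinity>n. S n) = C - E1 \<rho> - E2 \<theta>" by (rule LIMSEQ_unique[rotated])
qed

end

section \<open>The main relations\<close>

context hermitian_pencil
begin

section \<open>Brackets and the kernels D\<close>

definition Bk :: "real \<Rightarrow> complex \<Rightarrow> complex \<Rightarrow> complex^'m^'m"
  where "Bk x \<rho> \<theta> = dagger (phi1 L (cnj \<theta>) x) ** phi L \<rho> x - dagger (phi L (cnj \<theta>) x) ** phi1 L \<rho> x"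

text \<open>\<open>BS x \<rho> \<theta>\<close> and \<open>BSs x \<rho> \<theta>\<close> are the brackets of \<open>\<phi>\<^sup>*(\<theta>)\<close> with \<open>S(\<rho>)\<close> and of \<open>S\<^sup>*(\<theta>)\<close> with \<open>\<phi>(\<rho>)\<close>,
  where \<open>S\<close> is the solution with \<open>S(0) = 0\<close>, \<open>S'(0) = I\<close>.\<close>

definition BS :: "real \<Rightarrow> complex \<Rightarrow> complex \<Rightarrow> complex^'m^'m"
  where "BS x \<rho> \<theta> = dagger (phi1 L (cnj \<theta>) x) ** sisol L \<rho> x - dagger (phi L (cnj \<theta>) x) ** sisol1 L \<rho> x"

definition BSs :: "real \<Rightarrow> complex \<Rightarrow> complex \<Rightarrow> complex^'m^'m"
  where "BSs x \<rho> \<theta> = dagger (sisol1 L (cnj \<theta>) x) ** phi L \<rho> x - dagger (sisol L (cnj \<theta>) x) ** phi1 L \<rho> x"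

text \<open>Brackets at equal parameters are constant in x and are read off from the initial data at
  0.\<close>

lemma brackets_diagonal:
  assumes x: "x \<in> {0..pi}"
  shows "Bk x \<xi> \<xi> = 0" "BS x \<xi> \<xi> = - mat 1" "BSs x \<xi> \<xi> = mat 1"
proof -
  show "Bk x \<xi> \<xi> = 0"
    using bracket_constant[OF sol_phi sol_phi x, of \<xi>] by (simp add: Bk_def dagger_simps)
  show "BS x \<xi> \<xi> = - mat 1"
    using bracket_constant[OF sol_sisol sol_phi x, of \<xi>] by (simp add: BS_def)
  show "BSs x \<xi> \<xi> = mat 1"
    using bracket_constant[OF sol_phi sol_sisol x, of \<xi>] by (simp add: BSs_def)
qed

lemma entire_brackets:
  assumes x: "x \<in> {0..pi}"
  shows "entire_mat (\<lambda>\<xi>. Bk x \<xi> \<theta>)" "entire_mat (\<lambda>\<xi>. Bk x \<rho> \<xi>)" "entire_mat (\<lambda>\<xi>. BS x \<xi> \<theta>)" "entire_mat (\<lambda>\<xi>. BSs x \<rho> \<xi>)"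
  unfolding Bk_def BS_def BSs_def
  by (intro entire_mat_diff entire_mat_mult entire_mat_dagger[of "\<lambda>\<xi>. phi L \<xi> x"] entire_mat_dagger[of "\<lambda>\<xi>. phi1 L \<xi> x"]
      entire_mat_dagger[of "\<lambda>\<xi>. sisol L \<xi> x"] entire_mat_dagger[of "\<lambda>\<xi>. sisol1 L \<xi> x"] entire_mat_const
      entire_phi[OF x] entire_cosol[OF x])+

lemma bracket_eq:
  assumes x: "x \<in> {0..pi}"
  shows "bracket (phi_star L \<theta>) (phi L \<rho>) x = Bk x \<rho> \<theta>"
proof -
  have "((\<lambda>x. dagger (phi L (cnj \<theta>) x)) has_vector_derivative dagger (phi1 L (cnj \<theta>) x)) (at x within {0..pi})"
    by (rule bounded_linear.has_vector_derivative[OF bounded_linear_dagger sol_dx(1)[OF sol_phi x]])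
  then have "dx (phi_star L \<theta>) x = dagger (phi1 L (cnj \<theta>) x)"
    unfolding dx_def phi_star_def[abs_def] using x
    by (intro vector_derivative_within_cbox[of 0 pi, unfolded box_real]) auto
  then show ?thesis
    using sol_dx(2)[OF sol_phi x] by (simp add: bracket_def Bk_def phi_star_def)
qed

definition Bk_diag :: "real \<Rightarrow> complex \<Rightarrow> complex^'m^'m"
  where "Bk_diag x \<theta> = (\<chi> i j. deriv (\<lambda>\<xi>. Bk x \<xi> \<theta> $ i $ j) \<theta>)"

text \<open>The bracket vanishes at equal parameters, so the limit of the quotient is its derivative
  in the first parameter.\<close>

lemma D_ker_eq:
  assumes x: "x \<in> {0..pi}"
  shows "D_ker L x \<rho> \<theta> = (if \<rho> = \<theta> then Bk_diag x \<theta> else (1 / (\<rho> - \<theta>)) *\<^sub>M Bk x \<rho> \<theta>)"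
proof -
  have "((\<lambda>\<xi>. ((1 / (\<xi> - \<theta>)) *\<^sub>M Bk x \<xi> \<theta>) $ i $ j) \<longlongrightarrow> Bk_diag x \<theta> $ i $ j) (at \<theta>)" for i j
  proof -
    let ?f = "\<lambda>\<xi>. Bk x \<xi> \<theta> $ i $ j"
    have "?f field_differentiable at \<theta>"
      using entire_brackets(1)[OF x] by (auto simp: entire_mat_def holomorphic_on_def)
    then have "(?f has_field_derivative deriv ?f \<theta>) (at \<theta>)" by (simp add: DERIV_deriv_iff_field_differentiable)
    then show ?thesis
      by (simp add: has_field_derivative_iff Bk_diag_def brackets_diagonal[OF x])
  qed
  then have "((\<lambda>\<xi>. (1 / (\<xi> - \<theta>)) *\<^sub>M Bk x \<xi> \<theta>) \<longlongrightarrow> Bk_diag x \<theta>) (at \<theta>)"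
    by (intro vec_tendstoI) blast
  then have "Lim (at \<theta>) (\<lambda>\<xi>. (1 / (\<xi> - \<theta>)) *\<^sub>M Bk x \<xi> \<theta>) = Bk_diag x \<theta>"
    by (intro tendsto_Lim) auto
  then show ?thesis by (simp add: D_ker_def D_quot_def bracket_eq[OF x])
qed

lemma deriv_matrix_mult:
  fixes A B :: "complex \<Rightarrow> complex^'m^'m"
  assumes "entire_mat A" "entire_mat B"
  shows "((\<lambda>\<xi>. (A \<xi> ** B \<xi>) $ i $ j) has_field_derivative
    (\<Sum>k\<in>UNIV. deriv (\<lambda>\<xi>. A \<xi> $ i $ k) a * B a $ k $ j) + (\<Sum>k\<in>UNIV. A a $ i $ k * deriv (\<lambda>\<xi>. B \<xi> $ k $ j) a)) (at a)"
proof -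
  have d: "((\<lambda>\<xi>. A \<xi> $ i $ k) has_field_derivative deriv (\<lambda>\<xi>. A \<xi> $ i $ k) a) (at a)"
    "((\<lambda>\<xi>. B \<xi> $ k $ j) has_field_derivative deriv (\<lambda>\<xi>. B \<xi> $ k $ j) a) (at a)" for k
    using assms by (auto simp: entire_mat_def holomorphic_on_def DERIV_deriv_iff_field_differentiable)
  show ?thesis unfolding matrix_mult_nth
    by (rule derivative_eq_intros d refl)+ (simp add: sum.distrib mult_ac)
qed

text \<open>Since the bracket vanishes on the diagonal, its two partial derivatives there add up to zero;
  hence the kernel extended by continuity in its first argument is also continuous in the second.\<close>

lemma Bk_diag_second:
  assumes x: "x \<in> {0..pi}"
  shows "deriv (\<lambda>\<xi>. Bk x \<theta> \<xi> $ i $ j) \<theta> = - (Bk_diag x \<theta> $ i $ j)"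
proof -
  let ?A = "\<lambda>\<xi>. dagger (phi1 L (cnj \<xi>) x)" and ?B = "\<lambda>\<xi>. dagger (phi L (cnj \<xi>) x)"
  let ?f = "\<lambda>\<xi>. phi L \<xi> x" and ?g = "\<lambda>\<xi>. phi1 L \<xi> x"
  have e: "entire_mat ?A" "entire_mat ?B" "entire_mat ?f" "entire_mat ?g"
    using entire_phi[OF x] entire_mat_dagger[OF entire_phi(1)[OF x]] entire_mat_dagger[OF entire_phi(2)[OF x]] by auto
  note c = entire_mat_const
  note d = deriv_matrix_mult[where i = i and j = j and a = \<theta>]
  \<comment> \<open>Product rules for the bracket with its second parameter frozen, with its first
    parameter frozen, and along the diagonal.\<close>
  note d1 = DERIV_imp_deriv[OF DERIV_diff[OF d[where A = "\<lambda>_. ?A \<theta>", OF c e(3)] d[where A = "\<lambda>_. ?B \<theta>", OF c e(4)]]]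
  note d2 = DERIV_imp_deriv[OF DERIV_diff[OF d[where B = "\<lambda>_. ?f \<theta>", OF e(1) c] d[where B = "\<lambda>_. ?g \<theta>", OF e(2) c]]]
  note d3 = DERIV_imp_deriv[OF DERIV_diff[OF d[OF e(1,3)] d[OF e(2,4)]]]
  have "deriv (\<lambda>\<xi>. Bk x \<xi> \<xi> $ i $ j) \<theta> = 0"
    unfolding brackets_diagonal[OF x] by simp
  moreover have "deriv (\<lambda>\<xi>. Bk x \<xi> \<xi> $ i $ j) \<theta>
      = deriv (\<lambda>\<xi>. Bk x \<xi> \<theta> $ i $ j) \<theta> + deriv (\<lambda>\<xi>. Bk x \<theta> \<xi> $ i $ j) \<theta>"
    unfolding Bk_def vector_minus_component d1 d2 d3 by simp
  ultimately have "deriv (\<lambda>\<xi>. Bk x \<xi> \<theta> $ i $ j) \<theta> + deriv (\<lambda>\<xi>. Bk x \<theta> \<xi> $ i $ j) \<theta> = 0" by simp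
  then show ?thesis by (simp add: Bk_diag_def eq_neg_iff_add_eq_0 add.commute)
qed

text \<open>A removable singularity. In the second argument the difference quotient changes sign,
  and \<open>Bk_diag_second\<close> shows that the value on the diagonal fits there too.\<close>

lemma entire_D_ker:
  assumes x: "x \<in> {0..pi}"
  shows "entire_mat (\<lambda>\<xi>. D_ker L x \<xi> \<theta>)" "entire_mat (\<lambda>\<xi>. D_ker L x \<theta> \<xi>)"
proof -
  have hol: "(\<lambda>\<xi>. if \<xi> = \<theta> then deriv f \<theta> else (f \<xi> - f \<theta>) / (\<xi> - \<theta>)) holomorphic_on UNIV"
    if "f holomorphic_on UNIV" for f
    using pole_lemma_open[OF that open_UNIV] .
  have b: "(\<lambda>\<xi>. Bk x \<xi> \<theta> $ i $ j) holomorphic_on UNIV" "(\<lambda>\<xi>. Bk x \<theta> \<xi> $ i $ j) holomorphic_on UNIV" for i j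
    using entire_brackets[OF x] by (auto simp: entire_mat_def)
  show "entire_mat (\<lambda>\<xi>. D_ker L x \<xi> \<theta>)"
    unfolding entire_mat_def
  proof (intro allI)
    fix i j
    show "(\<lambda>\<xi>. D_ker L x \<xi> \<theta> $ i $ j) holomorphic_on UNIV"
      by (rule holomorphic_transform[OF hol[OF b(1)[of i j]]])
         (auto simp: D_ker_eq[OF x] Bk_diag_def brackets_diagonal[OF x])
  qed
  show "entire_mat (\<lambda>\<xi>. D_ker L x \<theta> \<xi>)"
    unfolding entire_mat_def
  proof (intro allI)
    fix i j
    have "(\<lambda>\<xi>. - (if \<xi> = \<theta> then deriv (\<lambda>\<xi>. Bk x \<theta> \<xi> $ i $ j) \<theta> else (Bk x \<theta> \<xi> $ i $ j - Bk x \<theta> \<theta> $ i $ j) / (\<xi> - \<theta>))) holomorphic_on UNIV"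
      by (intro holomorphic_on_minus hol b)
    then show "(\<lambda>\<xi>. D_ker L x \<theta> \<xi> $ i $ j) holomorphic_on UNIV"
    proof (rule holomorphic_transform)
      fix \<xi>
      have "1 / (\<theta> - \<xi>) = - (1 / (\<xi> - \<theta>))" by (simp add: minus_divide_right)
      then show "- (if \<xi> = \<theta> then deriv (\<lambda>\<xi>. Bk x \<theta> \<xi> $ i $ j) \<theta> else (Bk x \<theta> \<xi> $ i $ j - Bk x \<theta> \<theta> $ i $ j) / (\<xi> - \<theta>))
          = D_ker L x \<theta> \<xi> $ i $ j"
        by (auto simp: D_ker_eq[OF x] Bk_diag_second[OF x] brackets_diagonal[OF x])
    qed
  qed
qed

end

section \<open>The two relations for a model pair\<close>

locale model_spectral_pair =
  model_pair L Lt "gridF c" \<omega> \<delta> W Wt + spectral_pair L Lt \<omega> ev evt c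
  for L Lt :: "'m::finite pencil" and c \<omega> \<delta> W Wt ev evt
begin

text \<open>Taking adjoints at \<open>cnj \<xi>\<close> brings in the Weyl matrix at \<xi> itself,
  by its symmetry; the Weyl matrices of both pencils can then be subtracted at the same
  point.\<close>

lemma Phi_star_split:
  assumes "char_fun Lt \<xi> \<noteq> 0" "char_fun Lt (cnj \<xi>) \<noteq> 0" "x \<in> {0..pi}"
  shows "dagger (Phi Lt (cnj \<xi>) x) = dagger (sisol Lt (cnj \<xi>) x) + weyl Lt \<xi> ** dagger (phi Lt (cnj \<xi>) x)"
    and "dagger (Phi1 Lt (cnj \<xi>) x) = dagger (sisol1 Lt (cnj \<xi>) x) + weyl Lt \<xi> ** dagger (phi1 Lt (cnj \<xi>) x)"
  using B.Phi_spec(2)[OF assms(2,3)] B.weyl_dagger[OF assms(1,2)]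
  by (simp_all add: Phi1_def dagger_add dagger_mult)

lemma eventually_regular:
  "\<forall>\<^sub>F \<xi> in gridF c. char_fun L \<xi> \<noteq> 0 \<and> char_fun Lt \<xi> \<noteq> 0 \<and> char_fun Lt (cnj \<xi>) \<noteq> 0 \<and> \<xi> \<noteq> 0 \<and> \<xi> \<noteq> \<rho> \<and> \<xi> \<noteq> \<theta>"
  using resolvents A.cnj_invariant[OF resolvents(2)] A.eventually_large[of "norm \<rho> + norm \<theta> + 1"]
proof eventually_elim
  case (elim \<xi>)
  have "norm \<rho> \<ge> 0" "norm \<theta> \<ge> 0" by auto
  with elim show ?case by (intro conjI notI) auto
qed

text \<open>The derivatives in the bracket cost one power of \<xi>, which the denominator restores;
  the type \<open>x\<close> is that of the solutions.\<close>

lemma growth_kernels: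
  assumes x: "x \<in> {0..pi}"
  shows "growth (gridF c) (\<lambda>\<xi>. D_ker L x \<xi> \<theta>) x 0" "growth (gridF c) (\<lambda>\<xi>. D_ker Lt x \<rho> \<xi>) x 0"
proof -
  note g = growth_solutions[OF x]
  have "growth (gridF c) (\<lambda>\<xi>. (1 / (\<xi> - \<theta>)) *\<^sub>M (dagger (phi1 L (cnj \<theta>) x) ** phi L \<xi> x - dagger (phi L (cnj \<theta>) x) ** phi1 L \<xi> x)) (0 + x) (-1 + 1)"
    by (intro A.growth_cscale A.growth_inverse_shift growth_diff A.growth_const_mult g A.growth_mono[OF A.growth_const_mult[OF g(1)]]) auto
  then have *: "growth (gridF c) (\<lambda>\<xi>. (1 / (\<xi> - \<theta>)) *\<^sub>M A.Bk x \<xi> \<theta>) x 0" by (simp add: A.Bk_def)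
  show "growth (gridF c) (\<lambda>\<xi>. D_ker L x \<xi> \<theta>) x 0"
    by (rule growth_cong[OF *], rule eventually_mono[OF eventually_regular[of \<theta> \<theta>]]) (auto simp: A.D_ker_eq[OF x])
  have "growth (gridF c) (\<lambda>\<xi>. - ((1 / (\<xi> - \<rho>)) *\<^sub>M (dagger (phi1 Lt (cnj \<xi>) x) ** phi Lt \<rho> x - dagger (phi Lt (cnj \<xi>) x) ** phi1 Lt \<rho> x))) (0 + x) (-1 + 1)"
    by (intro growth_minus A.growth_cscale A.growth_inverse_shift growth_diff A.growth_mult_const g A.growth_mono[OF A.growth_mult_const[OF g(5)]]) auto
  then have *: "growth (gridF c) (\<lambda>\<xi>. - ((1 / (\<xi> - \<rho>)) *\<^sub>M B.Bk x \<rho> \<xi>)) x 0" by (simp add: B.Bk_def)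
  have neg: "1 / (\<rho> - \<xi>) = - (1 / (\<xi> - \<rho>))" for \<xi> by (simp add: minus_divide_right)
  show "growth (gridF c) (\<lambda>\<xi>. D_ker Lt x \<rho> \<xi>) x 0"
    by (rule growth_cong[OF *], rule eventually_mono[OF eventually_regular[of \<rho> \<rho>]]) (auto simp: B.D_ker_eq[OF x] neg)
qed

text \<open>The Cauchy poles lie at \<rho> and \<theta>, whereas the contour argument compares with
  a multiple of 1/\<xi>. The second expansion carries the factor \<xi> that multiplies
  \<open>Lambda\<close> in the asymptotics of \<open>P21\<close>.\<close>

lemma inverse_shift_expansion:
  "growth (gridF c) (\<lambda>\<xi>. 1 / (\<xi> - \<rho>) - 1 / \<xi>) 0 (-2)"
  "growth (gridF c) (\<lambda>\<xi>. \<xi> * (1 / (\<xi> - \<theta>) * (1 / (\<xi> - \<rho>))) - 1 / \<xi>) 0 (-2)"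
proof -
  have c': "growth (gridF c) (\<lambda>\<xi>. a) 0 0" for a :: complex by (rule growth_const0)
  have "growth (gridF c) (\<lambda>\<xi>. \<rho> * (1 / (\<xi> - \<rho>) * (1 / \<xi>))) (0 + (0 + 0)) (0 + (-1 + -1))"
    by (intro A.growth_times c' A.growth_inverse A.growth_inverse_shift)
  then have *: "growth (gridF c) (\<lambda>\<xi>. \<rho> * (1 / (\<xi> - \<rho>) * (1 / \<xi>))) 0 (-2)" by simp
  show "growth (gridF c) (\<lambda>\<xi>. 1 / (\<xi> - \<rho>) - 1 / \<xi>) 0 (-2)"
  proof (rule growth_cong[OF *])
    show "\<forall>\<^sub>F \<xi> in gridF c. \<rho> * (1 / (\<xi> - \<rho>) * (1 / \<xi>)) = 1 / (\<xi> - \<rho>) - 1 / \<xi>"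
      using eventually_regular[of \<rho> \<rho>] by eventually_elim (simp add: field_simps)
  qed
  have "growth (gridF c) (\<lambda>\<xi>. (\<theta> + \<rho>) * (1 / (\<xi> - \<theta>) * (1 / (\<xi> - \<rho>)))) (0 + (0 + 0)) (0 + (-1 + -1))"
    by (intro A.growth_times c' A.growth_inverse_shift)
  moreover have "growth (gridF c) (\<lambda>\<xi>. (\<theta> * \<rho>) * (1 / \<xi> * (1 / (\<xi> - \<theta>) * (1 / (\<xi> - \<rho>))))) (0 + (0 + (0 + 0))) (0 + (-1 + (-1 + -1)))"
    by (intro A.growth_times c' A.growth_inverse_shift A.growth_inverse)
  then have "growth (gridF c) (\<lambda>\<xi>. (\<theta> * \<rho>) * (1 / \<xi> * (1 / (\<xi> - \<theta>) * (1 / (\<xi> - \<rho>))))) 0 (-2)"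
    by (rule A.growth_mono) auto
  ultimately have *: "growth (gridF c) (\<lambda>\<xi>. (\<theta> + \<rho>) * (1 / (\<xi> - \<theta>) * (1 / (\<xi> - \<rho>))) - (\<theta> * \<rho>) * (1 / \<xi> * (1 / (\<xi> - \<theta>) * (1 / (\<xi> - \<rho>))))) 0 (-2)"
    by (intro growth_diff) simp_all
  show "growth (gridF c) (\<lambda>\<xi>. \<xi> * (1 / (\<xi> - \<theta>) * (1 / (\<xi> - \<rho>))) - 1 / \<xi>) 0 (-2)"
  proof (rule growth_cong[OF *])
    show "\<forall>\<^sub>F \<xi> in gridF c. (\<theta> + \<rho>) * (1 / (\<xi> - \<theta>) * (1 / (\<xi> - \<rho>))) - (\<theta> * \<rho>) * (1 / \<xi> * (1 / (\<xi> - \<theta>) * (1 / (\<xi> - \<rho>))))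
        = \<xi> * (1 / (\<xi> - \<theta>) * (1 / (\<xi> - \<rho>))) - 1 / \<xi>"
      using eventually_regular[of \<rho> \<theta>] 
    proof eventually_elim
      case (elim \<xi>)
      then have "\<xi> \<noteq> 0" "\<xi> - \<theta> \<noteq> 0" "\<xi> - \<rho> \<noteq> 0" by auto
      then show ?case by (simp add: divide_simps) (simp add: algebra_simps)
    qed
  qed
qed

text \<open>The algebraic core of both relations: the Weyl solutions recombine into the entries of the
  spectral mapping matrix.\<close>

lemma spectral_mapping_recombination:
  fixes f f1 :: "complex^'m^'m"
  assumes reg: "char_fun L \<xi> \<noteq> 0" "char_fun Lt \<xi> \<noteq> 0" "char_fun Lt (cnj \<xi>) \<noteq> 0" and x: "x \<in> {0..pi}"
  defines "ps \<equiv> dagger (phi Lt (cnj \<xi>) x)" and "ps1 \<equiv> dagger (phi1 Lt (cnj \<xi>) x)"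
    and "ss \<equiv> dagger (sisol Lt (cnj \<xi>) x)" and "ss1 \<equiv> dagger (sisol1 Lt (cnj \<xi>) x)"
  shows "phi L \<xi> x ** (weyl L \<xi> - weyl Lt \<xi>) ** (ps1 ** f - ps ** f1) + sisol L \<xi> x ** (ps1 ** f - ps ** f1)
      - phi L \<xi> x ** (ss1 ** f - ss ** f1) = - (P11 x \<xi> ** f + P12 x \<xi> ** f1)"
    and "phi1 L \<xi> x ** (weyl L \<xi> - weyl Lt \<xi>) ** (ps1 ** f - ps ** f1) + sisol1 L \<xi> x ** (ps1 ** f - ps ** f1)
      - phi1 L \<xi> x ** (ss1 ** f - ss ** f1) = - (P21 x \<xi> ** f + P22 x \<xi> ** f1)"
  unfolding P11_def P12_def P21_def P22_def Phi_star_split[OF reg(2,3) x] A.Phi_spec(2)[OF reg(1) x]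
    Phi1_def[of L] ps_def[symmetric] ps1_def[symmetric] ss_def[symmetric] ss1_def[symmetric]
  by (simp_all add: matrix_distribs matrix_mul_assoc)

text \<open>An instance of \<open>residue_series\<close> with left factor \<open>phi\<close>. The
  terms \<open>?E0\<close> and \<open>?E1\<close> supply the parts of the Weyl solutions free of
  Weyl matrices, so the whole becomes \<open>P11\<close> and \<open>P12\<close> applied to the model
  solution and its derivative, over \<open>\<xi> - \<rho>\<close>. There \<open>P11\<close> tends to
  \<open>Omega\<close>, and since \<open>BSs\<close> is the identity at equal parameters, the Cauchy
  term yields \<open>phi L \<rho> x\<close>.\<close>

lemma first_relation:
  fixes \<rho> :: complex
  assumes x: "x \<in> {0..pi}"
  defines "S \<equiv> \<lambda>n. \<Sum>q\<in>UNIV. phi L (ev n q) x ** weight L (ev n q) ** D_ker Lt x \<rho> (ev n q)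
    - phi L (evt n q) x ** weight Lt (evt n q) ** D_ker Lt x \<rho> (evt n q)"
  shows "S summable_on UNIV" "(\<Sum>\<^sub>\<infinity>n. S n) = Omega L Lt x ** phi Lt \<rho> x - phi L \<rho> x"
proof -
  let ?f = "phi Lt \<rho> x" and ?f1 = "phi1 Lt \<rho> x"
  let ?J = "\<lambda>\<xi>. D_ker Lt x \<rho> \<xi>"
  \<comment> \<open>There is only the Cauchy pole at \<rho>; the second term is zero, with its pole
    placed at 0.\<close>
  let ?E0 = "\<lambda>\<xi>. sisol L \<xi> x ** ?J \<xi>" and ?E1 = "\<lambda>\<xi>. phi L \<xi> x ** B.BSs x \<rho> \<xi>" and ?E2 = "\<lambda>\<xi>. 0 :: complex^'m^'m"
  let ?C = "Omega L Lt x ** ?f"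
  note a = spectral_mapping_asymptotics[OF x]
  have "growth (gridF c) (\<lambda>\<xi>. (1 / (\<xi> - \<rho>)) *\<^sub>M ((P11 x \<xi> - Omega L Lt x) ** ?f + P12 x \<xi> ** ?f1)) (0 + 0) (-1 + -1)"
    by (intro A.growth_cscale A.growth_inverse_shift growth_add A.growth_mult_const a)
  moreover have "growth (gridF c) (\<lambda>\<xi>. (1 / (\<xi> - \<rho>) - 1 / \<xi>) *\<^sub>M ?C) (0 + 0) (-2 + 0)"
    by (intro A.growth_cscale inverse_shift_expansion growth_const0)
  ultimately have g: "growth (gridF c) (\<lambda>\<xi>. (1 / (\<xi> - \<rho>)) *\<^sub>M ((P11 x \<xi> - Omega L Lt x) ** ?f + P12 x \<xi> ** ?f1)
      + (1 / (\<xi> - \<rho>) - 1 / \<xi>) *\<^sub>M ?C) 0 (-2)"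
    by (intro growth_add) simp_all
  have lim: "growth (gridF c) (\<lambda>\<xi>. phi L \<xi> x ** (weyl L \<xi> - weyl Lt \<xi>) ** ?J \<xi>
      + (?E0 \<xi> + (1 / (\<xi> - \<rho>)) *\<^sub>M ?E1 \<xi> + (1 / (\<xi> - 0)) *\<^sub>M ?E2 \<xi>) - (1 / \<xi>) *\<^sub>M ?C) 0 (-2)"
  proof (rule growth_cong[OF g])
    show "\<forall>\<^sub>F \<xi> in gridF c. (1 / (\<xi> - \<rho>)) *\<^sub>M ((P11 x \<xi> - Omega L Lt x) ** ?f + P12 x \<xi> ** ?f1) + (1 / (\<xi> - \<rho>) - 1 / \<xi>) *\<^sub>M ?C
      = phi L \<xi> x ** (weyl L \<xi> - weyl Lt \<xi>) ** ?J \<xi>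
        + (?E0 \<xi> + (1 / (\<xi> - \<rho>)) *\<^sub>M ?E1 \<xi> + (1 / (\<xi> - 0)) *\<^sub>M ?E2 \<xi>) - (1 / \<xi>) *\<^sub>M ?C"
      using eventually_regular[of \<rho> \<rho>]
    proof eventually_elim
      case (elim \<xi>)
      define r where "r = 1 / (\<xi> - \<rho>)"
      define X where "X = dagger (phi1 Lt (cnj \<xi>) x) ** ?f - dagger (phi Lt (cnj \<xi>) x) ** ?f1"
      have J: "?J \<xi> = - (r *\<^sub>M X)"
      proof -
        have "1 / (\<rho> - \<xi>) = - r" by (simp add: r_def minus_divide_right)
        then show ?thesis using elim by (auto simp: B.D_ker_eq[OF x] B.Bk_def X_def)
      qed
      have "phi L \<xi> x ** (weyl L \<xi> - weyl Lt \<xi>) ** X + sisol L \<xi> x ** X - phi L \<xi> x ** B.BSs x \<rho> \<xi>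
          = - (P11 x \<xi> ** ?f + P12 x \<xi> ** ?f1)"
        using spectral_mapping_recombination(1)[of \<xi> x ?f ?f1] elim x by (simp add: X_def B.BSs_def)
      then have rec: "r *\<^sub>M (phi L \<xi> x ** (weyl L \<xi> - weyl Lt \<xi>) ** X + sisol L \<xi> x ** X - phi L \<xi> x ** B.BSs x \<rho> \<xi>)
          = r *\<^sub>M (- (P11 x \<xi> ** ?f + P12 x \<xi> ** ?f1))" by (rule arg_cong)
      have "phi L \<xi> x ** (weyl L \<xi> - weyl Lt \<xi>) ** ?J \<xi> + (?E0 \<xi> + r *\<^sub>M ?E1 \<xi>)
          = - (r *\<^sub>M (phi L \<xi> x ** (weyl L \<xi> - weyl Lt \<xi>) ** X + sisol L \<xi> x ** X - phi L \<xi> x ** B.BSs x \<rho> \<xi>))"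
        unfolding J by (simp only: matrix_mult_minus_right cscale_mult_right cscale_add cscale_diff) simp
      also have "\<dots> = r *\<^sub>M (P11 x \<xi> ** ?f + P12 x \<xi> ** ?f1)" unfolding rec by (simp only: cscale_minus minus_minus)
      finally have "phi L \<xi> x ** (weyl L \<xi> - weyl Lt \<xi>) ** ?J \<xi> + (?E0 \<xi> + r *\<^sub>M ?E1 \<xi>) = r *\<^sub>M (P11 x \<xi> ** ?f + P12 x \<xi> ** ?f1)" .
      moreover have "r *\<^sub>M ((P11 x \<xi> - Omega L Lt x) ** ?f + P12 x \<xi> ** ?f1) + (r - 1 / \<xi>) *\<^sub>M ?C
          = r *\<^sub>M (P11 x \<xi> ** ?f + P12 x \<xi> ** ?f1) - (1 / \<xi>) *\<^sub>M ?C"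
        by (simp add: matrix_diff_rdistrib cscale_add cscale_diff cscale_diff_left)
      ultimately show ?case unfolding r_def[symmetric] by simp
    qed
  qed
  have x0: "0 \<le> x" using x by simp
  note rs = residue_series[OF A.entire_phi(1)[OF x] B.entire_D_ker(2)[OF x] growth_solutions(1)[OF x] growth_kernels(2)[OF x] x0
      entire_mat_mult[OF A.entire_cosol(3)[OF x] B.entire_D_ker(2)[OF x]]
      entire_mat_mult[OF A.entire_phi(1)[OF x] B.entire_brackets(4)[OF x]] entire_mat_const lim]
  show "S summable_on UNIV" unfolding S_def by (rule rs(1))
  show "(\<Sum>\<^sub>\<infinity>n. S n) = Omega L Lt x ** phi Lt \<rho> x - phi L \<rho> x"
    unfolding S_def using rs(2) by (simp add: B.brackets_diagonal[OF x])
qed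

text \<open>Here the left factor brings its own denominator \<open>\<xi> - \<theta>\<close>, so a
  second Cauchy term arises: \<open>BS\<close> is \<open>- mat 1\<close> at equal parameters and
  yields the model kernel, while the term at \<rho> yields the kernel of \<open>L\<close>. As
  \<open>P21\<close> behaves like \<open>- \<xi>\<close> times \<open>Lambda\<close>, one factor
  \<xi> against two denominators leaves the constant \<open>?C\<close>.\<close>

lemma second_relation:
  fixes \<rho> \<theta> :: complex
  assumes x: "x \<in> {0..pi}"
  defines "T \<equiv> \<lambda>n. \<Sum>q\<in>UNIV. D_ker L x (ev n q) \<theta> ** weight L (ev n q) ** D_ker Lt x \<rho> (ev n q)
    - D_ker L x (evt n q) \<theta> ** weight Lt (evt n q) ** D_ker Lt x \<rho> (evt n q)"
  shows "T summable_on UNIV"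
    "(\<Sum>\<^sub>\<infinity>n. T n) = phi_star L \<theta> x ** Lambda L Lt x ** phi Lt \<rho> x - D_ker L x \<rho> \<theta> + D_ker Lt x \<rho> \<theta>"
proof -
  let ?f = "phi Lt \<rho> x" and ?f1 = "phi1 Lt \<rho> x"
  let ?t = "dagger (phi L (cnj \<theta>) x)" and ?t1 = "dagger (phi1 L (cnj \<theta>) x)"
  let ?K = "\<lambda>\<xi>. D_ker L x \<xi> \<theta>" and ?J = "\<lambda>\<xi>. D_ker Lt x \<rho> \<xi>"
  let ?E0 = "\<lambda>\<xi>. 0 :: complex^'m^'m" and ?E1 = "\<lambda>\<xi>. ?K \<xi> ** B.BSs x \<rho> \<xi>" and ?E2 = "\<lambda>\<xi>. A.BS x \<xi> \<theta> ** ?J \<xi>"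
  let ?\<Lambda> = "Lambda L Lt x"
  let ?C = "?t ** ?\<Lambda> ** ?f"
  note a = spectral_mapping_asymptotics[OF x]
  have g11: "growth (gridF c) (P11 x) 0 0"
  proof -
    have "growth (gridF c) (\<lambda>\<xi>. (P11 x \<xi> - Omega L Lt x) + Omega L Lt x) 0 0"
      by (intro growth_add A.growth_mono[OF a(1)] growth_const0) auto
    then show ?thesis by simp
  qed
  \<comment> \<open>The growing part of \<open>P21\<close> is taken out; what is left is bounded,
    and the two denominators make it O(1/\<xi>^2).\<close>
  let ?R = "\<lambda>\<xi>. ?t1 ** (P11 x \<xi> ** ?f + P12 x \<xi> ** ?f1) - ?t ** ((P21 x \<xi> + \<xi> *\<^sub>M ?\<Lambda>) ** ?f + P22 x \<xi> ** ?f1)"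
  have "growth (gridF c) (\<lambda>\<xi>. (1 / (\<xi> - \<theta>)) *\<^sub>M ((1 / (\<xi> - \<rho>)) *\<^sub>M ?R \<xi>)) (0 + (0 + 0)) (-1 + (-1 + 0))"
    by (intro A.growth_cscale A.growth_inverse_shift growth_diff A.growth_const_mult growth_add A.growth_mult_const g11 a A.growth_mono[OF a(2)]) auto
  moreover have "growth (gridF c) (\<lambda>\<xi>. (\<xi> * (1 / (\<xi> - \<theta>) * (1 / (\<xi> - \<rho>))) - 1 / \<xi>) *\<^sub>M ?C) (0 + 0) (-2 + 0)"
    by (intro A.growth_cscale inverse_shift_expansion growth_const0)
  ultimately have g: "growth (gridF c) (\<lambda>\<xi>. (1 / (\<xi> - \<theta>)) *\<^sub>M ((1 / (\<xi> - \<rho>)) *\<^sub>M ?R \<xi>)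
      + (\<xi> * (1 / (\<xi> - \<theta>) * (1 / (\<xi> - \<rho>))) - 1 / \<xi>) *\<^sub>M ?C) 0 (-2)"
    by (intro growth_add) simp_all
  have lim: "growth (gridF c) (\<lambda>\<xi>. ?K \<xi> ** (weyl L \<xi> - weyl Lt \<xi>) ** ?J \<xi>
      + (?E0 \<xi> + (1 / (\<xi> - \<rho>)) *\<^sub>M ?E1 \<xi> + (1 / (\<xi> - \<theta>)) *\<^sub>M ?E2 \<xi>) - (1 / \<xi>) *\<^sub>M ?C) 0 (-2)"
  proof (rule growth_cong[OF g])
    show "\<forall>\<^sub>F \<xi> in gridF c. (1 / (\<xi> - \<theta>)) *\<^sub>M ((1 / (\<xi> - \<rho>)) *\<^sub>M ?R \<xi>) + (\<xi> * (1 / (\<xi> - \<theta>) * (1 / (\<xi> - \<rho>))) - 1 / \<xi>) *\<^sub>M ?C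
      = ?K \<xi> ** (weyl L \<xi> - weyl Lt \<xi>) ** ?J \<xi>
        + (?E0 \<xi> + (1 / (\<xi> - \<rho>)) *\<^sub>M ?E1 \<xi> + (1 / (\<xi> - \<theta>)) *\<^sub>M ?E2 \<xi>) - (1 / \<xi>) *\<^sub>M ?C"
      using eventually_regular[of \<rho> \<theta>]
    proof eventually_elim
      case (elim \<xi>)
      define r s where "r = 1 / (\<xi> - \<rho>)" and "s = 1 / (\<xi> - \<theta>)"
      define X where "X = dagger (phi1 Lt (cnj \<xi>) x) ** ?f - dagger (phi Lt (cnj \<xi>) x) ** ?f1"
      define Z where "Z = B.BSs x \<rho> \<xi>"
      define M where "M = weyl L \<xi> - weyl Lt \<xi>"
      \<comment> \<open>The recombination for solutions and for derivatives; the bracket in the left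
        kernel pairs them with \<open>?t1\<close> and \<open>?t\<close>.\<close>
      define U V where "U = phi L \<xi> x ** M ** X + sisol L \<xi> x ** X - phi L \<xi> x ** Z"
        and "V = phi1 L \<xi> x ** M ** X + sisol1 L \<xi> x ** X - phi1 L \<xi> x ** Z"
      have J: "?J \<xi> = - (r *\<^sub>M X)"
      proof -
        have "1 / (\<rho> - \<xi>) = - r" by (simp add: r_def minus_divide_right)
        then show ?thesis using elim by (auto simp: B.D_ker_eq[OF x] B.Bk_def X_def)
      qed
      have K: "?K \<xi> = s *\<^sub>M (?t1 ** phi L \<xi> x - ?t ** phi1 L \<xi> x)"
        using elim by (auto simp: A.D_ker_eq[OF x] A.Bk_def s_def)
      have U: "U = - (P11 x \<xi> ** ?f + P12 x \<xi> ** ?f1)" and V: "V = - (P21 x \<xi> ** ?f + P22 x \<xi> ** ?f1)"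
        using spectral_mapping_recombination[of \<xi> x ?f ?f1] elim x by (simp_all add: X_def U_def V_def Z_def M_def B.BSs_def)
      have "?K \<xi> ** M ** ?J \<xi> + (r *\<^sub>M ?E1 \<xi> + s *\<^sub>M ?E2 \<xi>) = - ((s * r) *\<^sub>M (?t1 ** U - ?t ** V))"
        unfolding J K U_def V_def A.BS_def Z_def[symmetric]
        by (simp add: matrix_distribs matrix_mul_assoc) (simp add: vec_eq_iff algebra_simps)
      also have "\<dots> = (s * r) *\<^sub>M (?t1 ** (P11 x \<xi> ** ?f + P12 x \<xi> ** ?f1) - ?t ** (P21 x \<xi> ** ?f + P22 x \<xi> ** ?f1))"
        unfolding U V matrix_mult_minus_right by (simp add: cscale_diff cscale_minus del: minus_add_distrib)
      finally have main: "?K \<xi> ** M ** ?J \<xi> + (r *\<^sub>M ?E1 \<xi> + s *\<^sub>M ?E2 \<xi>)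
          = (s * r) *\<^sub>M (?t1 ** (P11 x \<xi> ** ?f + P12 x \<xi> ** ?f1) - ?t ** (P21 x \<xi> ** ?f + P22 x \<xi> ** ?f1))" .
      have "s *\<^sub>M (r *\<^sub>M ?R \<xi>) + (\<xi> * (s * r) - 1 / \<xi>) *\<^sub>M ?C
          = (s * r) *\<^sub>M (?t1 ** (P11 x \<xi> ** ?f + P12 x \<xi> ** ?f1) - ?t ** (P21 x \<xi> ** ?f + P22 x \<xi> ** ?f1)) - (1 / \<xi>) *\<^sub>M ?C"
        by (simp add: matrix_distribs matrix_mul_assoc cscale_diff_left) (simp add: vec_eq_iff algebra_simps)
      then show ?case
        unfolding r_def[symmetric] s_def[symmetric] M_def[symmetric] using main by (simp add: add.assoc)
    qed
  qed
  have x0: "0 \<le> x" using x by simp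
  note rs = residue_series[OF A.entire_D_ker(1)[OF x] B.entire_D_ker(2)[OF x] growth_kernels(1)[OF x] growth_kernels(2)[OF x] x0
      entire_mat_const entire_mat_mult[OF A.entire_D_ker(1)[OF x] B.entire_brackets(4)[OF x]]
      entire_mat_mult[OF A.entire_brackets(3)[OF x] B.entire_D_ker(2)[OF x]] lim]
  show "T summable_on UNIV" unfolding T_def by (rule rs(1))
  show "(\<Sum>\<^sub>\<infinity>n. T n) = phi_star L \<theta> x ** Lambda L Lt x ** phi Lt \<rho> x - D_ker L x \<rho> \<theta> + D_ker Lt x \<rho> \<theta>"
    unfolding T_def using rs(2) by (simp add: B.brackets_diagonal[OF x] A.brackets_diagonal[OF x] phi_star_def)
qed

end

text \<open>The resolvent depends on \<open>W\<close> only through the projections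
  \<open>dagger W ** I_proj \<omega> q ** W\<close>, which are what the model conditions prescribe.
  Equal values of \<omega> repeat the same projection, hence the division by their number.\<close>

lemma resolv_projections:
  fixes \<omega> :: "'m::finite \<Rightarrow> real"
  shows "resolv \<omega> W \<xi> = (\<Sum>q\<in>UNIV. (1 / (1 - exp (2 * of_real pi * \<i> * (\<xi> - of_real (\<omega> q)))) / of_nat (card {j. \<omega> j = \<omega> q}))
      *\<^sub>M (dagger W ** I_proj \<omega> q ** W))"
proof -
  define d :: "real \<Rightarrow> complex" where "d = (\<lambda>r. 1 / (1 - exp (2 * of_real pi * \<i> * (\<xi> - of_real r))))"
  define k :: "real \<Rightarrow> complex" where "k r = of_nat (card {j. \<omega> j = r})" for r
  have "(\<Sum>q\<in>UNIV. d (\<omega> q) / k (\<omega> q) * (if \<omega> i = \<omega> q then 1 else 0)) = d (\<omega> i)" for i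
  proof -
    have pos: "k (\<omega> i) \<noteq> 0" by (auto simp: k_def card_eq_0_iff)
    have "(\<Sum>q\<in>UNIV. d (\<omega> q) / k (\<omega> q) * (if \<omega> i = \<omega> q then 1 else 0)) = (\<Sum>q | \<omega> q = \<omega> i. d (\<omega> i) / k (\<omega> i))"
      by (rule sum.mono_neutral_cong_right) auto
    also have "\<dots> = k (\<omega> i) * (d (\<omega> i) / k (\<omega> i))" by (simp add: k_def)
    finally show ?thesis using pos by simp
  qed
  then have "diag (\<lambda>q. d (\<omega> q)) = (\<Sum>q\<in>UNIV. (d (\<omega> q) / k (\<omega> q)) *\<^sub>M I_proj \<omega> q)"
    by (simp add: vec_eq_iff I_proj_def)
  then show ?thesis
    by (simp add: resolv_def d_def k_def matrix_mult_sum_left matrix_mult_sum_right cscale_mult_left cscale_mult_right)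
qed

theorem lemma8:
  fixes L Lt :: "'m::finite pencil"
    and \<omega> \<omega>t :: "'m \<Rightarrow> real"
    and W Wt :: "complex^'m^'m"
    and ev evt :: "windex \<Rightarrow> 'm \<Rightarrow> complex"
  assumes coeffs: "pencil_coeffs L" "pencil_coeffs Lt"
    and I: "condition_I L" "condition_I Lt"
    and II: "condition_II L" "condition_II Lt"
    and diagonalizations: "diagonalization L \<omega> W" "diagonalization Lt \<omega>t Wt"
    and numberings: "eigenvalue_numbering L \<omega> ev" "eigenvalue_numbering Lt \<omega>t evt"
    and model: "h1 Lt = h1 L" "\<And>q. \<omega>t q = \<omega> q"
      "\<And>q. dagger Wt ** I_proj \<omega>t q ** Wt = dagger W ** I_proj \<omega> q ** W"
    and spectrum: "simple_real_spectrum L" "simple_real_spectrum Lt"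
  shows "\<forall>x\<in>{0..pi}. \<forall>\<rho> \<theta>.
    (let S = (\<lambda>n. \<Sum>q\<in>UNIV.
            phi L (ev n q) x ** weight L (ev n q) ** D_ker Lt x \<rho> (ev n q)
          - phi L (evt n q) x ** weight Lt (evt n q) ** D_ker Lt x \<rho> (evt n q));
         T = (\<lambda>n. \<Sum>q\<in>UNIV.
            D_ker L x (ev n q) \<theta> ** weight L (ev n q) ** D_ker Lt x \<rho> (ev n q)
          - D_ker L x (evt n q) \<theta> ** weight Lt (evt n q) ** D_ker Lt x \<rho> (evt n q))
     in S summable_on UNIV \<and>
        Omega L Lt x ** phi Lt \<rho> x = phi L \<rho> x + (\<Sum>\<^sub>\<infinity>n. S n) \<and>
        T summable_on UNIV \<and>
        D_ker L x \<rho> \<theta> - D_ker Lt x \<rho> \<theta> - phi_star L \<theta> x ** Lambda L Lt x ** phi Lt \<rho> x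
          + (\<Sum>\<^sub>\<infinity>n. T n) = 0)"
proof -
  have \<omega>t: "\<omega>t = \<omega>" using model(2) by (simp add: fun_eq_iff)
  have \<omega>: "0 \<le> \<omega> q" "\<omega> q < 1" for q
    using diagonalizations(1) by (auto simp: diagonalization_def)
  \<comment> \<open>Finiteness of the index type leaves a gap between the largest
    \<open>\<omega> q\<close> and 1, through which the vertical sides of the contours pass.\<close>
  obtain c where c: "\<And>q. \<omega> q < c" and c1: "c < 1"
  proof -
    have "Max (range \<omega>) < 1" using \<omega> by (subst Max_less_iff) auto
    then obtain c where "Max (range \<omega>) < c" "c < 1" using dense by blast
    then show thesis using that[of c] by (auto simp: Max_less_iff)
  qed
  obtain \<delta> where \<delta>: "contour_filter (gridF c) \<omega> \<delta>"
    using contour_filter_grid[of \<omega> c] \<omega>(1) c c1 by blast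
  have AL: "asymptotic_pencil L (gridF c) \<omega> \<delta> W"
    using \<delta> coeffs(1) I(1) II(1) diagonalizations(1)
    by (simp add: asymptotic_pencil_def asymptotic_pencil_axioms_def hermitian_pencil_def
        hermitian_pencil_axioms_def regular_pencil_def)
  have BL: "asymptotic_pencil Lt (gridF c) \<omega> \<delta> Wt"
    using \<delta> coeffs(2) I(2) II(2) diagonalizations(2)
    by (simp add: \<omega>t asymptotic_pencil_def asymptotic_pencil_axioms_def hermitian_pencil_def
        hermitian_pencil_axioms_def regular_pencil_def)
  have res: "resolv \<omega> Wt = resolv \<omega> W"
    using model(3) by (simp add: fun_eq_iff resolv_projections \<omega>t)
  interpret MP: model_pair L Lt "gridF c" \<omega> \<delta> W Wt
    by (intro model_pair.intro model_pair_axioms.intro AL BL model res)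
  note evA = MP.A.eventually_char_fun_nonzero and evB = MP.B.eventually_char_fun_nonzero
  have SA: "spectral_pencil L \<omega> ev"
    using coeffs(1) spectrum(1) numberings(1) gridF_witness[OF evA]
    by (simp add: spectral_pencil_def spectral_pencil_axioms_def regular_pencil_def)
  have SB: "spectral_pencil Lt \<omega> evt"
    using coeffs(2) spectrum(2) numberings(2) gridF_witness[OF evB]
    by (simp add: \<omega>t spectral_pencil_def spectral_pencil_axioms_def regular_pencil_def)
  have SP: "spectral_pair L Lt \<omega> ev evt c"
    by (intro spectral_pair.intro spectral_pair_axioms.intro SA SB \<omega> c c1 MP.growth_weyl_diff evA evB)
  interpret model_spectral_pair L Lt c \<omega> \<delta> W Wt ev evt
    by (intro model_spectral_pair.intro MP.model_pair_axioms SP)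
  show ?thesis
    unfolding Let_def
    by (intro ballI allI conjI first_relation second_relation)
       (simp_all only: first_relation second_relation, simp_all)
qed

end
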